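(* Let $G$ be a compact group, let $A$ be a unital C*-algebra, and let $F$ be a finite dimensional C*-algebra. Let $\alpha \colon G \to \mathrm{Aut}(A)$ be an equivariantly semiprojective action, and let $\beta \colon G \to \mathrm{Aut}(F)$ be any action. Then the action $\beta \otimes \alpha \colon G \to \mathrm{Aut}(F \otimes A)$, $g \mapsto \beta_g \otimes \alpha_g$, is equivariantly semiprojective.
   Context: For a topological group $G$, a unital $G$-algebra $(G, A, \alpha)$ is a unital C*-algebra $A$ with a continuous action $\alpha \colon G \to \mathrm{Aut}(A)$ (i.e. $g \mapsto \alpha_g(a)$ is norm continuous for every $a \in A$). Ideals are closed and two-sided, homomorphisms are $*$-homomorphisms, and quotients by $G$-invariant ideals carry the induced actions. Equivariantly semiprojective: a unital $G$-algebra $(G, A, \alpha)$ (or the action $\alpha$) is equivariantly semiprojective if whenever $(G, C, \gamma)$ is a unital $G$-algebra, $J_0 \subset J_1 \subset \cdots$ are $G$-invariant ideals in $C$, $J = \overline{\bigcup_{n=0}^{\infty} J_n}$, $\pi_n \colon C/J_n \to C/J$ are the quotient maps, and $\varphi \colon A \to C/J$ is a unital equivariant homomorphism, then there exist $n$ and a unital equivariant homomorphism $\psi \colon A \to C/J_n$ such that $\pi_n \circ \psi = \varphi$. *)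

theory Defs
  imports "HOL-Analysis.Analysis" "HOL-Algebra.QuotRing" "HOL-Algebra.Module"
begin

section \<open>C*-algebras with explicit carriers\<close>

text \<open>
  Equivariant semiprojectivity quantifies over C*-algebras, their ideals and their quotients, so
  C*-algebras are records in the style of HOL-Algebra: the \<^type>\<open>module\<close> record over the complex
  numbers with an involution and a norm added. The field \<^const>\<open>one\<close> carries no meaning for an
  algebra that is not assumed to be unital.
\<close>

definition complex_ring :: "complex ring" where
  "complex_ring = \<lparr>carrier = UNIV, mult = (*), one = 1, zero = 0, add = (+)\<rparr>"

record 'a cstar = "(complex, 'a) module" +
  invol :: "'a \<Rightarrow> 'a"
  nrm :: "'a \<Rightarrow> real"

text \<open>The locale \<^locale>\<open>Metric_space\<close> wants a distance that is symmetric and nonnegative on the whole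
  type, hence the value 0 off the carrier.\<close>

definition cstar_dist :: "'a cstar \<Rightarrow> 'a \<Rightarrow> 'a \<Rightarrow> real" where
  "cstar_dist A x y =
     (if x \<in> carrier A \<and> y \<in> carrier A then nrm A (x \<ominus>\<^bsub>A\<^esub> y) else 0)"

definition cstar_topology :: "'a cstar \<Rightarrow> 'a topology" where
  "cstar_topology A = Metric_space.mtopology (carrier A) (cstar_dist A)"

locale cstar_algebra = module complex_ring A for A :: "'a cstar" (structure) +
  assumes mult_closed: "\<lbrakk>x \<in> carrier A; y \<in> carrier A\<rbrakk> \<Longrightarrow> x \<otimes> y \<in> carrier A"
    and mult_assoc: "\<lbrakk>x \<in> carrier A; y \<in> carrier A; z \<in> carrier A\<rbrakk> \<Longrightarrow> (x \<otimes> y) \<otimes> z = x \<otimes> (y \<otimes> z)"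
    and mult_add_left: "\<lbrakk>x \<in> carrier A; y \<in> carrier A; z \<in> carrier A\<rbrakk>
           \<Longrightarrow> (x \<oplus> y) \<otimes> z = x \<otimes> z \<oplus> y \<otimes> z"
    and mult_add_right: "\<lbrakk>x \<in> carrier A; y \<in> carrier A; z \<in> carrier A\<rbrakk>
           \<Longrightarrow> z \<otimes> (x \<oplus> y) = z \<otimes> x \<oplus> z \<otimes> y"
    and smult_mult_left: "\<lbrakk>x \<in> carrier A; y \<in> carrier A\<rbrakk> \<Longrightarrow> (c \<odot> x) \<otimes> y = c \<odot> (x \<otimes> y)"
    and smult_mult_right: "\<lbrakk>x \<in> carrier A; y \<in> carrier A\<rbrakk> \<Longrightarrow> x \<otimes> (c \<odot> y) = c \<odot> (x \<otimes> y)"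
    and invol_closed: "x \<in> carrier A \<Longrightarrow> invol A x \<in> carrier A"
    and invol_invol: "x \<in> carrier A \<Longrightarrow> invol A (invol A x) = x"
    and invol_add: "\<lbrakk>x \<in> carrier A; y \<in> carrier A\<rbrakk> \<Longrightarrow> invol A (x \<oplus> y) = invol A x \<oplus> invol A y"
    and invol_smult: "x \<in> carrier A \<Longrightarrow> invol A (c \<odot> x) = cnj c \<odot> invol A x"
    and invol_mult: "\<lbrakk>x \<in> carrier A; y \<in> carrier A\<rbrakk> \<Longrightarrow> invol A (x \<otimes> y) = invol A y \<otimes> invol A x"
    and nrm_nonneg: "x \<in> carrier A \<Longrightarrow> 0 \<le> nrm A x"
    and nrm_eq_0_iff: "x \<in> carrier A \<Longrightarrow> nrm A x = 0 \<longleftrightarrow> x = \<zero>"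
    and nrm_triangle: "\<lbrakk>x \<in> carrier A; y \<in> carrier A\<rbrakk> \<Longrightarrow> nrm A (x \<oplus> y) \<le> nrm A x + nrm A y"
    and nrm_smult: "x \<in> carrier A \<Longrightarrow> nrm A (c \<odot> x) = cmod c * nrm A x"
    and nrm_mult: "\<lbrakk>x \<in> carrier A; y \<in> carrier A\<rbrakk> \<Longrightarrow> nrm A (x \<otimes> y) \<le> nrm A x * nrm A y"
    and cstar_identity: "x \<in> carrier A \<Longrightarrow> nrm A (invol A x \<otimes> x) = (nrm A x)\<^sup>2"
    and complete: "Metric_space.mcomplete (carrier A) (cstar_dist A)"

text \<open>The zero algebra counts as unital, so that every quotient of a unital algebra is unital.\<close>

locale unital_cstar_algebra = cstar_algebra A + ring A for A :: "'a cstar" (structure)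

definition finite_dimensional :: "'a cstar \<Rightarrow> bool" where
  "finite_dimensional A \<longleftrightarrow>
     (\<exists>S. finite S \<and> S \<subseteq> carrier A \<and> (\<forall>x\<in>carrier A. \<exists>c. x = (\<Oplus>\<^bsub>A\<^esub>s\<in>S. c s \<odot>\<^bsub>A\<^esub> s)))"

definition star_hom :: "'a cstar \<Rightarrow> 'b cstar \<Rightarrow> ('a \<Rightarrow> 'b) \<Rightarrow> bool" where
  "star_hom A B \<phi> \<longleftrightarrow>
     \<phi> \<in> carrier A \<rightarrow> carrier B \<and>
     (\<forall>x\<in>carrier A. \<forall>y\<in>carrier A. \<phi> (x \<oplus>\<^bsub>A\<^esub> y) = \<phi> x \<oplus>\<^bsub>B\<^esub> \<phi> y) \<and>
     (\<forall>x\<in>carrier A. \<forall>y\<in>carrier A. \<phi> (x \<otimes>\<^bsub>A\<^esub> y) = \<phi> x \<otimes>\<^bsub>B\<^esub> \<phi> y) \<and>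
     (\<forall>c. \<forall>x\<in>carrier A. \<phi> (c \<odot>\<^bsub>A\<^esub> x) = c \<odot>\<^bsub>B\<^esub> \<phi> x) \<and>
     (\<forall>x\<in>carrier A. \<phi> (invol A x) = invol B (\<phi> x))"

definition unital_star_hom :: "'a cstar \<Rightarrow> 'b cstar \<Rightarrow> ('a \<Rightarrow> 'b) \<Rightarrow> bool" where
  "unital_star_hom A B \<phi> \<longleftrightarrow> star_hom A B \<phi> \<and> \<phi> \<one>\<^bsub>A\<^esub> = \<one>\<^bsub>B\<^esub>"

definition cstar_aut :: "'a cstar \<Rightarrow> ('a \<Rightarrow> 'a) set" where
  "cstar_aut A = {\<phi>. star_hom A A \<phi> \<and> bij_betw \<phi> (carrier A) (carrier A)}"

section \<open>Quotients\<close>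

definition closed_ideal :: "'a cstar \<Rightarrow> 'a set \<Rightarrow> bool" where
  "closed_ideal A J \<longleftrightarrow> ideal J A \<and> closedin (cstar_topology A) J"

text \<open>The map on cosets induced by \<open>f\<close>. If \<open>f\<close> is additive and maps the ideal \<open>I\<close> into the ideal
  \<open>J\<close>, it sends \<open>I + x\<close> to \<open>J + f x\<close>.\<close>

definition coset_map :: "'a cstar \<Rightarrow> 'a set \<Rightarrow> ('a \<Rightarrow> 'a) \<Rightarrow> 'a set \<Rightarrow> 'a set" where
  "coset_map A J f X = (\<Union>x\<in>X. J +>\<^bsub>A\<^esub> f x)"

text \<open>The ring structure is that of \<^const>\<open>FactRing\<close>.\<close>

definition quotient_cstar :: "'a cstar \<Rightarrow> 'a set \<Rightarrow> 'a set cstar" where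
  "quotient_cstar A J =
     \<lparr>carrier = carrier (A Quot J), mult = mult (A Quot J), one = one (A Quot J),
      zero = zero (A Quot J), add = add (A Quot J),
      smult = (\<lambda>c. coset_map A J (\<lambda>x. c \<odot>\<^bsub>A\<^esub> x)),
      invol = coset_map A J (invol A),
      nrm = (\<lambda>X. Inf (nrm A ` X))\<rparr>"

section \<open>Group actions\<close>

text \<open>The group is a type of class \<^class>\<open>topological_group_add\<close>: it is written additively, but
  the class does not ask for commutativity (nor for the Hausdorff property).\<close>

definition G_algebra :: "'a cstar \<Rightarrow> ('g::topological_group_add \<Rightarrow> 'a \<Rightarrow> 'a) \<Rightarrow> bool" where
  "G_algebra A \<alpha> \<longleftrightarrow>
     cstar_algebra A \<and>
     (\<forall>g. \<alpha> g \<in> cstar_aut A) \<and>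
     (\<forall>a\<in>carrier A. \<alpha> 0 a = a) \<and>
     (\<forall>g h. \<forall>a\<in>carrier A. \<alpha> (g + h) a = \<alpha> g (\<alpha> h a)) \<and>
     (\<forall>a\<in>carrier A. continuous_map euclidean (cstar_topology A) (\<lambda>g. \<alpha> g a))"

definition unital_G_algebra :: "'a cstar \<Rightarrow> ('g::topological_group_add \<Rightarrow> 'a \<Rightarrow> 'a) \<Rightarrow> bool" where
  "unital_G_algebra A \<alpha> \<longleftrightarrow> unital_cstar_algebra A \<and> G_algebra A \<alpha>"

definition invariant_ideal ::
  "'a cstar \<Rightarrow> ('g::topological_group_add \<Rightarrow> 'a \<Rightarrow> 'a) \<Rightarrow> 'a set \<Rightarrow> bool" where
  "invariant_ideal A \<alpha> J \<longleftrightarrow> closed_ideal A J \<and> (\<forall>g. \<alpha> g ` J \<subseteq> J)"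

definition quotient_action ::
  "'a cstar \<Rightarrow> ('g::topological_group_add \<Rightarrow> 'a \<Rightarrow> 'a) \<Rightarrow> 'a set \<Rightarrow> 'g \<Rightarrow> 'a set \<Rightarrow> 'a set" where
  "quotient_action A \<alpha> J g = coset_map A J (\<alpha> g)"

definition unital_equivariant_hom ::
  "'a cstar \<Rightarrow> ('g::topological_group_add \<Rightarrow> 'a \<Rightarrow> 'a) \<Rightarrow>
   'b cstar \<Rightarrow> ('g \<Rightarrow> 'b \<Rightarrow> 'b) \<Rightarrow> ('a \<Rightarrow> 'b) \<Rightarrow> bool" where
  "unital_equivariant_hom A \<alpha> B \<beta> \<phi> \<longleftrightarrow>
     unital_star_hom A B \<phi> \<and> (\<forall>g. \<forall>a\<in>carrier A. \<phi> (\<alpha> g a) = \<beta> g (\<phi> a))"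

section \<open>Equivariant semiprojectivity\<close>

text \<open>
  A HOL definition cannot quantify over types, so the test algebras \<open>C\<close> range over all unital
  \<open>G\<close>-algebras whose carrier is a set of elements of a type \<open>'c\<close>, passed as an argument. The
  unrestricted notion is the conjunction over all \<open>'c\<close>. The map
  \<open>\<pi>\<^sub>n : C/J\<^sub>n \<rightarrow> C/J\<close> is the coset map induced by the identity.
\<close>

definition equivariantly_semiprojective ::
  "'c itself \<Rightarrow> 'a cstar \<Rightarrow> ('g::topological_group_add \<Rightarrow> 'a \<Rightarrow> 'a) \<Rightarrow> bool" where
  "equivariantly_semiprojective U A \<alpha> \<longleftrightarrow>
     unital_G_algebra A \<alpha> \<and>
     (\<forall>(C :: 'c cstar) \<gamma> (J :: nat \<Rightarrow> 'c set) Jinf \<phi>.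
        unital_G_algebra C \<gamma> \<longrightarrow>
        (\<forall>n. invariant_ideal C \<gamma> (J n)) \<longrightarrow>
        (\<forall>n. J n \<subseteq> J (Suc n)) \<longrightarrow>
        Jinf = cstar_topology C closure_of (\<Union>n. J n) \<longrightarrow>
        unital_equivariant_hom A \<alpha> (quotient_cstar C Jinf) (quotient_action C \<gamma> Jinf) \<phi> \<longrightarrow>
        (\<exists>n \<psi>.
           unital_equivariant_hom A \<alpha> (quotient_cstar C (J n)) (quotient_action C \<gamma> (J n)) \<psi> \<and>
           (\<forall>a\<in>carrier A. coset_map C Jinf (\<lambda>x. x) (\<psi> a) = \<phi> a)))"

section \<open>Tensor products with a finite dimensional algebra\<close>

text \<open>
  \<open>(T, \<iota>)\<close> is a C*-algebra \<open>F \<otimes> A\<close>, where \<open>\<iota> f a\<close> stands for the elementary tensor \<open>f \<otimes> a\<close>: the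
  map \<open>\<iota>\<close> identifies the underlying *-algebra of \<open>T\<close> with the algebraic tensor product of \<open>F\<close> and
  \<open>A\<close> (linear disjointness gives injectivity, spanning gives surjectivity). For finite
  dimensional \<open>F\<close> the algebraic tensor product has exactly one C*-norm and is complete in it, so
  that no completion has to be taken and the C*-algebra \<open>T\<close> is determined up to isomorphism.
\<close>

locale fd_tensor_product =
  F: cstar_algebra F + A: cstar_algebra A + T: cstar_algebra T
  for F :: "'f cstar" and A :: "'a cstar" and T :: "'t cstar" +
  fixes \<iota> :: "'f \<Rightarrow> 'a \<Rightarrow> 't"
  assumes fin_dim: "finite_dimensional F"
    and tensor_closed: "\<lbrakk>f \<in> carrier F; a \<in> carrier A\<rbrakk> \<Longrightarrow> \<iota> f a \<in> carrier T"
    and tensor_add_left: "\<lbrakk>f \<in> carrier F; f' \<in> carrier F; a \<in> carrier A\<rbrakk>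
           \<Longrightarrow> \<iota> (f \<oplus>\<^bsub>F\<^esub> f') a = \<iota> f a \<oplus>\<^bsub>T\<^esub> \<iota> f' a"
    and tensor_add_right: "\<lbrakk>f \<in> carrier F; a \<in> carrier A; a' \<in> carrier A\<rbrakk>
           \<Longrightarrow> \<iota> f (a \<oplus>\<^bsub>A\<^esub> a') = \<iota> f a \<oplus>\<^bsub>T\<^esub> \<iota> f a'"
    and tensor_smult_left: "\<lbrakk>f \<in> carrier F; a \<in> carrier A\<rbrakk> \<Longrightarrow> \<iota> (c \<odot>\<^bsub>F\<^esub> f) a = c \<odot>\<^bsub>T\<^esub> \<iota> f a"
    and tensor_smult_right: "\<lbrakk>f \<in> carrier F; a \<in> carrier A\<rbrakk> \<Longrightarrow> \<iota> f (c \<odot>\<^bsub>A\<^esub> a) = c \<odot>\<^bsub>T\<^esub> \<iota> f a"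
    and tensor_mult: "\<lbrakk>f \<in> carrier F; f' \<in> carrier F; a \<in> carrier A; a' \<in> carrier A\<rbrakk>
           \<Longrightarrow> \<iota> f a \<otimes>\<^bsub>T\<^esub> \<iota> f' a' = \<iota> (f \<otimes>\<^bsub>F\<^esub> f') (a \<otimes>\<^bsub>A\<^esub> a')"
    and tensor_invol: "\<lbrakk>f \<in> carrier F; a \<in> carrier A\<rbrakk>
           \<Longrightarrow> invol T (\<iota> f a) = \<iota> (invol F f) (invol A a)"
    and tensor_span: "t \<in> carrier T
           \<Longrightarrow> \<exists>(n::nat) f a. f \<in> {..<n} \<rightarrow> carrier F \<and> a \<in> {..<n} \<rightarrow> carrier A \<and>
                 t = (\<Oplus>\<^bsub>T\<^esub>i\<in>{..<n}. \<iota> (f i) (a i))"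
    and tensor_linearly_disjoint: "\<And>(n::nat) f a.
           \<lbrakk>f \<in> {..<n} \<rightarrow> carrier F; a \<in> {..<n} \<rightarrow> carrier A;
            \<And>c. (\<Oplus>\<^bsub>F\<^esub>i\<in>{..<n}. c i \<odot>\<^bsub>F\<^esub> f i) = \<zero>\<^bsub>F\<^esub> \<Longrightarrow> \<forall>i<n. c i = 0;
            (\<Oplus>\<^bsub>T\<^esub>i\<in>{..<n}. \<iota> (f i) (a i)) = \<zero>\<^bsub>T\<^esub>\<rbrakk>
           \<Longrightarrow> \<forall>i<n. a i = \<zero>\<^bsub>A\<^esub>"

text \<open>The homomorphism \<open>\<sigma> \<otimes> \<rho>\<close> of \<open>F \<otimes> A\<close>, for endomorphisms \<open>\<sigma>\<close> of \<open>F\<close> and \<open>\<rho>\<close> of \<open>A\<close>. It is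
  made unique by its being \<^const>\<open>undefined\<close> off the carrier.\<close>

definition tensor_hom ::
  "'f cstar \<Rightarrow> 'a cstar \<Rightarrow> 't cstar \<Rightarrow> ('f \<Rightarrow> 'a \<Rightarrow> 't) \<Rightarrow> ('f \<Rightarrow> 'f) \<Rightarrow> ('a \<Rightarrow> 'a) \<Rightarrow> 't \<Rightarrow> 't" where
  "tensor_hom F A T \<iota> \<sigma> \<rho> =
     (THE \<theta>. \<theta> \<in> extensional (carrier T) \<and> star_hom T T \<theta> \<and>
        (\<forall>f\<in>carrier F. \<forall>a\<in>carrier A. \<theta> (\<iota> f a) = \<iota> (\<sigma> f) (\<rho> a)))"

definition tensor_action ::
  "'f cstar \<Rightarrow> 'a cstar \<Rightarrow> 't cstar \<Rightarrow> ('f \<Rightarrow> 'a \<Rightarrow> 't) \<Rightarrow>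
   ('g::topological_group_add \<Rightarrow> 'f \<Rightarrow> 'f) \<Rightarrow> ('g \<Rightarrow> 'a \<Rightarrow> 'a) \<Rightarrow> 'g \<Rightarrow> 't \<Rightarrow> 't" where
  "tensor_action F A T \<iota> \<beta> \<alpha> g = tensor_hom F A T \<iota> (\<beta> g) (\<alpha> g)"

end

theory Submission
  imports Defs "Jordan_Normal_Form.Spectral_Radius"
begin

text \<open>Let \<open>s : F \<otimes> A \<rightarrow> C/J\<close> be the given homomorphism. The trace form of \<open>F\<close> is nondegenerate, and dual
  bases \<open>e\<^sub>i\<close>, \<open>b\<^sub>i\<close> give a separability idempotent \<open>\<Sum> e\<^sub>i \<otimes> b\<^sub>i\<close> that is invariant under all automorphisms of
  \<open>F\<close>. The restriction of \<open>s\<close> to \<open>F\<close> lifts to a linear map into \<open>C\<close>; averaging over the compact group makes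
  the lift equivariant. It is almost multiplicative modulo \<open>J\<^sub>n\<close> for large \<open>n\<close>, and a Newton iteration built
  from the separability idempotent deforms it into a unital equivariant homomorphism \<open>l : F \<rightarrow> C/J\<^sub>n\<close>. Let \<open>D\<close>
  be the preimage in \<open>C\<close> of the commutant of \<open>l(F)\<close>. The invariant map \<open>c \<mapsto> \<Sum> l(e\<^sub>i) c l(b\<^sub>i)\<close> projects \<open>C\<close> onto
  \<open>D\<close> modulo \<open>J\<^sub>n\<close>, so \<open>J \<inter> D\<close> is the closure of the union of the \<open>J\<^sub>k \<inter> D\<close>, and the restriction of \<open>s\<close> to \<open>A\<close>
  lands in \<open>D/(J \<inter> D)\<close>. Semiprojectivity of \<open>A\<close> lifts it to \<open>\<rho> : A \<rightarrow> D/(J\<^sub>k \<inter> D)\<close>, and \<open>f \<otimes> a \<mapsto> l(f) \<rho>(a)\<close> is the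
  required lift of \<open>s\<close>.

  An ideal is not assumed to be closed under the involution, which the quotient maps need. A *-homomorphism
  into \<open>C/J\<close> exists only if \<open>J\<close> is *-closed, and semiprojectivity of \<open>A\<close> itself then provides arbitrarily
  large \<open>n\<close> with \<open>J\<^sub>n\<close> *-closed.\<close>

section \<open>Complex matrices\<close>

text \<open>Two constraints shape the argument. Semiprojectivity of \<open>A\<close> is assumed for
  test algebras over one fixed type \<open>'c\<close>, so it says nothing about a commutant formed
  inside \<open>C/J_n\<close>, whose elements are cosets; the preimage \<open>D\<close> of the
  commutant keeps the type \<open>'c\<close>. And maps into a quotient are handled throughout as
  maps into \<open>C\<close> whose laws hold up to congruence modulo the ideal; their size is
  measured by the quotient seminorm, which is submultiplicative and complete. Newton's method fits
  this setting because it is built from sums, products and the involution alone. The separability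
  idempotent takes the place of matrix units, which the action need not preserve: its invariance
  keeps every Newton step equivariant, so that averaging over the group is done once, for linear
  maps, where convex combinations make sense. The average itself is the limit of finite convex
  combinations, each of which shrinks the orbit by a fixed factor.\<close>

lemma trace_eq_sum_eigenvalues:
  fixes a :: "nat \<Rightarrow> nat \<Rightarrow> complex"
  shows "\<exists>es. length es = n \<and> (\<Sum>i<n. a i i) = sum_list es \<and>
    (\<forall>l. l \<in> set es \<longleftrightarrow> (\<exists>v. (\<exists>i<n. v i \<noteq> 0) \<and> (\<forall>i<n. (\<Sum>j<n. a i j * v j) = l * v i)))"
proof -
  define A where "A = Matrix.mat n n (\<lambda>(i,j). a i j)"
  have A: "A \<in> carrier_mat n n" by (simp add: A_def)
  obtain es where cp: "char_poly A = (\<Prod>e\<leftarrow>es. [:- e, 1:])" and len: "length es = n"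
    using char_poly_factorized[OF A] by auto
  obtain B P Q where "schur_decomposition A es = (B, P, Q)"
    by (metis prod_cases3)
  from schur_decomposition[OF A cp this]
  have sim: "similar_mat_wit A B P Q" and diag: "diag_mat B = es" by auto
  from similar_mat_witD2[OF A sim] have B: "B \<in> carrier_mat n n" and P: "P \<in> carrier_mat n n"
    and Q: "Q \<in> carrier_mat n n" and QP: "Q * P = 1\<^sub>m n" and AB: "A = P * B * Q" by auto
  \<comment> \<open>The trace is cyclic, hence unchanged by the similarity to the triangular matrix
    \<open>B\<close>, whose diagonal is \<open>es\<close>.\<close>
  have tr: "(\<Sum>i<n. (X * Y) $$ (i,i)) = (\<Sum>i<n. (Y * X) $$ (i,i))"
    if "X \<in> carrier_mat n n" "Y \<in> carrier_mat n n" for X Y :: "complex mat"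
  proof -
    have "(\<Sum>i<n. (X * Y) $$ (i,i)) = (\<Sum>i<n. \<Sum>j<n. X $$ (i,j) * Y $$ (j,i))"
      using that by (intro sum.cong refl) (auto simp: scalar_prod_def atLeast0LessThan)
    also have "\<dots> = (\<Sum>j<n. \<Sum>i<n. X $$ (i,j) * Y $$ (j,i))" by (rule sum.swap)
    also have "\<dots> = (\<Sum>i<n. (Y * X) $$ (i,i))"
      using that by (intro sum.cong refl) (auto simp: scalar_prod_def atLeast0LessThan mult.commute)
    finally show ?thesis .
  qed
  have "(\<Sum>i<n. a i i) = (\<Sum>i<n. A $$ (i,i))" by (simp add: A_def)
  also have "\<dots> = (\<Sum>i<n. (Q * (P * B)) $$ (i,i))"
    unfolding AB using P B Q by (intro tr) auto
  also have "Q * (P * B) = B"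
    using B by (simp add: assoc_mult_mat[OF Q P B, symmetric] QP)
  also have "(\<Sum>i<n. B $$ (i,i)) = sum_list es"
    unfolding diag[symmetric] diag_mat_def using B
    by (simp add: sum_list_distinct_conv_sum_set atLeast0LessThan)
  finally have sum: "(\<Sum>i<n. a i i) = sum_list es" .
  have "\<exists>v. (\<exists>i<n. v i \<noteq> 0) \<and> (\<forall>i<n. (\<Sum>j<n. a i j * v j) = l * v i)" if "l \<in> set es" for l
  proof -
    have "poly (char_poly A) l = 0" unfolding cp using linear_poly_root[OF that] .
    then have "eigenvalue A l" using eigenvalue_root_char_poly[OF A] by simp
    then obtain v where v: "v \<in> carrier_vec n" "v \<noteq> 0\<^sub>v n" "A *\<^sub>v v = l \<cdot>\<^sub>v v"
      unfolding eigenvalue_def eigenvector_def carrier_matD(1)[OF A] by blast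
    have "\<exists>i<n. vec_index v i \<noteq> 0" using v(1,2) by (metis carrier_vecD eq_vecI index_zero_vec)
    moreover have "(\<Sum>j<n. a i j * vec_index v j) = l * vec_index v i" if "i < n" for i
    proof -
      have "vec_index (A *\<^sub>v v) i = (\<Sum>j<n. a i j * vec_index v j)"
        using that v(1) by (auto simp: A_def scalar_prod_def atLeast0LessThan intro!: sum.cong)
      then show ?thesis using v that by simp
    qed
    ultimately show ?thesis by (intro exI[of _ "\<lambda>i. vec_index v i"]) auto
  qed
  moreover have "l \<in> set es" if v: "\<exists>i<n. v i \<noteq> 0" "\<forall>i<n. (\<Sum>j<n. a i j * v j) = l * v i" for l v
  proof -
    define w where "w = Matrix.vec n v"
    have "A *\<^sub>v w = l \<cdot>\<^sub>v w"
      using v(2) by (intro eq_vecI) (auto simp: A_def w_def scalar_prod_def atLeast0LessThan)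
    moreover have "w \<noteq> 0\<^sub>v n" using v(1) by (metis w_def index_vec index_zero_vec(1))
    ultimately have "eigenvalue A l"
      unfolding eigenvalue_def eigenvector_def using A by (auto simp: w_def intro!: exI[of _ w])
    then have "poly (char_poly A) l = 0" using eigenvalue_root_char_poly[OF A] by simp
    then show ?thesis unfolding cp by (auto simp: poly_prod_list prod_list_zero_iff)
  qed
  ultimately show ?thesis using len sum by blast
qed

text \<open>All eigenvalues vanish, so the spectral radius is 0 and the norm bound for powers of a
  matrix of spectral radius below 1 applies. The bounded orbit will later contradict the growth of
  norms that the C*-identity forces.\<close>

lemma bounded_orbit_of_nilpotent:
  fixes a :: "nat \<Rightarrow> nat \<Rightarrow> complex" and w :: "nat \<Rightarrow> nat \<Rightarrow> complex"
  assumes ev: "\<And>l v. \<exists>i<n. v i \<noteq> 0 \<Longrightarrow> \<forall>i<n. (\<Sum>j<n. a i j * v j) = l * v i \<Longrightarrow> l = 0"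
    and w: "\<And>k i. i < n \<Longrightarrow> w (Suc k) i = (\<Sum>j<n. a i j * w k j)"
  shows "\<exists>c. \<forall>k. \<forall>i<n. cmod (w k i) \<le> c"
proof -
  define A where "A = Matrix.mat n n (\<lambda>(i,j). a i j)"
  have A: "A \<in> carrier_mat n n" by (simp add: A_def)
  show ?thesis
  \<comment> \<open>The spectral radius is a maximum over the spectrum, which is empty for
    \<open>n = 0\<close>.\<close>
  proof (cases "n = 0")
    case False
    have ev0: "l = 0" if l: "eigenvalue A l" for l
    proof -
      obtain v where v: "v \<in> carrier_vec n" "v \<noteq> 0\<^sub>v n" "A *\<^sub>v v = l \<cdot>\<^sub>v v"
        using l unfolding eigenvalue_def eigenvector_def carrier_matD(1)[OF A] by blast
      have 1: "\<exists>i<n. vec_index v i \<noteq> 0" using v(1,2) by (metis carrier_vecD eq_vecI index_zero_vec)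
      have "(\<Sum>j<n. a i j * vec_index v j) = l * vec_index v i" if "i < n" for i
      proof -
        have "vec_index (A *\<^sub>v v) i = (\<Sum>j<n. a i j * vec_index v j)"
          using that v(1) by (auto simp: A_def scalar_prod_def atLeast0LessThan intro!: sum.cong)
        then show ?thesis using v that by simp
      qed
      then show ?thesis using ev[OF 1] by blast
    qed
    have "spectral_radius A < 1"
    proof -
      have "spectral_radius A \<in> norm ` spectrum A"
        using spectral_radius_mem_max(1)[OF A] False by simp
      then show ?thesis using ev0 unfolding spectrum_def by fastforce
    qed
    moreover have "\<exists>n_as. jordan_nf A n_as"
      using jordan_nf_exists[OF A] char_poly_factorized[OF A] by metis
    ultimately obtain c where c: "\<And>k. norm_bound (A ^\<^sub>m k) c"
      using spectral_radius_jnf_norm_bound_less_1[OF A] by blast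
    define u where "u = Matrix.vec n (w 0)"
    have u: "u \<in> carrier_vec n" by (simp add: u_def)
    have wk: "Matrix.vec n (w k) = (A ^\<^sub>m k) *\<^sub>v u" for k
    proof (induction k)
      case 0
      then show ?case using A by (simp add: u_def)
    next
      case (Suc k)
      have "Matrix.vec n (w (Suc k)) = A *\<^sub>v Matrix.vec n (w k)"
        by (intro eq_vecI) (auto simp: A_def scalar_prod_def w atLeast0LessThan)
      also have "\<dots> = (A * A ^\<^sub>m k) *\<^sub>v u"
        unfolding Suc using A u by (subst assoc_mult_mat_vec[of _ n n _ n]) auto
      also have "A * A ^\<^sub>m k = A ^\<^sub>m Suc k"
      proof (induction k)
        case 0
        then show ?case using A by simp
      next
        case (Suc k)
        have "A * A ^\<^sub>m Suc k = (A * A ^\<^sub>m k) * A"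
          using A by (simp add: assoc_mult_mat[of _ n n _ n _ n])
        then show ?case using Suc by simp
      qed
      finally show ?case .
    qed
    have "cmod (w k i) \<le> (\<Sum>j<n. c * cmod (w 0 j))" if "i < n" for i k
    proof -
      have "w k i = vec_index (Matrix.vec n (w k)) i" using that by simp
      also have "\<dots> = (\<Sum>j<n. (A ^\<^sub>m k) $$ (i,j) * w 0 j)"
        unfolding wk using that A by (auto simp: u_def scalar_prod_def atLeast0LessThan intro!: sum.cong)
      finally have "cmod (w k i) \<le> (\<Sum>j<n. cmod ((A ^\<^sub>m k) $$ (i,j)) * cmod (w 0 j))"
        by (metis (no_types, lifting) norm_mult norm_sum sum.cong)
      also have "\<dots> \<le> (\<Sum>j<n. c * cmod (w 0 j))"
        using c[of k] that A unfolding norm_bound_def by (intro sum_mono mult_right_mono) auto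
      finally show ?thesis .
    qed
    then show ?thesis by blast
  qed simp
qed

text \<open>Meant for the Gram matrix of the trace form, whose injectivity is nondegeneracy. An
  injective square matrix has nonzero determinant and so is a unit of the matrix ring; one side of
  its inverse is recorded.\<close>

lemma injective_matrix_inverse:
  fixes g :: "nat \<Rightarrow> nat \<Rightarrow> complex"
  assumes inj: "\<And>v. \<forall>i<n. (\<Sum>j<n. g i j * v j) = 0 \<Longrightarrow> \<forall>i<n. v i = 0"
  shows "\<exists>h. \<forall>i<n. \<forall>j<n. (\<Sum>l<n. g i l * h l j) = (if i = j then 1 else 0)"
proof -
  define G where "G = Matrix.mat n n (\<lambda>(i,j). g i j)"
  have G: "G \<in> carrier_mat n n" by (simp add: G_def)
  have "det G \<noteq> 0"
  proof
    assume "det G = 0"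
    then obtain v where v: "v \<in> carrier_vec n" "v \<noteq> 0\<^sub>v n" "G *\<^sub>v v = 0\<^sub>v n"
      using det_0_iff_vec_prod_zero_field[OF G] by blast
    have "(\<Sum>j<n. g i j * vec_index v j) = 0" if "i < n" for i
    proof -
      have "vec_index (G *\<^sub>v v) i = (\<Sum>j<n. g i j * vec_index v j)"
        using that v(1) by (auto simp: G_def scalar_prod_def atLeast0LessThan intro!: sum.cong)
      then show ?thesis using v that by simp
    qed
    from inj[of "\<lambda>i. vec_index v i"] this have "\<forall>i<n. vec_index v i = 0" by blast
    then show False using v by (metis carrier_vecD eq_vecI index_zero_vec)
  qed
  from det_non_zero_imp_unit[OF G this, of "()"]
  obtain H where H: "H \<in> carrier_mat n n" "G * H = 1\<^sub>m n"
    unfolding Units_def ring_mat_def by auto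
  have "(\<Sum>l<n. g i l * H $$ (l,j)) = (if i = j then 1 else 0)" if "i < n" "j < n" for i j
  proof -
    have "(G * H) $$ (i,j) = (\<Sum>l<n. g i l * H $$ (l,j))"
      using that H(1) by (auto simp: G_def scalar_prod_def atLeast0LessThan intro!: sum.cong)
    then show ?thesis using H that by simp
  qed
  then show ?thesis by (intro exI[of _ "\<lambda>l j. H $$ (l,j)"]) auto
qed

section \<open>C*-algebras\<close>

context cstar_algebra
begin

lemma sm_closed [simp, intro]: "x \<in> carrier A \<Longrightarrow> c \<odot> x \<in> carrier A"
  using smult_closed by (simp add: complex_ring_def)

lemma sm_add_l: "x \<in> carrier A \<Longrightarrow> (c + d) \<odot> x = c \<odot> x \<oplus> d \<odot> x"
  using smult_l_distr by (simp add: complex_ring_def)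

lemma sm_add_r: "x \<in> carrier A \<Longrightarrow> y \<in> carrier A \<Longrightarrow> c \<odot> (x \<oplus> y) = c \<odot> x \<oplus> c \<odot> y"
  using smult_r_distr by (simp add: complex_ring_def)

lemma sm_assoc: "x \<in> carrier A \<Longrightarrow> c \<odot> (d \<odot> x) = (c * d) \<odot> x"
  using smult_assoc1 by (simp add: complex_ring_def)

lemma sm_one [simp]: "x \<in> carrier A \<Longrightarrow> 1 \<odot> x = x"
  using smult_one by (simp add: complex_ring_def)

lemma sm_zero_l [simp]: "x \<in> carrier A \<Longrightarrow> 0 \<odot> x = \<zero>"
  using smult_l_null by (simp add: complex_ring_def)

lemma sm_zero_r [simp]: "c \<odot> \<zero> = \<zero>"
  using smult_r_null by (simp add: complex_ring_def)

lemma uminus_eq: "x \<in> carrier A \<Longrightarrow> \<ominus> x = (-1) \<odot> x"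
proof -
  assume x: "x \<in> carrier A"
  have "(-1) \<odot> x \<oplus> x = (-1 + 1) \<odot> x" using x by (simp only: sm_add_l sm_one)
  then have "(-1) \<odot> x \<oplus> x = \<zero>" using x by simp
  then show ?thesis using x by (metis minus_equality sm_closed)
qed

lemma diff_eq: "x \<in> carrier A \<Longrightarrow> y \<in> carrier A \<Longrightarrow> x \<ominus> y = x \<oplus> (-1) \<odot> y"
  by (simp add: minus_eq uminus_eq)

lemma sm_cancel [simp]:
  "x \<in> carrier A \<Longrightarrow> x \<oplus> (-1) \<odot> x = \<zero>"
  "x \<in> carrier A \<Longrightarrow> (-1) \<odot> x \<oplus> x = \<zero>"
  "x \<in> carrier A \<Longrightarrow> y \<in> carrier A \<Longrightarrow> x \<oplus> ((-1) \<odot> x \<oplus> y) = y"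
  "x \<in> carrier A \<Longrightarrow> y \<in> carrier A \<Longrightarrow> (-1) \<odot> x \<oplus> (x \<oplus> y) = y"
  by (simp_all add: uminus_eq[symmetric] r_neg l_neg r_neg1 r_neg2)

lemma sm_collect [simp]:
  "x \<in> carrier A \<Longrightarrow> c \<odot> x \<oplus> (- c) \<odot> x = \<zero>"
  "x \<in> carrier A \<Longrightarrow> (- c) \<odot> x \<oplus> c \<odot> x = \<zero>"
  "x \<in> carrier A \<Longrightarrow> y \<in> carrier A \<Longrightarrow> c \<odot> x \<oplus> ((- c) \<odot> x \<oplus> y) = y"
  "x \<in> carrier A \<Longrightarrow> y \<in> carrier A \<Longrightarrow> (- c) \<odot> x \<oplus> (c \<odot> x \<oplus> y) = y"
  by (simp_all add: a_assoc[symmetric] sm_add_l[symmetric])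

text \<open>Sorting a sum with \<open>a_ac\<close> can leave a foreign summand between an element
  and its negative. Cancelling such pairs lets \<open>lin_simps\<close> and \<open>alg_simps\<close>
  settle linear and ring identities.\<close>

lemma sm_cancel_apart [simp]:
  "x \<in> carrier A \<Longrightarrow> y \<in> carrier A \<Longrightarrow> x \<oplus> (y \<oplus> (-1) \<odot> x) = y"
  "x \<in> carrier A \<Longrightarrow> y \<in> carrier A \<Longrightarrow> z \<in> carrier A \<Longrightarrow> x \<oplus> (y \<oplus> ((-1) \<odot> x \<oplus> z)) = y \<oplus> z"
  by (simp_all add: a_lcomm[of x y])

lemmas lin_simps = diff_eq sm_add_r sm_assoc a_ac

lemma diff_self [simp]: "x \<in> carrier A \<Longrightarrow> x \<ominus> x = \<zero>"
  by (simp add: lin_simps)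

lemma diff_zero [simp]: "x \<in> carrier A \<Longrightarrow> x \<ominus> \<zero> = x"
  by (simp add: lin_simps)

lemma diff_add_cancel: "x \<in> carrier A \<Longrightarrow> y \<in> carrier A \<Longrightarrow> (x \<ominus> y) \<oplus> y = x"
  by (simp add: lin_simps)

lemma diff_telescope: "x \<in> carrier A \<Longrightarrow> y \<in> carrier A \<Longrightarrow> z \<in> carrier A \<Longrightarrow>
    (x \<ominus> y) \<oplus> (y \<ominus> z) = x \<ominus> z"
  by (simp add: lin_simps)

lemma sm_diff: "x \<in> carrier A \<Longrightarrow> y \<in> carrier A \<Longrightarrow> c \<odot> (x \<ominus> y) = c \<odot> x \<ominus> c \<odot> y"
  by (simp add: lin_simps)

lemma add_diff_add: "x \<in> carrier A \<Longrightarrow> y \<in> carrier A \<Longrightarrow> x' \<in> carrier A \<Longrightarrow> y' \<in> carrier A \<Longrightarrow>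
    (x \<oplus> y) \<ominus> (x' \<oplus> y') = (x \<ominus> x') \<oplus> (y \<ominus> y')"
  by (simp add: lin_simps)

lemma mult_closed' [simp, intro]: "x \<in> carrier A \<Longrightarrow> y \<in> carrier A \<Longrightarrow> x \<otimes> y \<in> carrier A"
  by (rule mult_closed)

lemma invol_closed' [simp, intro]: "x \<in> carrier A \<Longrightarrow> invol A x \<in> carrier A"
  by (rule invol_closed)

lemma mult_zero_l [simp]: "x \<in> carrier A \<Longrightarrow> \<zero> \<otimes> x = \<zero>"
  by (metis sm_zero_l smult_mult_left mult_closed zero_closed)

lemma mult_zero_r [simp]: "x \<in> carrier A \<Longrightarrow> x \<otimes> \<zero> = \<zero>"
  by (metis sm_zero_l smult_mult_right mult_closed zero_closed)

lemma mult_diff_l: "x \<in> carrier A \<Longrightarrow> y \<in> carrier A \<Longrightarrow> z \<in> carrier A \<Longrightarrow>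
    (x \<ominus> y) \<otimes> z = x \<otimes> z \<ominus> y \<otimes> z"
  by (simp add: diff_eq mult_add_left smult_mult_left)

lemma mult_diff_r: "x \<in> carrier A \<Longrightarrow> y \<in> carrier A \<Longrightarrow> z \<in> carrier A \<Longrightarrow>
    z \<otimes> (x \<ominus> y) = z \<otimes> x \<ominus> z \<otimes> y"
  by (simp add: diff_eq mult_add_right smult_mult_right)

lemma invol_zero [simp]: "invol A \<zero> = \<zero>"
  by (metis complex_cnj_zero invol_closed invol_smult sm_zero_l zero_closed)

lemma invol_diff: "x \<in> carrier A \<Longrightarrow> y \<in> carrier A \<Longrightarrow>
    invol A (x \<ominus> y) = invol A x \<ominus> invol A y"
  by (simp add: diff_eq invol_add invol_smult)

lemmas alg_simps = diff_eq sm_add_r sm_assoc a_ac mult_add_left mult_add_right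
  smult_mult_left smult_mult_right mult_assoc

lemma nrm_zero [simp]: "nrm A \<zero> = 0"
  by (simp add: nrm_eq_0_iff)

lemma nrm_diff_commute: "x \<in> carrier A \<Longrightarrow> y \<in> carrier A \<Longrightarrow> nrm A (x \<ominus> y) = nrm A (y \<ominus> x)"
proof -
  assume xy: "x \<in> carrier A" "y \<in> carrier A"
  then have "x \<ominus> y = (-1) \<odot> (y \<ominus> x)" by (simp add: lin_simps)
  then show ?thesis using xy nrm_smult[of "y \<ominus> x" "-1"] by simp
qed

lemma nrm_diff_triangle: "x \<in> carrier A \<Longrightarrow> y \<in> carrier A \<Longrightarrow> z \<in> carrier A \<Longrightarrow>
    nrm A (x \<ominus> z) \<le> nrm A (x \<ominus> y) + nrm A (y \<ominus> z)"
  using nrm_triangle[of "x \<ominus> y" "y \<ominus> z"] by (simp add: diff_telescope)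

lemma nrm_diff_le: "x \<in> carrier A \<Longrightarrow> y \<in> carrier A \<Longrightarrow> nrm A (x \<ominus> y) \<le> nrm A x + nrm A y"
  using nrm_triangle[of x "(-1) \<odot> y"] nrm_smult[of y "-1"] by (simp add: diff_eq)

lemma nrm_le_diff: "x \<in> carrier A \<Longrightarrow> y \<in> carrier A \<Longrightarrow> nrm A x \<le> nrm A (x \<ominus> y) + nrm A y"
  using nrm_triangle[of "x \<ominus> y" y] by (simp add: diff_add_cancel)

lemma nrm_invol: "x \<in> carrier A \<Longrightarrow> nrm A (invol A x) = nrm A x"
proof -
  have le: "nrm A x \<le> nrm A (invol A x)" if x: "x \<in> carrier A" for x
  proof (cases "nrm A x = 0")
    case False
    have "(nrm A x)\<^sup>2 \<le> nrm A (invol A x) * nrm A x"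
      using cstar_identity[OF x] nrm_mult[of "invol A x" x] x by simp
    then show ?thesis using False nrm_nonneg[OF x] by (simp add: power2_eq_square)
  qed (use x nrm_nonneg in auto)
  assume x: "x \<in> carrier A"
  show ?thesis using le[OF x] le[of "invol A x"] x by (simp add: invol_invol)
qed

lemma nrm_mult3: "x \<in> carrier A \<Longrightarrow> y \<in> carrier A \<Longrightarrow> z \<in> carrier A \<Longrightarrow>
    nrm A (x \<otimes> y \<otimes> z) \<le> nrm A x * nrm A y * nrm A z"
  by (meson dual_order.trans mult_closed mult_right_mono nrm_mult nrm_nonneg)

lemma finsum_induct:
  assumes "P \<zero>" "\<And>x y. x \<in> carrier A \<Longrightarrow> y \<in> carrier A \<Longrightarrow> P x \<Longrightarrow> P y \<Longrightarrow> P (x \<oplus> y)"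
    and "finite I" "f \<in> I \<rightarrow> carrier A" "\<And>i. i \<in> I \<Longrightarrow> P (f i)"
  shows "P (\<Oplus>i\<in>I. f i)"
  using assms(3-5)
proof (induction I rule: finite_induct)
  case empty
  then show ?case using assms(1) by simp
next
  case (insert i I)
  then show ?case using assms(2)[of "f i" "\<Oplus>i\<in>I. f i"] by (auto simp: Pi_iff intro: finsum_closed)
qed

lemma finsum_hom:
  fixes B :: "'b cstar"
  assumes "cstar_algebra B"
    and h: "h \<in> carrier B \<rightarrow> carrier A" "h \<zero>\<^bsub>B\<^esub> = \<zero>"
    and add: "\<And>x y. x \<in> carrier B \<Longrightarrow> y \<in> carrier B \<Longrightarrow> h (x \<oplus>\<^bsub>B\<^esub> y) = h x \<oplus> h y"
    and fin: "finite I" and f: "f \<in> I \<rightarrow> carrier B"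
  shows "h (\<Oplus>\<^bsub>B\<^esub>i\<in>I. f i) = (\<Oplus>i\<in>I. h (f i))"
proof -
  interpret B: cstar_algebra B by fact
  show ?thesis
    using fin f
  proof (induction I rule: finite_induct)
    case (insert i I)
    then have "f i \<in> carrier B" "f \<in> I \<rightarrow> carrier B" by auto
    moreover from this have "h (f i) \<in> carrier A" "(\<lambda>i. h (f i)) \<in> I \<rightarrow> carrier A" using h(1) by auto
    ultimately show ?case using insert by (simp add: add)
  qed (simp add: h)
qed

lemma sm_finsum: "finite I \<Longrightarrow> f \<in> I \<rightarrow> carrier A \<Longrightarrow> c \<odot> (\<Oplus>i\<in>I. f i) = (\<Oplus>i\<in>I. c \<odot> f i)"
  by (rule finsum_hom[OF cstar_algebra_axioms]) (auto simp: sm_add_r)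

lemma mult_finsum_l: "finite I \<Longrightarrow> f \<in> I \<rightarrow> carrier A \<Longrightarrow> x \<in> carrier A \<Longrightarrow>
    (\<Oplus>i\<in>I. f i) \<otimes> x = (\<Oplus>i\<in>I. f i \<otimes> x)"
  by (rule finsum_hom[OF cstar_algebra_axioms]) (auto simp: mult_add_left)

lemma mult_finsum_r: "finite I \<Longrightarrow> f \<in> I \<rightarrow> carrier A \<Longrightarrow> x \<in> carrier A \<Longrightarrow>
    x \<otimes> (\<Oplus>i\<in>I. f i) = (\<Oplus>i\<in>I. x \<otimes> f i)"
  by (rule finsum_hom[OF cstar_algebra_axioms]) (auto simp: mult_add_right)

lemma finsum_diff: "finite I \<Longrightarrow> f \<in> I \<rightarrow> carrier A \<Longrightarrow> g \<in> I \<rightarrow> carrier A \<Longrightarrow>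
    (\<Oplus>i\<in>I. f i \<ominus> g i) = (\<Oplus>i\<in>I. f i) \<ominus> (\<Oplus>i\<in>I. g i)"
proof (induction I rule: finite_induct)
  case (insert i I)
  then have *: "f i \<in> carrier A" "g i \<in> carrier A" "f \<in> I \<rightarrow> carrier A" "g \<in> I \<rightarrow> carrier A"
    "(\<lambda>i. f i \<ominus> g i) \<in> I \<rightarrow> carrier A" by auto
  then show ?case using insert by (simp add: add_diff_add finsum_closed)
qed simp

lemma finsum_swap:
  assumes "finite I" "finite K" "\<And>i k. i \<in> I \<Longrightarrow> k \<in> K \<Longrightarrow> f i k \<in> carrier A"
  shows "(\<Oplus>i\<in>I. \<Oplus>k\<in>K. f i k) = (\<Oplus>k\<in>K. \<Oplus>i\<in>I. f i k)"
  using assms(1,3)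
proof (induction I rule: finite_induct)
  case empty
  then show ?case by simp
next
  case (insert i I)
  have *: "(\<lambda>k. f i k) \<in> K \<rightarrow> carrier A" "(\<lambda>k. \<Oplus>i\<in>I. f i k) \<in> K \<rightarrow> carrier A"
    "(\<lambda>i. \<Oplus>k\<in>K. f i k) \<in> I \<rightarrow> carrier A" "(\<Oplus>k\<in>K. f i k) \<in> carrier A"
    using insert by (auto intro!: finsum_closed)
  have "(\<Oplus>k\<in>K. \<Oplus>i\<in>insert i I. f i k) = (\<Oplus>k\<in>K. f i k \<oplus> (\<Oplus>i\<in>I. f i k))"
    using insert by (intro finsum_cong) (auto simp: simp_implies_def Pi_iff intro!: finsum_closed finsum_insert)
  also have "\<dots> = (\<Oplus>k\<in>K. f i k) \<oplus> (\<Oplus>k\<in>K. \<Oplus>i\<in>I. f i k)"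
    by (rule finsum_addf[OF *(1,2)])
  finally show ?case using insert * by simp
qed

lemma nrm_finsum_le:
  assumes "finite I" "f \<in> I \<rightarrow> carrier A"
  shows "nrm A (\<Oplus>i\<in>I. f i) \<le> (\<Sum>i\<in>I. nrm A (f i))"
  using assms
proof (induction I rule: finite_induct)
  case (insert i I)
  then have *: "f i \<in> carrier A" "f \<in> I \<rightarrow> carrier A" by auto
  have "nrm A (\<Oplus>i\<in>insert i I. f i) \<le> nrm A (f i) + nrm A (\<Oplus>i\<in>I. f i)"
    using insert * by (simp add: nrm_triangle finsum_closed)
  then show ?case using insert * by simp
qed simp

lemma finsum_eqI: "(\<And>i. i \<in> I \<Longrightarrow> f i = g i) \<Longrightarrow> (\<And>i. i \<in> I \<Longrightarrow> g i \<in> carrier A) \<Longrightarrow>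
    (\<Oplus>i\<in>I. f i) = (\<Oplus>i\<in>I. g i)"
  by (rule finsum_cong') auto

section \<open>The metric, and topological notions expressed by the norm\<close>

lemma metric: "Metric_space (carrier A) (cstar_dist A)"
proof
  fix x y z
  show "0 \<le> cstar_dist A x y" by (auto simp: cstar_dist_def nrm_nonneg)
  show "cstar_dist A x y = cstar_dist A y x" by (auto simp: cstar_dist_def nrm_diff_commute)
  show "x \<in> carrier A \<Longrightarrow> y \<in> carrier A \<Longrightarrow> cstar_dist A x y = 0 \<longleftrightarrow> x = y"
    by (auto simp: cstar_dist_def nrm_eq_0_iff)
  show "x \<in> carrier A \<Longrightarrow> y \<in> carrier A \<Longrightarrow> z \<in> carrier A \<Longrightarrow>
      cstar_dist A x z \<le> cstar_dist A x y + cstar_dist A y z"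
    by (auto simp: cstar_dist_def nrm_diff_triangle)
qed

lemma limitin_iff: "limitin (cstar_topology A) x l sequentially \<longleftrightarrow>
   l \<in> carrier A \<and> (\<forall>\<epsilon>>0. \<exists>N. \<forall>n\<ge>N. x n \<in> carrier A \<and> nrm A (x n \<ominus> l) < \<epsilon>)"
  unfolding cstar_topology_def Metric_space.limit_metric_sequentially[OF metric]
  by (rule conj_cong) (simp_all add: cstar_dist_def cong: conj_cong)

lemma closure_of_iff:
  assumes "S \<subseteq> carrier A"
  shows "x \<in> cstar_topology A closure_of S \<longleftrightarrow>
    x \<in> carrier A \<and> (\<forall>\<epsilon>>0. \<exists>y\<in>S. nrm A (x \<ominus> y) < \<epsilon>)"
  unfolding cstar_topology_def Metric_space.metric_closure_of[OF metric]
  using assms by (auto simp: Metric_space.in_mball[OF metric] cstar_dist_def subset_iff)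

lemma closedin_iff: "closedin (cstar_topology A) S \<longleftrightarrow>
    S \<subseteq> carrier A \<and> (\<forall>x\<in>carrier A. (\<forall>\<epsilon>>0. \<exists>y\<in>S. nrm A (x \<ominus> y) < \<epsilon>) \<longrightarrow> x \<in> S)"
proof -
  have top: "topspace (cstar_topology A) = carrier A"
    by (simp add: cstar_topology_def Metric_space.topspace_mtopology[OF metric])
  show ?thesis
  proof (cases "S \<subseteq> carrier A")
    case True
    then show ?thesis
      using closure_of_iff[OF True] closure_of_subset_eq[of S "cstar_topology A"] top by (simp add: subset_iff Ball_def imp_conjL)
  next
    case False
    then show ?thesis using closedin_subset[of "cstar_topology A" S] top by auto
  qed
qed

lemma continuous_map_iff: "continuous_map euclidean (cstar_topology A) f \<longleftrightarrow>
    (\<forall>g. f g \<in> carrier A) \<and> (\<forall>g. \<forall>\<epsilon>>0. \<exists>U. open U \<and> g \<in> U \<and> (\<forall>h\<in>U. nrm A (f h \<ominus> f g) < \<epsilon>))"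
proof (cases "\<forall>g. f g \<in> carrier A")
  case True
  then have "f h \<in> Metric_space.mball (carrier A) (cstar_dist A) (f g) \<epsilon> \<longleftrightarrow> nrm A (f h \<ominus> f g) < \<epsilon>" for g h \<epsilon>
    by (simp add: Metric_space.in_mball[OF metric] cstar_dist_def nrm_diff_commute[of "f h" "f g"])
  with True show ?thesis
    unfolding cstar_topology_def Metric_space.continuous_map_to_metric[OF metric] by simp
next
  case False
  have "continuous_map euclidean (cstar_topology A) f \<Longrightarrow> \<forall>g. f g \<in> carrier A"
    using continuous_map_funspace Metric_space.topspace_mtopology[OF metric]
    unfolding cstar_topology_def by fastforce
  then show ?thesis using False by meson
qed

text \<open>Equalities that would follow from uniqueness of limits are obtained from this instead:
  the quantity in question is bounded by \<open>K * q ^ k\<close> for every \<open>k\<close>. The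
  same device works for the quotient seminorm.\<close>

lemma nonpos_if_le_geometric:
  fixes a :: real
  assumes "0 \<le> q" "q < 1" "\<And>k. a \<le> K * q ^ k"
  shows "a \<le> 0"
proof (rule LIMSEQ_le_const)
  have "(\<lambda>n. K * q ^ n) \<longlonglongrightarrow> K * 0"
    using assms by (intro tendsto_intros LIMSEQ_realpow_zero) auto
  then show "(\<lambda>n. K * q ^ n) \<longlonglongrightarrow> 0" by simp
qed (use assms in auto)

text \<open>The limit comes with its rate, because later arguments pass linearity, congruences and
  equivariance to limits by comparing rates.\<close>

lemma geometric_Cauchy_limit:
  assumes q: "0 \<le> q" "q < 1" and x: "\<And>k. x k \<in> carrier A"
    and step: "\<And>k. nrm A (x (Suc k) \<ominus> x k) \<le> K * q ^ k"
  shows "\<exists>l\<in>carrier A. \<forall>k. nrm A (x k \<ominus> l) \<le> K / (1 - q) * q ^ k"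
proof -
  define L where "L = K / (1 - q)"
  interpret Metric_space "carrier A" "cstar_dist A" by (rule metric)
  have "K \<ge> 0" using step[of 0] nrm_nonneg[of "x (Suc 0) \<ominus> x 0"] x by simp
  then have K: "L \<ge> 0" using q by (simp add: L_def)
  have L: "K = L * (1 - q)" using q by (simp add: L_def)
  \<comment> \<open>The bound is kept as a difference, the exact partial sum of the geometric series
    with \<open>K = L * (1 - q)\<close>; the bound \<open>L * q ^ k\<close> alone would not survive
    the induction.\<close>
  have tail: "nrm A (x (k + m) \<ominus> x k) \<le> L * q ^ k - L * q ^ (k + m)" for k m
  proof (induction m)
    case (Suc m)
    have "nrm A (x (k + Suc m) \<ominus> x k) \<le> nrm A (x (Suc (k + m)) \<ominus> x (k + m)) + nrm A (x (k + m) \<ominus> x k)"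
      using nrm_diff_triangle x by simp
    then show ?case using Suc step[of "k + m"] unfolding L by (simp add: algebra_simps)
  qed (use x in simp)
  have tail': "nrm A (x n \<ominus> x k) \<le> L * q ^ k" if "k \<le> n" for k n
  proof -
    have "0 \<le> L * q ^ (k + (n - k))" using K q by simp
    then show ?thesis using tail[of k "n - k"] that by simp
  qed
  have small: "\<exists>N. L * q ^ N < e" if "e > 0" for e :: real
  proof -
    have "(\<lambda>n. L * q ^ n) \<longlonglongrightarrow> L * 0" using q by (intro tendsto_intros LIMSEQ_realpow_zero) auto
    from order_tendstoD(2)[OF this, of e] have "\<forall>\<^sub>F n in sequentially. L * q ^ n < e"
      using that by simp
    then show ?thesis by (auto simp: eventually_sequentially)
  qed
  have "MCauchy x"
    unfolding MCauchy_def
  proof (intro conjI allI impI)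
    show "range x \<subseteq> carrier A" using x by auto
    fix e :: real assume "e > 0"
    then obtain N where N: "L * q ^ N < e / 2" using small[of "e / 2"] by auto
    show "\<exists>N. \<forall>n n'. N \<le> n \<longrightarrow> N \<le> n' \<longrightarrow> cstar_dist A (x n) (x n') < e"
    proof (intro exI allI impI)
      fix n n' assume "N \<le> n" "N \<le> n'"
      then have "nrm A (x n \<ominus> x N) < e/2" "nrm A (x n' \<ominus> x N) < e/2"
        using tail'[of N n] tail'[of N n'] N by linarith+
      then show "cstar_dist A (x n) (x n') < e"
        using nrm_diff_triangle[of "x n" "x N" "x n'"] nrm_diff_commute[of "x n'" "x N"] x
        by (simp add: cstar_dist_def)
    qed
  qed
  then obtain l where "limitin mtopology x l sequentially"
    using complete unfolding mcomplete_def by blast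
  then have l: "l \<in> carrier A" and lim: "\<forall>e>0. \<exists>N. \<forall>n\<ge>N. x n \<in> carrier A \<and> nrm A (x n \<ominus> l) < e"
    using limitin_iff[of x l] unfolding cstar_topology_def by simp_all
  have "nrm A (x k \<ominus> l) \<le> L * q ^ k" for k
  proof (rule field_le_epsilon)
    fix e :: real assume "e > 0"
    then obtain N where N: "\<forall>n\<ge>N. nrm A (x n \<ominus> l) < e" using lim by meson
    have "nrm A (x k \<ominus> l) \<le> nrm A (x k \<ominus> x (max k N)) + nrm A (x (max k N) \<ominus> l)"
      using nrm_diff_triangle x l by simp
    also have "nrm A (x k \<ominus> x (max k N)) \<le> L * q ^ k"
      using tail'[of k "max k N"] nrm_diff_commute x by simp
    finally show "nrm A (x k \<ominus> l) \<le> L * q ^ k + e" using N[rule_format, of "max k N"] by linarith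
  qed
  then show ?thesis using l unfolding L_def by blast
qed

end

section \<open>Square roots of elements close to the unit\<close>

context unital_cstar_algebra
begin

lemma invol_one [simp]: "invol A \<one> = \<one>"
  by (metis invol_closed invol_invol invol_mult l_one one_closed r_one)

text \<open>By the C*-identity this norm is its own square, so it is 0 or 1; the value 0 occurs in
  the zero algebra, which counts as unital.\<close>

lemma nrm_one_le: "nrm A \<one> \<le> 1"
proof -
  have "nrm A \<one> = (nrm A \<one>)\<^sup>2" using cstar_identity[of \<one>] by simp
  then show ?thesis by (smt (verit) mult_cancel_left1 one_closed nrm_nonneg power2_eq_square)
qed

text \<open>If \<open>l\<close> is a fixed point of \<open>f z = (y + z^2) / 2\<close>, then
  \<open>(1 - l)^2 = 1 - 2 l + l^2 = 1 - y\<close>, so \<open>1 - l\<close> is the desired root. On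
  the ball of radius \<open>q = nrm A y\<close> the map \<open>f\<close> is a contraction with
  constant \<open>q\<close>, and its iterates from zero are self-adjoint and commute with whatever
  commutes with \<open>y\<close>.\<close>

lemma sqrt_one_minus:
  assumes y: "y \<in> carrier A" "invol A y = y" "nrm A y < 1"
  shows "\<exists>s\<in>carrier A. invol A s = s \<and> s \<otimes> s = \<one> \<ominus> y \<and>
    (\<forall>x\<in>carrier A. x \<otimes> y = y \<otimes> x \<longrightarrow> x \<otimes> s = s \<otimes> x)"
proof -
  define q where "q = nrm A y"
  have q: "0 \<le> q" "q < 1" using y nrm_nonneg by (auto simp: q_def)
  define f where "f z = (1/2) \<odot> (y \<oplus> z \<otimes> z)" for z
  define z where "z n = (f ^^ n) \<zero>" for n
  have z0: "z 0 = \<zero>" and zS: "z (Suc n) = f (z n)" for n by (simp_all add: z_def)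
  have fc: "f x \<in> carrier A" if "x \<in> carrier A" for x using that y by (simp add: f_def)
  have zc [simp]: "z n \<in> carrier A" for n by (induction n) (auto simp: z0 zS fc)
  have zq: "nrm A (z n) \<le> q" for n
  proof (induction n)
    case (Suc n)
    have "nrm A (f (z n)) = 1/2 * nrm A (y \<oplus> z n \<otimes> z n)"
      unfolding f_def using y by (simp add: nrm_smult)
    also have "\<dots> \<le> 1/2 * (nrm A y + nrm A (z n) * nrm A (z n))"
      using nrm_triangle[of y "z n \<otimes> z n"] nrm_mult[of "z n" "z n"] y by simp
    also have "nrm A (z n) * nrm A (z n) \<le> q * 1"
      using Suc q nrm_nonneg[of "z n"] by (intro mult_mono) auto
    finally show ?case by (simp add: zS q_def)
  qed (use q in \<open>simp add: z0\<close>)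
  \<comment> \<open>Without commutativity \<open>v^2 - w^2\<close> still splits as
    \<open>v (v - w) + (v - w) w\<close>.\<close>
  have lip: "nrm A (f v \<ominus> f w) \<le> q * nrm A (v \<ominus> w)"
    if vw: "v \<in> carrier A" "w \<in> carrier A" "nrm A v \<le> q" "nrm A w \<le> q" for v w
  proof -
    have "f v \<ominus> f w = (1/2) \<odot> (v \<otimes> (v \<ominus> w) \<oplus> (v \<ominus> w) \<otimes> w)"
      using vw y by (simp add: f_def alg_simps)
    then have "nrm A (f v \<ominus> f w) = 1/2 * nrm A (v \<otimes> (v \<ominus> w) \<oplus> (v \<ominus> w) \<otimes> w)"
      using vw by (simp add: nrm_smult)
    also have "\<dots> \<le> 1/2 * (nrm A v * nrm A (v \<ominus> w) + nrm A (v \<ominus> w) * nrm A w)"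
      using nrm_triangle[of "v \<otimes> (v \<ominus> w)" "(v \<ominus> w) \<otimes> w"] nrm_mult[of v "v \<ominus> w"]
        nrm_mult[of "v \<ominus> w" w] vw by simp
    also have "\<dots> \<le> 1/2 * (q * nrm A (v \<ominus> w) + nrm A (v \<ominus> w) * q)"
      using vw q nrm_nonneg[of "v \<ominus> w"] by (intro mult_left_mono add_mono mult_mono) auto
    finally show ?thesis by simp
  qed
  have "nrm A (z (Suc k) \<ominus> z k) \<le> nrm A (z 1) * q ^ k" for k
  proof (induction k)
    case (Suc k)
    have "nrm A (z (Suc (Suc k)) \<ominus> z (Suc k)) \<le> q * nrm A (z (Suc k) \<ominus> z k)"
      using lip[OF zc zc zq zq, of "Suc k" k] by (simp add: zS)
    also have "\<dots> \<le> q * (nrm A (z 1) * q ^ k)" using Suc q by (intro mult_left_mono) auto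
    finally show ?case by (simp add: mult_ac)
  qed (simp add: z0)
  from geometric_Cauchy_limit[OF q zc this] obtain l K where l: "l \<in> carrier A"
    and lim: "\<And>k. nrm A (z k \<ominus> l) \<le> K * q ^ k" by blast
  have lq: "nrm A l \<le> q"
  proof -
    have "nrm A l - q \<le> K * q ^ k" for k
      using nrm_le_diff[of l "z k"] nrm_diff_commute[of l "z k"] zq[of k] lim[of k] l by simp
    from nonpos_if_le_geometric[OF q this] show ?thesis by simp
  qed
  have fl: "l = f l"
  proof -
    have "nrm A (l \<ominus> f l) \<le> (2 * K * q) * q ^ k" for k
    proof -
      have "nrm A (l \<ominus> f l) \<le> nrm A (l \<ominus> z (Suc k)) + nrm A (z (Suc k) \<ominus> f l)"
        using nrm_diff_triangle l fc by simp
      also have "nrm A (l \<ominus> z (Suc k)) \<le> K * q ^ Suc k"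
        using lim[of "Suc k"] nrm_diff_commute[of l "z (Suc k)"] l by simp
      also have "nrm A (z (Suc k) \<ominus> f l) \<le> q * nrm A (z k \<ominus> l)"
        unfolding zS using lip zq lq l by simp
      also have "\<dots> \<le> q * (K * q ^ k)" using lim q by (intro mult_left_mono) auto
      finally show ?thesis by (simp add: mult_ac)
    qed
    from nonpos_if_le_geometric[OF q this] have "nrm A (l \<ominus> f l) = 0"
      using nrm_nonneg l fc by (simp add: antisym)
    then show ?thesis using l fc by (simp add: nrm_eq_0_iff)
  qed
  have il: "invol A l = l"
  proof -
    have iz: "invol A (z n) = z n" for n
      by (induction n) (use y in \<open>simp_all add: z0 zS f_def invol_smult invol_add invol_mult\<close>)
    have "nrm A (invol A l \<ominus> l) \<le> (2 * K) * q ^ k" for k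
    proof -
      have "nrm A (invol A l \<ominus> l) \<le> nrm A (invol A l \<ominus> z k) + nrm A (z k \<ominus> l)"
        using nrm_diff_triangle l by simp
      also have "nrm A (invol A l \<ominus> z k) = nrm A (z k \<ominus> l)"
      proof -
        have "invol A (l \<ominus> z k) = invol A l \<ominus> z k" using l iz by (simp add: invol_diff)
        then show ?thesis using nrm_invol[of "l \<ominus> z k"] nrm_diff_commute[of l "z k"] l by simp
      qed
      finally show ?thesis using lim[of k] by simp
    qed
    from nonpos_if_le_geometric[OF q this] have "nrm A (invol A l \<ominus> l) = 0"
      using nrm_nonneg l by (simp add: antisym)
    then show ?thesis using l by (simp add: nrm_eq_0_iff)
  qed
  have comm: "x \<otimes> l = l \<otimes> x" if x: "x \<in> carrier A" "x \<otimes> y = y \<otimes> x" for x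
  proof -
    have xz: "x \<otimes> z n = z n \<otimes> x" for n
    proof (induction n)
      case (Suc n)
      have "x \<otimes> (z n \<otimes> z n) = z n \<otimes> z n \<otimes> x"
        using Suc x by (metis mult_assoc zc)
      then show ?case using x y
        by (simp add: zS f_def smult_mult_left smult_mult_right mult_add_left mult_add_right)
    qed (use x in \<open>simp add: z0\<close>)
    have "nrm A (x \<otimes> l \<ominus> l \<otimes> x) \<le> (2 * K * nrm A x) * q ^ k" for k
    proof -
      have "x \<otimes> l \<ominus> l \<otimes> x = x \<otimes> (l \<ominus> z k) \<oplus> (z k \<ominus> l) \<otimes> x"
        using x l xz[of k] by (simp add: mult_diff_l mult_diff_r diff_telescope)
      then have "nrm A (x \<otimes> l \<ominus> l \<otimes> x) \<le> nrm A x * nrm A (l \<ominus> z k) + nrm A (z k \<ominus> l) * nrm A x"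
        using nrm_triangle[of "x \<otimes> (l \<ominus> z k)" "(z k \<ominus> l) \<otimes> x"] nrm_mult[of x "l \<ominus> z k"]
          nrm_mult[of "z k \<ominus> l" x] x l by simp
      also have "\<dots> = 2 * nrm A x * nrm A (z k \<ominus> l)" using nrm_diff_commute[of l "z k"] l by simp
      also have "\<dots> \<le> 2 * nrm A x * (K * q ^ k)"
        using lim nrm_nonneg[OF x(1)] by (intro mult_left_mono) auto
      finally show ?thesis by (simp add: mult_ac)
    qed
    from nonpos_if_le_geometric[OF q this] have "nrm A (x \<otimes> l \<ominus> l \<otimes> x) = 0"
      using nrm_nonneg l x by (simp add: antisym)
    then show ?thesis using l x by (simp add: nrm_eq_0_iff)
  qed
  have "2 \<odot> l = y \<oplus> l \<otimes> l"
  proof -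
    have "2 \<odot> l = 2 \<odot> f l" using fl by simp
    also have "\<dots> = y \<oplus> l \<otimes> l" using l y by (simp add: f_def sm_assoc)
    finally show ?thesis .
  qed
  moreover have "2 \<odot> l = l \<oplus> l" using sm_add_l[of l 1 1] l by simp
  ultimately have ll: "l \<oplus> l = y \<oplus> l \<otimes> l" by simp
  have "(\<one> \<ominus> l) \<otimes> (\<one> \<ominus> l) = \<one> \<ominus> (l \<oplus> l) \<oplus> l \<otimes> l"
    using l by (simp add: alg_simps)
  also have "\<dots> = \<one> \<ominus> y" unfolding ll using l y by (simp add: alg_simps)
  finally have sq: "(\<one> \<ominus> l) \<otimes> (\<one> \<ominus> l) = \<one> \<ominus> y" .
  show ?thesis
    using l il sq comm by (intro bexI[of _ "\<one> \<ominus> l"]) (auto simp: invol_diff mult_diff_l mult_diff_r)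
qed

end

section \<open>Homomorphisms are contractive, automorphisms are isometric\<close>

lemma star_homD:
  assumes "star_hom A B \<phi>"
  shows "x \<in> carrier A \<Longrightarrow> \<phi> x \<in> carrier B"
    and "x \<in> carrier A \<Longrightarrow> y \<in> carrier A \<Longrightarrow> \<phi> (x \<oplus>\<^bsub>A\<^esub> y) = \<phi> x \<oplus>\<^bsub>B\<^esub> \<phi> y"
    and "x \<in> carrier A \<Longrightarrow> y \<in> carrier A \<Longrightarrow> \<phi> (x \<otimes>\<^bsub>A\<^esub> y) = \<phi> x \<otimes>\<^bsub>B\<^esub> \<phi> y"
    and "x \<in> carrier A \<Longrightarrow> \<phi> (c \<odot>\<^bsub>A\<^esub> x) = c \<odot>\<^bsub>B\<^esub> \<phi> x"
    and "x \<in> carrier A \<Longrightarrow> \<phi> (invol A x) = invol B (\<phi> x)"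
  using assms by (auto simp: star_hom_def)

lemma star_hom_diff:
  assumes "cstar_algebra A" "cstar_algebra B" "star_hom A B \<phi>" "x \<in> carrier A" "y \<in> carrier A"
  shows "\<phi> (x \<ominus>\<^bsub>A\<^esub> y) = \<phi> x \<ominus>\<^bsub>B\<^esub> \<phi> y"
proof -
  interpret A: cstar_algebra A by fact
  interpret B: cstar_algebra B by fact
  show ?thesis using assms(4,5) by (simp add: A.diff_eq B.diff_eq star_homD[OF assms(3)])
qed

text \<open>For self-adjoint \<open>h\<close> with \<open>\<parallel>h\<parallel> < 1\<close> put \<open>s = (1 - h\<^sup>2)\<^sup>1\<^sup>/\<^sup>2\<close>. Then \<open>h + is\<close> is unitary, hence so is its
  image, and the image of \<open>h\<close> is the real part of a unitary.\<close>

lemma unital_star_hom_contractive: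
  fixes A :: "'a cstar" and B :: "'b cstar"
  assumes uA: "unital_cstar_algebra A" and uB: "unital_cstar_algebra B"
    and hom: "star_hom A B \<phi>" and one: "\<phi> \<one>\<^bsub>A\<^esub> = \<one>\<^bsub>B\<^esub>" and x: "x \<in> carrier A"
  shows "nrm B (\<phi> x) \<le> nrm A x"
proof -
  interpret A: unital_cstar_algebra A by fact
  interpret B: unital_cstar_algebra B by fact
  note h = star_homD[OF hom]
  have lt1: "nrm B (\<phi> h) \<le> 1" if hA: "h \<in> carrier A" "invol A h = h" "nrm A h < 1" for h
  proof -
    have "nrm A (h \<otimes>\<^bsub>A\<^esub> h) < 1"
      using A.cstar_identity[of h] hA A.nrm_nonneg[of h] by (simp add: abs_square_less_1)
    then obtain s where s: "s \<in> carrier A" "invol A s = s" "s \<otimes>\<^bsub>A\<^esub> s = \<one>\<^bsub>A\<^esub> \<ominus>\<^bsub>A\<^esub> h \<otimes>\<^bsub>A\<^esub> h"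
      and comm: "h \<otimes>\<^bsub>A\<^esub> s = s \<otimes>\<^bsub>A\<^esub> h"
      using A.sqrt_one_minus[of "h \<otimes>\<^bsub>A\<^esub> h"] hA by (auto simp: A.invol_mult A.mult_assoc)
    define k t where "k = \<phi> h" and "t = \<phi> s"
    have k: "k \<in> carrier B" "invol B k = k" using hA h by (auto simp: k_def simp flip: h(5))
    have t: "t \<in> carrier B" "invol B t = t" using s h by (auto simp: t_def simp flip: h(5))
    have tt: "t \<otimes>\<^bsub>B\<^esub> t = \<one>\<^bsub>B\<^esub> \<ominus>\<^bsub>B\<^esub> k \<otimes>\<^bsub>B\<^esub> k"
    proof -
      have "\<phi> (s \<otimes>\<^bsub>A\<^esub> s) = \<phi> (\<one>\<^bsub>A\<^esub> \<ominus>\<^bsub>A\<^esub> h \<otimes>\<^bsub>A\<^esub> h)" using s by simp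
      then show ?thesis
        using s(1) hA star_hom_diff[OF A.cstar_algebra_axioms B.cstar_algebra_axioms hom]
        by (simp add: k_def t_def h one)
    qed
    have kt: "k \<otimes>\<^bsub>B\<^esub> t = t \<otimes>\<^bsub>B\<^esub> k" using s hA arg_cong[OF comm, of \<phi>] by (simp add: k_def t_def h)
    define u where "u = k \<oplus>\<^bsub>B\<^esub> \<i> \<odot>\<^bsub>B\<^esub> t"
    have u: "u \<in> carrier B" using k t by (simp add: u_def)
    have iu: "invol B u = k \<oplus>\<^bsub>B\<^esub> (-\<i>) \<odot>\<^bsub>B\<^esub> t"
      using k t by (simp add: u_def B.invol_add B.invol_smult)
    have "invol B u \<otimes>\<^bsub>B\<^esub> u = k \<otimes>\<^bsub>B\<^esub> k \<oplus>\<^bsub>B\<^esub> t \<otimes>\<^bsub>B\<^esub> t"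
      unfolding iu unfolding u_def using k t
      by (simp add: B.alg_simps kt)
    also have "\<dots> = \<one>\<^bsub>B\<^esub>" unfolding tt using k by (simp add: B.alg_simps)
    finally have "(nrm B u)\<^sup>2 \<le> 1" using B.cstar_identity[OF u] B.nrm_one_le by simp
    then have nu: "nrm B u \<le> 1" using B.nrm_nonneg[OF u] by (simp add: abs_square_le_1)
    have "u \<oplus>\<^bsub>B\<^esub> invol B u = k \<oplus>\<^bsub>B\<^esub> k" unfolding iu unfolding u_def using k t
      by (simp add: B.lin_simps)
    also have "\<dots> = 2 \<odot>\<^bsub>B\<^esub> k" using B.sm_add_l[of k 1 1] k by simp
    finally have "2 * nrm B k = nrm B (u \<oplus>\<^bsub>B\<^esub> invol B u)" using k by (simp add: B.nrm_smult)
    also have "\<dots> \<le> nrm B u + nrm B u" using B.nrm_triangle[of u "invol B u"] B.nrm_invol u by simp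
    finally show ?thesis using nu by (simp add: k_def)
  qed
  \<comment> \<open>\<open>lt1\<close> asks for a norm strictly below 1. If the two norms were in
    the wrong order, dividing by a number \<open>r\<close> strictly between them would contradict
    it.\<close>
  have sa: "nrm B (\<phi> h) \<le> nrm A h" if hA: "h \<in> carrier A" "invol A h = h" for h
  proof (rule ccontr)
    assume "\<not> ?thesis"
    then obtain r where r: "nrm A h < r" "r < nrm B (\<phi> h)" using dense by (auto simp: not_le)
    have r0: "r > 0" using r A.nrm_nonneg[OF hA(1)] by simp
    define c where "c = complex_of_real (1 / r)"
    have "nrm A (c \<odot>\<^bsub>A\<^esub> h) < 1" using hA r r0 by (simp add: c_def A.nrm_smult norm_divide)
    moreover have "invol A (c \<odot>\<^bsub>A\<^esub> h) = c \<odot>\<^bsub>A\<^esub> h" using hA by (simp add: c_def A.invol_smult)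
    ultimately have "nrm B (\<phi> (c \<odot>\<^bsub>A\<^esub> h)) \<le> 1" using lt1 hA by simp
    then show False using hA h r r0 by (simp add: c_def B.nrm_smult norm_divide)
  qed
  \<comment> \<open>The C*-identity reduces an arbitrary \<open>x\<close> to the self-adjoint
    element \<open>invol A x \<otimes> x\<close>.\<close>
  have "(nrm B (\<phi> x))\<^sup>2 = nrm B (\<phi> (invol A x \<otimes>\<^bsub>A\<^esub> x))"
    using x h B.cstar_identity[of "\<phi> x"] by simp
  also have "\<dots> \<le> nrm A (invol A x \<otimes>\<^bsub>A\<^esub> x)"
    using sa x by (simp add: A.invol_mult A.invol_invol)
  also have "\<dots> = (nrm A x)\<^sup>2" using x by (rule A.cstar_identity)
  finally show ?thesis using A.nrm_nonneg[OF x] by (rule power2_le_imp_le)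
qed

text \<open>Preservation of the unit is not part of \<open>cstar_aut\<close>. Surjectivity provides
  \<open>e\<close> whose image is the unit, and then
  \<open>\<phi> 1 = \<phi> 1 \<otimes> \<phi> e = \<phi> e\<close>.\<close>

lemma cstar_aut_one:
  assumes "unital_cstar_algebra A" "\<phi> \<in> cstar_aut A"
  shows "\<phi> \<one>\<^bsub>A\<^esub> = \<one>\<^bsub>A\<^esub>"
proof -
  interpret A: unital_cstar_algebra A by fact
  have hom: "star_hom A A \<phi>" and bij: "bij_betw \<phi> (carrier A) (carrier A)"
    using assms(2) by (auto simp: cstar_aut_def)
  note h = star_homD[OF hom]
  obtain e where e: "e \<in> carrier A" "\<phi> e = \<one>\<^bsub>A\<^esub>"
    using bij A.one_closed by (metis bij_betw_imp_surj_on image_iff)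
  have "\<phi> \<one>\<^bsub>A\<^esub> = \<phi> \<one>\<^bsub>A\<^esub> \<otimes>\<^bsub>A\<^esub> \<phi> e" using e h by simp
  also have "\<dots> = \<phi> e" using e h(3)[of "\<one>\<^bsub>A\<^esub>" e] by simp
  finally show ?thesis using e by simp
qed

lemma G_algebraD:
  assumes "G_algebra A \<alpha>"
  shows "cstar_algebra A" "\<alpha> g \<in> cstar_aut A" "star_hom A A (\<alpha> g)" "a \<in> carrier A \<Longrightarrow> \<alpha> g a \<in> carrier A"
    "a \<in> carrier A \<Longrightarrow> \<alpha> 0 a = a" "a \<in> carrier A \<Longrightarrow> \<alpha> (g + h) a = \<alpha> g (\<alpha> h a)"
    "a \<in> carrier A \<Longrightarrow> \<alpha> (- g) (\<alpha> g a) = a" "a \<in> carrier A \<Longrightarrow> \<alpha> g (\<alpha> (- g) a) = a"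
    "a \<in> carrier A \<Longrightarrow> continuous_map euclidean (cstar_topology A) (\<lambda>g. \<alpha> g a)"
proof -
  show *: "cstar_algebra A" "\<alpha> g \<in> cstar_aut A" "star_hom A A (\<alpha> g)"
    "a \<in> carrier A \<Longrightarrow> \<alpha> 0 a = a" "a \<in> carrier A \<Longrightarrow> \<alpha> (g + h) a = \<alpha> g (\<alpha> h a)"
    "a \<in> carrier A \<Longrightarrow> continuous_map euclidean (cstar_topology A) (\<lambda>g. \<alpha> g a)" for g h
    using assms by (auto simp: G_algebra_def cstar_aut_def)
  show "a \<in> carrier A \<Longrightarrow> \<alpha> g a \<in> carrier A" using star_homD(1)[OF *(3)] .
  show "a \<in> carrier A \<Longrightarrow> \<alpha> (- g) (\<alpha> g a) = a" using *(4) *(5)[of "-g" g] by simp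
  show "a \<in> carrier A \<Longrightarrow> \<alpha> g (\<alpha> (- g) a) = a" using *(4) *(5)[of g "-g"] by simp
qed

text \<open>Contractivity is applied both to \<open>\<alpha> g\<close> and to its inverse
  \<open>\<alpha> (- g)\<close>.\<close>

lemma G_algebra_isometric:
  assumes "unital_cstar_algebra A" "G_algebra A \<alpha>" "a \<in> carrier A"
  shows "nrm A (\<alpha> g a) = nrm A a"
proof (rule antisym)
  note G = G_algebraD[OF assms(2)]
  have le: "nrm A (\<alpha> g a) \<le> nrm A a" if "a \<in> carrier A" for g a
    using unital_star_hom_contractive[OF assms(1,1) G(3) cstar_aut_one[OF assms(1) G(2)] that] .
  show "nrm A (\<alpha> g a) \<le> nrm A a" using le assms by simp
  show "nrm A a \<le> nrm A (\<alpha> g a)" using le[of "\<alpha> g a" "-g"] G assms by simp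
qed

section \<open>The trace form of a finite dimensional C*-algebra\<close>

definition clinear_map :: "'a cstar \<Rightarrow> 'b cstar \<Rightarrow> ('a \<Rightarrow> 'b) \<Rightarrow> bool" where
  "clinear_map A B h \<longleftrightarrow> h \<in> carrier A \<rightarrow> carrier B \<and>
     (\<forall>x\<in>carrier A. \<forall>y\<in>carrier A. h (x \<oplus>\<^bsub>A\<^esub> y) = h x \<oplus>\<^bsub>B\<^esub> h y) \<and>
     (\<forall>c. \<forall>x\<in>carrier A. h (c \<odot>\<^bsub>A\<^esub> x) = c \<odot>\<^bsub>B\<^esub> h x)"

lemma clinear_mapD:
  assumes "clinear_map A B h"
  shows "x \<in> carrier A \<Longrightarrow> h x \<in> carrier B"
    and "x \<in> carrier A \<Longrightarrow> y \<in> carrier A \<Longrightarrow> h (x \<oplus>\<^bsub>A\<^esub> y) = h x \<oplus>\<^bsub>B\<^esub> h y"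
    and "x \<in> carrier A \<Longrightarrow> h (c \<odot>\<^bsub>A\<^esub> x) = c \<odot>\<^bsub>B\<^esub> h x"
  using assms by (auto simp: clinear_map_def)

lemma clinear_mapI:
  assumes "\<And>x. x \<in> carrier A \<Longrightarrow> h x \<in> carrier B"
    and "\<And>x y. x \<in> carrier A \<Longrightarrow> y \<in> carrier A \<Longrightarrow> h (x \<oplus>\<^bsub>A\<^esub> y) = h x \<oplus>\<^bsub>B\<^esub> h y"
    and "\<And>x c. x \<in> carrier A \<Longrightarrow> h (c \<odot>\<^bsub>A\<^esub> x) = c \<odot>\<^bsub>B\<^esub> h x"
  shows "clinear_map A B h"
  using assms by (auto simp: clinear_map_def)

lemma clinear_map_zero:
  assumes "cstar_algebra A" "cstar_algebra B" "clinear_map A B h"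
  shows "h \<zero>\<^bsub>A\<^esub> = \<zero>\<^bsub>B\<^esub>"
proof -
  interpret A: cstar_algebra A by fact
  interpret B: cstar_algebra B by fact
  show ?thesis using clinear_mapD(3)[OF assms(3), of "\<zero>\<^bsub>A\<^esub>" 0] clinear_mapD(1)[OF assms(3)] by simp
qed

lemma clinear_map_diff:
  assumes "cstar_algebra A" "cstar_algebra B" "clinear_map A B h" "x \<in> carrier A" "y \<in> carrier A"
  shows "h (x \<ominus>\<^bsub>A\<^esub> y) = h x \<ominus>\<^bsub>B\<^esub> h y"
proof -
  interpret A: cstar_algebra A by fact
  interpret B: cstar_algebra B by fact
  show ?thesis using assms(4,5) by (simp add: A.diff_eq B.diff_eq clinear_mapD[OF assms(3)])
qed

lemma clinear_map_finsum:
  assumes "cstar_algebra A" "cstar_algebra B" "clinear_map A B h" "finite I" "f \<in> I \<rightarrow> carrier A"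
  shows "h (\<Oplus>\<^bsub>A\<^esub>i\<in>I. f i) = (\<Oplus>\<^bsub>B\<^esub>i\<in>I. h (f i))"
  using cstar_algebra.finsum_hom[OF assms(2) assms(1), of h I f] clinear_mapD[OF assms(3)]
    clinear_map_zero[OF assms(1-3)] assms(4,5) by auto

definition cbilinear_map :: "'a cstar \<Rightarrow> 'b cstar \<Rightarrow> 'c cstar \<Rightarrow> ('a \<Rightarrow> 'b \<Rightarrow> 'c) \<Rightarrow> bool" where
  "cbilinear_map A B C h \<longleftrightarrow>
     (\<forall>x\<in>carrier A. clinear_map B C (h x)) \<and> (\<forall>y\<in>carrier B. clinear_map A C (\<lambda>x. h x y))"

lemma star_hom_linear: "star_hom A B h \<Longrightarrow> clinear_map A B h"
  by (auto simp: star_hom_def clinear_map_def)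

lemma (in cstar_algebra) sm_diff_l: "x \<in> carrier A \<Longrightarrow> (c - d) \<odot> x = c \<odot> x \<oplus> (- d) \<odot> x"
  using sm_add_l[of x c "- d"] by simp

text \<open>\<open>co\<close> is only asked to provide some expansion; independence makes the
  coordinates unique and therefore linear.\<close>

locale cstar_basis = cstar_algebra A for A :: "'a cstar" (structure) +
  fixes N :: nat and e :: "nat \<Rightarrow> 'a" and co :: "nat \<Rightarrow> 'a \<Rightarrow> complex"
  assumes e_closed [simp]: "i < N \<Longrightarrow> e i \<in> carrier A"
    and expand: "x \<in> carrier A \<Longrightarrow> x = (\<Oplus>i\<in>{..<N}. co i x \<odot> e i)"
    and independent: "(\<Oplus>i\<in>{..<N}. c i \<odot> e i) = \<zero> \<Longrightarrow> \<forall>i<N. c i = 0"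

text \<open>A spanning family of least length is independent, since a nontrivial relation would
  express one member by the others.\<close>

lemma (in cstar_algebra) basis_exists:
  assumes fd: "finite_dimensional A"
  shows "\<exists>N e co. cstar_basis A N e co"
proof -
  define spans where "spans N e \<longleftrightarrow> (\<forall>i<N. e i \<in> carrier A) \<and>
      (\<forall>x\<in>carrier A. \<exists>c. x = (\<Oplus>i\<in>{..<N}. c i \<odot> e i))" for N :: nat and e :: "nat \<Rightarrow> 'a"
  obtain S where S: "finite S" "S \<subseteq> carrier A" "\<And>x. x \<in> carrier A \<Longrightarrow> \<exists>c. x = (\<Oplus>s\<in>S. c s \<odot> s)"
    using fd unfolding finite_dimensional_def by blast
  obtain f where f: "bij_betw f {..<card S} S"
    using ex_bij_betw_nat_finite[OF S(1)] by (auto simp: atLeast0LessThan)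
  have "spans (card S) f"
    unfolding spans_def
  proof (intro conjI allI impI ballI)
    fix i assume "i < card S"
    then show "f i \<in> carrier A" using f S(2) by (auto simp: bij_betw_def)
  next
    fix x assume "x \<in> carrier A"
    then obtain c where c: "x = (\<Oplus>s\<in>S. c s \<odot> s)" using S(3) by blast
    also have "\<dots> = (\<Oplus>s\<in>f ` {..<card S}. c s \<odot> s)" using f by (simp add: bij_betw_def)
    also have "\<dots> = (\<Oplus>i\<in>{..<card S}. c (f i) \<odot> f i)"
      using f S(2) by (subst finsum_reindex) (auto simp: bij_betw_def)
    finally show "\<exists>c. x = (\<Oplus>i\<in>{..<card S}. c i \<odot> f i)" by (intro exI[of _ "\<lambda>i. c (f i)"])
  qed
  define N where "N = (LEAST N. \<exists>e. spans N e)"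
  obtain e where e: "spans N e"
    using LeastI_ex[of "\<lambda>N. \<exists>e. spans N e"] \<open>spans (card S) f\<close> unfolding N_def by blast
  have min: "\<not> spans M e'" if "M < N" for M e'
    using not_less_Least[of M "\<lambda>N. \<exists>e. spans N e"] that unfolding N_def by blast
  have ec: "i < N \<Longrightarrow> e i \<in> carrier A" for i using e by (auto simp: spans_def)
  have indep: "\<forall>i<N. c i = 0" if c: "(\<Oplus>i\<in>{..<N}. c i \<odot> e i) = \<zero>" for c
  proof (rule ccontr)
    assume "\<not> ?thesis"
    then obtain k where k: "k < N" "c k \<noteq> 0" by blast
    define M where "M = N - 1"
    \<comment> \<open>\<open>skip\<close> enumerates the indices other than \<open>k\<close> by
      \<open>{..<M}\<close>, position \<open>k\<close> being filled with the last index
      \<open>M\<close>.\<close>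
    define skip where "skip i = (if i = k then M else i)" for i
    have bij: "bij_betw skip {..<M} ({..<N} - {k})"
      by (rule bij_betw_byWitness[where f' = "\<lambda>j. if j = M then k else j"])
        (use k in \<open>auto simp: skip_def M_def\<close>)
    have ek: "e k = (\<Oplus>i\<in>{..<N} - {k}. (- (c i / c k)) \<odot> e i)"
    proof -
      let ?R = "\<Oplus>i\<in>{..<N} - {k}. c i \<odot> e i"
      have R: "?R \<in> carrier A" using ec by (intro finsum_closed) auto
      have "insert k ({..<N} - {k}) = {..<N}" using k by auto
      then have "\<zero> = c k \<odot> e k \<oplus> ?R"
        using c finsum_insert[of "{..<N} - {k}" k "\<lambda>i. c i \<odot> e i"] ec k by auto
      then have "c k \<odot> e k = \<ominus> ?R" using R ec k by (metis minus_equality sm_closed)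
      then have "(1 / c k) \<odot> (c k \<odot> e k) = (1 / c k) \<odot> ((-1) \<odot> ?R)" using R by (simp add: uminus_eq)
      then have "e k = (- (1 / c k)) \<odot> ?R" using k ec R by (simp add: sm_assoc)
      also have "\<dots> = (\<Oplus>i\<in>{..<N} - {k}. (- (c i / c k)) \<odot> e i)"
        using ec by (subst sm_finsum) (auto simp: sm_assoc intro!: finsum_eqI)
      finally show ?thesis .
    qed
    have "spans M (\<lambda>i. e (skip i))"
      unfolding spans_def
    proof (intro conjI allI impI ballI)
      fix i assume "i < M"
      then show "e (skip i) \<in> carrier A" using bij ec by (auto simp: bij_betw_def)
    next
      fix x assume "x \<in> carrier A"
      then obtain d where d: "x = (\<Oplus>i\<in>{..<N}. d i \<odot> e i)" using e by (auto simp: spans_def)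
      have "insert k ({..<N} - {k}) = {..<N}" using k by auto
      then have "x = d k \<odot> e k \<oplus> (\<Oplus>i\<in>{..<N} - {k}. d i \<odot> e i)"
        using d finsum_insert[of "{..<N} - {k}" k "\<lambda>i. d i \<odot> e i"] ec k by auto
      also have "d k \<odot> e k = (\<Oplus>i\<in>{..<N} - {k}. (d k * - (c i / c k)) \<odot> e i)"
        by (subst ek, subst sm_finsum) (use ec in \<open>auto simp: sm_assoc intro!: finsum_eqI\<close>)
      also have "\<dots> \<oplus> (\<Oplus>i\<in>{..<N} - {k}. d i \<odot> e i) =
          (\<Oplus>i\<in>{..<N} - {k}. (d k * - (c i / c k)) \<odot> e i \<oplus> d i \<odot> e i)"
        using ec by (intro finsum_addf[symmetric]) auto
      also have "\<dots> = (\<Oplus>i\<in>{..<N} - {k}. (d k * - (c i / c k) + d i) \<odot> e i)"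
        using ec by (intro finsum_eqI) (auto simp: sm_diff_l a_comm)
      also have "\<dots> = (\<Oplus>j\<in>skip ` {..<M}. (d k * - (c j / c k) + d j) \<odot> e j)"
        using bij by (simp add: bij_betw_def)
      also have "\<dots> = (\<Oplus>i\<in>{..<M}. (d k * - (c (skip i) / c k) + d (skip i)) \<odot> e (skip i))"
        using bij ec by (subst finsum_reindex) (auto simp: bij_betw_def)
      finally show "\<exists>c. x = (\<Oplus>i\<in>{..<M}. c i \<odot> e (skip i))" by (intro exI)
    qed
    moreover have "M < N" using k by (simp add: M_def)
    ultimately show False using min by blast
  qed
  obtain co where co: "\<And>x. x \<in> carrier A \<Longrightarrow> x = (\<Oplus>i\<in>{..<N}. co x i \<odot> e i)"
    using e unfolding spans_def by metis
  have "cstar_basis A N e (\<lambda>i x. co x i)"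
    by unfold_locales (use ec co indep in auto)
  then show ?thesis by blast
qed

context cstar_basis
begin

lemma comb_closed [simp]: "(\<Oplus>i\<in>{..<N}. c i \<odot> e i) \<in> carrier A"
  by (intro finsum_closed) auto

lemma co_comb:
  assumes "i < N"
  shows "co i (\<Oplus>j\<in>{..<N}. c j \<odot> e j) = c i"
proof -
  let ?x = "\<Oplus>j\<in>{..<N}. c j \<odot> e j"
  have "(\<Oplus>j\<in>{..<N}. (co j ?x + - c j) \<odot> e j) = (\<Oplus>j\<in>{..<N}. co j ?x \<odot> e j \<oplus> (-1) \<odot> (c j \<odot> e j))"
    by (intro finsum_eqI) (auto simp: sm_diff_l sm_assoc)
  also have "\<dots> = (\<Oplus>j\<in>{..<N}. co j ?x \<odot> e j) \<oplus> (\<Oplus>j\<in>{..<N}. (-1) \<odot> (c j \<odot> e j))"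
    by (intro finsum_addf) auto
  also have "(\<Oplus>j\<in>{..<N}. (-1) \<odot> (c j \<odot> e j)) = (-1) \<odot> ?x"
    by (intro sm_finsum[symmetric]) auto
  also have "(\<Oplus>j\<in>{..<N}. co j ?x \<odot> e j) = ?x" by (rule expand[symmetric]) simp
  finally have "(\<Oplus>j\<in>{..<N}. (co j ?x + - c j) \<odot> e j) = \<zero>" by simp
  from independent[OF this] assms show ?thesis by (simp add: eq_neg_iff_add_eq_0)
qed

lemma co_add:
  assumes "x \<in> carrier A" "y \<in> carrier A" "i < N"
  shows "co i (x \<oplus> y) = co i x + co i y"
proof -
  have "x \<oplus> y = (\<Oplus>j\<in>{..<N}. co j x \<odot> e j) \<oplus> (\<Oplus>j\<in>{..<N}. co j y \<odot> e j)"
    by (rule arg_cong2[OF expand[OF assms(1)] expand[OF assms(2)]])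
  also have "\<dots> = (\<Oplus>j\<in>{..<N}. co j x \<odot> e j \<oplus> co j y \<odot> e j)"
    by (intro finsum_addf[symmetric]) auto
  also have "\<dots> = (\<Oplus>j\<in>{..<N}. (co j x + co j y) \<odot> e j)"
    by (intro finsum_eqI) (auto simp: sm_add_l)
  finally show ?thesis using co_comb[OF assms(3)] by simp
qed

lemma co_smult:
  assumes "x \<in> carrier A" "i < N"
  shows "co i (c \<odot> x) = c * co i x"
proof -
  have "c \<odot> x = c \<odot> (\<Oplus>j\<in>{..<N}. co j x \<odot> e j)" by (rule arg_cong[OF expand[OF assms(1)]])
  also have "\<dots> = (\<Oplus>j\<in>{..<N}. (c * co j x) \<odot> e j)"
    by (subst sm_finsum) (auto simp: sm_assoc intro!: finsum_eqI)
  finally show ?thesis using co_comb[OF assms(2)] by simp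
qed

lemma co_zero: "i < N \<Longrightarrow> co i \<zero> = 0"
  using co_smult[of \<zero> i 0] by simp

lemma co_finsum:
  assumes "finite I" "f \<in> I \<rightarrow> carrier A" "i < N"
  shows "co i (\<Oplus>j\<in>I. f j) = (\<Sum>j\<in>I. co i (f j))"
  using assms
proof (induction I rule: finite_induct)
  case (insert j I)
  then have "f j \<in> carrier A" "f \<in> I \<rightarrow> carrier A" by auto
  then show ?case using insert by (simp add: co_add finsum_closed)
qed (simp add: co_zero)

text \<open>The trace of left multiplication by \<open>x\<close>, that is, of the regular
  representation. Being intrinsic, it is invariant under automorphisms
  (\<open>tr_automorphism\<close>).\<close>

definition tr :: "'a \<Rightarrow> complex" where
  "tr x = (\<Sum>i<N. co i (x \<otimes> e i))"

lemma tr_add: "x \<in> carrier A \<Longrightarrow> y \<in> carrier A \<Longrightarrow> tr (x \<oplus> y) = tr x + tr y"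
  by (simp add: tr_def mult_add_left co_add sum.distrib)

lemma tr_smult: "x \<in> carrier A \<Longrightarrow> tr (c \<odot> x) = c * tr x"
  by (simp add: tr_def smult_mult_left co_smult sum_distrib_left)

lemma tr_zero [simp]: "tr \<zero> = 0"
  using tr_smult[of \<zero> 0] by simp

lemma tr_diff: "x \<in> carrier A \<Longrightarrow> y \<in> carrier A \<Longrightarrow> tr (x \<ominus> y) = tr x - tr y"
  by (simp add: diff_eq tr_add tr_smult)

lemma tr_finsum: "finite I \<Longrightarrow> f \<in> I \<rightarrow> carrier A \<Longrightarrow> tr (\<Oplus>j\<in>I. f j) = (\<Sum>j\<in>I. tr (f j))"
proof (induction I rule: finite_induct)
  case (insert j I)
  then have "f j \<in> carrier A" "f \<in> I \<rightarrow> carrier A" by auto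
  then show ?case using insert by (simp add: tr_add finsum_closed)
qed simp

lemma co_mult_expand:
  assumes "x \<in> carrier A" "y \<in> carrier A" "i < N"
  shows "co i (x \<otimes> y) = (\<Sum>j<N. co i (x \<otimes> e j) * co j y)"
proof -
  have "x \<otimes> y = x \<otimes> (\<Oplus>j\<in>{..<N}. co j y \<odot> e j)" by (rule arg_cong[OF expand[OF assms(2)]])
  also have "\<dots> = (\<Oplus>j\<in>{..<N}. co j y \<odot> (x \<otimes> e j))"
    using assms by (subst mult_finsum_r) (auto simp: smult_mult_right intro!: finsum_eqI)
  also have "co i \<dots> = (\<Sum>j<N. co i (x \<otimes> e j) * co j y)"
    using assms by (subst co_finsum) (auto simp: co_smult mult.commute)
  finally show ?thesis .
qed

text \<open>Left multiplication turns products into products of coordinate matrices, and the trace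
  of a product of two matrices is symmetric in them.\<close>

lemma tr_comm:
  assumes "x \<in> carrier A" "y \<in> carrier A"
  shows "tr (x \<otimes> y) = tr (y \<otimes> x)"
proof -
  have *: "tr (x \<otimes> y) = (\<Sum>i<N. \<Sum>j<N. co i (x \<otimes> e j) * co j (y \<otimes> e i))"
    if "x \<in> carrier A" "y \<in> carrier A" for x y
    unfolding tr_def using that
    by (intro sum.cong refl) (auto simp: mult_assoc co_mult_expand[of x "y \<otimes> _"])
  have "tr (x \<otimes> y) = (\<Sum>j<N. \<Sum>i<N. co i (x \<otimes> e j) * co j (y \<otimes> e i))"
    unfolding *[OF assms] by (rule sum.swap)
  also have "\<dots> = tr (y \<otimes> x)" unfolding *[OF assms(2,1)] by (simp add: mult.commute)
  finally show ?thesis .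
qed

lemma eigenvector_mult:
  assumes x: "x \<in> carrier A" and v: "\<exists>i<N. v i \<noteq> 0" "\<forall>i<N. (\<Sum>j<N. co i (x \<otimes> e j) * v j) = l * v i"
  shows "\<exists>w\<in>carrier A. w \<noteq> \<zero> \<and> x \<otimes> w = l \<odot> w"
proof (intro bexI conjI)
  let ?w = "\<Oplus>j\<in>{..<N}. v j \<odot> e j"
  show w: "?w \<in> carrier A" by simp
  show "?w \<noteq> \<zero>" using independent[of v] v(1) by blast
  have "x \<otimes> ?w = (\<Oplus>i\<in>{..<N}. co i (x \<otimes> ?w) \<odot> e i)" by (rule expand) (use x in simp)

  also have "\<dots> = (\<Oplus>i\<in>{..<N}. co i (l \<odot> ?w) \<odot> e i)"
    using x v(2) co_mult_expand[OF x w] by (intro finsum_eqI) (auto simp: co_comb co_smult)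
  also have "\<dots> = l \<odot> ?w" by (rule expand[symmetric]) simp
  finally show "x \<otimes> ?w = l \<odot> ?w" .
qed

text \<open>The third clause gives eigenvectors in \<open>A\<close>, to which the C*-identity can be
  applied; the last one stays in coordinates because that is what
  \<open>bounded_orbit_of_nilpotent\<close> asks about.\<close>

lemma trace_eigenvalues:
  assumes "x \<in> carrier A"
  shows "\<exists>es. length es = N \<and> tr x = sum_list es \<and> (\<forall>l\<in>set es. \<exists>w\<in>carrier A. w \<noteq> \<zero> \<and> x \<otimes> w = l \<odot> w) \<and>
    (\<forall>l v. (\<exists>i<N. v i \<noteq> 0) \<longrightarrow> (\<forall>i<N. (\<Sum>j<N. co i (x \<otimes> e j) * v j) = l * v i) \<longrightarrow> l \<in> set es)"
proof -
  obtain es where es: "length es = N" "tr x = sum_list es"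
    "\<And>l. l \<in> set es \<longleftrightarrow> (\<exists>v. (\<exists>i<N. v i \<noteq> 0) \<and> (\<forall>i<N. (\<Sum>j<N. co i (x \<otimes> e j) * v j) = l * v i))"
    using trace_eq_sum_eigenvalues[of N "\<lambda>i j. co i (x \<otimes> e j)"] unfolding tr_def by blast
  have "\<exists>w\<in>carrier A. w \<noteq> \<zero> \<and> x \<otimes> w = l \<odot> w" if l: "l \<in> set es" for l
  proof -
    obtain v where "\<exists>i<N. v i \<noteq> 0" "\<forall>i<N. (\<Sum>j<N. co i (x \<otimes> e j) * v j) = l * v i"
      using l unfolding es(3) by blast
    then show ?thesis by (rule eigenvector_mult[OF assms])
  qed
  then show ?thesis using es(1,2) unfolding es(3)[symmetric] by (intro exI[of _ es]) (use es(3) in blast)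
qed

lemma eigenvalue_bound:
  assumes "x \<in> carrier A" "w \<in> carrier A" "w \<noteq> \<zero>" "x \<otimes> w = l \<odot> w"
  shows "cmod l \<le> nrm A x"
proof -
  have "nrm A w > 0" using assms nrm_nonneg[of w] nrm_eq_0_iff[of w] by (simp add: less_le)
  moreover have "cmod l * nrm A w \<le> nrm A x * nrm A w"
    using nrm_mult[of x w] assms by (simp add: nrm_smult)
  ultimately show ?thesis by simp
qed

text \<open>The trace is a sum of \<open>N\<close> eigenvalues, each bounded by the norm. Together
  with \<open>co_tr\<close> this will bound the coordinate functionals
  (\<open>co_bound\<close>).\<close>

lemma tr_bound:
  assumes x: "x \<in> carrier A"
  shows "cmod (tr x) \<le> N * nrm A x"
proof -
  obtain es where es: "length es = N" "tr x = sum_list es"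
    "\<forall>l\<in>set es. \<exists>w\<in>carrier A. w \<noteq> \<zero> \<and> x \<otimes> w = l \<odot> w"
    using trace_eigenvalues[OF x] by blast
  have "cmod (sum_list es) \<le> (\<Sum>l\<leftarrow>es. cmod l)" by (induction es) (auto intro: norm_triangle_mono)
  also have "\<dots> \<le> (\<Sum>l\<leftarrow>es. nrm A x)"
    using es(3) eigenvalue_bound[OF x] by (intro sum_list_mono) blast
  finally show ?thesis using es by (simp add: sum_list_triv)
qed

lemma star_self_nonzero:
  assumes "w \<in> carrier A" "w \<noteq> \<zero>"
  shows "invol A w \<otimes> w \<noteq> \<zero>"
  using assms cstar_identity[of w] nrm_eq_0_iff[of w] by auto

lemma smult_left_cancel:
  assumes "x \<in> carrier A" "x \<noteq> \<zero>" "c \<odot> x = d \<odot> x"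
  shows "c = d"
proof (rule ccontr)
  assume "c \<noteq> d"
  have "(c + - d) \<odot> x = c \<odot> x \<oplus> (- d) \<odot> x" using assms(1) by (rule sm_add_l)
  then have "(c + - d) \<odot> x = \<zero>" using assms by simp
  then have "nrm A ((c + - d) \<odot> x) = 0" by simp
  then show False using assms \<open>c \<noteq> d\<close> by (simp add: nrm_smult nrm_eq_0_iff)
qed

text \<open>\<open>invol A w \<otimes> w\<close> plays the part of the scalar product of
  \<open>w\<close> with itself: \<open>invol A w \<otimes> (h \<otimes> w)\<close> is self-adjoint
  and equals \<open>l\<close> times this nonzero self-adjoint element.\<close>

lemma selfadjoint_eigenvalue_real:
  assumes h: "h \<in> carrier A" "invol A h = h" and w: "w \<in> carrier A" "w \<noteq> \<zero>" "h \<otimes> w = l \<odot> w"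
  shows "cnj l = l"
proof -
  have ww: "invol A w \<otimes> w \<in> carrier A" "invol A w \<otimes> w \<noteq> \<zero>" using w star_self_nonzero by auto
  have "invol A (invol A w \<otimes> (h \<otimes> w)) = invol A w \<otimes> (h \<otimes> w)"
    using h w(1) by (simp add: invol_mult invol_invol mult_assoc)
  then have "cnj l \<odot> (invol A w \<otimes> w) = l \<odot> (invol A w \<otimes> w)"
    unfolding w(3) using w(1) by (simp add: smult_mult_right invol_smult invol_mult invol_invol)
  from smult_left_cancel[OF ww this] show ?thesis .
qed

text \<open>For a square root \<open>m\<close> of \<open>l\<close> the equation
  \<open>(h - m) (h + m) w = 0\<close> leaves two cases: \<open>w\<close> is an eigenvector of
  \<open>h\<close> for \<open>- m\<close>, or \<open>v = (h + m) w\<close> is one for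
  \<open>m\<close>. In both \<open>m\<close> is real, and \<open>l\<close> is its square.\<close>

lemma selfadjoint_square_eigenvalue_nonneg:
  assumes h: "h \<in> carrier A" "invol A h = h" and w: "w \<in> carrier A" "w \<noteq> \<zero>" "h \<otimes> h \<otimes> w = l \<odot> w"
  shows "\<exists>r\<ge>0. l = complex_of_real r"
proof -
  define m where "m = csqrt l"
  have mm: "m * m = l" using power2_csqrt[of l] by (simp add: m_def power2_eq_square)
  define v where "v = h \<otimes> w \<oplus> m \<odot> w"
  have v: "v \<in> carrier A" using h w by (simp add: v_def)
  have "cnj m = m"
  proof (cases "v = \<zero>")
    case True
    then have "h \<otimes> w \<oplus> m \<odot> w = \<zero>" by (simp add: v_def)
    then have "h \<otimes> w = \<ominus> (m \<odot> w)" using h(1) w(1) by (metis minus_equality mult_closed sm_closed)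
    then have "h \<otimes> w = (- m) \<odot> w" using w(1) by (simp add: uminus_eq sm_assoc)
    from selfadjoint_eigenvalue_real[OF h w(1,2) this] show ?thesis by simp
  next
    case False
    have "h \<otimes> v = l \<odot> w \<oplus> m \<odot> (h \<otimes> w)"
      unfolding v_def using h w by (simp add: mult_add_right smult_mult_right mult_assoc[symmetric])
    also have "\<dots> = m \<odot> v"
      unfolding v_def using h(1) w(1) by (simp add: sm_add_r sm_assoc mm a_comm)
    finally show ?thesis by (rule selfadjoint_eigenvalue_real[OF h v False])
  qed
  then have "m = complex_of_real (Re m)" by (simp add: complex_eq_iff)
  then have "l = complex_of_real (Re m * Re m)" using mm by (metis of_real_mult)
  then show ?thesis by (intro exI[of _ "Re m * Re m"]) simp
qed

lemma norm_le_coordinates: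
  assumes "x \<in> carrier A" "\<And>i. i < N \<Longrightarrow> cmod (co i x) \<le> c"
  shows "nrm A x \<le> c * (\<Sum>i<N. nrm A (e i))"
proof -
  have "nrm A x = nrm A (\<Oplus>i\<in>{..<N}. co i x \<odot> e i)" by (rule arg_cong[OF expand[OF assms(1)]])
  also have "\<dots> \<le> (\<Sum>i<N. nrm A (co i x \<odot> e i))" by (intro nrm_finsum_le) auto
  also have "\<dots> \<le> (\<Sum>i<N. c * nrm A (e i))"
    using assms by (intro sum_mono) (auto simp: nrm_smult nrm_nonneg intro!: mult_right_mono)
  finally show ?thesis by (simp add: sum_distrib_left)
qed

primrec pw :: "'a \<Rightarrow> nat \<Rightarrow> 'a" where
  "pw k 0 = k"
| "pw k (Suc n) = k \<otimes> pw k n"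

lemma pw_closed [simp]: "k \<in> carrier A \<Longrightarrow> pw k n \<in> carrier A"
  by (induction n) auto

lemma pw_mult: "k \<in> carrier A \<Longrightarrow> pw k m \<otimes> pw k n = pw k (Suc (m + n))"
  by (induction m) (auto simp: mult_assoc)

lemma pw_selfadjoint:
  assumes "k \<in> carrier A" "invol A k = k"
  shows "invol A (pw k n) = pw k n"
proof (induction n)
  case (Suc n)
  have "invol A (pw k (Suc n)) = pw k n \<otimes> pw k 0" using assms Suc by (simp add: invol_mult)
  also have "\<dots> = pw k (Suc n)" using assms(1) pw_mult[of k n 0] by simp
  finally show ?case .
qed (use assms in simp)

text \<open>Squaring a self-adjoint element squares its norm. In the shifted numbering the power
  with exponent \<open>2^j\<close> has index \<open>2 ^ j - 1\<close>.\<close>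

lemma pw_norm:
  assumes "k \<in> carrier A" "invol A k = k"
  shows "nrm A (pw k (2 ^ j - 1)) = nrm A k ^ 2 ^ j"
proof (induction j)
  case (Suc j)
  have "Suc ((2 ^ j - 1) + (2 ^ j - 1)) = 2 ^ Suc j - (1::nat)"
    using one_le_power[of "2::nat" j] unfolding power_Suc by linarith
  then have "pw k (2 ^ Suc j - 1) = invol A (pw k (2 ^ j - 1)) \<otimes> pw k (2 ^ j - 1)"
    using pw_mult[OF assms(1), of "2 ^ j - 1" "2 ^ j - 1"] pw_selfadjoint[OF assms] by metis
  then show ?case using cstar_identity[of "pw k (2 ^ j - 1)"] assms Suc
    by (simp add: power_mult[symmetric] mult.commute)
qed simp

text \<open>The eigenvalues of left multiplication by \<open>h^2\<close> are nonnegative and add up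
  to the trace 0, so they all vanish and the powers of any multiple of \<open>h^2\<close> stay
  bounded. For nonzero \<open>h\<close> a suitable multiple has powers of unbounded norm.\<close>

lemma selfadjoint_zero_if_tr_square_zero:
  assumes h: "h \<in> carrier A" "invol A h = h" and tr0: "tr (h \<otimes> h) = 0"
  shows "h = \<zero>"
proof (rule ccontr)
  assume "h \<noteq> \<zero>"
  then have hpos: "nrm A h > 0" using h nrm_nonneg[of h] nrm_eq_0_iff[of h] by (simp add: less_le)
  \<comment> \<open>The scaling gives \<open>g\<close> norm 2 and \<open>k = g^2\<close> norm 4; any
    norm of \<open>k\<close> above 1 would do.\<close>
  define c where "c = complex_of_real (2 / nrm A h)"
  define g where "g = c \<odot> h"
  define k where "k = g \<otimes> g"
  have g: "g \<in> carrier A" "invol A g = g" "nrm A g = 2"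
    using h hpos by (auto simp: g_def c_def invol_smult nrm_smult norm_divide)
  have k: "k \<in> carrier A" "invol A k = k" using g by (auto simp: k_def invol_mult)
  have nk: "nrm A k = 4" using cstar_identity[OF g(1)] g by (simp add: k_def)
  have "tr k = 0" using h tr0 by (simp add: k_def g_def smult_mult_left smult_mult_right tr_smult)
  obtain es where es: "tr k = sum_list es" "\<forall>l\<in>set es. \<exists>w\<in>carrier A. w \<noteq> \<zero> \<and> k \<otimes> w = l \<odot> w"
    and spec: "\<forall>l v. (\<exists>i<N. v i \<noteq> 0) \<longrightarrow> (\<forall>i<N. (\<Sum>j<N. co i (k \<otimes> e j) * v j) = l * v i) \<longrightarrow> l \<in> set es"
    using trace_eigenvalues[OF k(1)] by (elim exE conjE) blast
  have nonneg: "Re l \<ge> 0 \<and> Im l = 0" if "l \<in> set es" for l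
    using es(2) that selfadjoint_square_eigenvalue_nonneg[OF g(1,2)] unfolding k_def by fastforce
  have "(\<Sum>l\<leftarrow>es. Re l) = Re (sum_list es)" by (induction es) auto
  also have "\<dots> = 0" using \<open>tr k = 0\<close> es by simp
  finally have "\<forall>l\<in>set es. Re l = 0"
    using nonneg sum_list_nonneg_eq_0_iff[of "map Re es"] by auto
  then have ev0: "l = 0" if "l \<in> set es" for l using that nonneg by (simp add: complex_eq_iff)
  have "\<exists>b. \<forall>n. \<forall>i<N. cmod (co i (pw k n)) \<le> b"
  proof (rule bounded_orbit_of_nilpotent[of N "\<lambda>i j. co i (k \<otimes> e j)"])
    fix l v
    assume "\<exists>i<N. v i \<noteq> 0" "\<forall>i<N. (\<Sum>j<N. co i (k \<otimes> e j) * v j) = l * v i"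
    then show "l = 0" using spec ev0 by blast
  next
    fix n i assume "i < N"
    then show "co i (pw k (Suc n)) = (\<Sum>j<N. co i (k \<otimes> e j) * co j (pw k n))"
      using co_mult_expand[OF k(1) pw_closed[OF k(1)]] by simp
  qed
  then obtain b where b: "\<And>n i. i < N \<Longrightarrow> cmod (co i (pw k n)) \<le> b" by blast
  define K where "K = b * (\<Sum>i<N. nrm A (e i))"
  have bound: "nrm A (pw k n) \<le> K" for n unfolding K_def using norm_le_coordinates b k(1) by simp
  obtain j :: nat where j: "K < of_nat j" using reals_Archimedean2 by blast
  have "j < (2::nat) ^ j" by simp
  also have "\<dots> < 2 ^ 2 ^ j" by simp
  also have "\<dots> \<le> 4 ^ 2 ^ j" by (intro power_mono) auto
  finally have "real j < 4 ^ 2 ^ j" by (metis of_nat_less_iff of_nat_numeral of_nat_power)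
  also have "\<dots> = nrm A (pw k (2 ^ j - 1))" using pw_norm[OF k] nk by simp
  finally show False using bound[of "2 ^ j - 1"] j by simp
qed

text \<open>Testing with \<open>y = invol A x \<otimes> (x \<otimes> invol A x)\<close> shows that
  the square of the self-adjoint element \<open>x \<otimes> invol A x\<close> has trace 0. So this
  element vanishes, and by the C*-identity so does \<open>x\<close>.\<close>

lemma tr_nondegenerate:
  assumes x: "x \<in> carrier A" and 0: "\<And>y. y \<in> carrier A \<Longrightarrow> tr (x \<otimes> y) = 0"
  shows "x = \<zero>"
proof -
  let ?h = "x \<otimes> invol A x"
  have "tr (?h \<otimes> ?h) = tr (x \<otimes> (invol A x \<otimes> ?h))" using x by (simp add: mult_assoc)
  then have "?h = \<zero>"
    using x 0 by (intro selfadjoint_zero_if_tr_square_zero) (auto simp: invol_mult invol_invol)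
  then have "invol A x = \<zero>" using star_self_nonzero[of "invol A x"] x by (auto simp: invol_invol)
  then show ?thesis using x invol_invol[of x] by simp
qed

text \<open>Dual bases for the trace form, described by the two expansions instead of Kronecker
  deltas \<open>tr (a i \<otimes> b j)\<close>: the expansions are what computations with
  \<open>\<Sum> a_i \<otimes> b_i\<close> consume.\<close>

definition dual_pair :: "(nat \<Rightarrow> 'a) \<Rightarrow> (nat \<Rightarrow> 'a) \<Rightarrow> bool" where
  "dual_pair a b \<longleftrightarrow> (\<forall>i<N. a i \<in> carrier A \<and> b i \<in> carrier A) \<and>
     (\<forall>x\<in>carrier A. x = (\<Oplus>i\<in>{..<N}. tr (x \<otimes> b i) \<odot> a i) \<and> x = (\<Oplus>i\<in>{..<N}. tr (x \<otimes> a i) \<odot> b i))"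

text \<open>The coefficients of the dual basis are the entries of the inverse of the Gram matrix
  \<open>tr (e i \<otimes> e j)\<close>, which is injective by nondegeneracy.\<close>

lemma dual_basis_exists: "\<exists>b. dual_pair e b \<and> (\<forall>i<N. \<forall>x\<in>carrier A. co i x = tr (x \<otimes> b i))"
proof -
  have zero: "w = \<zero>" if w: "w \<in> carrier A" "\<And>i. i < N \<Longrightarrow> tr (w \<otimes> e i) = 0" for w
  proof (rule tr_nondegenerate[OF w(1)])
    fix y assume y: "y \<in> carrier A"
    have "w \<otimes> y = w \<otimes> (\<Oplus>j\<in>{..<N}. co j y \<odot> e j)" by (rule arg_cong[OF expand[OF y]])
    also have "\<dots> = (\<Oplus>j\<in>{..<N}. co j y \<odot> (w \<otimes> e j))"
      using w y by (subst mult_finsum_r) (auto simp: smult_mult_right intro!: finsum_eqI)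
    finally show "tr (w \<otimes> y) = 0" using w by (simp add: tr_finsum tr_smult)
  qed
  have inj: "\<forall>i<N. v i = 0" if v: "\<forall>i<N. (\<Sum>j<N. tr (e i \<otimes> e j) * v j) = 0" for v
  proof -
    let ?w = "\<Oplus>j\<in>{..<N}. v j \<odot> e j"
    have "tr (?w \<otimes> e i) = 0" if "i < N" for i
    proof -
      have "?w \<otimes> e i = (\<Oplus>j\<in>{..<N}. v j \<odot> (e j \<otimes> e i))"
        using that by (subst mult_finsum_l) (auto simp: smult_mult_left intro!: finsum_eqI)
      then have "tr (?w \<otimes> e i) = (\<Sum>j<N. v j * tr (e j \<otimes> e i))"
        using that by (simp add: tr_finsum tr_smult)
      also have "\<dots> = (\<Sum>j<N. tr (e i \<otimes> e j) * v j)"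
        using that by (intro sum.cong refl) (simp add: tr_comm[of "e i"] mult.commute)
      finally show ?thesis using v that by simp
    qed
    from zero[OF comb_closed this] show ?thesis by (rule independent)
  qed
  have "\<exists>h. \<forall>i<N. \<forall>j<N. (\<Sum>l<N. tr (e i \<otimes> e l) * h l j) = (if i = j then 1 else 0)"
    by (rule injective_matrix_inverse) (rule inj)
  then obtain h where
    h: "\<And>i j. i < N \<Longrightarrow> j < N \<Longrightarrow> (\<Sum>l<N. tr (e i \<otimes> e l) * h l j) = (if i = j then 1 else 0)"
    by blast
  define b where "b j = (\<Oplus>l\<in>{..<N}. h l j \<odot> e l)" for j
  have b [simp]: "b j \<in> carrier A" for j by (simp add: b_def)
  have eb: "tr (e i \<otimes> b j) = (if i = j then 1 else 0)" if "i < N" "j < N" for i j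
  proof -
    have "e i \<otimes> b j = (\<Oplus>l\<in>{..<N}. h l j \<odot> (e i \<otimes> e l))"
      using that unfolding b_def by (subst mult_finsum_r) (auto simp: smult_mult_right intro!: finsum_eqI)
    then show ?thesis using h that by (simp add: tr_finsum tr_smult mult.commute)
  qed
  have co: "co i x = tr (x \<otimes> b i)" if "i < N" "x \<in> carrier A" for i x
  proof -
    have "x \<otimes> b i = (\<Oplus>j\<in>{..<N}. co j x \<odot> e j) \<otimes> b i"
      by (rule arg_cong[OF expand[OF that(2)]])
    also have "\<dots> = (\<Oplus>j\<in>{..<N}. co j x \<odot> (e j \<otimes> b i))"
      by (subst mult_finsum_l) (auto simp: smult_mult_left intro!: finsum_eqI)
    finally show ?thesis using that by (simp add: tr_finsum tr_smult eb if_distrib sum.delta cong: if_cong)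
  qed
  have x1: "x = (\<Oplus>i\<in>{..<N}. tr (x \<otimes> b i) \<odot> e i)" if x: "x \<in> carrier A" for x
  proof -
    have "(\<Oplus>i\<in>{..<N}. co i x \<odot> e i) = (\<Oplus>i\<in>{..<N}. tr (x \<otimes> b i) \<odot> e i)"
      using x by (intro finsum_eqI) (auto simp: co)
    with expand[OF x] show ?thesis by (rule trans)
  qed
  \<comment> \<open>The difference of the two sides is orthogonal to every \<open>e j\<close> under
    the trace form, hence zero.\<close>
  have x2: "x = (\<Oplus>i\<in>{..<N}. tr (x \<otimes> e i) \<odot> b i)" if x: "x \<in> carrier A" for x
  proof -
    let ?y = "\<Oplus>i\<in>{..<N}. tr (x \<otimes> e i) \<odot> b i"
    have y: "?y \<in> carrier A" by (intro finsum_closed) auto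
    have "tr ((x \<ominus> ?y) \<otimes> e j) = 0" if j: "j < N" for j
    proof -
      have "?y \<otimes> e j = (\<Oplus>i\<in>{..<N}. tr (x \<otimes> e i) \<odot> (b i \<otimes> e j))"
        using j by (subst mult_finsum_l) (auto simp: smult_mult_left intro!: finsum_eqI)
      then have "tr (?y \<otimes> e j) = (\<Sum>i<N. tr (x \<otimes> e i) * tr (e j \<otimes> b i))"
        using j by (simp add: tr_finsum tr_smult tr_comm[of "b _" "e j"])
      also have "\<dots> = tr (x \<otimes> e j)" using j by (simp add: eb if_distrib sum.delta' cong: if_cong)
      finally show ?thesis using x y j by (simp add: mult_diff_l tr_diff)
    qed
    from zero[OF _ this] have "x \<ominus> ?y = \<zero>" using x y by simp
    then show ?thesis using x y by simp
  qed
  show ?thesis unfolding dual_pair_def using x1 x2 co by (intro exI[of _ b]) auto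
qed

end

lemma cbilinear_mapD:
  assumes "cbilinear_map A B C h"
  shows "x \<in> carrier A \<Longrightarrow> clinear_map B C (h x)"
    and "y \<in> carrier B \<Longrightarrow> clinear_map A C (\<lambda>x. h x y)"
    and "x \<in> carrier A \<Longrightarrow> y \<in> carrier B \<Longrightarrow> h x y \<in> carrier C"
    and "x \<in> carrier A \<Longrightarrow> y \<in> carrier B \<Longrightarrow> h (c \<odot>\<^bsub>A\<^esub> x) y = c \<odot>\<^bsub>C\<^esub> h x y"
    and "x \<in> carrier A \<Longrightarrow> y \<in> carrier B \<Longrightarrow> h x (c \<odot>\<^bsub>B\<^esub> y) = c \<odot>\<^bsub>C\<^esub> h x y"
  using assms by (auto simp: cbilinear_map_def clinear_map_def)

section \<open>The separability idempotent and its invariance\<close>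

context cstar_basis
begin

text \<open>The element \<open>\<Sum> a_i \<otimes> c_i\<close> of the tensor square is observed
  through arbitrary bilinear maps \<open>B\<close>. Expanding \<open>a i\<close> in the family
  \<open>a'\<close>, or \<open>c' j\<close> in the family \<open>c\<close>, turns either side into
  the double sum with coefficients \<open>tr (a i \<otimes> c' j)\<close>.\<close>

lemma casimir_unique:
  fixes C :: "'b cstar"
  assumes C: "cstar_algebra C" and B: "cbilinear_map A A C B"
    and ac: "dual_pair a c" and ac': "dual_pair a' c'"
  shows "(\<Oplus>\<^bsub>C\<^esub>i\<in>{..<N}. B (a i) (c i)) = (\<Oplus>\<^bsub>C\<^esub>i\<in>{..<N}. B (a' i) (c' i))"
proof -
  interpret C: cstar_algebra C by fact
  have cl: "i < N \<Longrightarrow> a i \<in> carrier A" "i < N \<Longrightarrow> c i \<in> carrier A"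
    "i < N \<Longrightarrow> a' i \<in> carrier A" "i < N \<Longrightarrow> c' i \<in> carrier A" for i
    using ac ac' by (auto simp: dual_pair_def)
  note Bd [simp] = cbilinear_mapD(3-5)[OF B]
  have 1: "B (a i) (c i) = (\<Oplus>\<^bsub>C\<^esub>j\<in>{..<N}. tr (a i \<otimes> c' j) \<odot>\<^bsub>C\<^esub> B (a' j) (c i))" if i: "i < N" for i
  proof -
    have "a i = (\<Oplus>j\<in>{..<N}. tr (a i \<otimes> c' j) \<odot> a' j)" using ac' cl(1)[OF i] by (auto simp: dual_pair_def)
    then have "B (a i) (c i) = B (\<Oplus>j\<in>{..<N}. tr (a i \<otimes> c' j) \<odot> a' j) (c i)" by simp
    also have "\<dots> = (\<Oplus>\<^bsub>C\<^esub>j\<in>{..<N}. B (tr (a i \<otimes> c' j) \<odot> a' j) (c i))"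
      using cl i by (intro clinear_map_finsum[OF cstar_algebra_axioms C cbilinear_mapD(2)[OF B]]) auto
    also have "\<dots> = (\<Oplus>\<^bsub>C\<^esub>j\<in>{..<N}. tr (a i \<otimes> c' j) \<odot>\<^bsub>C\<^esub> B (a' j) (c i))"
      using cl i by (intro C.finsum_eqI) auto
    finally show ?thesis .
  qed
  have 2: "B (a' j) (c' j) = (\<Oplus>\<^bsub>C\<^esub>i\<in>{..<N}. tr (a i \<otimes> c' j) \<odot>\<^bsub>C\<^esub> B (a' j) (c i))" if j: "j < N" for j
  proof -
    have "c' j = (\<Oplus>i\<in>{..<N}. tr (c' j \<otimes> a i) \<odot> c i)" using ac cl(4)[OF j] by (auto simp: dual_pair_def)
    then have "B (a' j) (c' j) = B (a' j) (\<Oplus>i\<in>{..<N}. tr (c' j \<otimes> a i) \<odot> c i)" by simp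
    also have "\<dots> = (\<Oplus>\<^bsub>C\<^esub>i\<in>{..<N}. B (a' j) (tr (c' j \<otimes> a i) \<odot> c i))"
      using cl j by (intro clinear_map_finsum[OF cstar_algebra_axioms C cbilinear_mapD(1)[OF B]]) auto
    also have "\<dots> = (\<Oplus>\<^bsub>C\<^esub>i\<in>{..<N}. tr (a i \<otimes> c' j) \<odot>\<^bsub>C\<^esub> B (a' j) (c i))"
      using cl j by (intro C.finsum_eqI) (auto simp: tr_comm[of "c' j"])
    finally show ?thesis .
  qed
  have "(\<Oplus>\<^bsub>C\<^esub>i\<in>{..<N}. B (a i) (c i)) =
      (\<Oplus>\<^bsub>C\<^esub>i\<in>{..<N}. \<Oplus>\<^bsub>C\<^esub>j\<in>{..<N}. tr (a i \<otimes> c' j) \<odot>\<^bsub>C\<^esub> B (a' j) (c i))"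
    using 1 cl by (intro C.finsum_eqI) (auto intro!: C.finsum_closed)
  also have "\<dots> = (\<Oplus>\<^bsub>C\<^esub>j\<in>{..<N}. \<Oplus>\<^bsub>C\<^esub>i\<in>{..<N}. tr (a i \<otimes> c' j) \<odot>\<^bsub>C\<^esub> B (a' j) (c i))"
    using cl by (intro C.finsum_swap) auto
  also have "\<dots> = (\<Oplus>\<^bsub>C\<^esub>j\<in>{..<N}. B (a' j) (c' j))"
    using 2 cl by (intro C.finsum_eqI) auto
  finally show ?thesis .
qed

text \<open>Left multiplication by \<open>s x\<close> is left multiplication by \<open>x\<close>
  conjugated with \<open>s\<close>. In coordinates both traces are the same double sum, taken in its
  two orders.\<close>

lemma tr_automorphism:
  assumes s: "s \<in> cstar_aut A" and x: "x \<in> carrier A"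
  shows "tr (s x) = tr x"
proof -
  have hom: "star_hom A A s" and bij: "bij_betw s (carrier A) (carrier A)"
    using s by (auto simp: cstar_aut_def)
  note h = star_homD[OF hom]
  define t where "t = inv_into (carrier A) s"
  have t: "t y \<in> carrier A" "s (t y) = y" if "y \<in> carrier A" for y
    using bij that by (auto simp: t_def bij_betw_def f_inv_into_f inv_into_into)
  have ts: "t (s y) = y" if "y \<in> carrier A" for y
    using bij that by (auto simp: t_def bij_betw_def inv_into_f_f)
  have "inj_on s (carrier A)" using bij by (simp add: bij_betw_def)
  then have inj: "y = z" if "y \<in> carrier A" "z \<in> carrier A" "s y = s z" for y z using that by (meson inj_onD)
  have lt: "clinear_map A A t"
  proof (rule clinear_mapI)
    show "t (y \<oplus> z) = t y \<oplus> t z" if "y \<in> carrier A" "z \<in> carrier A" for y z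
      by (rule inj) (use that in \<open>simp_all add: t h\<close>)
    show "t (k \<odot> y) = k \<odot> t y" if "y \<in> carrier A" for y k
      by (rule inj) (use that in \<open>simp_all add: t h\<close>)
  qed (rule t)
  have "co i (s x \<otimes> e i) = (\<Sum>j<N. co i (s (e j)) * co j (x \<otimes> t (e i)))" if i: "i < N" for i
  proof -
    have "s x \<otimes> e i = s (x \<otimes> t (e i))" using x i t h by simp
    also have "\<dots> = s (\<Oplus>j\<in>{..<N}. co j (x \<otimes> t (e i)) \<odot> e j)"
      by (rule arg_cong[OF expand]) (use x i t in simp)
    also have "\<dots> = (\<Oplus>j\<in>{..<N}. s (co j (x \<otimes> t (e i)) \<odot> e j))"
      by (intro clinear_map_finsum[OF cstar_algebra_axioms cstar_algebra_axioms star_hom_linear[OF hom]]) auto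
    also have "co i \<dots> = (\<Sum>j<N. co i (s (co j (x \<otimes> t (e i)) \<odot> e j)))"
      using i h by (intro co_finsum) auto
    also have "\<dots> = (\<Sum>j<N. co i (s (e j)) * co j (x \<otimes> t (e i)))"
      using i h by (intro sum.cong) (auto simp: co_smult)
    finally show ?thesis .
  qed
  then have "tr (s x) = (\<Sum>i<N. \<Sum>j<N. co i (s (e j)) * co j (x \<otimes> t (e i)))"
    unfolding tr_def by (intro sum.cong) auto
  also have "\<dots> = (\<Sum>j<N. \<Sum>i<N. co i (s (e j)) * co j (x \<otimes> t (e i)))" by (rule sum.swap)
  also have "\<dots> = (\<Sum>j<N. co j (x \<otimes> e j))"
  proof (intro sum.cong refl)
    fix j assume "j \<in> {..<N}"
    then have j: "j < N" by simp
    have "e j = t (s (e j))" using j ts by simp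
    also have "\<dots> = t (\<Oplus>i\<in>{..<N}. co i (s (e j)) \<odot> e i)"
      by (rule arg_cong[OF expand]) (use j h in simp)
    also have "\<dots> = (\<Oplus>i\<in>{..<N}. t (co i (s (e j)) \<odot> e i))"
      by (intro clinear_map_finsum[OF cstar_algebra_axioms cstar_algebra_axioms lt]) auto
    also have "\<dots> = (\<Oplus>i\<in>{..<N}. co i (s (e j)) \<odot> t (e i))"
      using t by (intro finsum_eqI) (auto simp: clinear_mapD[OF lt])
    finally have "x \<otimes> e j = x \<otimes> (\<Oplus>i\<in>{..<N}. co i (s (e j)) \<odot> t (e i))" by simp
    also have "\<dots> = (\<Oplus>i\<in>{..<N}. co i (s (e j)) \<odot> (x \<otimes> t (e i)))"
      using x t by (subst mult_finsum_r) (auto simp: smult_mult_right intro!: finsum_eqI)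
    also have "co j \<dots> = (\<Sum>i<N. co j (co i (s (e j)) \<odot> (x \<otimes> t (e i))))"
      using x t j by (intro co_finsum) auto
    also have "\<dots> = (\<Sum>i<N. co i (s (e j)) * co j (x \<otimes> t (e i)))"
      using x t j by (intro sum.cong) (auto simp: co_smult)
    finally show "(\<Sum>i<N. co i (s (e j)) * co j (x \<otimes> t (e i))) = co j (x \<otimes> e j)" by simp
  qed
  finally show ?thesis by (simp add: tr_def)
qed

text \<open>Applying \<open>s\<close> to both expansions of an element leaves the coefficients
  unchanged, by \<open>tr_automorphism\<close>.\<close>

lemma dual_pair_automorphism:
  assumes s: "s \<in> cstar_aut A" and ac: "dual_pair a c"
  shows "dual_pair (\<lambda>i. s (a i)) (\<lambda>i. s (c i))"
proof -
  have hom: "star_hom A A s" and surj: "s ` carrier A = carrier A"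
    using s by (auto simp: cstar_aut_def bij_betw_def)
  note h = star_homD[OF hom]
  have cl: "i < N \<Longrightarrow> a i \<in> carrier A" "i < N \<Longrightarrow> c i \<in> carrier A" for i
    using ac by (auto simp: dual_pair_def)
  have *: "s x = (\<Oplus>i\<in>{..<N}. tr (s x \<otimes> s (p i)) \<odot> s (q i))"
    if x: "x \<in> carrier A" "x = (\<Oplus>i\<in>{..<N}. tr (x \<otimes> p i) \<odot> q i)"
      and pq: "\<And>i. i < N \<Longrightarrow> p i \<in> carrier A \<and> q i \<in> carrier A" for x p q
  proof -
    have "s x = s (\<Oplus>i\<in>{..<N}. tr (x \<otimes> p i) \<odot> q i)" by (rule arg_cong[OF x(2)])
    also have "\<dots> = (\<Oplus>i\<in>{..<N}. s (tr (x \<otimes> p i) \<odot> q i))"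
      using pq by (intro clinear_map_finsum[OF cstar_algebra_axioms cstar_algebra_axioms star_hom_linear[OF hom]]) auto
    also have "\<dots> = (\<Oplus>i\<in>{..<N}. tr (s x \<otimes> s (p i)) \<odot> s (q i))"
      using pq x(1) by (intro finsum_eqI) (auto simp: h h(3)[symmetric] tr_automorphism[OF s] simp del: h(3))
    finally show ?thesis .
  qed
  show ?thesis
    unfolding dual_pair_def
  proof (intro conjI allI impI ballI)
    fix y assume "y \<in> carrier A"
    then obtain x where x: "x \<in> carrier A" "y = s x" using surj by blast
    then have "x = (\<Oplus>i\<in>{..<N}. tr (x \<otimes> c i) \<odot> a i)" "x = (\<Oplus>i\<in>{..<N}. tr (x \<otimes> a i) \<odot> c i)"
      using ac by (auto simp: dual_pair_def)
    with * x cl show "y = (\<Oplus>i\<in>{..<N}. tr (y \<otimes> s (c i)) \<odot> s (a i))"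
      "y = (\<Oplus>i\<in>{..<N}. tr (y \<otimes> s (a i)) \<odot> s (c i))" by auto
  qed (use cl h in auto)
qed

end

locale dual_basis = cstar_basis +
  fixes b
  assumes dual: "dual_pair e b" and co_tr: "i < N \<Longrightarrow> x \<in> carrier A \<Longrightarrow> co i x = tr (x \<otimes> b i)"

lemma (in cstar_algebra) dual_basis_exists:
  "finite_dimensional A \<Longrightarrow> \<exists>N e co b. dual_basis A N e co b"
  using basis_exists cstar_basis.dual_basis_exists
  by (metis dual_basis.intro dual_basis_axioms.intro)

context dual_basis
begin

lemma b_closed [simp]: "i < N \<Longrightarrow> b i \<in> carrier A"
  using dual by (auto simp: dual_pair_def)

lemma expand_dual: "x \<in> carrier A \<Longrightarrow> x = (\<Oplus>i\<in>{..<N}. tr (x \<otimes> e i) \<odot> b i)"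
  using dual by (auto simp: dual_pair_def)

text \<open>The bimodule property \<open>x z = z x\<close> of the separability idempotent
  \<open>z\<close>. Expanding \<open>x \<otimes> e i\<close> in \<open>e\<close> and
  \<open>b j \<otimes> x\<close> in \<open>b\<close> produces the same coefficients
  \<open>tr (x \<otimes> e i \<otimes> b j)\<close>, because the trace is symmetric.\<close>

lemma casimir_move:
  fixes C :: "'b cstar"
  assumes C: "cstar_algebra C" and B: "cbilinear_map A A C B" and x: "x \<in> carrier A"
  shows "(\<Oplus>\<^bsub>C\<^esub>i\<in>{..<N}. B (x \<otimes> e i) (b i)) = (\<Oplus>\<^bsub>C\<^esub>i\<in>{..<N}. B (e i) (b i \<otimes> x))"
proof -
  interpret C: cstar_algebra C by fact
  note Bd [simp] = cbilinear_mapD(3-5)[OF B]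
  define k where "k i j = tr (x \<otimes> e i \<otimes> b j)" for i j
  have 1: "B (x \<otimes> e i) (b i) = (\<Oplus>\<^bsub>C\<^esub>j\<in>{..<N}. k i j \<odot>\<^bsub>C\<^esub> B (e j) (b i))" if i: "i < N" for i
  proof -
    have "B (x \<otimes> e i) (b i) = B (\<Oplus>j\<in>{..<N}. co j (x \<otimes> e i) \<odot> e j) (b i)"
      by (rule arg_cong[OF expand]) (use x i in simp)
    also have "\<dots> = (\<Oplus>\<^bsub>C\<^esub>j\<in>{..<N}. B (co j (x \<otimes> e i) \<odot> e j) (b i))"
      using i x by (intro clinear_map_finsum[OF cstar_algebra_axioms C cbilinear_mapD(2)[OF B]]) auto
    also have "\<dots> = (\<Oplus>\<^bsub>C\<^esub>j\<in>{..<N}. k i j \<odot>\<^bsub>C\<^esub> B (e j) (b i))"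
      using i x by (intro C.finsum_eqI) (auto simp: co_tr k_def)
    finally show ?thesis .
  qed
  have 2: "B (e j) (b j \<otimes> x) = (\<Oplus>\<^bsub>C\<^esub>i\<in>{..<N}. k i j \<odot>\<^bsub>C\<^esub> B (e j) (b i))" if j: "j < N" for j
  proof -
    have tr: "tr (b j \<otimes> x \<otimes> e i) = k i j" if "i < N" for i
      using tr_comm[of "b j" "x \<otimes> e i"] x j that by (simp add: k_def mult_assoc)
    have "B (e j) (b j \<otimes> x) = B (e j) (\<Oplus>i\<in>{..<N}. tr (b j \<otimes> x \<otimes> e i) \<odot> b i)"
      by (rule arg_cong[OF expand_dual]) (use x j in simp)
    also have "\<dots> = (\<Oplus>\<^bsub>C\<^esub>i\<in>{..<N}. B (e j) (tr (b j \<otimes> x \<otimes> e i) \<odot> b i))"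
      using j x by (intro clinear_map_finsum[OF cstar_algebra_axioms C cbilinear_mapD(1)[OF B]]) auto
    also have "\<dots> = (\<Oplus>\<^bsub>C\<^esub>i\<in>{..<N}. k i j \<odot>\<^bsub>C\<^esub> B (e j) (b i))"
      using j x by (intro C.finsum_eqI) (auto simp: tr)
    finally show ?thesis .
  qed
  have "(\<Oplus>\<^bsub>C\<^esub>i\<in>{..<N}. B (x \<otimes> e i) (b i)) = (\<Oplus>\<^bsub>C\<^esub>i\<in>{..<N}. \<Oplus>\<^bsub>C\<^esub>j\<in>{..<N}. k i j \<odot>\<^bsub>C\<^esub> B (e j) (b i))"
    using 1 by (intro C.finsum_eqI) (auto intro!: C.finsum_closed)
  also have "\<dots> = (\<Oplus>\<^bsub>C\<^esub>j\<in>{..<N}. \<Oplus>\<^bsub>C\<^esub>i\<in>{..<N}. k i j \<odot>\<^bsub>C\<^esub> B (e j) (b i))"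
    by (intro C.finsum_swap) auto
  also have "\<dots> = (\<Oplus>\<^bsub>C\<^esub>i\<in>{..<N}. B (e i) (b i \<otimes> x))"
    using 2 x by (intro C.finsum_eqI) auto
  finally show ?thesis .
qed

lemma casimir_automorphism:
  assumes "cstar_algebra C" "cbilinear_map A A C B" "s \<in> cstar_aut A"
  shows "(\<Oplus>\<^bsub>C\<^esub>i\<in>{..<N}. B (s (e i)) (s (b i))) = (\<Oplus>\<^bsub>C\<^esub>i\<in>{..<N}. B (e i) (b i))"
  by (rule casimir_unique[OF assms(1,2) dual_pair_automorphism[OF assms(3) dual] dual])

text \<open>Multiplying out the separability idempotent yields the unit of the algebra; in a general
  \<open>cstar_algebra\<close> the field \<open>one\<close> has no meaning. By
  \<open>tr_unit\<close> the elements \<open>unit \<otimes> y\<close> and \<open>y\<close> have the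
  same trace for all \<open>y\<close>, and nondegeneracy does the rest.\<close>

definition unit :: 'a where
  "unit = (\<Oplus>i\<in>{..<N}. e i \<otimes> b i)"

lemma unit_closed [simp]: "unit \<in> carrier A"
  by (auto simp: unit_def intro!: finsum_closed)

lemma tr_unit:
  assumes y: "y \<in> carrier A"
  shows "tr (unit \<otimes> y) = tr y"
proof -
  have "tr (unit \<otimes> y) = (\<Sum>i<N. tr (e i \<otimes> b i \<otimes> y))"
    unfolding unit_def using y by (subst mult_finsum_l) (auto intro!: tr_finsum)
  also have "\<dots> = (\<Sum>i<N. co i (y \<otimes> e i))"
  proof (intro sum.cong refl)
    fix i assume "i \<in> {..<N}"
    then show "tr (e i \<otimes> b i \<otimes> y) = co i (y \<otimes> e i)"
      using y tr_comm[of "e i \<otimes> b i" y] by (simp add: co_tr mult_assoc)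
  qed
  finally show ?thesis by (simp add: tr_def)
qed

lemma unit_mult_l [simp]:
  assumes x: "x \<in> carrier A"
  shows "unit \<otimes> x = x"
proof -
  have "unit \<otimes> x \<ominus> x = \<zero>"
    using x tr_unit[of "x \<otimes> _"]
    by (intro tr_nondegenerate) (auto simp: mult_diff_l tr_diff mult_assoc)
  then show ?thesis using x by simp
qed

text \<open>The involution turns the left unit into a right unit, and a left and a right unit
  coincide.\<close>

lemma unit_mult_r [simp]:
  assumes x: "x \<in> carrier A"
  shows "x \<otimes> unit = x"
proof -
  have r: "y \<otimes> invol A unit = y" if "y \<in> carrier A" for y
    using that unit_mult_l[of "invol A y"] by (metis invol_closed invol_invol invol_mult unit_closed)
  have "invol A unit = unit" using r[of unit] by simp
  with r[OF x] show ?thesis by simp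
qed

lemma unital: "unital_cstar_algebra (A\<lparr>one := unit\<rparr>)"
proof -
  let ?U = "A\<lparr>one := unit\<rparr>"
  have dist: "cstar_dist ?U = cstar_dist A"
    by (simp add: cstar_dist_def a_minus_def a_inv_def fun_eq_iff)
  have U: "cstar_algebra ?U"
    using cstar_algebra_axioms
    by (simp add: cstar_algebra_def cstar_algebra_axioms_def module_def module_axioms_def
        abelian_group_def abelian_monoid_def abelian_group_axioms_def dist)
  interpret U: cstar_algebra ?U by (rule U)
  have "ring ?U"
    by (rule ringI[OF U.abelian_group_axioms monoidI])
      (auto simp: mult_assoc mult_add_left mult_add_right)
  then show ?thesis using U by (simp add: unital_cstar_algebra_def)
qed

text \<open>\<open>co i x\<close> is the trace of \<open>x \<otimes> b i\<close>, to which
  \<open>tr_bound\<close> applies.\<close>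

lemma co_bound: "\<exists>K\<ge>0. \<forall>x\<in>carrier A. \<forall>i<N. cmod (co i x) \<le> K * nrm A x"
proof (intro exI[of _ "N * (\<Sum>i<N. nrm A (b i))"] conjI ballI allI impI)
  show "0 \<le> N * (\<Sum>i<N. nrm A (b i))" by (intro mult_nonneg_nonneg sum_nonneg) (auto intro: nrm_nonneg)
  fix x i assume x: "x \<in> carrier A" and i: "i < N"
  have "nrm A (b i) \<le> (\<Sum>i<N. nrm A (b i))" using i by (intro member_le_sum) (auto intro: nrm_nonneg)
  then have "nrm A x * nrm A (b i) \<le> nrm A x * (\<Sum>i<N. nrm A (b i))"
    using nrm_nonneg[OF x] by (rule mult_left_mono)
  then have "nrm A (x \<otimes> b i) \<le> (\<Sum>i<N. nrm A (b i)) * nrm A x"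
    using nrm_mult[of x "b i"] x i by (simp add: mult.commute)
  then have "N * nrm A (x \<otimes> b i) \<le> N * ((\<Sum>i<N. nrm A (b i)) * nrm A x)" by (rule mult_left_mono) simp
  moreover have "cmod (co i x) \<le> N * nrm A (x \<otimes> b i)"
    using tr_bound[of "x \<otimes> b i"] x i by (simp add: co_tr)
  ultimately show "cmod (co i x) \<le> N * (\<Sum>i<N. nrm A (b i)) * nrm A x"
    unfolding mult.assoc by linarith
qed

end

section \<open>Almost fixed points of compact groups of isometries\<close>

text \<open>Intended model: linear lifts of a given map, with operator norm distance, the
  conjugation action and \<open>cc t x y = t x + (1 - t) y\<close>. \<open>d\<close> is treated as a
  pseudometric. \<open>d_act_cc\<close> says that the displacement between two group elements is a
  convex function of the point. Continuity at the identity is enough because the action is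
  isometric.\<close>

locale convex_group_action =
  fixes P :: "'v set" and d :: "'v \<Rightarrow> 'v \<Rightarrow> real"
    and act :: "'g::topological_group_add \<Rightarrow> 'v \<Rightarrow> 'v" and cc :: "real \<Rightarrow> 'v \<Rightarrow> 'v \<Rightarrow> 'v"
  assumes compact_group: "compact (UNIV :: 'g set)"
    and act_closed: "x \<in> P \<Longrightarrow> act g x \<in> P"
    and act_add: "x \<in> P \<Longrightarrow> act (g + h) x = act g (act h x)"
    and act_zero: "x \<in> P \<Longrightarrow> act 0 x = x"
    and cc_closed: "x \<in> P \<Longrightarrow> y \<in> P \<Longrightarrow> 0 \<le> t \<Longrightarrow> t \<le> 1 \<Longrightarrow> cc t x y \<in> P"
    and d_nonneg: "x \<in> P \<Longrightarrow> y \<in> P \<Longrightarrow> 0 \<le> d x y"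
    and d_sym: "x \<in> P \<Longrightarrow> y \<in> P \<Longrightarrow> d x y = d y x"
    and d_triangle: "x \<in> P \<Longrightarrow> y \<in> P \<Longrightarrow> z \<in> P \<Longrightarrow> d x z \<le> d x y + d y z"
    and d_act: "x \<in> P \<Longrightarrow> y \<in> P \<Longrightarrow> d (act g x) (act g y) = d x y"
    and d_cc: "x \<in> P \<Longrightarrow> y \<in> P \<Longrightarrow> z \<in> P \<Longrightarrow> 0 \<le> t \<Longrightarrow> t \<le> 1 \<Longrightarrow>
      d (cc t x y) z \<le> t * d x z + (1 - t) * d y z"
    and d_act_cc: "x \<in> P \<Longrightarrow> y \<in> P \<Longrightarrow> 0 \<le> t \<Longrightarrow> t \<le> 1 \<Longrightarrow>
      d (act g (cc t x y)) (act h (cc t x y)) \<le> t * d (act g x) (act h x) + (1 - t) * d (act g y) (act h y)"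
    and act_continuous: "x \<in> P \<Longrightarrow> 0 < \<epsilon> \<Longrightarrow> \<exists>U. open U \<and> 0 \<in> U \<and> (\<forall>u\<in>U. d (act u x) x < \<epsilon>)"
begin

lemma finite_translates:
  assumes "open W" "(0::'g) \<in> W"
  shows "\<exists>L. finite L \<and> (\<forall>g. \<exists>k\<in>L. - k + g \<in> W)"
proof -
  have op: "open ((\<lambda>g. - k + g) -` W)" for k
    by (rule open_vimage[OF assms(1)]) (intro continuous_intros)
  have "UNIV \<subseteq> (\<Union>k\<in>UNIV. (\<lambda>g. - k + g) -` W)" using assms(2) by (auto intro: exI[of _ "_::'g"])
  from compactE_image[OF compact_group op this]
  obtain L where "finite L" "UNIV \<subseteq> (\<Union>k\<in>L. (\<lambda>g. - k + g) -` W)" by auto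
  then show ?thesis by (intro exI[of _ L]) auto
qed

lemma d_act_left:
  assumes "x \<in> P" "y \<in> P"
  shows "d (act g x) (act h y) = d (act (- h + g) x) y"
proof -
  have "d (act g x) (act h y) = d (act (- h) (act g x)) (act (- h) (act h y))"
    using assms by (simp add: d_act act_closed)
  also have "act (- h) (act h y) = y"
    using act_add[OF assms(2), of "- h" h] act_zero[OF assms(2)] by simp
  finally show ?thesis using assms by (simp add: act_add[OF assms(1)])
qed

lemma orbit_net:
  assumes "v \<in> P" "0 < \<epsilon>"
  shows "\<exists>H. finite H \<and> (\<forall>g. \<exists>k\<in>H. d (act g v) (act k v) < \<epsilon>)"
proof -
  obtain U where U: "open U" "0 \<in> U" "\<forall>u\<in>U. d (act u v) v < \<epsilon>"
    using act_continuous[OF assms] by blast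
  obtain H where H: "finite H" "\<forall>g. \<exists>k\<in>H. - k + g \<in> U"
    using finite_translates[OF U(1,2)] by blast
  show ?thesis
    using H U(3) by (intro exI[of _ H]) (auto simp: d_act_left[OF assms(1,1)])
qed

text \<open>One finite set \<open>L\<close> approximates every \<open>g\<close> simultaneously at
  all points of the orbit: take a finite net of the orbit, a neighbourhood of the identity that
  serves all points of the net, and a three-term estimate. The uniformity is what allows
  \<open>L\<close> to be kept while \<open>v\<close> is replaced by averages over its orbit.\<close>

lemma uniform_net:
  assumes v: "v \<in> P" and eps: "0 < \<epsilon>"
  shows "\<exists>L. finite L \<and> (\<forall>g. \<exists>k\<in>L. \<forall>h. d (act g (act h v)) (act k (act h v)) \<le> \<epsilon>)"
proof -
  obtain H where H: "finite H" "\<forall>g. \<exists>k\<in>H. d (act g v) (act k v) < \<epsilon> / 3"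
    using orbit_net[OF v, of "\<epsilon> / 3"] eps by auto
  have "\<forall>k\<in>H. \<exists>U. open U \<and> 0 \<in> U \<and> (\<forall>u\<in>U. d (act u (act k v)) (act k v) < \<epsilon> / 3)"
    using act_continuous[OF act_closed[OF v], of "\<epsilon> / 3"] eps by simp
  then obtain U where U: "\<And>k. k \<in> H \<Longrightarrow> open (U k) \<and> 0 \<in> U k \<and>
      (\<forall>u\<in>U k. d (act u (act k v)) (act k v) < \<epsilon> / 3)"
    by metis
  obtain L where L: "finite L" "\<forall>g. \<exists>k\<in>L. - k + g \<in> (\<Inter>k\<in>H. U k)"
    using finite_translates[of "\<Inter>k\<in>H. U k"] U H(1) by (metis INT_I open_INT)
  have "\<exists>k\<in>L. \<forall>h. d (act g (act h v)) (act k (act h v)) \<le> \<epsilon>" for g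
  proof -
    obtain k where k: "k \<in> L" "- k + g \<in> (\<Inter>k\<in>H. U k)" using L by blast
    have "d (act g (act h v)) (act k (act h v)) \<le> \<epsilon>" for h
    proof -
      obtain h' where h': "h' \<in> H" "d (act h v) (act h' v) < \<epsilon> / 3" using H by blast
      note cl = act_closed[OF v] act_closed[OF act_closed[OF v]]
      have "d (act g (act h v)) (act g (act h' v)) < \<epsilon> / 3" using h' cl by (simp add: d_act)
      moreover have "d (act g (act h' v)) (act k (act h' v)) < \<epsilon> / 3"
        using U[OF h'(1)] k(2) h'(1) cl by (simp add: d_act_left[of "act h' v" "act h' v"])
      moreover have "d (act k (act h' v)) (act k (act h v)) < \<epsilon> / 3"
        using h' cl by (simp add: d_act d_sym[of "act h' v"])
      ultimately show ?thesis
        using d_triangle[of "act g (act h v)" "act g (act h' v)" "act k (act h v)"]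
          d_triangle[of "act g (act h' v)" "act k (act h' v)" "act k (act h v)"] cl by force
    qed
    then show ?thesis using k by blast
  qed
  then show ?thesis using L by blast
qed

text \<open>By invariance of \<open>d\<close> this bounds the diameter of the orbit of
  \<open>x\<close> (\<open>osc_leD\<close>).\<close>

definition osc_le :: "'v \<Rightarrow> real \<Rightarrow> bool" where
  "osc_le x r \<longleftrightarrow> (\<forall>g. d (act g x) x \<le> r)"

lemma osc_leD: "x \<in> P \<Longrightarrow> osc_le x r \<Longrightarrow> d (act g x) (act h x) \<le> r"
  by (simp add: osc_le_def d_act_left)

lemma osc_le_mono: "osc_le x r \<Longrightarrow> r \<le> r' \<Longrightarrow> osc_le x r'"
  unfolding osc_le_def by (meson order_trans)

text \<open>The uniform average of a list, built from two-point combinations; what is kept of it is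
  the bound for its distance to other points.\<close>

lemma average_exists:
  assumes "xs \<noteq> []" "set xs \<subseteq> S" "S \<subseteq> P"
    and S: "\<And>x y t. x \<in> S \<Longrightarrow> y \<in> S \<Longrightarrow> 0 \<le> t \<Longrightarrow> t \<le> 1 \<Longrightarrow> cc t x y \<in> S"
  shows "\<exists>p\<in>S. \<forall>z\<in>P. d p z \<le> (\<Sum>x\<leftarrow>xs. d x z) / length xs"
  using assms(1,2)
proof (induction xs rule: list_nonempty_induct)
  case (single x)
  then show ?case by (intro bexI[of _ x]) auto
next
  case (cons x xs)
  then obtain p where p: "p \<in> S" "\<forall>z\<in>P. d p z \<le> (\<Sum>x\<leftarrow>xs. d x z) / length xs" by auto
  define n where "n = real (length xs)"
  have n: "n > 0" using cons by (simp add: n_def)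
  \<comment> \<open>Weight of a new point joining the average of \<open>n\<close> points.\<close>
  define t where "t = 1 / (1 + n)"
  have t: "0 \<le> t" "t \<le> 1" "(1 - t) = n / (1 + n)" using n by (auto simp: t_def field_simps)
  show ?case
  proof (intro bexI ballI)
    show "cc t x p \<in> S" using S t p cons by auto
    fix z assume z: "z \<in> P"
    have "d (cc t x p) z \<le> t * d x z + (1 - t) * d p z"
      using cons p z t assms(3) by (intro d_cc) auto
    also have "\<dots> \<le> t * d x z + (1 - t) * ((\<Sum>x\<leftarrow>xs. d x z) / n)"
      using p z t unfolding n_def by (intro add_left_mono mult_left_mono) auto
    also have "\<dots> = (\<Sum>x\<leftarrow>x # xs. d x z) / length (x # xs)"
    proof -
      have "(1 - t) * (s / n) = s / (1 + n)" "t * s = s / (1 + n)" for s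
        unfolding t(3) using n by (simp_all add: t_def)
      then show ?thesis by (simp add: n_def[symmetric] add_divide_distrib)
    qed
    finally show "d (cc t x p) z \<le> (\<Sum>x\<leftarrow>x # xs. d x z) / length (x # xs)" .
  qed
qed

text \<open>Averaging a point over an \<open>\<epsilon>\<close>-net of its orbit brings every point of the orbit closer by a
  fixed factor, because one of the \<open>n\<close> distances averaged is small.\<close>

lemma contraction_step:
  assumes w: "w \<in> S" "osc_le w r" and SP: "S \<subseteq> P"
    and S_act: "\<And>x g. x \<in> S \<Longrightarrow> act g x \<in> S"
    and S_cc: "\<And>x y t. x \<in> S \<Longrightarrow> y \<in> S \<Longrightarrow> 0 \<le> t \<Longrightarrow> t \<le> 1 \<Longrightarrow> cc t x y \<in> S"
    and L: "finite L" "\<forall>g. \<exists>k\<in>L. d (act g w) (act k w) \<le> \<epsilon>"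
    and r: "2 * \<epsilon> \<le> r"
  shows "\<exists>p\<in>S. osc_le p (r * (1 - 1 / (2 * real (card L))))"
proof -
  have wP: "w \<in> P" using w SP by auto
  obtain ks where ks: "set ks = L" "distinct ks" using finite_distinct_list[OF L(1)] by blast
  define n where "n = length ks"
  have nL: "n = card L" using ks distinct_card n_def by metis
  have L0: "L \<noteq> {}" using L(2) by auto
  then have n0: "n > 0" using nL L(1) by (simp add: card_gt_0_iff)
  obtain p where p: "p \<in> S" "\<forall>z\<in>P. d p z \<le> (\<Sum>x\<leftarrow>map (\<lambda>k. act k w) ks. d x z) / length (map (\<lambda>k. act k w) ks)"
    using average_exists[of "map (\<lambda>k. act k w) ks" S] L0 ks w S_act S_cc SP by force
  have pz: "d p z \<le> (\<Sum>k\<in>L. d (act k w) z) / n" if "z \<in> P" for z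
    using p(2) that ks by (simp add: n_def o_def sum_list_distinct_conv_sum_set)
  have pP: "p \<in> P" using p SP by auto
  define c where "c = r * (1 - 1 / (2 * real (card L)))"
  have orbit: "d p (act h w) \<le> c" for h
  proof -
    obtain k where k: "k \<in> L" "d (act h w) (act k w) \<le> \<epsilon>" using L by blast
    have "(\<Sum>k\<in>L. d (act k w) (act h w)) = d (act k w) (act h w) + (\<Sum>k\<in>L - {k}. d (act k w) (act h w))"
      using k L(1) by (simp add: sum.remove)
    also have "\<dots> \<le> \<epsilon> + (\<Sum>k\<in>L - {k}. r)"
      using k osc_leD[OF wP w(2)] d_sym[of "act k w" "act h w"] act_closed[OF wP]
      by (intro add_mono sum_mono) auto
    also have "\<dots> = \<epsilon> + (n - 1) * r" using k L(1) nL n0 by (simp add: of_nat_diff)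
    finally have "d p (act h w) \<le> (\<epsilon> + (n - 1) * r) / n"
      using pz[OF act_closed[OF wP], of h] n0 by (smt (verit) divide_right_mono of_nat_0_le_iff)
    \<comment> \<open>One distance is at most half of \<open>r\<close> and the other
      \<open>n - 1\<close> are at most \<open>r\<close>, so their mean is at most
      \<open>r * (1 - 1 / (2 * n))\<close>.\<close>
    also have "\<dots> \<le> (r / 2 + (n - 1) * r) / n" using r n0 by (intro divide_right_mono) auto
    also have "\<dots> = c" using n0 by (simp add: c_def nL[symmetric] field_simps of_nat_diff)
    finally show ?thesis .
  qed
  \<comment> \<open>The averaging inequality is used a second time, with \<open>act g p\<close> as
    the test point: by invariance its distances to the orbit of \<open>w\<close> are bounded by
    \<open>c\<close> too, and \<open>p\<close> is an average of points of that orbit.\<close>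
  have "d (act g p) p \<le> c" for g
  proof -
    have "d (act g p) p = d p (act g p)" using d_sym act_closed pP by simp
    also have "\<dots> \<le> (\<Sum>k\<in>L. d (act k w) (act g p)) / n" using pz act_closed pP by simp
    also have "(\<Sum>k\<in>L. d (act k w) (act g p)) \<le> (\<Sum>k\<in>L. c)"
      using orbit wP pP act_closed by (intro sum_mono) (simp add: d_act_left d_sym[of _ p])
    finally show ?thesis using n0 nL by (simp add: divide_right_mono)
  qed
  then show ?thesis using p(1) unfolding osc_le_def c_def by blast
qed

text \<open>\<open>contraction_step\<close> is iterated inside a convex invariant set
  \<open>S\<close> that contains \<open>v\<close> and on which the finite set \<open>L\<close> found
  for \<open>v\<close> still works. So the number of averaged points, and with it the contraction
  factor \<open>q\<close>, is the same in every step; membership in \<open>S\<close> also keeps the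
  distance to \<open>v\<close> at most \<open>r\<close>.\<close>

lemma small_oscillation:
  assumes v: "v \<in> P" "osc_le v r" and r: "0 \<le> r" and eps: "0 < \<epsilon>"
  shows "\<exists>w\<in>P. osc_le w \<epsilon> \<and> d w v \<le> r"
proof -
  \<comment> \<open>Pairs that act alike up to \<open>\<epsilon> / 2\<close> on the whole orbit of
    \<open>v\<close>. Because the whole orbit is quantified over, \<open>Z\<close> is invariant
    under right translation, and this makes \<open>S\<close> invariant.\<close>
  define Z where "Z = {(g, k). \<forall>h. d (act g (act h v)) (act k (act h v)) \<le> \<epsilon> / 2}"
  define S where "S = {x \<in> P. (\<forall>(g, k)\<in>Z. d (act g x) (act k x) \<le> \<epsilon> / 2) \<and> (\<forall>h. d x (act h v) \<le> r)}"
  have SP: "S \<subseteq> P" by (auto simp: S_def)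
  obtain L where L: "finite L" "\<forall>g. \<exists>k\<in>L. (g, k) \<in> Z"
    using uniform_net[OF v(1), of "\<epsilon> / 2"] eps by (auto simp: Z_def)
  have S_act: "act g x \<in> S" if x: "x \<in> S" for x g
  proof -
    have xP: "x \<in> P" using x by (simp add: S_def)
    have "d (act a (act g x)) (act k (act g x)) \<le> \<epsilon> / 2" if "(a, k) \<in> Z" for a k
    proof -
      have "(a + g, k + g) \<in> Z"
        using that v(1) unfolding Z_def
        by (auto simp: act_add[OF act_closed[OF v(1)]]) (auto simp flip: act_add[OF v(1), of g])
      then show ?thesis using x by (auto simp: S_def act_add[OF xP])
    qed
    moreover have "d (act g x) (act h v) \<le> r" for h
    proof -
      have "d (act g x) (act h v) = d (act (- g) (act g x)) (act (- g) (act h v))"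
        using xP v by (simp add: d_act act_closed)
      also have "\<dots> = d x (act (- g + h) v)"
        using xP v by (simp add: act_zero flip: act_add)
      finally show ?thesis using x by (simp add: S_def)
    qed
    ultimately show ?thesis using xP by (auto simp: S_def act_closed)
  qed
  have S_cc: "cc t x y \<in> S" if x: "x \<in> S" and y: "y \<in> S" and t: "0 \<le> t" "t \<le> 1" for x y t
  proof -
    have xy: "x \<in> P" "y \<in> P" using x y by (auto simp: S_def)
    have conv: "t * a + (1 - t) * b \<le> c" if "a \<le> c" "b \<le> c" for a b c :: real
    proof -
      have "t * a + (1 - t) * b \<le> t * c + (1 - t) * c" using that t by (intro add_mono mult_left_mono) auto
      then show ?thesis by (simp add: algebra_simps)
    qed
    have "d (act g (cc t x y)) (act k (cc t x y)) \<le> \<epsilon> / 2" if "(g, k) \<in> Z" for g k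
    proof -
      have "d (act g x) (act k x) \<le> \<epsilon> / 2" "d (act g y) (act k y) \<le> \<epsilon> / 2"
        using x y that by (auto simp: S_def)
      from order_trans[OF d_act_cc[OF xy t] conv[OF this]] show ?thesis .
    qed
    moreover have "d (cc t x y) (act h v) \<le> r" for h
    proof -
      have "d x (act h v) \<le> r" "d y (act h v) \<le> r" using x y by (auto simp: S_def)
      from order_trans[OF d_cc[OF xy act_closed[OF v(1)] t] conv[OF this]] show ?thesis .
    qed
    ultimately show ?thesis using xy t by (auto simp: S_def cc_closed)
  qed
  have vS: "v \<in> S"
  proof -
    have "d (act g v) (act k v) \<le> \<epsilon> / 2" if "(g, k) \<in> Z" for g k
      using that act_zero[OF v(1)] unfolding Z_def by (metis (mono_tags, lifting) case_prodD mem_Collect_eq)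
    moreover have "d v (act h v) \<le> r" for h
      using osc_leD[OF v, of 0 h] act_zero[OF v(1)] by simp
    ultimately show ?thesis using v(1) by (auto simp: S_def)
  qed
  define q where "q = 1 - 1 / (2 * real (card L))"
  have "L \<noteq> {}" using L(2) by auto
  then have "card L > 0" using L(1) by (simp add: card_gt_0_iff)
  then have q: "0 \<le> q" "q < 1" by (auto simp: q_def field_simps)
  \<comment> \<open>The maximum keeps the claim true once \<open>\<epsilon>\<close> is reached.
    Before that the oscillation bound is at least twice the precision \<open>\<epsilon> / 2\<close>
    of the net, as \<open>contraction_step\<close> demands.\<close>
  have iter: "\<exists>w\<in>S. osc_le w (max \<epsilon> (r * q ^ k))" for k
  proof (induction k)
    case 0
    have "osc_le v (max \<epsilon> (r * q ^ 0))" by (rule osc_le_mono[OF v(2)]) simp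
    then show ?case using vS by blast
  next
    case (Suc k)
    then obtain w where w: "w \<in> S" "osc_le w (max \<epsilon> (r * q ^ k))" by blast
    show ?case
    proof (cases "r * q ^ k \<le> \<epsilon>")
      case True
      then have "osc_le w \<epsilon>" using w(2) by (simp add: max_absorb1)
      then show ?thesis using w(1) osc_le_mono by (meson max.cobounded1)
    next
      case False
      have net: "\<forall>g. \<exists>k\<in>L. d (act g w) (act k w) \<le> \<epsilon> / 2" using w(1) L(2) by (fastforce simp: S_def)
      have "\<exists>p\<in>S. osc_le p (max \<epsilon> (r * q ^ k) * (1 - 1 / (2 * real (card L))))"
        using False by (intro contraction_step[OF w SP S_act S_cc L(1) net]) auto
      then obtain p where "p \<in> S" "osc_le p (r * q ^ Suc k)"
        unfolding q_def[symmetric] using False by (auto simp: max_def mult_ac)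
      then show ?thesis using osc_le_mono by (meson max.cobounded2)
    qed
  qed
  obtain k where k: "r * q ^ k \<le> \<epsilon>"
  proof -
    have "(\<lambda>k. r * q ^ k) \<longlonglongrightarrow> r * 0" using q by (intro tendsto_intros LIMSEQ_realpow_zero) auto
    from order_tendstoD(2)[OF this, of \<epsilon>] eps show ?thesis
      using that by (fastforce simp: eventually_sequentially dest: less_imp_le)
  qed
  obtain w where w: "w \<in> S" "osc_le w \<epsilon>" using iter[of k] k by (auto simp: max_absorb1)
  have "d w (act 0 v) \<le> r" using w(1) unfolding S_def by blast
  then show ?thesis using w SP act_zero[OF v(1)] by auto
qed

text \<open>Each use of \<open>small_oscillation\<close> halves the oscillation and moves the point
  by at most the current bound, so the steps are summable. The limit is taken later, pointwise in
  the complete algebra \<open>C\<close>.\<close>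

lemma almost_fixed_sequence:
  assumes v: "v \<in> P"
  shows "\<exists>w K. (\<forall>k. w k \<in> P) \<and> (\<forall>k g. d (act g (w k)) (w k) \<le> K * (1/2) ^ k) \<and>
    (\<forall>k. d (w (Suc k)) (w k) \<le> K * (1/2) ^ k)"
proof -
  obtain H where H: "finite H" "\<forall>g. \<exists>k\<in>H. d (act g v) (act k v) < 1"
    using orbit_net[OF v, of 1] by auto
  \<comment> \<open>A finite net of the orbit with precision 1 bounds the initial
    oscillation.\<close>
  define K where "K = 1 + (\<Sum>k\<in>H. d (act k v) v)"
  have K: "K > 0" unfolding K_def using d_nonneg act_closed v by (intro add_pos_nonneg sum_nonneg) auto
  have "d (act g v) v \<le> K" for g
  proof -
    obtain k where k: "k \<in> H" "d (act g v) (act k v) < 1" using H by blast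
    have "d (act k v) v \<le> (\<Sum>k\<in>H. d (act k v) v)"
      using k H d_nonneg act_closed v by (intro member_le_sum) auto
    then show ?thesis using d_triangle[of "act g v" "act k v" v] k act_closed v by (simp add: K_def)
  qed
  then have v0: "osc_le v K" by (simp add: osc_le_def)
  have "\<exists>w. \<forall>k. (w k \<in> P \<and> osc_le (w k) (K * (1/2) ^ k)) \<and> d (w (Suc k)) (w k) \<le> K * (1/2) ^ k"
  proof (rule dependent_nat_choice)
    show "\<exists>x. x \<in> P \<and> osc_le x (K * (1/2) ^ 0)" using v v0 by auto
    fix x k assume "x \<in> P \<and> osc_le x (K * (1/2) ^ k)"
    then show "\<exists>y. (y \<in> P \<and> osc_le y (K * (1/2) ^ Suc k)) \<and> d y x \<le> K * (1/2) ^ k"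
      using small_oscillation[of x "K * (1/2) ^ k" "K * (1/2) ^ Suc k"] K by auto
  qed
  then show ?thesis unfolding osc_le_def by blast
qed

end

section \<open>Ideals\<close>

locale cstar_ideal = unital_cstar_algebra A for A :: "'a cstar" (structure) +
  fixes J :: "'a set"
  assumes closed_ideal: "closed_ideal A J"
begin

lemma J_ideal: "ideal J A"
  using closed_ideal by (simp add: closed_ideal_def)

lemma J_carrier: "x \<in> J \<Longrightarrow> x \<in> carrier A"
  using J_ideal by (meson additive_subgroup.a_Hcarr ideal.axioms(1))

lemma J_zero [simp]: "\<zero> \<in> J"
  using J_ideal by (meson additive_subgroup.zero_closed ideal.axioms(1))

lemma J_add: "x \<in> J \<Longrightarrow> y \<in> J \<Longrightarrow> x \<oplus> y \<in> J"
  using J_ideal by (meson additive_subgroup.a_closed ideal.axioms(1))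

lemma J_mult_l: "x \<in> carrier A \<Longrightarrow> y \<in> J \<Longrightarrow> x \<otimes> y \<in> J"
  using J_ideal by (meson ideal.I_l_closed)

lemma J_mult_r: "x \<in> J \<Longrightarrow> y \<in> carrier A \<Longrightarrow> x \<otimes> y \<in> J"
  using J_ideal by (meson ideal.I_r_closed)

lemma J_smult: "x \<in> J \<Longrightarrow> c \<odot> x \<in> J"
  using J_mult_l[of "c \<odot> \<one>" x] J_carrier[of x] by (simp add: smult_mult_left)

lemma J_diff: "x \<in> J \<Longrightarrow> y \<in> J \<Longrightarrow> x \<ominus> y \<in> J"
  by (simp add: diff_eq J_carrier J_add J_smult)

lemma J_finsum: "finite I \<Longrightarrow> (\<And>i. i \<in> I \<Longrightarrow> f i \<in> J) \<Longrightarrow> (\<Oplus>i\<in>I. f i) \<in> J"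
  by (rule finsum_induct[of "\<lambda>x. x \<in> J"]) (auto simp: J_add J_carrier)

lemma J_closed: "x \<in> carrier A \<Longrightarrow> (\<And>\<epsilon>. \<epsilon> > 0 \<Longrightarrow> \<exists>y\<in>J. nrm A (x \<ominus> y) < \<epsilon>) \<Longrightarrow> x \<in> J"
  using closed_ideal by (auto simp: closed_ideal_def closedin_iff)

text \<open>Equality in the quotient, expressed on representatives. Membership in the carrier is
  included, so that \<open>cgD\<close> yields closure facts.\<close>

definition cg :: "'a \<Rightarrow> 'a \<Rightarrow> bool" where
  "cg x y \<longleftrightarrow> x \<in> carrier A \<and> y \<in> carrier A \<and> x \<ominus> y \<in> J"

lemma cg_refl: "x \<in> carrier A \<Longrightarrow> cg x x"
  by (simp add: cg_def)

lemma cgD: "cg x y \<Longrightarrow> x \<in> carrier A" "cg x y \<Longrightarrow> y \<in> carrier A" "cg x y \<Longrightarrow> x \<ominus> y \<in> J"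
  by (auto simp: cg_def)

lemma cg_sym: "cg x y \<Longrightarrow> cg y x"
proof -
  assume xy: "cg x y"
  then have "y \<ominus> x = (-1) \<odot> (x \<ominus> y)" by (simp add: cg_def lin_simps)
  then show ?thesis using xy J_smult by (simp add: cg_def)
qed

lemma cg_trans [trans]: "cg x y \<Longrightarrow> cg y z \<Longrightarrow> cg x z"
  using J_add[of "x \<ominus> y" "y \<ominus> z"] by (simp add: cg_def diff_telescope)

lemma cg_add: "cg x y \<Longrightarrow> cg x' y' \<Longrightarrow> cg (x \<oplus> x') (y \<oplus> y')"
  using J_add[of "x \<ominus> y" "x' \<ominus> y'"] by (simp add: cg_def add_diff_add)

lemma cg_smult: "cg x y \<Longrightarrow> cg (c \<odot> x) (c \<odot> y)"
  using J_smult[of "x \<ominus> y" c] by (simp add: cg_def sm_diff)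

lemma cg_diff: "cg x y \<Longrightarrow> cg x' y' \<Longrightarrow> cg (x \<ominus> x') (y \<ominus> y')"
  using cg_add[of x y "(-1) \<odot> x'" "(-1) \<odot> y'"] cg_smult[of x' y' "-1"] by (simp add: diff_eq cgD)

lemma cg_mult: "cg x y \<Longrightarrow> cg x' y' \<Longrightarrow> cg (x \<otimes> x') (y \<otimes> y')"
proof -
  assume xy: "cg x y" "cg x' y'"
  have "cg (x \<otimes> x') (y \<otimes> x')"
    using xy J_mult_r[of "x \<ominus> y" x'] by (simp add: cg_def mult_diff_l)
  also have "cg (y \<otimes> x') (y \<otimes> y')"
    using xy J_mult_l[of y "x' \<ominus> y'"] by (simp add: cg_def mult_diff_r)
  finally show ?thesis .
qed

lemma cg_finsum:
  assumes "finite I" "\<And>i. i \<in> I \<Longrightarrow> cg (f i) (g i)"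
  shows "cg (\<Oplus>i\<in>I. f i) (\<Oplus>i\<in>I. g i)"
proof -
  have "f \<in> I \<rightarrow> carrier A" "g \<in> I \<rightarrow> carrier A" using assms(2)[THEN cgD(1)] assms(2)[THEN cgD(2)] by auto
  moreover from this have "(\<Oplus>i\<in>I. f i) \<ominus> (\<Oplus>i\<in>I. g i) \<in> J"
    using assms(1) assms(2)[THEN cgD(3)] by (subst finsum_diff[symmetric]) (auto intro!: J_finsum)
  ultimately show ?thesis by (auto simp: cg_def intro!: finsum_closed)
qed

lemma cg_zero_iff: "cg x \<zero> \<longleftrightarrow> x \<in> J"
  using J_carrier by (auto simp: cg_def)

text \<open>The quotient norm as a function of a representative; it turns out to be a
  submultiplicative seminorm with kernel \<open>J\<close>.\<close>

definition qn :: "'a \<Rightarrow> real" where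
  "qn x = (INF j\<in>J. nrm A (x \<ominus> j))"

lemma qn_bdd: "x \<in> carrier A \<Longrightarrow> bdd_below ((\<lambda>j. nrm A (x \<ominus> j)) ` J)"
  by (rule bdd_belowI[of _ 0]) (auto simp: J_carrier nrm_nonneg)

lemma qn_le: "x \<in> carrier A \<Longrightarrow> j \<in> J \<Longrightarrow> qn x \<le> nrm A (x \<ominus> j)"
  unfolding qn_def by (rule cINF_lower[OF qn_bdd])

lemma qn_le_nrm: "x \<in> carrier A \<Longrightarrow> qn x \<le> nrm A x"
  using qn_le[of x \<zero>] by simp

lemma qn_nonneg: "x \<in> carrier A \<Longrightarrow> 0 \<le> qn x"
  unfolding qn_def by (rule cINF_greatest) (auto simp: J_carrier nrm_nonneg intro: J_zero)

lemma qn_approx: "x \<in> carrier A \<Longrightarrow> 0 < \<epsilon> \<Longrightarrow> \<exists>j\<in>J. nrm A (x \<ominus> j) < qn x + \<epsilon>"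
proof -
  assume "x \<in> carrier A" "0 < \<epsilon>"
  moreover have "J \<noteq> {}" using J_zero by blast
  ultimately show ?thesis using cINF_less_iff[OF _ qn_bdd, of x "qn x + \<epsilon>"] by (simp add: qn_def)
qed

lemma qn_add:
  assumes "x \<in> carrier A" "y \<in> carrier A"
  shows "qn (x \<oplus> y) \<le> qn x + qn y"
proof (rule field_le_epsilon)
  fix e :: real assume "e > 0"
  then obtain j k where j: "j \<in> J" "nrm A (x \<ominus> j) < qn x + e / 2" and k: "k \<in> J" "nrm A (y \<ominus> k) < qn y + e / 2"
    using qn_approx[of x "e/2"] qn_approx[of y "e/2"] assms by auto
  have "qn (x \<oplus> y) \<le> nrm A ((x \<oplus> y) \<ominus> (j \<oplus> k))" using assms j k by (intro qn_le) (auto simp: J_add)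
  also have "\<dots> \<le> nrm A (x \<ominus> j) + nrm A (y \<ominus> k)"
    using assms j k nrm_triangle[of "x \<ominus> j" "y \<ominus> k"] by (simp add: add_diff_add J_carrier)
  finally show "qn (x \<oplus> y) \<le> qn x + qn y + e" using j k by simp
qed

text \<open>The product \<open>(x - j) (y - k)\<close> differs from \<open>x y\<close> by the
  element \<open>x k + j (y - k)\<close> of \<open>J\<close>.\<close>

lemma qn_mult:
  assumes "x \<in> carrier A" "y \<in> carrier A"
  shows "qn (x \<otimes> y) \<le> qn x * qn y"
proof -
  have *: "qn (x \<otimes> y) \<le> (qn x + e) * (qn y + e)" if e: "e > 0" for e
  proof -
    obtain j k where j: "j \<in> J" "nrm A (x \<ominus> j) < qn x + e" and k: "k \<in> J" "nrm A (y \<ominus> k) < qn y + e"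
      using qn_approx[of x e] qn_approx[of y e] assms e by auto
    have c: "j \<in> carrier A" "k \<in> carrier A" using j k J_carrier by auto
    have "x \<otimes> k \<oplus> j \<otimes> (y \<ominus> k) \<in> J"
      using assms j k c by (intro J_add J_mult_l J_mult_r) auto
    then have "qn (x \<otimes> y) \<le> nrm A (x \<otimes> y \<ominus> (x \<otimes> k \<oplus> j \<otimes> (y \<ominus> k)))"
      using assms by (intro qn_le) auto
    also have "x \<otimes> y \<ominus> (x \<otimes> k \<oplus> j \<otimes> (y \<ominus> k)) = (x \<ominus> j) \<otimes> (y \<ominus> k)"
      using assms c by (simp add: alg_simps)
    also have "nrm A \<dots> \<le> nrm A (x \<ominus> j) * nrm A (y \<ominus> k)" using assms c by (intro nrm_mult) auto
    also have "\<dots> \<le> (qn x + e) * (qn y + e)"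
      using j k assms c qn_nonneg[of x] e by (intro mult_mono) (auto simp: nrm_nonneg)
    finally show ?thesis .
  qed
  have "((\<lambda>e. (qn x + e) * (qn y + e)) \<longlongrightarrow> (qn x + 0) * (qn y + 0)) (at_right 0)"
    by (intro tendsto_intros)
  then have "qn (x \<otimes> y) \<le> (qn x + 0) * (qn y + 0)"
    by (rule tendsto_lowerbound) (auto simp: eventually_at_right_less * intro!: eventually_at_rightI[of 0 1])
  then show ?thesis by simp
qed

lemma qn_J: "j \<in> J \<Longrightarrow> qn j = 0"
  using qn_le[of j j] qn_nonneg[of j] by (simp add: J_carrier)

lemma qn_zero_imp: "x \<in> carrier A \<Longrightarrow> qn x \<le> 0 \<Longrightarrow> x \<in> J"
  using qn_approx[of x] by (intro J_closed) force+

lemma qn_cong: "cg x y \<Longrightarrow> qn x = qn y"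
proof -
  have le: "qn x \<le> qn y" if "cg x y" for x y
    using qn_add[of "x \<ominus> y" y] qn_J[of "x \<ominus> y"] cgD[OF that] by (simp add: diff_add_cancel)
  assume "cg x y"
  then show ?thesis using le cg_sym by (metis antisym)
qed

lemma qn_smult:
  assumes x: "x \<in> carrier A"
  shows "qn (c \<odot> x) \<le> cmod c * qn x"
proof -
  have "qn (c \<odot> x) \<le> cmod c * qn x + cmod c * e" if e: "e > 0" for e
  proof -
    obtain j where j: "j \<in> J" "nrm A (x \<ominus> j) < qn x + e" using qn_approx[of x e] x e by auto
    have "qn (c \<odot> x) \<le> nrm A (c \<odot> x \<ominus> c \<odot> j)" using x j by (intro qn_le J_smult) auto
    also have "\<dots> = cmod c * nrm A (x \<ominus> j)" using x j J_carrier by (simp add: sm_diff[symmetric] nrm_smult)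
    also have "\<dots> \<le> cmod c * (qn x + e)" using j by (intro mult_left_mono) auto
    finally show ?thesis by (simp add: algebra_simps)
  qed
  moreover have "((\<lambda>e. cmod c * qn x + cmod c * e) \<longlongrightarrow> cmod c * qn x + cmod c * 0) (at_right 0)"
    by (intro tendsto_intros)
  ultimately have "qn (c \<odot> x) \<le> cmod c * qn x + cmod c * 0"
    by (intro tendsto_lowerbound[of "\<lambda>e. cmod c * qn x + cmod c * e"])
      (auto simp: eventually_at_right_less intro!: eventually_at_rightI[of 0 1])
  then show ?thesis by simp
qed

lemma qn_diff: "x \<in> carrier A \<Longrightarrow> y \<in> carrier A \<Longrightarrow> qn (x \<ominus> y) \<le> qn x + qn y"
  using qn_add[of x "(-1) \<odot> y"] qn_smult[of y "-1"] by (simp add: diff_eq)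

lemma qn_diff_commute: "x \<in> carrier A \<Longrightarrow> y \<in> carrier A \<Longrightarrow> qn (x \<ominus> y) = qn (y \<ominus> x)"
proof -
  have le: "qn (x \<ominus> y) \<le> qn (y \<ominus> x)" if "x \<in> carrier A" "y \<in> carrier A" for x y
  proof -
    have "x \<ominus> y = (-1) \<odot> (y \<ominus> x)" using that by (simp add: lin_simps)
    then show ?thesis using qn_smult[of "y \<ominus> x" "-1"] that by simp
  qed
  assume "x \<in> carrier A" "y \<in> carrier A"
  then show ?thesis using le by (simp add: antisym)
qed

lemma qn_triangle: "x \<in> carrier A \<Longrightarrow> y \<in> carrier A \<Longrightarrow> z \<in> carrier A \<Longrightarrow>
    qn (x \<ominus> z) \<le> qn (x \<ominus> y) + qn (y \<ominus> z)"
  using qn_add[of "x \<ominus> y" "y \<ominus> z"] by (simp add: diff_telescope)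

lemma qn_le_diff: "x \<in> carrier A \<Longrightarrow> y \<in> carrier A \<Longrightarrow> qn x \<le> qn (x \<ominus> y) + qn y"
  using qn_add[of "x \<ominus> y" y] by (simp add: diff_add_cancel)

lemma qn_finsum_le:
  assumes "finite I" "f \<in> I \<rightarrow> carrier A"
  shows "qn (\<Oplus>i\<in>I. f i) \<le> (\<Sum>i\<in>I. qn (f i))"
  using assms
proof (induction I rule: finite_induct)
  case (insert i I)
  then have *: "f i \<in> carrier A" "f \<in> I \<rightarrow> carrier A" by auto
  have "qn (\<Oplus>i\<in>insert i I. f i) \<le> qn (f i) + qn (\<Oplus>i\<in>I. f i)"
    using insert * by (simp add: qn_add finsum_closed)
  then show ?case using insert * by simp
qed (simp add: qn_J)

text \<open>Completeness of the quotient, stated without forming it: correct the terms by elements of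
  \<open>J\<close> so that the series of differences converges absolutely in \<open>A\<close>.\<close>

lemma qn_geometric_limit:
  assumes q: "0 < q" "q < 1" and x: "\<And>k. x k \<in> carrier A"
    and step: "\<And>k. qn (x (Suc k) \<ominus> x k) \<le> K * q ^ k"
  shows "\<exists>l\<in>carrier A. \<exists>K'. \<forall>k. qn (x k \<ominus> l) \<le> K' * q ^ k"
proof -
  have "\<forall>k. \<exists>j\<in>J. nrm A (x (Suc k) \<ominus> x k \<ominus> j) \<le> (K + 1) * q ^ k"
  proof
    fix k
    obtain j where "j \<in> J" "nrm A (x (Suc k) \<ominus> x k \<ominus> j) < qn (x (Suc k) \<ominus> x k) + q ^ k"
      using qn_approx[of "x (Suc k) \<ominus> x k" "q ^ k"] x q by auto
    then show "\<exists>j\<in>J. nrm A (x (Suc k) \<ominus> x k \<ominus> j) \<le> (K + 1) * q ^ k"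
      using step[of k] by (intro bexI[of _ j]) (auto simp: algebra_simps)
  qed
  then obtain j where j: "\<And>k. j k \<in> J" "\<And>k. nrm A (x (Suc k) \<ominus> x k \<ominus> j k) \<le> (K + 1) * q ^ k" by metis
  have jc [simp]: "j k \<in> carrier A" for k using j(1) J_carrier by simp
  define y where "y k = x k \<ominus> (\<Oplus>i\<in>{..<k}. j i)" for k
  have sc [simp]: "(\<Oplus>i\<in>{..<k}. j i) \<in> carrier A" for k by (intro finsum_closed) auto
  have yc [simp]: "y k \<in> carrier A" for k using x by (simp add: y_def)
  have "y (Suc k) \<ominus> y k = x (Suc k) \<ominus> x k \<ominus> j k" for k
  proof -
    have "(\<Oplus>i\<in>{..<Suc k}. j i) = j k \<oplus> (\<Oplus>i\<in>{..<k}. j i)"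
      by (subst lessThan_Suc) (rule finsum_insert, auto)
    then show ?thesis using x by (simp add: y_def lin_simps)
  qed
  then have "nrm A (y (Suc k) \<ominus> y k) \<le> (K + 1) * q ^ k" for k using j(2) by simp
  from geometric_Cauchy_limit[OF _ q(2) yc this] q
  obtain l where l: "l \<in> carrier A" "\<And>k. nrm A (y k \<ominus> l) \<le> (K + 1) / (1 - q) * q ^ k" by auto
  have "qn (x k \<ominus> l) \<le> (K + 1) / (1 - q) * q ^ k" for k
  proof -
    have "cg (x k) (y k)"
      unfolding cg_def y_def using x j(1) J_finsum[of "{..<k}" j] by (simp add: lin_simps)
    then have "qn (x k \<ominus> l) = qn (y k \<ominus> l)" using l by (intro qn_cong cg_diff cg_refl)
    also have "\<dots> \<le> nrm A (y k \<ominus> l)" using l by (intro qn_le_nrm) auto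
    finally show ?thesis using l(2)[of k] by simp
  qed
  then show ?thesis using l(1) by blast
qed

end

locale star_ideal = cstar_ideal +
  assumes J_invol: "x \<in> J \<Longrightarrow> invol A x \<in> J"
begin

lemma cg_invol: "cg x y \<Longrightarrow> cg (invol A x) (invol A y)"
  using J_invol[of "x \<ominus> y"] by (simp add: cg_def invol_diff)

lemma qn_invol:
  assumes "x \<in> carrier A"
  shows "qn (invol A x) = qn x"
proof -
  have le: "qn (invol A x) \<le> qn x" if x: "x \<in> carrier A" for x
  proof (rule field_le_epsilon)
    fix e :: real assume "e > 0"
    then obtain j where j: "j \<in> J" "nrm A (x \<ominus> j) < qn x + e" using qn_approx x by blast
    have "qn (invol A x) \<le> nrm A (invol A x \<ominus> invol A j)" using x j by (intro qn_le J_invol) auto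
    also have "\<dots> = nrm A (x \<ominus> j)" using x j J_carrier by (simp add: invol_diff[symmetric] nrm_invol)
    finally show "qn (invol A x) \<le> qn x + e" using j by simp
  qed
  show ?thesis using le[OF assms] le[of "invol A x"] assms by (simp add: invol_invol)
qed

end

lemma (in cstar_ideal) cg_automorphism:
  assumes "G_algebra A \<gamma>" "\<And>c. c \<in> J \<Longrightarrow> \<gamma> g c \<in> J" "cg x y"
  shows "cg (\<gamma> g x) (\<gamma> g y)"
  using assms(2)[of "x \<ominus> y"] assms(3) G_algebraD(4)[OF assms(1)]
    star_hom_diff[OF cstar_algebra_axioms cstar_algebra_axioms G_algebraD(3)[OF assms(1)]]
  by (simp add: cg_def)

lemma (in cstar_algebra) eq_if_le_geometric:
  assumes "0 \<le> q" "q < 1" "x \<in> carrier A" "y \<in> carrier A" "\<And>k. nrm A (x \<ominus> y) \<le> K * q ^ k"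
  shows "x = y"
proof -
  have "nrm A (x \<ominus> y) = 0"
    using nonpos_if_le_geometric[OF assms(1,2,5)] nrm_nonneg[of "x \<ominus> y"] assms(3,4) by simp
  then show ?thesis using assms(3,4) by (simp add: nrm_eq_0_iff)
qed

lemma (in cstar_basis) clinear_map_expand:
  assumes C: "cstar_algebra C" and h: "clinear_map A C h" and x: "x \<in> carrier A"
  shows "h x = (\<Oplus>\<^bsub>C\<^esub>i\<in>{..<N}. co i x \<odot>\<^bsub>C\<^esub> h (e i))"
proof -
  interpret C: cstar_algebra C by fact
  have "h x = h (\<Oplus>i\<in>{..<N}. co i x \<odot> e i)" by (rule arg_cong[OF expand[OF x]])
  also have "\<dots> = (\<Oplus>\<^bsub>C\<^esub>i\<in>{..<N}. h (co i x \<odot> e i))"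
    by (intro clinear_map_finsum[OF cstar_algebra_axioms C h]) auto
  also have "\<dots> = (\<Oplus>\<^bsub>C\<^esub>i\<in>{..<N}. co i x \<odot>\<^bsub>C\<^esub> h (e i))"
    by (intro C.finsum_eqI) (auto simp: clinear_mapD[OF h])
  finally show ?thesis .
qed

lemma (in cstar_basis) linear_comb:
  assumes C: "cstar_algebra C" and y: "\<And>i. i < N \<Longrightarrow> y i \<in> carrier C"
  shows "clinear_map A C (\<lambda>x. \<Oplus>\<^bsub>C\<^esub>i\<in>{..<N}. co i x \<odot>\<^bsub>C\<^esub> y i)"
proof -
  interpret C: cstar_algebra C by fact
  show ?thesis
  proof (rule clinear_mapI)
    fix x x' assume x: "x \<in> carrier A" "x' \<in> carrier A"
    have "(\<Oplus>\<^bsub>C\<^esub>i\<in>{..<N}. co i (x \<oplus> x') \<odot>\<^bsub>C\<^esub> y i) =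
        (\<Oplus>\<^bsub>C\<^esub>i\<in>{..<N}. co i x \<odot>\<^bsub>C\<^esub> y i \<oplus>\<^bsub>C\<^esub> co i x' \<odot>\<^bsub>C\<^esub> y i)"
      using x y by (intro C.finsum_eqI) (auto simp: co_add C.sm_add_l)
    also have "\<dots> = (\<Oplus>\<^bsub>C\<^esub>i\<in>{..<N}. co i x \<odot>\<^bsub>C\<^esub> y i) \<oplus>\<^bsub>C\<^esub> (\<Oplus>\<^bsub>C\<^esub>i\<in>{..<N}. co i x' \<odot>\<^bsub>C\<^esub> y i)"
      using y by (intro C.finsum_addf) auto
    finally show "(\<Oplus>\<^bsub>C\<^esub>i\<in>{..<N}. co i (x \<oplus> x') \<odot>\<^bsub>C\<^esub> y i) =
      (\<Oplus>\<^bsub>C\<^esub>i\<in>{..<N}. co i x \<odot>\<^bsub>C\<^esub> y i) \<oplus>\<^bsub>C\<^esub> (\<Oplus>\<^bsub>C\<^esub>i\<in>{..<N}. co i x' \<odot>\<^bsub>C\<^esub> y i)" .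
  next
    fix x c assume x: "x \<in> carrier A"
    show "(\<Oplus>\<^bsub>C\<^esub>i\<in>{..<N}. co i (c \<odot> x) \<odot>\<^bsub>C\<^esub> y i) = c \<odot>\<^bsub>C\<^esub> (\<Oplus>\<^bsub>C\<^esub>i\<in>{..<N}. co i x \<odot>\<^bsub>C\<^esub> y i)"
      using x y by (subst C.sm_finsum) (auto simp: co_smult C.sm_assoc intro!: C.finsum_eqI)
  qed (use y in \<open>auto intro!: C.finsum_closed\<close>)
qed

lemma (in cstar_ideal) cg_additive_finsum:
  assumes B: "cstar_algebra B" and closed: "\<And>x. x \<in> carrier B \<Longrightarrow> s x \<in> carrier A"
    and add: "\<And>x y. x \<in> carrier B \<Longrightarrow> y \<in> carrier B \<Longrightarrow> cg (s (x \<oplus>\<^bsub>B\<^esub> y)) (s x \<oplus> s y)"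
    and smult: "\<And>x c. x \<in> carrier B \<Longrightarrow> cg (s (c \<odot>\<^bsub>B\<^esub> x)) (c \<odot> s x)"
    and I: "finite I" "f \<in> I \<rightarrow> carrier B"
  shows "cg (s (\<Oplus>\<^bsub>B\<^esub>i\<in>I. f i)) (\<Oplus>i\<in>I. s (f i))"
proof -
  interpret B: cstar_algebra B by fact
  show ?thesis
    using I
  proof (induction I rule: finite_induct)
    case empty
    then show ?case using smult[of "\<zero>\<^bsub>B\<^esub>" 0] closed[of "\<zero>\<^bsub>B\<^esub>"] by simp
  next
    case (insert i I)
    then have *: "f i \<in> carrier B" "f \<in> I \<rightarrow> carrier B" "(\<lambda>i. s (f i)) \<in> I \<rightarrow> carrier A" "s (f i) \<in> carrier A"
      using closed by auto
    have "cg (s (f i \<oplus>\<^bsub>B\<^esub> (\<Oplus>\<^bsub>B\<^esub>i\<in>I. f i))) (s (f i) \<oplus> s (\<Oplus>\<^bsub>B\<^esub>i\<in>I. f i))"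
      using * by (intro add B.finsum_closed)
    also have "cg (s (f i) \<oplus> s (\<Oplus>\<^bsub>B\<^esub>i\<in>I. f i)) (s (f i) \<oplus> (\<Oplus>i\<in>I. s (f i)))"
      using insert * by (intro cg_add cg_refl) auto
    finally show ?case using insert * by simp
  qed
qed

text \<open>A map that is linear modulo \<open>J\<close> is determined modulo \<open>J\<close> by
  its values on a basis, and these values extend to an exactly linear map.\<close>

lemma (in cstar_basis) linearize_mod:
  assumes C: "cstar_ideal C J" and closed: "\<And>x. x \<in> carrier A \<Longrightarrow> s x \<in> carrier C"
    and add: "\<And>x y. x \<in> carrier A \<Longrightarrow> y \<in> carrier A \<Longrightarrow> cstar_ideal.cg C J (s (x \<oplus> y)) (s x \<oplus>\<^bsub>C\<^esub> s y)"
    and smult: "\<And>x c. x \<in> carrier A \<Longrightarrow> cstar_ideal.cg C J (s (c \<odot> x)) (c \<odot>\<^bsub>C\<^esub> s x)"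
  shows "\<exists>h. clinear_map A C h \<and> (\<forall>x\<in>carrier A. cstar_ideal.cg C J (h x) (s x))"
proof -
  interpret C: cstar_ideal C J by fact
  have "C.cg (\<Oplus>\<^bsub>C\<^esub>i\<in>{..<N}. co i x \<odot>\<^bsub>C\<^esub> s (e i)) (s x)" if x: "x \<in> carrier A" for x
  proof -
    have "C.cg (\<Oplus>\<^bsub>C\<^esub>i\<in>{..<N}. co i x \<odot>\<^bsub>C\<^esub> s (e i)) (\<Oplus>\<^bsub>C\<^esub>i\<in>{..<N}. s (co i x \<odot> e i))"
      by (intro C.cg_finsum C.cg_sym[OF smult]) auto
    also have "C.cg \<dots> (s (\<Oplus>i\<in>{..<N}. co i x \<odot> e i))"
      by (intro C.cg_sym[OF C.cg_additive_finsum[OF cstar_algebra_axioms closed add smult]]) auto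
    also have "s (\<Oplus>i\<in>{..<N}. co i x \<odot> e i) = s x" by (rule arg_cong[OF expand[OF x, symmetric]])
    finally show ?thesis .
  qed
  moreover have "clinear_map A C (\<lambda>x. \<Oplus>\<^bsub>C\<^esub>i\<in>{..<N}. co i x \<odot>\<^bsub>C\<^esub> s (e i))"
    by (rule linear_comb[OF C.cstar_algebra_axioms]) (simp add: closed)
  ultimately show ?thesis by blast
qed

text \<open>The constant depends on the basis alone and serves all \<open>C\<close> and
  \<open>h\<close>. This uniformity is used in \<open>translate_continuous\<close>, where the linear
  map varies with the group element.\<close>

lemma (in dual_basis) linear_estimate:
  "\<exists>K\<ge>0. \<forall>(C :: 'c cstar) h x. cstar_algebra C \<longrightarrow> clinear_map A C h \<longrightarrow> x \<in> carrier A \<longrightarrow>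
     nrm C (h x) \<le> K * nrm A x * (\<Sum>i<N. nrm C (h (e i)))"
proof -
  obtain K where K: "K \<ge> 0" "\<forall>x\<in>carrier A. \<forall>i<N. cmod (co i x) \<le> K * nrm A x" using co_bound by blast
  have "nrm C (h x) \<le> K * nrm A x * (\<Sum>i<N. nrm C (h (e i)))"
    if C: "cstar_algebra C" and h: "clinear_map A C h" and x: "x \<in> carrier A" for C :: "'c cstar" and h x
  proof -
    interpret C: cstar_algebra C by fact
    have "nrm C (h x) \<le> (\<Sum>i<N. nrm C (co i x \<odot>\<^bsub>C\<^esub> h (e i)))"
      unfolding clinear_map_expand[OF C h x] by (rule C.nrm_finsum_le) (auto simp: clinear_mapD[OF h])
    also have "\<dots> \<le> (\<Sum>i<N. K * nrm A x * nrm C (h (e i)))"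
      using K(2) x by (intro sum_mono) (auto simp: C.nrm_smult C.nrm_nonneg clinear_mapD[OF h] intro!: mult_right_mono)
    finally show ?thesis by (simp add: sum_distrib_left)
  qed
  then show ?thesis using K(1) by blast
qed

lemma clinear_map_sub:
  assumes "cstar_algebra A" "cstar_algebra B" "clinear_map A B f" "clinear_map A B h"
  shows "clinear_map A B (\<lambda>x. f x \<ominus>\<^bsub>B\<^esub> h x)"
proof -
  interpret A: cstar_algebra A by fact
  interpret B: cstar_algebra B by fact
  show ?thesis
    by (rule clinear_mapI) (simp_all add: clinear_mapD[OF assms(3)] clinear_mapD[OF assms(4)] B.add_diff_add B.sm_diff)
qed

section \<open>Equivariant linear lifts\<close>

locale equivariant_lifting =
  F: unital_cstar_algebra F + F: dual_basis F N e co b + C: cstar_ideal C J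
  for F :: "'f cstar" and N e co b and C :: "'c cstar" and J +
  fixes \<beta> :: "'g::topological_group_add \<Rightarrow> 'f \<Rightarrow> 'f" and \<gamma> :: "'g \<Rightarrow> 'c \<Rightarrow> 'c" and s :: "'f \<Rightarrow> 'c"
  assumes compact_group: "compact (UNIV :: 'g set)"
    and \<beta>: "G_algebra F \<beta>" and \<gamma>: "G_algebra C \<gamma>"
    and J_invariant: "c \<in> J \<Longrightarrow> \<gamma> g c \<in> J"
    and s_closed: "x \<in> carrier F \<Longrightarrow> s x \<in> carrier C"
    and s_equivariant: "x \<in> carrier F \<Longrightarrow> C.cg (s (\<beta> g x)) (\<gamma> g (s x))"
begin

lemmas \<beta>D [simp] = G_algebraD(4-8)[OF \<beta>] and \<gamma>D [simp] = G_algebraD(4-8)[OF \<gamma>]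

lemma F_cstar: "cstar_algebra F" and C_cstar: "cstar_algebra C"
  by unfold_locales

lemma \<beta>_isometric [simp]: "x \<in> carrier F \<Longrightarrow> nrm F (\<beta> g x) = nrm F x"
  by (rule G_algebra_isometric[OF F.unital_cstar_algebra_axioms \<beta>])

lemma \<gamma>_isometric [simp]: "x \<in> carrier C \<Longrightarrow> nrm C (\<gamma> g x) = nrm C x"
  by (rule G_algebra_isometric[OF C.unital_cstar_algebra_axioms \<gamma>])

lemma \<gamma>_linear: "clinear_map C C (\<gamma> g)"
  by (rule star_hom_linear[OF G_algebraD(3)[OF \<gamma>]])

lemma \<beta>_linear: "clinear_map F F (\<beta> g)"
  by (rule star_hom_linear[OF G_algebraD(3)[OF \<beta>]])

lemma \<gamma>_diff: "x \<in> carrier C \<Longrightarrow> y \<in> carrier C \<Longrightarrow> \<gamma> g (x \<ominus>\<^bsub>C\<^esub> y) = \<gamma> g x \<ominus>\<^bsub>C\<^esub> \<gamma> g y"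
  by (rule clinear_map_diff[OF C_cstar C_cstar \<gamma>_linear])

lemma cg_\<gamma>: "C.cg x y \<Longrightarrow> C.cg (\<gamma> g x) (\<gamma> g y)"
  by (rule C.cg_automorphism[OF \<gamma> J_invariant])

text \<open>Extensional functions, because \<open>convex_group_action\<close> asks for the action
  laws as equations between points.\<close>

definition lifts :: "('f \<Rightarrow> 'c) set" where
  "lifts = {h \<in> extensional (carrier F). clinear_map F C h \<and> (\<forall>x\<in>carrier F. C.cg (h x) (s x))}"

text \<open>Operator norm distance; the supremum is finite because linear maps out of
  \<open>F\<close> are bounded (\<open>dist_lift_bdd\<close>).\<close>

definition dist_lift :: "('f \<Rightarrow> 'c) \<Rightarrow> ('f \<Rightarrow> 'c) \<Rightarrow> real" where
  "dist_lift h k = (SUP x\<in>{x \<in> carrier F. nrm F x \<le> 1}. nrm C (h x \<ominus>\<^bsub>C\<^esub> k x))"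

text \<open>The conjugation action on maps, whose fixed points are the equivariant maps.\<close>

definition translate :: "'g \<Rightarrow> ('f \<Rightarrow> 'c) \<Rightarrow> 'f \<Rightarrow> 'c" where
  "translate g h = (\<lambda>x\<in>carrier F. \<gamma> g (h (\<beta> (- g) x)))"

definition mix :: "real \<Rightarrow> ('f \<Rightarrow> 'c) \<Rightarrow> ('f \<Rightarrow> 'c) \<Rightarrow> 'f \<Rightarrow> 'c" where
  "mix t h k = (\<lambda>x\<in>carrier F. complex_of_real t \<odot>\<^bsub>C\<^esub> h x \<oplus>\<^bsub>C\<^esub> complex_of_real (1 - t) \<odot>\<^bsub>C\<^esub> k x)"

lemma liftsD:
  assumes "h \<in> lifts"
  shows "clinear_map F C h" "x \<in> carrier F \<Longrightarrow> h x \<in> carrier C" "x \<in> carrier F \<Longrightarrow> C.cg (h x) (s x)"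
    "h \<in> extensional (carrier F)"
  using assms by (auto simp: lifts_def dest: clinear_mapD(1))

lemma linear_bounded: "clinear_map F C h \<Longrightarrow> \<exists>M\<ge>0. \<forall>x\<in>carrier F. nrm C (h x) \<le> M * nrm F x"
proof -
  assume h: "clinear_map F C h"
  obtain K where K: "K \<ge> 0" "\<forall>x\<in>carrier F. nrm C (h x) \<le> K * nrm F x * (\<Sum>i<N. nrm C (h (e i)))"
    using F.linear_estimate[where 'c = 'c] h C_cstar by blast
  have "(\<Sum>i<N. nrm C (h (e i))) \<ge> 0" by (intro sum_nonneg C.nrm_nonneg clinear_mapD[OF h]) auto
  then show ?thesis using K by (intro exI[of _ "K * (\<Sum>i<N. nrm C (h (e i)))"]) (auto simp: mult_ac)
qed

lemma dist_lift_bdd: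
  assumes "h \<in> lifts" "k \<in> lifts"
  shows "bdd_above ((\<lambda>x. nrm C (h x \<ominus>\<^bsub>C\<^esub> k x)) ` {x \<in> carrier F. nrm F x \<le> 1})"
proof -
  obtain M where M: "M \<ge> 0" "\<forall>x\<in>carrier F. nrm C (h x \<ominus>\<^bsub>C\<^esub> k x) \<le> M * nrm F x"
    using linear_bounded[OF clinear_map_sub[OF F_cstar C_cstar liftsD(1)[OF assms(1)] liftsD(1)[OF assms(2)]]] by blast
  show ?thesis
  proof (rule bdd_aboveI2[of _ _ M])
    fix x assume x: "x \<in> {x \<in> carrier F. nrm F x \<le> 1}"
    then have "M * nrm F x \<le> M * 1" using M(1) by (intro mult_left_mono) auto
    then show "nrm C (h x \<ominus>\<^bsub>C\<^esub> k x) \<le> M" using M(2) x by force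
  qed
qed

lemma dist_liftI:
  assumes "\<And>x. x \<in> carrier F \<Longrightarrow> nrm F x \<le> 1 \<Longrightarrow> nrm C (h x \<ominus>\<^bsub>C\<^esub> k x) \<le> r"
  shows "dist_lift h k \<le> r"
  unfolding dist_lift_def by (rule cSUP_least) (use assms F.nrm_zero in \<open>auto intro!: exI[of _ "\<zero>\<^bsub>F\<^esub>"]\<close>)

lemma dist_liftD1:
  assumes "h \<in> lifts" "k \<in> lifts" "x \<in> carrier F" "nrm F x \<le> 1"
  shows "nrm C (h x \<ominus>\<^bsub>C\<^esub> k x) \<le> dist_lift h k"
  unfolding dist_lift_def by (rule cSUP_upper[OF _ dist_lift_bdd]) (use assms in auto)

lemma dist_lift_nonneg: "h \<in> lifts \<Longrightarrow> k \<in> lifts \<Longrightarrow> 0 \<le> dist_lift h k"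
  using dist_liftD1[of h k "\<zero>\<^bsub>F\<^esub>"] C.nrm_nonneg[of "h \<zero>\<^bsub>F\<^esub> \<ominus>\<^bsub>C\<^esub> k \<zero>\<^bsub>F\<^esub>"]
  by (simp add: liftsD)

lemma dist_liftD:
  assumes h: "h \<in> lifts" "k \<in> lifts" and x: "x \<in> carrier F"
  shows "nrm C (h x \<ominus>\<^bsub>C\<^esub> k x) \<le> dist_lift h k * nrm F x"
proof (cases "nrm F x = 0")
  case True
  then have "x = \<zero>\<^bsub>F\<^esub>" using x by (simp add: F.nrm_eq_0_iff)
  then show ?thesis
    using clinear_map_zero[OF F_cstar C_cstar liftsD(1)[OF h(1)]]
      clinear_map_zero[OF F_cstar C_cstar liftsD(1)[OF h(2)]] by simp
next
  case False
  then have pos: "nrm F x > 0" using F.nrm_nonneg[OF x] by simp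
  define c where "c = complex_of_real (1 / nrm F x)"
  have c: "cmod c = 1 / nrm F x" using pos by (simp add: c_def norm_divide)
  have "nrm C (h (c \<odot>\<^bsub>F\<^esub> x) \<ominus>\<^bsub>C\<^esub> k (c \<odot>\<^bsub>F\<^esub> x)) \<le> dist_lift h k"
    using x pos by (intro dist_liftD1 h) (auto simp: F.nrm_smult c)
  also have "h (c \<odot>\<^bsub>F\<^esub> x) \<ominus>\<^bsub>C\<^esub> k (c \<odot>\<^bsub>F\<^esub> x) = c \<odot>\<^bsub>C\<^esub> (h x \<ominus>\<^bsub>C\<^esub> k x)"
    using x h by (simp add: clinear_mapD(3)[OF liftsD(1)] liftsD C.sm_diff)
  also have "nrm C \<dots> = nrm C (h x \<ominus>\<^bsub>C\<^esub> k x) / nrm F x"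
    using x h by (subst C.nrm_smult) (auto simp: liftsD c)
  finally show ?thesis using pos by (simp add: pos_divide_le_eq)
qed

lemma translate_apply [simp]: "x \<in> carrier F \<Longrightarrow> translate g h x = \<gamma> g (h (\<beta> (- g) x))"
  by (simp add: translate_def)

lemma mix_apply [simp]: "x \<in> carrier F \<Longrightarrow>
    mix t h k x = complex_of_real t \<odot>\<^bsub>C\<^esub> h x \<oplus>\<^bsub>C\<^esub> complex_of_real (1 - t) \<odot>\<^bsub>C\<^esub> k x"
  by (simp add: mix_def)

lemma translate_closed:
  assumes h: "h \<in> lifts"
  shows "translate g h \<in> lifts"
proof -
  have "clinear_map F C (translate g h)"
    by (rule clinear_mapI)
      (simp_all add: h liftsD clinear_mapD[OF liftsD(1)[OF h]] clinear_mapD[OF \<gamma>_linear] clinear_mapD[OF \<beta>_linear])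
  moreover have "C.cg (translate g h x) (s x)" if x: "x \<in> carrier F" for x
  proof -
    have "C.cg (translate g h x) (\<gamma> g (s (\<beta> (- g) x)))"
      using x h by (simp add: cg_\<gamma> liftsD)
    also have "C.cg (\<gamma> g (s (\<beta> (- g) x))) (s (\<beta> g (\<beta> (- g) x)))"
      using x by (intro C.cg_sym[OF s_equivariant]) simp
    finally show ?thesis using x by simp
  qed
  ultimately show ?thesis by (simp add: lifts_def) (simp add: translate_def)
qed

lemma mix_closed:
  assumes h: "h \<in> lifts" "k \<in> lifts"
  shows "mix t h k \<in> lifts"
proof -
  have "clinear_map F C (mix t h k)"
    by (rule clinear_mapI)
      (simp_all add: h liftsD clinear_mapD[OF liftsD(1)[OF h(1)]] clinear_mapD[OF liftsD(1)[OF h(2)]]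
        C.lin_simps mult.commute)
  moreover have "C.cg (mix t h k x) (s x)" if x: "x \<in> carrier F" for x
  proof -
    have "C.cg (mix t h k x) (complex_of_real t \<odot>\<^bsub>C\<^esub> s x \<oplus>\<^bsub>C\<^esub> complex_of_real (1 - t) \<odot>\<^bsub>C\<^esub> s x)"
      using x h by (simp only: mix_apply) (intro C.cg_add C.cg_smult liftsD)
    also have "complex_of_real t \<odot>\<^bsub>C\<^esub> s x \<oplus>\<^bsub>C\<^esub> complex_of_real (1 - t) \<odot>\<^bsub>C\<^esub> s x = s x"
      using s_closed[OF x] by (simp flip: C.sm_add_l)
    finally show ?thesis .
  qed
  ultimately show ?thesis by (simp add: lifts_def) (simp add: mix_def)
qed

text \<open>With \<open>x = \<beta> u y\<close> the difference to be estimated is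
  \<open>\<gamma> u (h y) - h (\<beta> u y)\<close>. It is linear in \<open>y\<close> and small on
  the finitely many basis vectors when \<open>u\<close> is near the identity;
  \<open>linear_estimate\<close> spreads this over the unit ball.\<close>

lemma translate_continuous:
  assumes h: "h \<in> lifts" and eps: "0 < \<epsilon>"
  shows "\<exists>U. open U \<and> 0 \<in> U \<and> (\<forall>u\<in>U. dist_lift (translate u h) h < \<epsilon>)"
proof -
  obtain K where K: "K \<ge> 0"
    "\<And>h x. clinear_map F C h \<Longrightarrow> x \<in> carrier F \<Longrightarrow> nrm C (h x) \<le> K * nrm F x * (\<Sum>i<N. nrm C (h (e i)))"
    using F.linear_estimate[where 'c = 'c] C_cstar by blast
  obtain M where M: "M \<ge> 0" "\<And>x. x \<in> carrier F \<Longrightarrow> nrm C (h x) \<le> M * nrm F x"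
    using linear_bounded[OF liftsD(1)[OF h]] by blast
  \<comment> \<open>Chosen so that \<open>(K + 1) * (N + 1) * (M + 1) * \<eta>\<close> equals
    \<open>\<epsilon> / 2\<close>; the added ones keep the denominator positive.\<close>
  define \<eta> where "\<eta> = \<epsilon> / (2 * (K + 1) * (real N + 1) * (M + 1))"
  have \<eta>: "\<eta> > 0" using K(1) M(1) eps by (auto simp: \<eta>_def intro!: divide_pos_pos mult_pos_pos)
  have "\<exists>U. open U \<and> 0 \<in> U \<and> (\<forall>u\<in>U. nrm C (\<gamma> u (h (e i)) \<ominus>\<^bsub>C\<^esub> h (e i)) < \<eta>)" if "i < N" for i
    using G_algebraD(9)[OF \<gamma>, of "h (e i)"] that h \<eta> unfolding C.continuous_map_iff
    by (auto simp: liftsD dest!: spec[of _ 0] spec[of _ \<eta>])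
  then obtain U where U: "\<And>i. i < N \<Longrightarrow> open (U i) \<and> 0 \<in> U i \<and> (\<forall>u\<in>U i. nrm C (\<gamma> u (h (e i)) \<ominus>\<^bsub>C\<^esub> h (e i)) < \<eta>)"
    by metis
  have "\<exists>U. open U \<and> 0 \<in> U \<and> (\<forall>u\<in>U. nrm F (\<beta> u (e i) \<ominus>\<^bsub>F\<^esub> e i) < \<eta>)" if "i < N" for i
    using G_algebraD(9)[OF \<beta>, of "e i"] that \<eta> unfolding F.continuous_map_iff
    by (auto dest!: spec[of _ 0] spec[of _ \<eta>])
  then obtain V where V: "\<And>i. i < N \<Longrightarrow> open (V i) \<and> 0 \<in> V i \<and> (\<forall>u\<in>V i. nrm F (\<beta> u (e i) \<ominus>\<^bsub>F\<^esub> e i) < \<eta>)"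
    by metis
  define W where "W = (\<Inter>i\<in>{..<N}. U i \<inter> V i)"
  have "open W" unfolding W_def using U V by (intro open_INT ballI open_Int) auto
  moreover have "0 \<in> W" using U V by (auto simp: W_def)
  moreover have "dist_lift (translate u h) h < \<epsilon>" if u: "u \<in> W" for u
  proof -
    have lin: "clinear_map F C (\<lambda>y. \<gamma> u (h y) \<ominus>\<^bsub>C\<^esub> h (\<beta> u y))"
      by (rule clinear_mapI)
        (simp_all add: h liftsD clinear_mapD[OF liftsD(1)[OF h]] clinear_mapD[OF \<gamma>_linear] clinear_mapD[OF \<beta>_linear]
          C.add_diff_add C.sm_diff)
    have small: "nrm C (\<gamma> u (h (e i)) \<ominus>\<^bsub>C\<^esub> h (\<beta> u (e i))) \<le> (M + 1) * \<eta>" if i: "i < N" for i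
    proof -
      have "nrm C (\<gamma> u (h (e i)) \<ominus>\<^bsub>C\<^esub> h (\<beta> u (e i))) \<le>
          nrm C (\<gamma> u (h (e i)) \<ominus>\<^bsub>C\<^esub> h (e i)) + nrm C (h (e i) \<ominus>\<^bsub>C\<^esub> h (\<beta> u (e i)))"
        using i h by (intro C.nrm_diff_triangle) (auto simp: liftsD)
      also have "nrm C (\<gamma> u (h (e i)) \<ominus>\<^bsub>C\<^esub> h (e i)) \<le> \<eta>" using U[OF i] u i by (auto simp: W_def intro: less_imp_le)
      also have "nrm C (h (e i) \<ominus>\<^bsub>C\<^esub> h (\<beta> u (e i))) = nrm C (h (e i \<ominus>\<^bsub>F\<^esub> \<beta> u (e i)))"
        using i by (simp add: clinear_map_diff[OF F_cstar C_cstar liftsD(1)[OF h]])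
      also have "\<dots> \<le> M * nrm F (e i \<ominus>\<^bsub>F\<^esub> \<beta> u (e i))" using i by (intro M) auto
      also have "\<dots> \<le> M * \<eta>"
        using V[OF i] u i M(1) by (intro mult_left_mono) (auto simp: W_def F.nrm_diff_commute[of "e i"] intro: less_imp_le)
      finally show ?thesis by (simp add: algebra_simps)
    qed
    have "dist_lift (translate u h) h \<le> K * (N * ((M + 1) * \<eta>))"
    proof (rule dist_liftI)
      fix x assume x: "x \<in> carrier F" "nrm F x \<le> 1"
      define y where "y = \<beta> (- u) x"
      have y: "y \<in> carrier F" "nrm F y = nrm F x" "\<beta> u y = x" using x by (auto simp: y_def)
      have "nrm C (translate u h x \<ominus>\<^bsub>C\<^esub> h x) = nrm C (\<gamma> u (h y) \<ominus>\<^bsub>C\<^esub> h (\<beta> u y))"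
        using x y by (simp add: y_def)
      also have "\<dots> \<le> K * nrm F y * (\<Sum>i<N. nrm C (\<gamma> u (h (e i)) \<ominus>\<^bsub>C\<^esub> h (\<beta> u (e i))))"
        by (rule K(2)[OF lin y(1)])
      also have "\<dots> \<le> K * 1 * (\<Sum>i<N. (M + 1) * \<eta>)"
        using K(1) y x small F.nrm_nonneg[OF x(1)] h
        by (intro mult_mono sum_mono sum_nonneg C.nrm_nonneg) (auto simp: liftsD intro: mult_nonneg_nonneg)
      finally show "nrm C (translate u h x \<ominus>\<^bsub>C\<^esub> h x) \<le> K * (N * ((M + 1) * \<eta>))" by simp
    qed
    also have "\<dots> \<le> (K + 1) * ((real N + 1) * ((M + 1) * \<eta>))"
      using K(1) M(1) \<eta> by (intro mult_mono) auto
    also have "\<dots> = \<epsilon> / 2"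
    proof -
      have "p * (q * (r * (\<epsilon> / (2 * p * q * r)))) = \<epsilon> / 2" if "p \<noteq> 0" "q \<noteq> 0" "r \<noteq> 0" for p q r :: real
        using that by simp
      moreover have "K + 1 \<noteq> 0" "real N + 1 \<noteq> 0" "M + 1 \<noteq> 0" using K(1) M(1) by auto
      ultimately show ?thesis unfolding \<eta>_def of_nat_add of_nat_1 by blast
    qed
    finally show ?thesis using eps by simp
  qed
  ultimately show ?thesis by blast
qed

lemma convex_group_action: "convex_group_action lifts dist_lift translate mix"
proof
  show "compact (UNIV :: 'g set)" by (rule compact_group)
next
  fix h g assume "h \<in> lifts"
  then show "translate g h \<in> lifts" by (rule translate_closed)
next
  fix h g g' assume h: "h \<in> lifts"
  \<comment> \<open>Negation reverses a sum in this possibly noncommutative group, which matches the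
    nesting of the two translates.\<close>
  have b: "\<beta> (- (g + g')) x = \<beta> (- g') (\<beta> (- g) x)" if "x \<in> carrier F" for x
    unfolding minus_add using that by (rule \<beta>D(3))
  show "translate (g + g') h = translate g (translate g' h)"
    by (rule extensionalityI[of _ "carrier F"]) (auto simp: translate_def b h liftsD simp del: minus_add)
next
  fix h assume h: "h \<in> lifts"
  show "translate 0 h = h"
    by (rule extensionalityI[of _ "carrier F"]) (auto simp: translate_def h liftsD)
next
  fix h k and t :: real assume "h \<in> lifts" "k \<in> lifts"
  then show "mix t h k \<in> lifts" by (rule mix_closed)
next
  fix h k assume "h \<in> lifts" "k \<in> lifts"
  then show "0 \<le> dist_lift h k" by (rule dist_lift_nonneg)
next
  fix h k assume hk: "h \<in> lifts" "k \<in> lifts"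
  show "dist_lift h k = dist_lift k h"
    unfolding dist_lift_def by (intro SUP_cong refl) (use hk in \<open>auto simp: liftsD C.nrm_diff_commute\<close>)
next
  fix h k l assume *: "h \<in> lifts" "k \<in> lifts" "l \<in> lifts"
  show "dist_lift h l \<le> dist_lift h k + dist_lift k l"
  proof (rule dist_liftI)
    fix x assume x: "x \<in> carrier F" "nrm F x \<le> 1"
    have "nrm C (h x \<ominus>\<^bsub>C\<^esub> l x) \<le> nrm C (h x \<ominus>\<^bsub>C\<^esub> k x) + nrm C (k x \<ominus>\<^bsub>C\<^esub> l x)"
      using * x by (intro C.nrm_diff_triangle) (auto simp: liftsD)
    also have "\<dots> \<le> dist_lift h k + dist_lift k l" using * x by (intro add_mono dist_liftD1)
    finally show "nrm C (h x \<ominus>\<^bsub>C\<^esub> l x) \<le> dist_lift h k + dist_lift k l" .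
  qed
next
  fix h k g assume hk: "h \<in> lifts" "k \<in> lifts"
  \<comment> \<open>Every translate is contractive; applied to \<open>g\<close> and to
    \<open>- g\<close> this gives an isometry.\<close>
  have le: "dist_lift (translate g h) (translate g k) \<le> dist_lift h k" if "h \<in> lifts" "k \<in> lifts" for g h k
  proof (rule dist_liftI)
    fix x assume x: "x \<in> carrier F" "nrm F x \<le> 1"
    then show "nrm C (translate g h x \<ominus>\<^bsub>C\<^esub> translate g k x) \<le> dist_lift h k"
      using that dist_liftD1[OF that, of "\<beta> (- g) x"] by (simp add: liftsD flip: \<gamma>_diff)
  qed
  have "translate (- g) (translate g h) = h" if "h \<in> lifts" for h
    by (rule extensionalityI[of _ "carrier F"]) (use that in \<open>auto simp: translate_def liftsD\<close>)
  then show "dist_lift (translate g h) (translate g k) = dist_lift h k"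
    using le[OF hk, of g] le[OF translate_closed[OF hk(1)] translate_closed[OF hk(2)], of "- g" g g] hk
    by simp
next
  fix h k l and t :: real assume *: "h \<in> lifts" "k \<in> lifts" "l \<in> lifts" "0 \<le> t" "t \<le> 1"
  show "dist_lift (mix t h k) l \<le> t * dist_lift h l + (1 - t) * dist_lift k l"
  proof (rule dist_liftI)
    fix x assume x: "x \<in> carrier F" "nrm F x \<le> 1"
    note hx = liftsD(2)[OF *(1) x(1)] liftsD(2)[OF *(2) x(1)] liftsD(2)[OF *(3) x(1)]
    have "l x = complex_of_real t \<odot>\<^bsub>C\<^esub> l x \<oplus>\<^bsub>C\<^esub> complex_of_real (1 - t) \<odot>\<^bsub>C\<^esub> l x"
      using hx by (simp flip: C.sm_add_l)
    then have "mix t h k x \<ominus>\<^bsub>C\<^esub> l x = mix t h k x \<ominus>\<^bsub>C\<^esub>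
        (complex_of_real t \<odot>\<^bsub>C\<^esub> l x \<oplus>\<^bsub>C\<^esub> complex_of_real (1 - t) \<odot>\<^bsub>C\<^esub> l x)" by simp
    also have "\<dots> = complex_of_real t \<odot>\<^bsub>C\<^esub> (h x \<ominus>\<^bsub>C\<^esub> l x) \<oplus>\<^bsub>C\<^esub> complex_of_real (1 - t) \<odot>\<^bsub>C\<^esub> (k x \<ominus>\<^bsub>C\<^esub> l x)"
      using hx x by (simp add: C.add_diff_add C.sm_diff)
    also have "nrm C \<dots> \<le> t * nrm C (h x \<ominus>\<^bsub>C\<^esub> l x) + (1 - t) * nrm C (k x \<ominus>\<^bsub>C\<^esub> l x)"
      using C.nrm_triangle[of "complex_of_real t \<odot>\<^bsub>C\<^esub> (h x \<ominus>\<^bsub>C\<^esub> l x)" "complex_of_real (1 - t) \<odot>\<^bsub>C\<^esub> (k x \<ominus>\<^bsub>C\<^esub> l x)"]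
        hx * by (simp add: C.nrm_smult del: of_real_diff)
    also have "\<dots> \<le> t * dist_lift h l + (1 - t) * dist_lift k l"
      using * x by (intro add_mono mult_left_mono dist_liftD1) auto
    finally show "nrm C (mix t h k x \<ominus>\<^bsub>C\<^esub> l x) \<le> t * dist_lift h l + (1 - t) * dist_lift k l" .
  qed
next
  fix h k g g' and t :: real assume *: "h \<in> lifts" "k \<in> lifts" "0 \<le> t" "t \<le> 1"
  note tr = translate_closed[OF *(1)] translate_closed[OF *(2)]
  show "dist_lift (translate g (mix t h k)) (translate g' (mix t h k)) \<le>
      t * dist_lift (translate g h) (translate g' h) + (1 - t) * dist_lift (translate g k) (translate g' k)"
  proof (rule dist_liftI)
    fix x assume x: "x \<in> carrier F" "nrm F x \<le> 1"
    have mix: "translate g (mix t h k) x = complex_of_real t \<odot>\<^bsub>C\<^esub> translate g h x \<oplus>\<^bsub>C\<^esub>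
        complex_of_real (1 - t) \<odot>\<^bsub>C\<^esub> translate g k x" for g
      using x * by (simp add: liftsD clinear_mapD[OF \<gamma>_linear])
    have c: "translate g h x \<in> carrier C" "translate g k x \<in> carrier C" for g
      using liftsD(2)[OF tr(1) x(1)] liftsD(2)[OF tr(2) x(1)] by auto
    have eq: "translate g (mix t h k) x \<ominus>\<^bsub>C\<^esub> translate g' (mix t h k) x =
        complex_of_real t \<odot>\<^bsub>C\<^esub> (translate g h x \<ominus>\<^bsub>C\<^esub> translate g' h x) \<oplus>\<^bsub>C\<^esub>
        complex_of_real (1 - t) \<odot>\<^bsub>C\<^esub> (translate g k x \<ominus>\<^bsub>C\<^esub> translate g' k x)"
      unfolding mix using c by (simp add: C.add_diff_add C.sm_diff del: translate_apply)
    have "nrm C (translate g (mix t h k) x \<ominus>\<^bsub>C\<^esub> translate g' (mix t h k) x) \<le> t * nrm C (translate g h x \<ominus>\<^bsub>C\<^esub> translate g' h x) +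
        (1 - t) * nrm C (translate g k x \<ominus>\<^bsub>C\<^esub> translate g' k x)"
      unfolding eq using C.nrm_triangle[of "complex_of_real t \<odot>\<^bsub>C\<^esub> (translate g h x \<ominus>\<^bsub>C\<^esub> translate g' h x)"
          "complex_of_real (1 - t) \<odot>\<^bsub>C\<^esub> (translate g k x \<ominus>\<^bsub>C\<^esub> translate g' k x)"]
        c * by (simp add: C.nrm_smult del: of_real_diff translate_apply)
    also have "\<dots> \<le> t * dist_lift (translate g h) (translate g' h) + (1 - t) * dist_lift (translate g k) (translate g' k)"
      using dist_liftD1[OF translate_closed[OF *(1)] translate_closed[OF *(1)] x, of g g']
        dist_liftD1[OF translate_closed[OF *(2)] translate_closed[OF *(2)] x, of g g'] *(3,4)
      by (intro add_mono mult_left_mono) (simp_all del: translate_apply)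
    finally show "nrm C (translate g (mix t h k) x \<ominus>\<^bsub>C\<^esub> translate g' (mix t h k) x) \<le>
      t * dist_lift (translate g h) (translate g' h) + (1 - t) * dist_lift (translate g k) (translate g' k)" .
  qed
next
  fix h and \<epsilon> :: real assume "h \<in> lifts" "0 < \<epsilon>"
  then show "\<exists>U. open U \<and> 0 \<in> U \<and> (\<forall>u\<in>U. dist_lift (translate u h) h < \<epsilon>)"
    by (rule translate_continuous)
qed

text \<open>The almost fixed lifts converge pointwise in \<open>C\<close>. Linearity and
  equivariance pass to the limit because every error is bounded by a multiple of
  \<open>(1/2) ^ k\<close>.\<close>

lemma equivariant_lift_exists:
  assumes s_linear: "\<And>x y. x \<in> carrier F \<Longrightarrow> y \<in> carrier F \<Longrightarrow> C.cg (s (x \<oplus>\<^bsub>F\<^esub> y)) (s x \<oplus>\<^bsub>C\<^esub> s y)"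
    "\<And>x c. x \<in> carrier F \<Longrightarrow> C.cg (s (c \<odot>\<^bsub>F\<^esub> x)) (c \<odot>\<^bsub>C\<^esub> s x)"
  shows "\<exists>\<psi>. clinear_map F C \<psi> \<and> (\<forall>x\<in>carrier F. C.cg (\<psi> x) (s x)) \<and>
    (\<forall>g. \<forall>x\<in>carrier F. \<psi> (\<beta> g x) = \<gamma> g (\<psi> x))"
proof -
  obtain h where h: "clinear_map F C h" "\<And>x. x \<in> carrier F \<Longrightarrow> C.cg (h x) (s x)"
    using F.linearize_mod[OF C.cstar_ideal_axioms s_closed s_linear] by blast
  define v where "v = restrict h (carrier F)"
  have "clinear_map F C v" using h(1) by (auto simp: clinear_map_def v_def)
  moreover have "C.cg (v x) (s x)" if "x \<in> carrier F" for x using h(2) that by (simp add: v_def)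
  ultimately have "v \<in> lifts" by (simp add: lifts_def) (simp add: v_def)
  interpret convex_group_action lifts dist_lift translate mix by (rule convex_group_action)
  obtain w K where w: "\<And>k. w k \<in> lifts" and osc: "\<And>k g. dist_lift (translate g (w k)) (w k) \<le> K * (1/2) ^ k"
    and step: "\<And>k. dist_lift (w (Suc k)) (w k) \<le> K * (1/2) ^ k"
    using almost_fixed_sequence[OF \<open>v \<in> lifts\<close>] by blast
  have "\<exists>l\<in>carrier C. \<forall>k. nrm C (w k x \<ominus>\<^bsub>C\<^esub> l) \<le> (K * nrm F x) / (1 - 1/2) * (1/2) ^ k" if x: "x \<in> carrier F" for x
  proof (rule C.geometric_Cauchy_limit)
    fix k
    show "w k x \<in> carrier C" using w x by (simp add: liftsD)
    have "nrm C (w (Suc k) x \<ominus>\<^bsub>C\<^esub> w k x) \<le> dist_lift (w (Suc k)) (w k) * nrm F x" by (rule dist_liftD[OF w w x])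
    also have "\<dots> \<le> K * (1/2) ^ k * nrm F x" by (rule mult_right_mono[OF step F.nrm_nonneg[OF x]])
    finally show "nrm C (w (Suc k) x \<ominus>\<^bsub>C\<^esub> w k x) \<le> K * nrm F x * (1/2) ^ k" by (simp add: mult_ac)
  qed auto
  then obtain l where l [simp]: "\<And>x. x \<in> carrier F \<Longrightarrow> l x \<in> carrier C"
    and lim': "\<And>x k. x \<in> carrier F \<Longrightarrow> nrm C (w k x \<ominus>\<^bsub>C\<^esub> l x) \<le> (K * nrm F x) / (1 - 1/2) * (1/2) ^ k" by metis
  define B where "B x = (K * nrm F x) / (1 - 1/2)" for x
  have lim: "nrm C (w k x \<ominus>\<^bsub>C\<^esub> l x) \<le> B x * (1/2) ^ k" if "x \<in> carrier F" for x k
    using lim'[OF that] by (simp add: B_def)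
  have wc [simp]: "w k x \<in> carrier C" if "x \<in> carrier F" for k x using w that by (simp add: liftsD)
  note wl = clinear_mapD[OF liftsD(1)[OF w]]
  have half: "(0::real) \<le> 1/2" "(1/2::real) < 1" by auto
  have "clinear_map F C l"
  proof (rule clinear_mapI)
    fix x y assume xy: "x \<in> carrier F" "y \<in> carrier F"
    show "l (x \<oplus>\<^bsub>F\<^esub> y) = l x \<oplus>\<^bsub>C\<^esub> l y"
    proof (rule C.eq_if_le_geometric[OF half])
      fix k
      have "nrm C (l (x \<oplus>\<^bsub>F\<^esub> y) \<ominus>\<^bsub>C\<^esub> (l x \<oplus>\<^bsub>C\<^esub> l y)) \<le> nrm C (l (x \<oplus>\<^bsub>F\<^esub> y) \<ominus>\<^bsub>C\<^esub> w k (x \<oplus>\<^bsub>F\<^esub> y)) +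
          nrm C (w k (x \<oplus>\<^bsub>F\<^esub> y) \<ominus>\<^bsub>C\<^esub> (l x \<oplus>\<^bsub>C\<^esub> l y))"
        using xy by (intro C.nrm_diff_triangle) auto
      also have "w k (x \<oplus>\<^bsub>F\<^esub> y) \<ominus>\<^bsub>C\<^esub> (l x \<oplus>\<^bsub>C\<^esub> l y) = (w k x \<ominus>\<^bsub>C\<^esub> l x) \<oplus>\<^bsub>C\<^esub> (w k y \<ominus>\<^bsub>C\<^esub> l y)"
        using xy by (simp add: wl C.add_diff_add)
      also have "nrm C (l (x \<oplus>\<^bsub>F\<^esub> y) \<ominus>\<^bsub>C\<^esub> w k (x \<oplus>\<^bsub>F\<^esub> y)) \<le> B (x \<oplus>\<^bsub>F\<^esub> y) * (1/2) ^ k"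
        using lim[of "x \<oplus>\<^bsub>F\<^esub> y" k] xy by (simp add: C.nrm_diff_commute)
      also have "nrm C ((w k x \<ominus>\<^bsub>C\<^esub> l x) \<oplus>\<^bsub>C\<^esub> (w k y \<ominus>\<^bsub>C\<^esub> l y)) \<le> B x * (1/2) ^ k + B y * (1/2) ^ k"
        using C.nrm_triangle[of "w k x \<ominus>\<^bsub>C\<^esub> l x" "w k y \<ominus>\<^bsub>C\<^esub> l y"] lim[OF xy(1), of k] lim[OF xy(2), of k] xy by simp
      finally show "nrm C (l (x \<oplus>\<^bsub>F\<^esub> y) \<ominus>\<^bsub>C\<^esub> (l x \<oplus>\<^bsub>C\<^esub> l y)) \<le> (B (x \<oplus>\<^bsub>F\<^esub> y) + B x + B y) * (1/2) ^ k"
        by (simp add: algebra_simps)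
    qed (use xy in auto)
  next
    fix x c assume x: "x \<in> carrier F"
    show "l (c \<odot>\<^bsub>F\<^esub> x) = c \<odot>\<^bsub>C\<^esub> l x"
    proof (rule C.eq_if_le_geometric[OF half])
      fix k
      have "nrm C (l (c \<odot>\<^bsub>F\<^esub> x) \<ominus>\<^bsub>C\<^esub> c \<odot>\<^bsub>C\<^esub> l x) \<le> nrm C (l (c \<odot>\<^bsub>F\<^esub> x) \<ominus>\<^bsub>C\<^esub> w k (c \<odot>\<^bsub>F\<^esub> x)) +
          nrm C (w k (c \<odot>\<^bsub>F\<^esub> x) \<ominus>\<^bsub>C\<^esub> c \<odot>\<^bsub>C\<^esub> l x)"
        using x by (intro C.nrm_diff_triangle) auto
      also have "w k (c \<odot>\<^bsub>F\<^esub> x) \<ominus>\<^bsub>C\<^esub> c \<odot>\<^bsub>C\<^esub> l x = c \<odot>\<^bsub>C\<^esub> (w k x \<ominus>\<^bsub>C\<^esub> l x)"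
        using x by (simp add: wl C.sm_diff)
      also have "nrm C (l (c \<odot>\<^bsub>F\<^esub> x) \<ominus>\<^bsub>C\<^esub> w k (c \<odot>\<^bsub>F\<^esub> x)) \<le> B (c \<odot>\<^bsub>F\<^esub> x) * (1/2) ^ k"
        using lim[of "c \<odot>\<^bsub>F\<^esub> x" k] x by (simp add: C.nrm_diff_commute)
      also have "nrm C (c \<odot>\<^bsub>C\<^esub> (w k x \<ominus>\<^bsub>C\<^esub> l x)) \<le> cmod c * (B x * (1/2) ^ k)"
        using lim[OF x, of k] x by (simp add: C.nrm_smult mult_left_mono)
      finally show "nrm C (l (c \<odot>\<^bsub>F\<^esub> x) \<ominus>\<^bsub>C\<^esub> c \<odot>\<^bsub>C\<^esub> l x) \<le> (B (c \<odot>\<^bsub>F\<^esub> x) + cmod c * B x) * (1/2) ^ k"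
        by (simp add: algebra_simps)
    qed (use x in auto)
  qed simp
  moreover have "C.cg (l x) (s x)" if x: "x \<in> carrier F" for x
  proof -
    \<comment> \<open>The elements \<open>w k x - s x\<close> lie in \<open>J\<close> and converge
      to \<open>l x - s x\<close>, and \<open>J\<close> is closed.\<close>
    have "l x \<ominus>\<^bsub>C\<^esub> s x \<in> J"
    proof (rule C.J_closed)
      fix \<epsilon> :: real assume "\<epsilon> > 0"
      have "(\<lambda>k. B x * (1/2) ^ k) \<longlonglongrightarrow> B x * 0" by (intro tendsto_intros LIMSEQ_realpow_zero) auto
      from order_tendstoD(2)[OF this, of \<epsilon>] \<open>\<epsilon> > 0\<close> obtain k where k: "B x * (1/2) ^ k < \<epsilon>"
        by (auto simp: eventually_sequentially)
      have "(l x \<ominus>\<^bsub>C\<^esub> s x) \<ominus>\<^bsub>C\<^esub> (w k x \<ominus>\<^bsub>C\<^esub> s x) = l x \<ominus>\<^bsub>C\<^esub> w k x"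
        using x s_closed by (simp add: C.lin_simps)
      then have "nrm C ((l x \<ominus>\<^bsub>C\<^esub> s x) \<ominus>\<^bsub>C\<^esub> (w k x \<ominus>\<^bsub>C\<^esub> s x)) < \<epsilon>"
        using lim[OF x, of k] k x by (simp add: C.nrm_diff_commute)
      then show "\<exists>y\<in>J. nrm C (l x \<ominus>\<^bsub>C\<^esub> s x \<ominus>\<^bsub>C\<^esub> y) < \<epsilon>"
        using C.cgD(3)[OF liftsD(3)[OF w x]] by blast
    qed (use x s_closed in auto)
    then show ?thesis using x s_closed by (simp add: C.cg_def)
  qed
  moreover have "l (\<beta> g x) = \<gamma> g (l x)" if x: "x \<in> carrier F" for g x
  proof (rule C.eq_if_le_geometric[OF half])
    fix k
    have bx: "\<beta> g x \<in> carrier F" using x by simp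
    have "nrm C (l (\<beta> g x) \<ominus>\<^bsub>C\<^esub> \<gamma> g (l x)) \<le> nrm C (l (\<beta> g x) \<ominus>\<^bsub>C\<^esub> w k (\<beta> g x)) + nrm C (w k (\<beta> g x) \<ominus>\<^bsub>C\<^esub> \<gamma> g (l x))"
      using x by (intro C.nrm_diff_triangle) auto
    also have "nrm C (w k (\<beta> g x) \<ominus>\<^bsub>C\<^esub> \<gamma> g (l x)) \<le> nrm C (w k (\<beta> g x) \<ominus>\<^bsub>C\<^esub> \<gamma> g (w k x)) + nrm C (\<gamma> g (w k x) \<ominus>\<^bsub>C\<^esub> \<gamma> g (l x))"
      using x by (intro C.nrm_diff_triangle) auto
    also have "nrm C (\<gamma> g (w k x) \<ominus>\<^bsub>C\<^esub> \<gamma> g (l x)) \<le> B x * (1/2) ^ k"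
      using x lim by (simp flip: \<gamma>_diff)
    also have "nrm C (l (\<beta> g x) \<ominus>\<^bsub>C\<^esub> w k (\<beta> g x)) \<le> B (\<beta> g x) * (1/2) ^ k"
      using lim[OF bx, of k] x by (simp add: C.nrm_diff_commute)
    \<comment> \<open>An almost fixed map is almost equivariant: the displacement of
      \<open>w k\<close> under \<open>g\<close> is evaluated at \<open>\<beta> g x\<close>.\<close>
    also have "nrm C (w k (\<beta> g x) \<ominus>\<^bsub>C\<^esub> \<gamma> g (w k x)) \<le> K * (1/2) ^ k * nrm F x"
    proof -
      have "nrm C (w k (\<beta> g x) \<ominus>\<^bsub>C\<^esub> \<gamma> g (w k x)) = nrm C (translate g (w k) (\<beta> g x) \<ominus>\<^bsub>C\<^esub> w k (\<beta> g x))"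
        using x by (simp add: C.nrm_diff_commute)
      also have "\<dots> \<le> dist_lift (translate g (w k)) (w k) * nrm F (\<beta> g x)"
        by (rule dist_liftD[OF translate_closed[OF w] w bx])
      also have "\<dots> \<le> K * (1/2) ^ k * nrm F (\<beta> g x)"
        by (rule mult_right_mono[OF osc F.nrm_nonneg[OF bx]])
      finally show ?thesis using x by simp
    qed
    finally show "nrm C (l (\<beta> g x) \<ominus>\<^bsub>C\<^esub> \<gamma> g (l x)) \<le> (B (\<beta> g x) + K * nrm F x + B x) * (1/2) ^ k"
      by (simp add: algebra_simps)
  qed (use x in auto)
  ultimately show ?thesis by blast
qed

end

section \<open>Perturbation of almost multiplicative maps\<close>

locale approximate_hom =
  F: unital_cstar_algebra F + F: dual_basis F N e co b + C: star_ideal C J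
  for F :: "'f cstar" and N e co b and C :: "'c cstar" and J
begin

lemma F_cstar: "cstar_algebra F" and C_cstar: "cstar_algebra C"
  by unfold_locales

lemma unit_eq_one: "F.unit = \<one>\<^bsub>F\<^esub>"
  by (metis F.one_closed F.r_one F.unit_closed F.unit_mult_l)

lemma invol_linear_invol:
  assumes "clinear_map F C h"
  shows "clinear_map F C (\<lambda>x. invol C (h (invol F x)))"
  by (rule clinear_mapI)
    (simp_all add: clinear_mapD[OF assms] F.invol_add F.invol_smult C.invol_add C.invol_smult)

definition defect :: "('f \<Rightarrow> 'c) \<Rightarrow> 'f \<Rightarrow> 'f \<Rightarrow> 'c" where
  "defect \<psi> x y = \<psi> (x \<otimes>\<^bsub>F\<^esub> y) \<ominus>\<^bsub>C\<^esub> \<psi> x \<otimes>\<^bsub>C\<^esub> \<psi> y"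

text \<open>The contracting homotopy given by the separability idempotent, applied to the first
  argument of the defect.\<close>

definition correction :: "('f \<Rightarrow> 'c) \<Rightarrow> 'f \<Rightarrow> 'c" where
  "correction \<psi> x = (\<Oplus>\<^bsub>C\<^esub>i\<in>{..<N}. \<psi> (e i) \<otimes>\<^bsub>C\<^esub> defect \<psi> (b i) x)"

definition improve :: "('f \<Rightarrow> 'c) \<Rightarrow> 'f \<Rightarrow> 'c" where
  "improve \<psi> x = \<psi> x \<oplus>\<^bsub>C\<^esub> correction \<psi> x"

text \<open>\<open>improve \<psi>\<close> need not commute with the involution even if
  \<open>\<psi>\<close> does; the mean with its conjugate map does
  (\<open>newton_invol\<close>).\<close>

definition newton :: "('f \<Rightarrow> 'c) \<Rightarrow> 'f \<Rightarrow> 'c" where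
  "newton \<psi> x = (1/2) \<odot>\<^bsub>C\<^esub> (improve \<psi> x \<oplus>\<^bsub>C\<^esub> invol C (improve \<psi> (invol F x)))"

context
  fixes \<psi> assumes \<psi>: "clinear_map F C \<psi>"
begin

lemmas lin = clinear_mapD[OF \<psi>]

lemma defect_closed [simp]: "x \<in> carrier F \<Longrightarrow> y \<in> carrier F \<Longrightarrow> defect \<psi> x y \<in> carrier C"
  by (simp add: defect_def lin)

lemma defect_linear_l: "y \<in> carrier F \<Longrightarrow> clinear_map F C (\<lambda>x. defect \<psi> x y)"
  by (rule clinear_mapI)
    (simp_all add: defect_def lin F.mult_add_left C.mult_add_left F.smult_mult_left C.smult_mult_left
      C.add_diff_add C.sm_diff)

lemma defect_linear_r: "x \<in> carrier F \<Longrightarrow> clinear_map F C (defect \<psi> x)"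
  by (rule clinear_mapI)
    (simp_all add: defect_def lin F.mult_add_right C.mult_add_right F.smult_mult_right C.smult_mult_right
      C.add_diff_add C.sm_diff)

lemma correction_closed [simp]: "x \<in> carrier F \<Longrightarrow> correction \<psi> x \<in> carrier C"
  unfolding correction_def by (intro C.finsum_closed) (simp add: lin)

lemma correction_linear: "clinear_map F C (correction \<psi>)"
proof (rule clinear_mapI)
  fix x y assume xy: "x \<in> carrier F" "y \<in> carrier F"
  have "correction \<psi> (x \<oplus>\<^bsub>F\<^esub> y) =
      (\<Oplus>\<^bsub>C\<^esub>i\<in>{..<N}. \<psi> (e i) \<otimes>\<^bsub>C\<^esub> defect \<psi> (b i) x \<oplus>\<^bsub>C\<^esub> \<psi> (e i) \<otimes>\<^bsub>C\<^esub> defect \<psi> (b i) y)"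
    unfolding correction_def using xy
    by (intro C.finsum_eqI) (simp_all add: lin clinear_mapD(2)[OF defect_linear_r] C.mult_add_right)
  also have "\<dots> = correction \<psi> x \<oplus>\<^bsub>C\<^esub> correction \<psi> y"
    unfolding correction_def using xy by (intro C.finsum_addf) (auto simp: lin)
  finally show "correction \<psi> (x \<oplus>\<^bsub>F\<^esub> y) = correction \<psi> x \<oplus>\<^bsub>C\<^esub> correction \<psi> y" .
next
  fix x c assume x: "x \<in> carrier F"
  show "correction \<psi> (c \<odot>\<^bsub>F\<^esub> x) = c \<odot>\<^bsub>C\<^esub> correction \<psi> x"
    unfolding correction_def using x
    by (subst C.sm_finsum) (auto simp: lin clinear_mapD(3)[OF defect_linear_r] C.smult_mult_right intro!: C.finsum_eqI)
qed simp

lemma improve_linear: "clinear_map F C (improve \<psi>)"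
  by (rule clinear_mapI)
    (simp_all add: improve_def lin clinear_mapD[OF correction_linear] C.lin_simps)

lemma newton_linear: "clinear_map F C (newton \<psi>)"
  by (rule clinear_mapI)
    (simp_all add: newton_def clinear_mapD[OF improve_linear] clinear_mapD[OF invol_linear_invol[OF improve_linear]]
      C.lin_simps mult.commute)

lemma newton_invol: "x \<in> carrier F \<Longrightarrow> newton \<psi> (invol F x) = invol C (newton \<psi> x)"
  by (simp add: newton_def clinear_mapD[OF improve_linear] C.invol_smult C.invol_add C.invol_invol F.invol_invol C.a_comm)

text \<open>Associativity: both sides expand to the same four terms. The identity is exact although
  \<open>\<psi>\<close> is not multiplicative.\<close>

lemma cocycle:
  assumes "a \<in> carrier F" "x \<in> carrier F" "y \<in> carrier F"
  shows "defect \<psi> a (x \<otimes>\<^bsub>F\<^esub> y) \<ominus>\<^bsub>C\<^esub> defect \<psi> a x \<otimes>\<^bsub>C\<^esub> \<psi> y =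
    defect \<psi> (a \<otimes>\<^bsub>F\<^esub> x) y \<ominus>\<^bsub>C\<^esub> \<psi> a \<otimes>\<^bsub>C\<^esub> defect \<psi> x y"
  using assms by (simp add: defect_def lin F.mult_assoc C.alg_simps)

text \<open>Newton's method for the equation \<open>\<psi>(xy) = \<psi>(x)\<psi>(y)\<close>: the separability idempotent
  \<open>\<Sum> e\<^sub>i \<otimes> b\<^sub>i\<close> contracts the Hochschild complex, so the correction kills the defect to first order.\<close>

lemma defect_improve:
  assumes x: "x \<in> carrier F" and y: "y \<in> carrier F"
  shows "defect (improve \<psi>) x y =
    ((\<one>\<^bsub>C\<^esub> \<ominus>\<^bsub>C\<^esub> \<psi> \<one>\<^bsub>F\<^esub>) \<otimes>\<^bsub>C\<^esub> defect \<psi> x y \<oplus>\<^bsub>C\<^esub> (\<Oplus>\<^bsub>C\<^esub>i\<in>{..<N}. defect \<psi> x (e i) \<otimes>\<^bsub>C\<^esub> defect \<psi> (b i) y)) \<oplus>\<^bsub>C\<^esub>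
    ((\<Oplus>\<^bsub>C\<^esub>i\<in>{..<N}. defect \<psi> (e i) (b i)) \<otimes>\<^bsub>C\<^esub> defect \<psi> x y \<ominus>\<^bsub>C\<^esub> correction \<psi> x \<otimes>\<^bsub>C\<^esub> correction \<psi> y)"
proof -
  let ?d = "defect \<psi> x y" and ?h = "correction \<psi>"
  define S1 where "S1 = (\<Oplus>\<^bsub>C\<^esub>i\<in>{..<N}. defect \<psi> x (e i) \<otimes>\<^bsub>C\<^esub> defect \<psi> (b i) y)"
  define S2 where "S2 = (\<Oplus>\<^bsub>C\<^esub>i\<in>{..<N}. defect \<psi> (e i) (b i))"
  have S [simp]: "S1 \<in> carrier C" "S2 \<in> carrier C"
    unfolding S1_def S2_def using x y by (auto intro!: C.finsum_closed)
  have bil: "cbilinear_map F F C (\<lambda>p q. \<psi> p \<otimes>\<^bsub>C\<^esub> defect \<psi> q y)"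
    unfolding cbilinear_map_def using y
    by (auto intro!: clinear_mapI simp: lin clinear_mapD[OF defect_linear_l] C.mult_add_left C.mult_add_right
        C.smult_mult_left C.smult_mult_right)
  \<comment> \<open>The cocycle identity is multiplied by \<open>\<psi> (e i)\<close> and summed.
    \<open>casimir_move\<close> carries \<open>x\<close> from the second leg of the idempotent to
    the first, and replacing \<open>\<psi> (x \<otimes> e i)\<close> by a product costs the
    quadratic term \<open>S1\<close>.\<close>
  have e1: "?h (x \<otimes>\<^bsub>F\<^esub> y) \<ominus>\<^bsub>C\<^esub> ?h x \<otimes>\<^bsub>C\<^esub> \<psi> y = (\<psi> x \<otimes>\<^bsub>C\<^esub> ?h y \<oplus>\<^bsub>C\<^esub> S1) \<ominus>\<^bsub>C\<^esub> (\<psi> \<one>\<^bsub>F\<^esub> \<ominus>\<^bsub>C\<^esub> S2) \<otimes>\<^bsub>C\<^esub> ?d"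
  proof -
    have "?h (x \<otimes>\<^bsub>F\<^esub> y) \<ominus>\<^bsub>C\<^esub> ?h x \<otimes>\<^bsub>C\<^esub> \<psi> y =
        (\<Oplus>\<^bsub>C\<^esub>i\<in>{..<N}. \<psi> (e i) \<otimes>\<^bsub>C\<^esub> defect \<psi> (b i) (x \<otimes>\<^bsub>F\<^esub> y)) \<ominus>\<^bsub>C\<^esub>
        (\<Oplus>\<^bsub>C\<^esub>i\<in>{..<N}. \<psi> (e i) \<otimes>\<^bsub>C\<^esub> defect \<psi> (b i) x \<otimes>\<^bsub>C\<^esub> \<psi> y)"
      unfolding correction_def using x y by (subst C.mult_finsum_l) (auto simp: lin)
    also have "\<dots> = (\<Oplus>\<^bsub>C\<^esub>i\<in>{..<N}. \<psi> (e i) \<otimes>\<^bsub>C\<^esub> defect \<psi> (b i) (x \<otimes>\<^bsub>F\<^esub> y) \<ominus>\<^bsub>C\<^esub>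
        \<psi> (e i) \<otimes>\<^bsub>C\<^esub> defect \<psi> (b i) x \<otimes>\<^bsub>C\<^esub> \<psi> y)"
      using x y by (intro C.finsum_diff[symmetric]) (auto simp: lin)
    also have "\<dots> = (\<Oplus>\<^bsub>C\<^esub>i\<in>{..<N}. \<psi> (e i) \<otimes>\<^bsub>C\<^esub> defect \<psi> (b i \<otimes>\<^bsub>F\<^esub> x) y \<ominus>\<^bsub>C\<^esub>
        \<psi> (e i) \<otimes>\<^bsub>C\<^esub> \<psi> (b i) \<otimes>\<^bsub>C\<^esub> ?d)"
    proof (rule C.finsum_eqI)
      fix i assume "i \<in> {..<N}"
      then have i: "i < N" by simp
      have "\<psi> (e i) \<otimes>\<^bsub>C\<^esub> defect \<psi> (b i) (x \<otimes>\<^bsub>F\<^esub> y) \<ominus>\<^bsub>C\<^esub> \<psi> (e i) \<otimes>\<^bsub>C\<^esub> defect \<psi> (b i) x \<otimes>\<^bsub>C\<^esub> \<psi> y =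
          \<psi> (e i) \<otimes>\<^bsub>C\<^esub> (defect \<psi> (b i) (x \<otimes>\<^bsub>F\<^esub> y) \<ominus>\<^bsub>C\<^esub> defect \<psi> (b i) x \<otimes>\<^bsub>C\<^esub> \<psi> y)"
        using i x y by (simp add: lin C.mult_diff_r C.mult_assoc)
      also have "\<dots> = \<psi> (e i) \<otimes>\<^bsub>C\<^esub> (defect \<psi> (b i \<otimes>\<^bsub>F\<^esub> x) y \<ominus>\<^bsub>C\<^esub> \<psi> (b i) \<otimes>\<^bsub>C\<^esub> ?d)"
        using i x y by (simp add: cocycle)
      also have "\<dots> = \<psi> (e i) \<otimes>\<^bsub>C\<^esub> defect \<psi> (b i \<otimes>\<^bsub>F\<^esub> x) y \<ominus>\<^bsub>C\<^esub> \<psi> (e i) \<otimes>\<^bsub>C\<^esub> \<psi> (b i) \<otimes>\<^bsub>C\<^esub> ?d"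
        using i x y by (simp add: lin C.mult_diff_r C.mult_assoc)
      finally show "\<psi> (e i) \<otimes>\<^bsub>C\<^esub> defect \<psi> (b i) (x \<otimes>\<^bsub>F\<^esub> y) \<ominus>\<^bsub>C\<^esub> \<psi> (e i) \<otimes>\<^bsub>C\<^esub> defect \<psi> (b i) x \<otimes>\<^bsub>C\<^esub> \<psi> y =
        \<psi> (e i) \<otimes>\<^bsub>C\<^esub> defect \<psi> (b i \<otimes>\<^bsub>F\<^esub> x) y \<ominus>\<^bsub>C\<^esub> \<psi> (e i) \<otimes>\<^bsub>C\<^esub> \<psi> (b i) \<otimes>\<^bsub>C\<^esub> ?d" .
    qed (use x y in \<open>auto simp: lin\<close>)
    also have "\<dots> = (\<Oplus>\<^bsub>C\<^esub>i\<in>{..<N}. \<psi> (e i) \<otimes>\<^bsub>C\<^esub> defect \<psi> (b i \<otimes>\<^bsub>F\<^esub> x) y) \<ominus>\<^bsub>C\<^esub>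
        (\<Oplus>\<^bsub>C\<^esub>i\<in>{..<N}. \<psi> (e i) \<otimes>\<^bsub>C\<^esub> \<psi> (b i) \<otimes>\<^bsub>C\<^esub> ?d)"
      using x y by (intro C.finsum_diff) (auto simp: lin)
    also have "(\<Oplus>\<^bsub>C\<^esub>i\<in>{..<N}. \<psi> (e i) \<otimes>\<^bsub>C\<^esub> defect \<psi> (b i \<otimes>\<^bsub>F\<^esub> x) y) =
        (\<Oplus>\<^bsub>C\<^esub>i\<in>{..<N}. \<psi> (x \<otimes>\<^bsub>F\<^esub> e i) \<otimes>\<^bsub>C\<^esub> defect \<psi> (b i) y)"
      by (rule F.casimir_move[OF C_cstar bil x, symmetric])
    also have "\<dots> = (\<Oplus>\<^bsub>C\<^esub>i\<in>{..<N}. \<psi> x \<otimes>\<^bsub>C\<^esub> (\<psi> (e i) \<otimes>\<^bsub>C\<^esub> defect \<psi> (b i) y) \<oplus>\<^bsub>C\<^esub> defect \<psi> x (e i) \<otimes>\<^bsub>C\<^esub> defect \<psi> (b i) y)"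
    proof (rule C.finsum_eqI)
      fix i assume "i \<in> {..<N}"
      then have i: "i < N" by simp
      have "\<psi> (x \<otimes>\<^bsub>F\<^esub> e i) = \<psi> x \<otimes>\<^bsub>C\<^esub> \<psi> (e i) \<oplus>\<^bsub>C\<^esub> defect \<psi> x (e i)"
        using i x by (simp add: defect_def lin C.lin_simps)
      then show "\<psi> (x \<otimes>\<^bsub>F\<^esub> e i) \<otimes>\<^bsub>C\<^esub> defect \<psi> (b i) y =
          \<psi> x \<otimes>\<^bsub>C\<^esub> (\<psi> (e i) \<otimes>\<^bsub>C\<^esub> defect \<psi> (b i) y) \<oplus>\<^bsub>C\<^esub> defect \<psi> x (e i) \<otimes>\<^bsub>C\<^esub> defect \<psi> (b i) y"
        using i x y by (simp add: lin C.mult_add_left C.mult_assoc)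
    qed (use x y in \<open>auto simp: lin\<close>)
    also have "\<dots> = \<psi> x \<otimes>\<^bsub>C\<^esub> ?h y \<oplus>\<^bsub>C\<^esub> S1"
      unfolding correction_def S1_def using x y
      by (subst C.mult_finsum_r) (auto simp: lin intro!: C.finsum_addf)
    also have "(\<Oplus>\<^bsub>C\<^esub>i\<in>{..<N}. \<psi> (e i) \<otimes>\<^bsub>C\<^esub> \<psi> (b i) \<otimes>\<^bsub>C\<^esub> ?d) = (\<Oplus>\<^bsub>C\<^esub>i\<in>{..<N}. \<psi> (e i) \<otimes>\<^bsub>C\<^esub> \<psi> (b i)) \<otimes>\<^bsub>C\<^esub> ?d"
      using x y by (subst C.mult_finsum_l) (auto simp: lin)
    \<comment> \<open>The idempotent multiplies out to the unit of \<open>F\<close>, so this sum is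
      \<open>\<psi>\<close> of the unit up to the sum \<open>S2\<close> of defects.\<close>
    also have "(\<Oplus>\<^bsub>C\<^esub>i\<in>{..<N}. \<psi> (e i) \<otimes>\<^bsub>C\<^esub> \<psi> (b i)) = (\<Oplus>\<^bsub>C\<^esub>i\<in>{..<N}. \<psi> (e i \<otimes>\<^bsub>F\<^esub> b i) \<ominus>\<^bsub>C\<^esub> defect \<psi> (e i) (b i))"
      by (intro C.finsum_eqI) (auto simp: defect_def lin C.lin_simps)
    also have "\<dots> = (\<Oplus>\<^bsub>C\<^esub>i\<in>{..<N}. \<psi> (e i \<otimes>\<^bsub>F\<^esub> b i)) \<ominus>\<^bsub>C\<^esub> S2"
      unfolding S2_def by (intro C.finsum_diff) (auto simp: lin)
    also have "(\<Oplus>\<^bsub>C\<^esub>i\<in>{..<N}. \<psi> (e i \<otimes>\<^bsub>F\<^esub> b i)) = \<psi> \<one>\<^bsub>F\<^esub>"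
      unfolding unit_eq_one[symmetric] F.unit_def by (intro clinear_map_finsum[OF F_cstar C_cstar \<psi>, symmetric]) auto
    finally show ?thesis .
  qed
  have hc: "?h x \<in> carrier C" "?h y \<in> carrier C" "?h (x \<otimes>\<^bsub>F\<^esub> y) \<in> carrier C" "\<psi> x \<in> carrier C" "\<psi> y \<in> carrier C"
    "\<psi> (x \<otimes>\<^bsub>F\<^esub> y) \<in> carrier C" "\<psi> \<one>\<^bsub>F\<^esub> \<in> carrier C" "?d \<in> carrier C"
    using x y by (simp_all add: lin)
  have "defect (improve \<psi>) x y = (?d \<oplus>\<^bsub>C\<^esub> (?h (x \<otimes>\<^bsub>F\<^esub> y) \<ominus>\<^bsub>C\<^esub> ?h x \<otimes>\<^bsub>C\<^esub> \<psi> y)) \<ominus>\<^bsub>C\<^esub>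
      (\<psi> x \<otimes>\<^bsub>C\<^esub> ?h y \<oplus>\<^bsub>C\<^esub> ?h x \<otimes>\<^bsub>C\<^esub> ?h y)"
    using hc by (simp add: defect_def improve_def C.alg_simps)
  also have "\<dots> = ((\<one>\<^bsub>C\<^esub> \<ominus>\<^bsub>C\<^esub> \<psi> \<one>\<^bsub>F\<^esub>) \<otimes>\<^bsub>C\<^esub> ?d \<oplus>\<^bsub>C\<^esub> S1) \<oplus>\<^bsub>C\<^esub> (S2 \<otimes>\<^bsub>C\<^esub> ?d \<ominus>\<^bsub>C\<^esub> ?h x \<otimes>\<^bsub>C\<^esub> ?h y)"
  proof -
    \<comment> \<open>An identity in six independent elements. The common summand \<open>p\<close>
      is removed by hand, after which rewriting closes the rest.\<close>
    have "(d \<oplus>\<^bsub>C\<^esub> ((p \<oplus>\<^bsub>C\<^esub> s) \<ominus>\<^bsub>C\<^esub> (u \<ominus>\<^bsub>C\<^esub> t) \<otimes>\<^bsub>C\<^esub> d)) \<ominus>\<^bsub>C\<^esub> (p \<oplus>\<^bsub>C\<^esub> k) =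
        ((\<one>\<^bsub>C\<^esub> \<ominus>\<^bsub>C\<^esub> u) \<otimes>\<^bsub>C\<^esub> d \<oplus>\<^bsub>C\<^esub> s) \<oplus>\<^bsub>C\<^esub> (t \<otimes>\<^bsub>C\<^esub> d \<ominus>\<^bsub>C\<^esub> k)"
      if "d \<in> carrier C" "p \<in> carrier C" "s \<in> carrier C" "u \<in> carrier C" "t \<in> carrier C" "k \<in> carrier C" for d p s u t k
    proof -
      let ?w = "d \<oplus>\<^bsub>C\<^esub> (s \<ominus>\<^bsub>C\<^esub> (u \<ominus>\<^bsub>C\<^esub> t) \<otimes>\<^bsub>C\<^esub> d)"
      have "d \<oplus>\<^bsub>C\<^esub> ((p \<oplus>\<^bsub>C\<^esub> s) \<ominus>\<^bsub>C\<^esub> (u \<ominus>\<^bsub>C\<^esub> t) \<otimes>\<^bsub>C\<^esub> d) = p \<oplus>\<^bsub>C\<^esub> ?w"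
        using that by (simp add: C.alg_simps)
      then have "(d \<oplus>\<^bsub>C\<^esub> ((p \<oplus>\<^bsub>C\<^esub> s) \<ominus>\<^bsub>C\<^esub> (u \<ominus>\<^bsub>C\<^esub> t) \<otimes>\<^bsub>C\<^esub> d)) \<ominus>\<^bsub>C\<^esub> (p \<oplus>\<^bsub>C\<^esub> k) = ?w \<ominus>\<^bsub>C\<^esub> k"
        using that C.add_diff_add[of p ?w p k] by simp
      also have "\<dots> = ((\<one>\<^bsub>C\<^esub> \<ominus>\<^bsub>C\<^esub> u) \<otimes>\<^bsub>C\<^esub> d \<oplus>\<^bsub>C\<^esub> s) \<oplus>\<^bsub>C\<^esub> (t \<otimes>\<^bsub>C\<^esub> d \<ominus>\<^bsub>C\<^esub> k)"
        using that by (simp add: C.alg_simps)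
      finally show ?thesis .
    qed
    from this[of ?d "\<psi> x \<otimes>\<^bsub>C\<^esub> ?h y" S1 "\<psi> \<one>\<^bsub>F\<^esub>" S2 "?h x \<otimes>\<^bsub>C\<^esub> ?h y"] show ?thesis
      unfolding e1 using hc by simp
  qed
  finally show ?thesis unfolding S1_def S2_def .
qed

end

lemma defect_invol:
  assumes \<psi>: "clinear_map F C \<psi>" and xy: "x \<in> carrier F" "y \<in> carrier F"
  shows "defect (\<lambda>x. invol C (\<psi> (invol F x))) x y = invol C (defect \<psi> (invol F y) (invol F x))"
  using xy by (simp add: defect_def clinear_mapD[OF \<psi>] F.invol_mult C.invol_mult C.invol_diff)

text \<open>The product is quadratic, so by polarization the mean of the products is the product of
  the means plus a quarter of the product of the differences. Averaging two almost multiplicative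
  maps thus costs a term quadratic in their distance.\<close>

lemma defect_mean:
  assumes p: "clinear_map F C p" and q: "clinear_map F C q" and xy: "x \<in> carrier F" "y \<in> carrier F"
  shows "defect (\<lambda>x. (1/2) \<odot>\<^bsub>C\<^esub> (p x \<oplus>\<^bsub>C\<^esub> q x)) x y =
    (1/2) \<odot>\<^bsub>C\<^esub> (defect p x y \<oplus>\<^bsub>C\<^esub> defect q x y) \<oplus>\<^bsub>C\<^esub> (1/4) \<odot>\<^bsub>C\<^esub> ((p x \<ominus>\<^bsub>C\<^esub> q x) \<otimes>\<^bsub>C\<^esub> (p y \<ominus>\<^bsub>C\<^esub> q y))"
proof -
  have c: "p x \<in> carrier C" "p y \<in> carrier C" "q x \<in> carrier C" "q y \<in> carrier C"
    "p (x \<otimes>\<^bsub>F\<^esub> y) \<in> carrier C" "q (x \<otimes>\<^bsub>F\<^esub> y) \<in> carrier C"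
    using xy by (simp_all add: clinear_mapD[OF p] clinear_mapD[OF q])
  \<comment> \<open>After expansion the products of values of \<open>p\<close> and of
    \<open>q\<close> occur with coefficients in halves and quarters; splitting the halves lets the
    quarters cancel.\<close>
  have half: "(1/2) \<odot>\<^bsub>C\<^esub> z = (1/4) \<odot>\<^bsub>C\<^esub> z \<oplus>\<^bsub>C\<^esub> (1/4) \<odot>\<^bsub>C\<^esub> z"
    "(- (1/2)) \<odot>\<^bsub>C\<^esub> z = (- (1/4)) \<odot>\<^bsub>C\<^esub> z \<oplus>\<^bsub>C\<^esub> (- (1/4)) \<odot>\<^bsub>C\<^esub> z" if "z \<in> carrier C" for z
    using that by (simp_all flip: C.sm_add_l)
  have apart: "k \<odot>\<^bsub>C\<^esub> z \<oplus>\<^bsub>C\<^esub> (u \<oplus>\<^bsub>C\<^esub> ((- k) \<odot>\<^bsub>C\<^esub> z \<oplus>\<^bsub>C\<^esub> w)) = u \<oplus>\<^bsub>C\<^esub> w"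
    "k \<odot>\<^bsub>C\<^esub> z \<oplus>\<^bsub>C\<^esub> (u \<oplus>\<^bsub>C\<^esub> (v \<oplus>\<^bsub>C\<^esub> (v' \<oplus>\<^bsub>C\<^esub> ((- k) \<odot>\<^bsub>C\<^esub> z \<oplus>\<^bsub>C\<^esub> w)))) = u \<oplus>\<^bsub>C\<^esub> (v \<oplus>\<^bsub>C\<^esub> (v' \<oplus>\<^bsub>C\<^esub> w))"
    if "z \<in> carrier C" "u \<in> carrier C" "v \<in> carrier C" "v' \<in> carrier C" "w \<in> carrier C" for k z u v v' w
    using that by (simp_all add: C.a_lcomm[of "k \<odot>\<^bsub>C\<^esub> z"])
  show ?thesis
    unfolding defect_def using c
    by (simp add: C.alg_simps)
      (simp add: C.a_ac half(2)[of "p x \<otimes>\<^bsub>C\<^esub> p y"] half(2)[of "q x \<otimes>\<^bsub>C\<^esub> q y"] apart)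
qed

end

text \<open>A unital *-homomorphism into \<open>C/J\<close> given by representatives.
  \<open>unital_star_hom_lift\<close> and \<open>unital_star_hom_of_hom_mod\<close> translate
  between the two descriptions.\<close>

definition hom_mod :: "'a cstar \<Rightarrow> 'b cstar \<Rightarrow> 'b set \<Rightarrow> ('a \<Rightarrow> 'b) \<Rightarrow> bool" where
  "hom_mod A C J s \<longleftrightarrow>
     (\<forall>x\<in>carrier A. s x \<in> carrier C) \<and>
     (\<forall>x\<in>carrier A. \<forall>y\<in>carrier A. cstar_ideal.cg C J (s (x \<oplus>\<^bsub>A\<^esub> y)) (s x \<oplus>\<^bsub>C\<^esub> s y)) \<and>
     (\<forall>x\<in>carrier A. \<forall>y\<in>carrier A. cstar_ideal.cg C J (s (x \<otimes>\<^bsub>A\<^esub> y)) (s x \<otimes>\<^bsub>C\<^esub> s y)) \<and>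
     (\<forall>c. \<forall>x\<in>carrier A. cstar_ideal.cg C J (s (c \<odot>\<^bsub>A\<^esub> x)) (c \<odot>\<^bsub>C\<^esub> s x)) \<and>
     (\<forall>x\<in>carrier A. cstar_ideal.cg C J (s (invol A x)) (invol C (s x))) \<and>
     cstar_ideal.cg C J (s \<one>\<^bsub>A\<^esub>) \<one>\<^bsub>C\<^esub>"

lemma hom_modD:
  assumes "hom_mod A C J s"
  shows "x \<in> carrier A \<Longrightarrow> s x \<in> carrier C"
    and "x \<in> carrier A \<Longrightarrow> y \<in> carrier A \<Longrightarrow> cstar_ideal.cg C J (s (x \<oplus>\<^bsub>A\<^esub> y)) (s x \<oplus>\<^bsub>C\<^esub> s y)"
    and "x \<in> carrier A \<Longrightarrow> y \<in> carrier A \<Longrightarrow> cstar_ideal.cg C J (s (x \<otimes>\<^bsub>A\<^esub> y)) (s x \<otimes>\<^bsub>C\<^esub> s y)"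
    and "x \<in> carrier A \<Longrightarrow> cstar_ideal.cg C J (s (c \<odot>\<^bsub>A\<^esub> x)) (c \<odot>\<^bsub>C\<^esub> s x)"
    and "x \<in> carrier A \<Longrightarrow> cstar_ideal.cg C J (s (invol A x)) (invol C (s x))"
    and "cstar_ideal.cg C J (s \<one>\<^bsub>A\<^esub>) \<one>\<^bsub>C\<^esub>"
  using assms by (auto simp: hom_mod_def)

section \<open>Estimates for a single Newton step\<close>

context approximate_hom
begin

text \<open>The size of the separability idempotent: a bound for its projective tensor norm.\<close>

definition kappa :: real where
  "kappa = (\<Sum>i<N. nrm F (e i) * nrm F (b i))"

lemma kappa_nonneg: "0 \<le> kappa"
  unfolding kappa_def by (intro sum_nonneg mult_nonneg_nonneg F.nrm_nonneg) auto

lemma qn_mult_le: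
  "x \<in> carrier C \<Longrightarrow> y \<in> carrier C \<Longrightarrow> C.qn x \<le> a \<Longrightarrow> C.qn y \<le> c \<Longrightarrow> C.qn (x \<otimes>\<^bsub>C\<^esub> y) \<le> a * c"
  using C.qn_mult[of x y] C.qn_nonneg[of x] C.qn_nonneg[of y] mult_mono[of "C.qn x" a "C.qn y" c] by linarith

text \<open>The passage to limits modulo \<open>J\<close>: if two sequences converge at geometric
  rates and their difference decays at one, the limits are congruent.\<close>

lemma cg_limit:
  assumes "a \<in> carrier C" "c \<in> carrier C" "\<And>k. p k \<in> carrier C" "\<And>k. q k \<in> carrier C"
    and "\<And>k. C.qn (p k \<ominus>\<^bsub>C\<^esub> a) \<le> K * (1/2) ^ k" "\<And>k. C.qn (q k \<ominus>\<^bsub>C\<^esub> c) \<le> L * (1/2) ^ k"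
    and "\<And>k. C.qn (p k \<ominus>\<^bsub>C\<^esub> q k) \<le> R * (1/2) ^ k"
  shows "C.cg a c"
proof -
  have "C.qn (a \<ominus>\<^bsub>C\<^esub> c) \<le> (K + R + L) * (1/2) ^ k" for k
  proof -
    have "C.qn (a \<ominus>\<^bsub>C\<^esub> c) \<le> C.qn (a \<ominus>\<^bsub>C\<^esub> p k) + C.qn (p k \<ominus>\<^bsub>C\<^esub> c)"
      using assms by (intro C.qn_triangle)
    also have "C.qn (p k \<ominus>\<^bsub>C\<^esub> c) \<le> C.qn (p k \<ominus>\<^bsub>C\<^esub> q k) + C.qn (q k \<ominus>\<^bsub>C\<^esub> c)"
      using assms by (intro C.qn_triangle)
    also have "C.qn (a \<ominus>\<^bsub>C\<^esub> p k) = C.qn (p k \<ominus>\<^bsub>C\<^esub> a)" using assms by (intro C.qn_diff_commute)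
    finally show ?thesis using assms(5)[of k] assms(6)[of k] assms(7)[of k] by (simp add: algebra_simps)
  qed
  from C.nonpos_if_le_geometric[OF _ _ this] have "C.qn (a \<ominus>\<^bsub>C\<^esub> c) \<le> 0" by simp
  then show ?thesis using assms C.qn_zero_imp by (simp add: C.cg_def)
qed

lemma newton_eq: "newton \<psi> = (\<lambda>x. (1/2) \<odot>\<^bsub>C\<^esub> (improve \<psi> x \<oplus>\<^bsub>C\<^esub> invol C (improve \<psi> (invol F x))))"
  by (simp add: newton_def fun_eq_iff)

context
  fixes \<psi> M D r
  assumes \<psi>: "clinear_map F C \<psi>" and M: "0 \<le> M" and D: "0 \<le> D"
    and bound: "\<And>x. x \<in> carrier F \<Longrightarrow> C.qn (\<psi> x) \<le> M * nrm F x"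
    and small: "\<And>x y. x \<in> carrier F \<Longrightarrow> y \<in> carrier F \<Longrightarrow> C.qn (defect \<psi> x y) \<le> D * nrm F x * nrm F y"
    and unital: "C.qn (\<one>\<^bsub>C\<^esub> \<ominus>\<^bsub>C\<^esub> \<psi> \<one>\<^bsub>F\<^esub>) \<le> r"
begin

lemmas cl [simp] = clinear_mapD(1)[OF \<psi>] defect_closed[OF \<psi>] correction_closed[OF \<psi>]
  clinear_mapD(1)[OF improve_linear[OF \<psi>]] clinear_mapD(1)[OF newton_linear[OF \<psi>]]

lemma qn_correction:
  assumes x: "x \<in> carrier F"
  shows "C.qn (correction \<psi> x) \<le> M * kappa * D * nrm F x"
proof -
  have "C.qn (correction \<psi> x) \<le> (\<Sum>i<N. C.qn (\<psi> (e i) \<otimes>\<^bsub>C\<^esub> defect \<psi> (b i) x))"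
    unfolding correction_def using x by (intro C.qn_finsum_le) auto
  also have "\<dots> \<le> (\<Sum>i<N. (M * nrm F (e i)) * (D * nrm F (b i) * nrm F x))"
    using x bound small by (intro sum_mono qn_mult_le) auto
  also have "\<dots> = M * kappa * D * nrm F x"
    by (simp add: kappa_def sum_distrib_left sum_distrib_right mult_ac)
  finally show ?thesis .
qed

text \<open>Three of the four terms in \<open>defect_improve\<close> are quadratic in
  \<open>D\<close>. The remaining one is only linear in \<open>D\<close> and carries
  \<open>r\<close>, the bound on the distance of \<open>\<psi>\<close> of the unit from 1; a small
  fixed \<open>r\<close> therefore yields a fixed contraction factor.\<close>

lemma qn_defect_improve:
  assumes x: "x \<in> carrier F" and y: "y \<in> carrier F"
  shows "C.qn (defect (improve \<psi>) x y) \<le> (r + 2 * kappa * D + (M * kappa)\<^sup>2 * D) * D * nrm F x * nrm F y"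
proof -
  let ?d = "defect \<psi> x y" and ?h = "correction \<psi>"
  let ?S1 = "\<Oplus>\<^bsub>C\<^esub>i\<in>{..<N}. defect \<psi> x (e i) \<otimes>\<^bsub>C\<^esub> defect \<psi> (b i) y"
  let ?S2 = "\<Oplus>\<^bsub>C\<^esub>i\<in>{..<N}. defect \<psi> (e i) (b i)"
  have c: "?S1 \<in> carrier C" "?S2 \<in> carrier C" using x y by (auto intro!: C.finsum_closed)
  have 1: "C.qn ((\<one>\<^bsub>C\<^esub> \<ominus>\<^bsub>C\<^esub> \<psi> \<one>\<^bsub>F\<^esub>) \<otimes>\<^bsub>C\<^esub> ?d) \<le> r * (D * nrm F x * nrm F y)"
    using x y small unital by (intro qn_mult_le) auto
  have "C.qn ?S1 \<le> (\<Sum>i<N. C.qn (defect \<psi> x (e i) \<otimes>\<^bsub>C\<^esub> defect \<psi> (b i) y))"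
    using x y by (intro C.qn_finsum_le) auto
  also have "\<dots> \<le> (\<Sum>i<N. (D * nrm F x * nrm F (e i)) * (D * nrm F (b i) * nrm F y))"
    using x y small by (intro sum_mono qn_mult_le) auto
  also have "\<dots> = kappa * D * D * nrm F x * nrm F y"
    by (simp add: kappa_def sum_distrib_left sum_distrib_right mult_ac)
  finally have 2: "C.qn ?S1 \<le> kappa * D * D * nrm F x * nrm F y" .
  have "C.qn ?S2 \<le> (\<Sum>i<N. C.qn (defect \<psi> (e i) (b i)))" by (intro C.qn_finsum_le) auto
  also have "\<dots> \<le> (\<Sum>i<N. D * nrm F (e i) * nrm F (b i))" using small by (intro sum_mono) auto
  also have "\<dots> = kappa * D" by (simp add: kappa_def sum_distrib_left sum_distrib_right mult_ac)
  finally have 3: "C.qn (?S2 \<otimes>\<^bsub>C\<^esub> ?d) \<le> (kappa * D) * (D * nrm F x * nrm F y)"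
    using x y small c by (intro qn_mult_le) auto
  have 4: "C.qn (?h x \<otimes>\<^bsub>C\<^esub> ?h y) \<le> (M * kappa * D * nrm F x) * (M * kappa * D * nrm F y)"
    using x y qn_correction by (intro qn_mult_le) auto
  have "C.qn (defect (improve \<psi>) x y) \<le> (C.qn ((\<one>\<^bsub>C\<^esub> \<ominus>\<^bsub>C\<^esub> \<psi> \<one>\<^bsub>F\<^esub>) \<otimes>\<^bsub>C\<^esub> ?d) + C.qn ?S1) +
      (C.qn (?S2 \<otimes>\<^bsub>C\<^esub> ?d) + C.qn (?h x \<otimes>\<^bsub>C\<^esub> ?h y))"
    unfolding defect_improve[OF \<psi> x y] using x y c
    by (intro order_trans[OF C.qn_add] order_trans[OF C.qn_diff] add_mono C.qn_add C.qn_diff) auto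
  also have "\<dots> \<le> (r * (D * nrm F x * nrm F y) + kappa * D * D * nrm F x * nrm F y) +
      ((kappa * D) * (D * nrm F x * nrm F y) + (M * kappa * D * nrm F x) * (M * kappa * D * nrm F y))"
    by (intro add_mono 1 2 3 4)
  also have "\<dots> = (r + 2 * kappa * D + (M * kappa)\<^sup>2 * D) * D * nrm F x * nrm F y"
    by (simp add: algebra_simps power2_eq_square)
  finally show ?thesis .
qed

context
  assumes star: "\<And>x. x \<in> carrier F \<Longrightarrow> \<psi> (invol F x) = invol C (\<psi> x)"
begin

lemma qn_newton_step:
  assumes x: "x \<in> carrier F"
  shows "C.qn (newton \<psi> x \<ominus>\<^bsub>C\<^esub> \<psi> x) \<le> M * kappa * D * nrm F x"
proof -
  have "\<psi> x = (1/2) \<odot>\<^bsub>C\<^esub> (\<psi> x \<oplus>\<^bsub>C\<^esub> \<psi> x)" using x by (simp add: C.sm_add_r flip: C.sm_add_l)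
  then have "newton \<psi> x \<ominus>\<^bsub>C\<^esub> \<psi> x = newton \<psi> x \<ominus>\<^bsub>C\<^esub> (1/2) \<odot>\<^bsub>C\<^esub> (\<psi> x \<oplus>\<^bsub>C\<^esub> \<psi> x)" by simp
  also have "\<dots> = (1/2) \<odot>\<^bsub>C\<^esub> (correction \<psi> x \<oplus>\<^bsub>C\<^esub> invol C (correction \<psi> (invol F x)))"
  proof -
    have "(p \<oplus>\<^bsub>C\<^esub> u) \<oplus>\<^bsub>C\<^esub> (p \<oplus>\<^bsub>C\<^esub> v) \<ominus>\<^bsub>C\<^esub> (p \<oplus>\<^bsub>C\<^esub> p) = u \<oplus>\<^bsub>C\<^esub> v"
      if "p \<in> carrier C" "u \<in> carrier C" "v \<in> carrier C" for p u v
    proof -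
      have "(p \<oplus>\<^bsub>C\<^esub> u) \<oplus>\<^bsub>C\<^esub> (p \<oplus>\<^bsub>C\<^esub> v) = (p \<oplus>\<^bsub>C\<^esub> p) \<oplus>\<^bsub>C\<^esub> (u \<oplus>\<^bsub>C\<^esub> v)" using that by (simp add: C.a_ac)
      then show ?thesis
        using that C.add_diff_add[of "p \<oplus>\<^bsub>C\<^esub> p" "u \<oplus>\<^bsub>C\<^esub> v" "p \<oplus>\<^bsub>C\<^esub> p" "\<zero>\<^bsub>C\<^esub>"] by simp
    qed
    then show ?thesis
      using x by (simp add: newton_def improve_def star C.invol_add C.invol_invol flip: C.sm_diff)
  qed
  finally have "C.qn (newton \<psi> x \<ominus>\<^bsub>C\<^esub> \<psi> x) \<le>
      cmod (1/2) * C.qn (correction \<psi> x \<oplus>\<^bsub>C\<^esub> invol C (correction \<psi> (invol F x)))"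
    using x by (simp only:) (rule C.qn_smult, simp)
  also have "C.qn (correction \<psi> x \<oplus>\<^bsub>C\<^esub> invol C (correction \<psi> (invol F x))) \<le>
      C.qn (correction \<psi> x) + C.qn (correction \<psi> (invol F x))"
    using x C.qn_add[of "correction \<psi> x" "invol C (correction \<psi> (invol F x))"] by (simp add: C.qn_invol)
  also have "\<dots> \<le> M * kappa * D * nrm F x + M * kappa * D * nrm F x"
    using qn_correction[OF x] qn_correction[of "invol F x"] x by (intro add_mono) (simp_all add: F.nrm_invol)
  finally show ?thesis by (simp add: mult_ac)
qed

text \<open>Compared with \<open>qn_defect_improve\<close> there is one more summand
  \<open>(M * kappa)^2 * D\<close>. It comes from the last term of \<open>defect_mean\<close>, where
  the two averaged maps differ by at most \<open>2 * M * kappa * D\<close> times the norm.\<close>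

lemma qn_defect_newton:
  assumes x: "x \<in> carrier F" and y: "y \<in> carrier F"
  shows "C.qn (defect (newton \<psi>) x y) \<le> (r + 2 * kappa * D + 2 * (M * kappa)\<^sup>2 * D) * D * nrm F x * nrm F y"
proof -
  let ?p = "improve \<psi>" and ?q = "\<lambda>x. invol C (improve \<psi> (invol F x))"
  define B where "B = (r + 2 * kappa * D + (M * kappa)\<^sup>2 * D) * D * nrm F x * nrm F y"
  note p = improve_linear[OF \<psi>]
  note q = invol_linear_invol[OF p]
  have dp: "C.qn (defect ?p x y) \<le> B" unfolding B_def by (rule qn_defect_improve[OF x y])
  have dq: "C.qn (defect ?q x y) \<le> B"
    using qn_defect_improve[of "invol F y" "invol F x"] x y
    by (simp add: B_def defect_invol[OF p] C.qn_invol defect_closed[OF p] F.nrm_invol mult_ac)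
  have pq: "C.qn (?p z \<ominus>\<^bsub>C\<^esub> ?q z) \<le> 2 * (M * kappa * D * nrm F z)" if z: "z \<in> carrier F" for z
  proof -
    have "?p z \<ominus>\<^bsub>C\<^esub> ?q z = correction \<psi> z \<ominus>\<^bsub>C\<^esub> invol C (correction \<psi> (invol F z))"
      using z by (simp add: improve_def star C.invol_add C.invol_invol C.add_diff_add)
    then have "C.qn (?p z \<ominus>\<^bsub>C\<^esub> ?q z) \<le> C.qn (correction \<psi> z) + C.qn (correction \<psi> (invol F z))"
      using z C.qn_diff[of "correction \<psi> z" "invol C (correction \<psi> (invol F z))"] by (simp add: C.qn_invol)
    then show ?thesis using qn_correction[OF z] qn_correction[of "invol F z"] z by (simp add: F.nrm_invol)
  qed
  have c: "defect ?p x y \<in> carrier C" "defect ?q x y \<in> carrier C"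
    "?p x \<ominus>\<^bsub>C\<^esub> ?q x \<in> carrier C" "?p y \<ominus>\<^bsub>C\<^esub> ?q y \<in> carrier C"
    using x y defect_closed[OF p] defect_closed[OF q] by auto
  have "C.qn (defect (newton \<psi>) x y) \<le> C.qn ((1/2) \<odot>\<^bsub>C\<^esub> (defect ?p x y \<oplus>\<^bsub>C\<^esub> defect ?q x y)) +
      C.qn ((1/4) \<odot>\<^bsub>C\<^esub> ((?p x \<ominus>\<^bsub>C\<^esub> ?q x) \<otimes>\<^bsub>C\<^esub> (?p y \<ominus>\<^bsub>C\<^esub> ?q y)))"
    unfolding newton_eq defect_mean[OF p q x y] using c by (intro C.qn_add) auto
  also have "C.qn ((1/2) \<odot>\<^bsub>C\<^esub> (defect ?p x y \<oplus>\<^bsub>C\<^esub> defect ?q x y)) \<le> cmod (1/2) * (B + B)"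
    using c dp dq C.qn_add[of "defect ?p x y" "defect ?q x y"]
    by (intro order_trans[OF C.qn_smult] mult_left_mono) auto
  also have "C.qn ((1/4) \<odot>\<^bsub>C\<^esub> ((?p x \<ominus>\<^bsub>C\<^esub> ?q x) \<otimes>\<^bsub>C\<^esub> (?p y \<ominus>\<^bsub>C\<^esub> ?q y))) \<le>
      cmod (1/4) * ((2 * (M * kappa * D * nrm F x)) * (2 * (M * kappa * D * nrm F y)))"
    using c pq[OF x] pq[OF y] by (intro order_trans[OF C.qn_smult] mult_left_mono qn_mult_le) auto
  finally show ?thesis unfolding B_def by (simp add: algebra_simps power2_eq_square)
qed

end

end

section \<open>Convergence of the Newton iteration\<close>

context
  fixes \<psi> M D
  assumes \<psi>: "clinear_map F C \<psi>" and M: "1 \<le> M" and D: "0 \<le> D"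
    and bound: "\<And>x. x \<in> carrier F \<Longrightarrow> C.qn (\<psi> x) \<le> (M - 1) * nrm F x"
    and small: "\<And>x y. x \<in> carrier F \<Longrightarrow> y \<in> carrier F \<Longrightarrow> C.qn (defect \<psi> x y) \<le> D * nrm F x * nrm F y"
    and unital: "C.qn (\<one>\<^bsub>C\<^esub> \<ominus>\<^bsub>C\<^esub> \<psi> \<one>\<^bsub>F\<^esub>) \<le> 1/8"
    and star: "\<And>x. x \<in> carrier F \<Longrightarrow> \<psi> (invol F x) = invol C (\<psi> x)"
    and D1: "2 * M * kappa * D \<le> 1/8" and D2: "(2 * kappa + 2 * (M * kappa)\<^sup>2) * D \<le> 1/4"
begin

definition iter :: "nat \<Rightarrow> 'f \<Rightarrow> 'c" where
  "iter k = (newton ^^ k) \<psi>"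

lemma iter_0: "iter 0 = \<psi>" and iter_Suc: "iter (Suc k) = newton (iter k)"
  by (simp_all add: iter_def)

lemma iter_star_linear:
  "clinear_map F C (iter k) \<and> (\<forall>x\<in>carrier F. iter k (invol F x) = invol C (iter k x))"
  by (induction k) (simp_all add: iter_0 iter_Suc \<psi> star newton_linear newton_invol)

lemma iter_linear: "clinear_map F C (iter k)"
  using iter_star_linear by blast

lemma iter_closed [simp]: "x \<in> carrier F \<Longrightarrow> iter k x \<in> carrier C"
  using clinear_mapD(1)[OF iter_linear] .

lemma psi_closed [simp]: "x \<in> carrier F \<Longrightarrow> \<psi> x \<in> carrier C"
  using clinear_mapD(1)[OF \<psi>] .

text \<open>The constants contain a reserve for the drift, which by \<open>D1\<close> is at most 1/8
  in total: the bound \<open>M - 1\<close> grows to at most \<open>M\<close>, and the distance from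
  the unit grows from 1/8 to at most 1/4.\<close>

lemma iter_bounds_from_drift:
  assumes "\<And>x. x \<in> carrier F \<Longrightarrow> C.qn (iter k x \<ominus>\<^bsub>C\<^esub> \<psi> x) \<le> 2 * M * kappa * D * (1 - (1/2) ^ k) * nrm F x"
  shows "x \<in> carrier F \<Longrightarrow> C.qn (iter k x) \<le> M * nrm F x"
    and "C.qn (\<one>\<^bsub>C\<^esub> \<ominus>\<^bsub>C\<^esub> iter k \<one>\<^bsub>F\<^esub>) \<le> 1/4"
proof -
  have nn: "0 \<le> 2 * M * kappa * D" using M D kappa_nonneg by simp
  have "2 * M * kappa * D * (1 - (1/2) ^ k) \<le> 2 * M * kappa * D * 1" using nn by (intro mult_left_mono) auto
  then have le: "2 * M * kappa * D * (1 - (1/2) ^ k) \<le> 1/8" using D1 by simp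
  have drift: "C.qn (iter k x \<ominus>\<^bsub>C\<^esub> \<psi> x) \<le> 1/8 * nrm F x" if x: "x \<in> carrier F" for x
    using assms[OF x] mult_right_mono[OF le F.nrm_nonneg[OF x]] by linarith
  show "C.qn (iter k x) \<le> M * nrm F x" if x: "x \<in> carrier F"
  proof -
    have "C.qn (iter k x) \<le> 1/8 * nrm F x + (M - 1) * nrm F x"
      using C.qn_le_diff[of "iter k x" "\<psi> x"] drift[OF x] bound[OF x] x by simp
    then show ?thesis using F.nrm_nonneg[OF x] by (simp add: algebra_simps)
  qed
  have "C.qn (\<one>\<^bsub>C\<^esub> \<ominus>\<^bsub>C\<^esub> iter k \<one>\<^bsub>F\<^esub>) \<le> C.qn (\<one>\<^bsub>C\<^esub> \<ominus>\<^bsub>C\<^esub> \<psi> \<one>\<^bsub>F\<^esub>) + C.qn (\<psi> \<one>\<^bsub>F\<^esub> \<ominus>\<^bsub>C\<^esub> iter k \<one>\<^bsub>F\<^esub>)"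
    by (rule C.qn_triangle) auto
  also have "C.qn (\<psi> \<one>\<^bsub>F\<^esub> \<ominus>\<^bsub>C\<^esub> iter k \<one>\<^bsub>F\<^esub>) \<le> 1/8 * nrm F \<one>\<^bsub>F\<^esub>"
    using drift[OF F.one_closed] by (simp add: C.qn_diff_commute)
  finally show "C.qn (\<one>\<^bsub>C\<^esub> \<ominus>\<^bsub>C\<^esub> iter k \<one>\<^bsub>F\<^esub>) \<le> 1/4" using unital F.nrm_one_le by simp
qed

text \<open>The two bounds go together, because a step estimate needs the size of the current map,
  which the drift controls. With 1/4 from the unit and 1/4 from \<open>D2\<close> the defect is
  multiplied by at most 1/2, and the drifts add up to a geometric series of total
  \<open>2 * M * kappa * D\<close>.\<close>

lemma iter_invariant:
  "(\<forall>x\<in>carrier F. \<forall>y\<in>carrier F. C.qn (defect (iter k) x y) \<le> D * (1/2) ^ k * nrm F x * nrm F y) \<and>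
   (\<forall>x\<in>carrier F. C.qn (iter k x \<ominus>\<^bsub>C\<^esub> \<psi> x) \<le> 2 * M * kappa * D * (1 - (1/2) ^ k) * nrm F x)"
proof (induction k)
  case 0
  then show ?case using small by (simp add: iter_0 C.qn_J)
next
  case (Suc k)
  define E where "E = D * (1/2) ^ k"
  have E: "0 \<le> E" "E \<le> D" using D by (auto simp: E_def mult_left_le power_le_one)
  have def: "C.qn (defect (iter k) x y) \<le> E * nrm F x * nrm F y" if "x \<in> carrier F" "y \<in> carrier F" for x y
    using Suc that by (simp add: E_def)
  have drift: "C.qn (iter k x \<ominus>\<^bsub>C\<^esub> \<psi> x) \<le> 2 * M * kappa * D * (1 - (1/2) ^ k) * nrm F x" if "x \<in> carrier F" for x
    using Suc that by blast
  note bnd = iter_bounds_from_drift[OF drift]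
  have st: "iter k (invol F x) = invol C (iter k x)" if "x \<in> carrier F" for x
    using iter_star_linear that by blast
  have M0: "0 \<le> M" using M by simp
  show ?case
  proof (intro conjI ballI)
    fix x y assume xy: "x \<in> carrier F" "y \<in> carrier F"
    have "C.qn (defect (iter (Suc k)) x y) \<le>
        (1/4 + 2 * kappa * E + 2 * (M * kappa)\<^sup>2 * E) * E * nrm F x * nrm F y"
      unfolding iter_Suc by (rule qn_defect_newton[OF iter_linear M0 E(1) bnd(1) def bnd(2) st xy])
    also have "\<dots> \<le> 1/2 * E * nrm F x * nrm F y"
    proof -
      have "(2 * kappa + 2 * (M * kappa)\<^sup>2) * E \<le> (2 * kappa + 2 * (M * kappa)\<^sup>2) * D"
        using E kappa_nonneg by (intro mult_left_mono) auto
      then have "1/4 + 2 * kappa * E + 2 * (M * kappa)\<^sup>2 * E \<le> 1/2" using D2 by (simp add: algebra_simps)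
      then show ?thesis using E F.nrm_nonneg xy by (intro mult_right_mono) auto
    qed
    finally show "C.qn (defect (iter (Suc k)) x y) \<le> D * (1/2) ^ Suc k * nrm F x * nrm F y"
      by (simp add: E_def)
  next
    fix x assume x: "x \<in> carrier F"
    have "C.qn (iter (Suc k) x \<ominus>\<^bsub>C\<^esub> iter k x) \<le> M * kappa * E * nrm F x"
      unfolding iter_Suc by (rule qn_newton_step[OF iter_linear M0 E(1) bnd(1) def bnd(2) st x])
    moreover have "C.qn (iter (Suc k) x \<ominus>\<^bsub>C\<^esub> \<psi> x) \<le>
        C.qn (iter (Suc k) x \<ominus>\<^bsub>C\<^esub> iter k x) + C.qn (iter k x \<ominus>\<^bsub>C\<^esub> \<psi> x)"
      using x by (intro C.qn_triangle) auto
    ultimately have "C.qn (iter (Suc k) x \<ominus>\<^bsub>C\<^esub> \<psi> x) \<le>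
        M * kappa * E * nrm F x + 2 * M * kappa * D * (1 - (1/2) ^ k) * nrm F x"
      using drift[OF x] by linarith
    also have "\<dots> = 2 * M * kappa * D * (1 - (1/2) ^ Suc k) * nrm F x"
      by (simp add: E_def algebra_simps)
    finally show "C.qn (iter (Suc k) x \<ominus>\<^bsub>C\<^esub> \<psi> x) \<le> 2 * M * kappa * D * (1 - (1/2) ^ Suc k) * nrm F x" .
  qed
qed

lemma iter_step:
  assumes x: "x \<in> carrier F"
  shows "C.qn (iter (Suc k) x \<ominus>\<^bsub>C\<^esub> iter k x) \<le> M * kappa * D * nrm F x * (1/2) ^ k"
proof -
  have drift: "C.qn (iter k x \<ominus>\<^bsub>C\<^esub> \<psi> x) \<le> 2 * M * kappa * D * (1 - (1/2) ^ k) * nrm F x" if "x \<in> carrier F" for x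
    using iter_invariant that by blast
  have st: "iter k (invol F x) = invol C (iter k x)" if "x \<in> carrier F" for x
    using iter_star_linear that by blast
  have def: "C.qn (defect (iter k) x y) \<le> D * (1/2) ^ k * nrm F x * nrm F y"
    if "x \<in> carrier F" "y \<in> carrier F" for x y
    using iter_invariant that by blast
  have M0: "0 \<le> M" "0 \<le> D * (1/2) ^ k" using M D by auto
  note bnd = iter_bounds_from_drift[OF drift]
  have "C.qn (iter (Suc k) x \<ominus>\<^bsub>C\<^esub> iter k x) \<le> M * kappa * (D * (1/2) ^ k) * nrm F x"
    unfolding iter_Suc by (rule qn_newton_step[OF iter_linear M0 bnd(1) def bnd(2) st x])
  then show ?thesis by (simp add: mult_ac)
qed

lemma iter_limit_exists:
  "\<exists>l. hom_mod F C J l \<and> (\<forall>x\<in>carrier F. \<exists>K. \<forall>k. C.qn (iter k x \<ominus>\<^bsub>C\<^esub> l x) \<le> K * (1/2) ^ k)"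
proof -
  have "\<exists>l\<in>carrier C. \<exists>K. \<forall>k. C.qn (iter k x \<ominus>\<^bsub>C\<^esub> l) \<le> K * (1/2) ^ k" if x: "x \<in> carrier F" for x
    by (rule C.qn_geometric_limit[OF _ _ _ iter_step[OF x]]) (use x in auto)
  then obtain l B where l [simp]: "\<And>x. x \<in> carrier F \<Longrightarrow> l x \<in> carrier C"
    and lim: "\<And>x k. x \<in> carrier F \<Longrightarrow> C.qn (iter k x \<ominus>\<^bsub>C\<^esub> l x) \<le> B x * (1/2) ^ k" by metis
  note it = clinear_mapD[OF iter_linear]
  have add: "C.cg (l (x \<oplus>\<^bsub>F\<^esub> y)) (l x \<oplus>\<^bsub>C\<^esub> l y)" if xy: "x \<in> carrier F" "y \<in> carrier F" for x y
  proof (rule cg_limit)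
    fix k
    show "C.qn (iter k (x \<oplus>\<^bsub>F\<^esub> y) \<ominus>\<^bsub>C\<^esub> l (x \<oplus>\<^bsub>F\<^esub> y)) \<le> B (x \<oplus>\<^bsub>F\<^esub> y) * (1/2) ^ k" using xy by (simp add: lim)
    have "C.qn (iter k x \<oplus>\<^bsub>C\<^esub> iter k y \<ominus>\<^bsub>C\<^esub> (l x \<oplus>\<^bsub>C\<^esub> l y)) \<le> C.qn (iter k x \<ominus>\<^bsub>C\<^esub> l x) + C.qn (iter k y \<ominus>\<^bsub>C\<^esub> l y)"
      using xy C.qn_add[of "iter k x \<ominus>\<^bsub>C\<^esub> l x" "iter k y \<ominus>\<^bsub>C\<^esub> l y"] by (simp add: C.add_diff_add)
    then show "C.qn (iter k x \<oplus>\<^bsub>C\<^esub> iter k y \<ominus>\<^bsub>C\<^esub> (l x \<oplus>\<^bsub>C\<^esub> l y)) \<le> (B x + B y) * (1/2) ^ k"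
      using lim[OF xy(1), of k] lim[OF xy(2), of k] by (simp add: algebra_simps)
    show "C.qn (iter k (x \<oplus>\<^bsub>F\<^esub> y) \<ominus>\<^bsub>C\<^esub> (iter k x \<oplus>\<^bsub>C\<^esub> iter k y)) \<le> 0 * (1/2) ^ k"
      using xy by (simp add: it C.qn_J)
  qed (use xy in auto)
  have smult: "C.cg (l (c \<odot>\<^bsub>F\<^esub> x)) (c \<odot>\<^bsub>C\<^esub> l x)" if x: "x \<in> carrier F" for c x
  proof (rule cg_limit)
    fix k
    show "C.qn (iter k (c \<odot>\<^bsub>F\<^esub> x) \<ominus>\<^bsub>C\<^esub> l (c \<odot>\<^bsub>F\<^esub> x)) \<le> B (c \<odot>\<^bsub>F\<^esub> x) * (1/2) ^ k" using x by (simp add: lim)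
    have "C.qn (c \<odot>\<^bsub>C\<^esub> iter k x \<ominus>\<^bsub>C\<^esub> c \<odot>\<^bsub>C\<^esub> l x) \<le> cmod c * C.qn (iter k x \<ominus>\<^bsub>C\<^esub> l x)"
      using x C.qn_smult[of "iter k x \<ominus>\<^bsub>C\<^esub> l x" c] by (simp add: C.sm_diff)
    also have "\<dots> \<le> cmod c * (B x * (1/2) ^ k)" using lim[OF x] by (intro mult_left_mono) auto
    finally show "C.qn (c \<odot>\<^bsub>C\<^esub> iter k x \<ominus>\<^bsub>C\<^esub> c \<odot>\<^bsub>C\<^esub> l x) \<le> (cmod c * B x) * (1/2) ^ k" by (simp add: mult_ac)
    show "C.qn (iter k (c \<odot>\<^bsub>F\<^esub> x) \<ominus>\<^bsub>C\<^esub> c \<odot>\<^bsub>C\<^esub> iter k x) \<le> 0 * (1/2) ^ k"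
      using x by (simp add: it C.qn_J)
  qed (use x in auto)
  have inv: "C.cg (l (invol F x)) (invol C (l x))" if x: "x \<in> carrier F" for x
  proof (rule cg_limit)
    fix k
    show "C.qn (iter k (invol F x) \<ominus>\<^bsub>C\<^esub> l (invol F x)) \<le> B (invol F x) * (1/2) ^ k" using x by (simp add: lim)
    show "C.qn (invol C (iter k x) \<ominus>\<^bsub>C\<^esub> invol C (l x)) \<le> B x * (1/2) ^ k"
      using x lim[OF x, of k] by (simp add: C.qn_invol flip: C.invol_diff)
    show "C.qn (iter k (invol F x) \<ominus>\<^bsub>C\<^esub> invol C (iter k x)) \<le> 0 * (1/2) ^ k"
      using x iter_star_linear by (simp add: C.qn_J)
  qed (use x in auto)
  have mult: "C.cg (l (x \<otimes>\<^bsub>F\<^esub> y)) (l x \<otimes>\<^bsub>C\<^esub> l y)" if xy: "x \<in> carrier F" "y \<in> carrier F" for x y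
  proof (rule cg_limit)
    fix k
    show "C.qn (iter k (x \<otimes>\<^bsub>F\<^esub> y) \<ominus>\<^bsub>C\<^esub> l (x \<otimes>\<^bsub>F\<^esub> y)) \<le> B (x \<otimes>\<^bsub>F\<^esub> y) * (1/2) ^ k" using xy by (simp add: lim)
    have "iter k x \<otimes>\<^bsub>C\<^esub> iter k y \<ominus>\<^bsub>C\<^esub> l x \<otimes>\<^bsub>C\<^esub> l y =
        iter k x \<otimes>\<^bsub>C\<^esub> (iter k y \<ominus>\<^bsub>C\<^esub> l y) \<oplus>\<^bsub>C\<^esub> (iter k x \<ominus>\<^bsub>C\<^esub> l x) \<otimes>\<^bsub>C\<^esub> l y"
      using xy by (simp add: C.mult_diff_l C.mult_diff_r C.diff_telescope)
    then have "C.qn (iter k x \<otimes>\<^bsub>C\<^esub> iter k y \<ominus>\<^bsub>C\<^esub> l x \<otimes>\<^bsub>C\<^esub> l y) \<le>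
        C.qn (iter k x \<otimes>\<^bsub>C\<^esub> (iter k y \<ominus>\<^bsub>C\<^esub> l y)) + C.qn ((iter k x \<ominus>\<^bsub>C\<^esub> l x) \<otimes>\<^bsub>C\<^esub> l y)"
      using xy by (simp add: C.qn_add)
    also have "C.qn (iter k x \<otimes>\<^bsub>C\<^esub> (iter k y \<ominus>\<^bsub>C\<^esub> l y)) \<le> M * nrm F x * (B y * (1/2) ^ k)"
      using xy lim iter_bounds_from_drift(1) iter_invariant by (intro qn_mult_le) auto
    also have "C.qn ((iter k x \<ominus>\<^bsub>C\<^esub> l x) \<otimes>\<^bsub>C\<^esub> l y) \<le> (B x * (1/2) ^ k) * C.qn (l y)"
      using xy lim by (intro qn_mult_le) auto
    finally show "C.qn (iter k x \<otimes>\<^bsub>C\<^esub> iter k y \<ominus>\<^bsub>C\<^esub> l x \<otimes>\<^bsub>C\<^esub> l y) \<le>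
        (M * nrm F x * B y + B x * C.qn (l y)) * (1/2) ^ k" by (simp add: algebra_simps)
    have "C.qn (defect (iter k) x y) \<le> D * (1/2) ^ k * nrm F x * nrm F y" using iter_invariant xy by blast
    then show "C.qn (iter k (x \<otimes>\<^bsub>F\<^esub> y) \<ominus>\<^bsub>C\<^esub> iter k x \<otimes>\<^bsub>C\<^esub> iter k y) \<le> (D * nrm F x * nrm F y) * (1/2) ^ k"
      by (simp add: defect_def mult_ac)
  qed (use xy in auto)
  \<comment> \<open>\<open>?f\<close>, which is 1 minus the image of the unit, is idempotent modulo
    \<open>J\<close> and has seminorm at most 1/2. Its seminorm \<open>a\<close> satisfies
    \<open>a \<le> a^2 \<le> a / 2\<close> and hence vanishes.\<close>
  have one: "C.cg (l \<one>\<^bsub>F\<^esub>) \<one>\<^bsub>C\<^esub>"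
  proof -
    let ?f = "\<one>\<^bsub>C\<^esub> \<ominus>\<^bsub>C\<^esub> l \<one>\<^bsub>F\<^esub>"
    have f: "?f \<in> carrier C" by simp
    have "?f \<otimes>\<^bsub>C\<^esub> ?f = ?f \<ominus>\<^bsub>C\<^esub> (l \<one>\<^bsub>F\<^esub> \<ominus>\<^bsub>C\<^esub> l \<one>\<^bsub>F\<^esub> \<otimes>\<^bsub>C\<^esub> l \<one>\<^bsub>F\<^esub>)"
      by (simp add: C.alg_simps)
    also have "C.cg (?f \<ominus>\<^bsub>C\<^esub> (l \<one>\<^bsub>F\<^esub> \<ominus>\<^bsub>C\<^esub> l \<one>\<^bsub>F\<^esub> \<otimes>\<^bsub>C\<^esub> l \<one>\<^bsub>F\<^esub>)) (?f \<ominus>\<^bsub>C\<^esub> \<zero>\<^bsub>C\<^esub>)"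
      using mult[of "\<one>\<^bsub>F\<^esub>" "\<one>\<^bsub>F\<^esub>"] by (intro C.cg_diff C.cg_refl) (auto simp: C.cg_zero_iff C.cg_def)
    finally have "C.cg (?f \<otimes>\<^bsub>C\<^esub> ?f) ?f" by simp
    from C.qn_cong[OF this] have "C.qn ?f \<le> C.qn ?f * C.qn ?f" using C.qn_mult[OF f f] by simp
    moreover have "C.qn ?f \<le> 1/2"
    proof -
      have "C.qn ?f - 1/4 \<le> B \<one>\<^bsub>F\<^esub> * (1/2) ^ k" for k
      proof -
        have "C.qn ?f \<le> C.qn (\<one>\<^bsub>C\<^esub> \<ominus>\<^bsub>C\<^esub> iter k \<one>\<^bsub>F\<^esub>) + C.qn (iter k \<one>\<^bsub>F\<^esub> \<ominus>\<^bsub>C\<^esub> l \<one>\<^bsub>F\<^esub>)"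
          by (rule C.qn_triangle) auto
        also have "C.qn (\<one>\<^bsub>C\<^esub> \<ominus>\<^bsub>C\<^esub> iter k \<one>\<^bsub>F\<^esub>) \<le> 1/4"
          using iter_bounds_from_drift(2) iter_invariant by blast
        also have "C.qn (iter k \<one>\<^bsub>F\<^esub> \<ominus>\<^bsub>C\<^esub> l \<one>\<^bsub>F\<^esub>) \<le> B \<one>\<^bsub>F\<^esub> * (1/2) ^ k" by (simp add: lim)
        finally show ?thesis by simp
      qed
      from C.nonpos_if_le_geometric[OF _ _ this] show ?thesis by simp
    qed
    ultimately have "C.qn ?f \<le> C.qn ?f * (1/2)"
      using mult_left_mono[of "C.qn ?f" "1/2" "C.qn ?f"] C.qn_nonneg[OF f] by linarith
    then have "?f \<in> J" using C.qn_zero_imp[OF f] by simp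
    then have "C.cg \<one>\<^bsub>C\<^esub> (l \<one>\<^bsub>F\<^esub>)" by (simp add: C.cg_def)
    then show ?thesis by (rule C.cg_sym)
  qed
  have "hom_mod F C J l"
    unfolding hom_mod_def by (simp add: add mult smult inv one)
  then show ?thesis using lim by (intro exI[of _ l]) auto
qed

end

end

section \<open>Newton steps respect equivariance and congruences\<close>

context approximate_hom
begin

text \<open>Transport by \<open>\<sigma>\<close> replaces the dual bases in
  \<open>correction\<close> by their images, and by \<open>casimir_automorphism\<close> the sum over
  dual bases does not change.\<close>

lemma improve_equivariant:
  assumes \<psi>: "clinear_map F C \<psi>" and \<sigma>: "\<sigma> \<in> cstar_aut F" and \<tau>: "star_hom C C \<tau>"
    and eq: "\<And>x. x \<in> carrier F \<Longrightarrow> \<psi> (\<sigma> x) = \<tau> (\<psi> x)" and x: "x \<in> carrier F"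
  shows "improve \<psi> (\<sigma> x) = \<tau> (improve \<psi> x)"
proof -
  have \<sigma>h: "star_hom F F \<sigma>" using \<sigma> by (simp add: cstar_aut_def)
  note s = star_homD[OF \<sigma>h] and t = star_homD[OF \<tau>] and l = clinear_mapD[OF \<psi>]
  have d: "defect \<psi> (\<sigma> p) (\<sigma> q) = \<tau> (defect \<psi> p q)" if "p \<in> carrier F" "q \<in> carrier F" for p q
    using that star_hom_diff[OF C_cstar C_cstar \<tau>] by (simp add: defect_def l t eq flip: s(3))
  have bil: "cbilinear_map F F C (\<lambda>p q. \<psi> p \<otimes>\<^bsub>C\<^esub> defect \<psi> q (\<sigma> x))"
    unfolding cbilinear_map_def using x
    by (auto intro!: clinear_mapI simp: l s defect_closed[OF \<psi>] clinear_mapD[OF defect_linear_l[OF \<psi>]]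
        C.mult_add_left C.mult_add_right C.smult_mult_left C.smult_mult_right)
  have "correction \<psi> (\<sigma> x) = (\<Oplus>\<^bsub>C\<^esub>i\<in>{..<N}. \<psi> (\<sigma> (e i)) \<otimes>\<^bsub>C\<^esub> defect \<psi> (\<sigma> (b i)) (\<sigma> x))"
    unfolding correction_def by (rule F.casimir_automorphism[OF C_cstar bil \<sigma>, symmetric])
  also have "\<dots> = (\<Oplus>\<^bsub>C\<^esub>i\<in>{..<N}. \<tau> (\<psi> (e i) \<otimes>\<^bsub>C\<^esub> defect \<psi> (b i) x))"
    using x by (intro C.finsum_eqI) (auto simp: d eq t l defect_closed[OF \<psi>])
  also have "\<dots> = \<tau> (correction \<psi> x)"
    unfolding correction_def using x
    by (intro clinear_map_finsum[OF C_cstar C_cstar star_hom_linear[OF \<tau>], symmetric])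
      (auto simp: l defect_closed[OF \<psi>])
  finally show ?thesis using x by (simp add: improve_def eq t l correction_closed[OF \<psi>])
qed

lemma newton_equivariant:
  assumes \<psi>: "clinear_map F C \<psi>" and \<sigma>: "\<sigma> \<in> cstar_aut F" and \<tau>: "star_hom C C \<tau>"
    and eq: "\<And>x. x \<in> carrier F \<Longrightarrow> \<psi> (\<sigma> x) = \<tau> (\<psi> x)" and x: "x \<in> carrier F"
  shows "newton \<psi> (\<sigma> x) = \<tau> (newton \<psi> x)"
proof -
  have \<sigma>h: "star_hom F F \<sigma>" using \<sigma> by (simp add: cstar_aut_def)
  have i: "improve \<psi> (\<sigma> z) = \<tau> (improve \<psi> z)" if "z \<in> carrier F" for z
    by (rule improve_equivariant[OF \<psi> \<sigma> \<tau>]) (use that eq in auto)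
  note il = clinear_mapD(1)[OF improve_linear[OF \<psi>]]
  have "improve \<psi> (invol F (\<sigma> x)) = \<tau> (improve \<psi> (invol F x))"
    using i[of "invol F x"] x by (simp add: star_homD(5)[OF \<sigma>h])
  then show ?thesis using x i[OF x] by (simp add: newton_def il star_homD[OF \<tau>])
qed

text \<open>In the application \<open>J'\<close> is the limit ideal while the step is taken at a
  finite stage. Modulo \<open>J'\<close> the map \<open>\<psi>\<close> is already multiplicative, so
  its correction lies in \<open>J'\<close> and the step keeps it a lift of \<open>s\<close>.\<close>

lemma newton_cong:
  assumes "star_ideal C J'" and s: "hom_mod F C J' s" and \<psi>: "clinear_map F C \<psi>"
    and cong: "\<And>x. x \<in> carrier F \<Longrightarrow> cstar_ideal.cg C J' (\<psi> x) (s x)" and x: "x \<in> carrier F"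
  shows "cstar_ideal.cg C J' (newton \<psi> x) (s x)"
proof -
  interpret K: star_ideal C J' by fact
  note h = hom_modD[OF s] and l = clinear_mapD[OF \<psi>]
  have d: "defect \<psi> x y \<in> J'" if xy: "x \<in> carrier F" "y \<in> carrier F" for x y
  proof -
    have "K.cg (\<psi> (x \<otimes>\<^bsub>F\<^esub> y)) (s (x \<otimes>\<^bsub>F\<^esub> y))" using xy by (intro cong) simp
    also have "K.cg (s (x \<otimes>\<^bsub>F\<^esub> y)) (s x \<otimes>\<^bsub>C\<^esub> s y)" using xy by (rule h(3))
    also have "K.cg (s x \<otimes>\<^bsub>C\<^esub> s y) (\<psi> x \<otimes>\<^bsub>C\<^esub> \<psi> y)" using xy by (intro K.cg_mult K.cg_sym[OF cong])
    finally show ?thesis unfolding defect_def by (rule K.cgD(3))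
  qed
  have i: "K.cg (improve \<psi> x) (s x)" if x: "x \<in> carrier F" for x
  proof -
    have "correction \<psi> x \<in> J'"
      unfolding correction_def using x by (intro K.J_finsum K.J_mult_l d) (auto simp: l)
    then have "K.cg (\<psi> x \<oplus>\<^bsub>C\<^esub> correction \<psi> x) (s x \<oplus>\<^bsub>C\<^esub> \<zero>\<^bsub>C\<^esub>)"
      using x by (intro K.cg_add cong) (simp_all add: K.cg_zero_iff)
    then show ?thesis using x h(1) by (simp add: improve_def)
  qed
  have "K.cg (invol C (improve \<psi> (invol F x))) (invol C (s (invol F x)))"
    using x by (intro K.cg_invol i) simp
  also have "K.cg (invol C (s (invol F x))) (invol C (invol C (s x)))"
    using x by (intro K.cg_invol h(5))
  also have "invol C (invol C (s x)) = s x" using x h(1) by (simp add: C.invol_invol)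
  finally have "K.cg (newton \<psi> x) ((1/2) \<odot>\<^bsub>C\<^esub> (s x \<oplus>\<^bsub>C\<^esub> s x))"
    unfolding newton_def using x by (intro K.cg_smult K.cg_add i)
  also have "(1/2) \<odot>\<^bsub>C\<^esub> (s x \<oplus>\<^bsub>C\<^esub> s x) = s x" using x h(1) by (simp add: C.sm_add_r flip: C.sm_add_l)
  finally show ?thesis .
qed

text \<open>Expansion in both arguments reduces the defect to finitely many pairs of basis vectors.
  This matters because a common stage \<open>n\<close> can be found for finitely many elements
  only.\<close>

lemma defect_estimate:
  fixes K \<delta> :: real
  assumes \<psi>: "clinear_map F C \<psi>"
    and K: "\<And>x i. x \<in> carrier F \<Longrightarrow> i < N \<Longrightarrow> cmod (co i x) \<le> K * nrm F x" "0 \<le> K"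
    and small: "\<And>i j. i < N \<Longrightarrow> j < N \<Longrightarrow> C.qn (defect \<psi> (e i) (e j)) \<le> \<delta>" and \<delta>: "0 \<le> \<delta>"
    and xy: "x \<in> carrier F" "y \<in> carrier F"
  shows "C.qn (defect \<psi> x y) \<le> (N * K)\<^sup>2 * \<delta> * nrm F x * nrm F y"
proof -
  note dc = defect_closed[OF \<psi>]
  have expand: "C.qn (h z) \<le> N * (K * nrm F z) * B"
    if h: "clinear_map F C h" and z: "z \<in> carrier F" and B: "\<And>i. i < N \<Longrightarrow> C.qn (h (e i)) \<le> B" "0 \<le> B" for h z B
  proof -
    have "C.qn (h z) \<le> (\<Sum>i<N. C.qn (co i z \<odot>\<^bsub>C\<^esub> h (e i)))"
      unfolding F.clinear_map_expand[OF C_cstar h z] by (rule C.qn_finsum_le) (auto simp: clinear_mapD[OF h])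
    also have "\<dots> \<le> (\<Sum>i<N. (K * nrm F z) * B)"
    proof (rule sum_mono)
      fix i assume "i \<in> {..<N}"
      then have i: "i < N" by simp
      have "C.qn (co i z \<odot>\<^bsub>C\<^esub> h (e i)) \<le> cmod (co i z) * C.qn (h (e i))"
        using i by (intro C.qn_smult) (simp add: clinear_mapD[OF h])
      also have "\<dots> \<le> (K * nrm F z) * B"
        using i z K B F.nrm_nonneg[OF z] by (intro mult_mono C.qn_nonneg) (auto simp: clinear_mapD[OF h])
      finally show "C.qn (co i z \<odot>\<^bsub>C\<^esub> h (e i)) \<le> (K * nrm F z) * B" .
    qed
    finally show ?thesis by simp
  qed
  have 1: "C.qn (defect \<psi> (e i) y) \<le> N * (K * nrm F y) * \<delta>" if i: "i < N" for i
    using i xy(2) small \<delta> by (intro expand defect_linear_r[OF \<psi>]) auto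
  have "C.qn (defect \<psi> x y) \<le> N * (K * nrm F x) * (N * (K * nrm F y) * \<delta>)"
    using expand[OF defect_linear_l[OF \<psi> xy(2)] xy(1) 1] K(2) \<delta> F.nrm_nonneg[OF xy(2)] by simp
  then show ?thesis by (simp add: power2_eq_square mult_ac)
qed

end

section \<open>Increasing sequences of ideals and their limit\<close>

lemma (in unital_cstar_algebra) idealI_cstar:
  assumes "S \<subseteq> carrier A" "\<zero> \<in> S" "\<And>x y. x \<in> S \<Longrightarrow> y \<in> S \<Longrightarrow> x \<oplus> y \<in> S"
    and l: "\<And>x y. x \<in> carrier A \<Longrightarrow> y \<in> S \<Longrightarrow> x \<otimes> y \<in> S" and "\<And>x y. x \<in> S \<Longrightarrow> y \<in> carrier A \<Longrightarrow> x \<otimes> y \<in> S"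
  shows "ideal S A"
proof (rule idealI[OF ring_axioms])
  have "\<ominus> x \<in> S" if "x \<in> S" for x
    using l[of "(-1) \<odot> \<one>" x] that assms(1) by (auto simp: uminus_eq smult_mult_left subset_iff)
  then show "subgroup S (add_monoid A)"
    using assms by (intro subgroup.intro) (auto simp: a_inv_def)
qed (use assms in auto)

locale ideal_sequence = unital_cstar_algebra A for A :: "'a cstar" (structure) +
  fixes J :: "nat \<Rightarrow> 'a set" and Jinf
  assumes J_closed_ideal: "closed_ideal A (J n)" and J_Suc: "J n \<subseteq> J (Suc n)"
    and Jinf: "Jinf = cstar_topology A closure_of (\<Union>n. J n)"
begin

lemma J_mono: "m \<le> n \<Longrightarrow> J m \<subseteq> J n"
  using lift_Suc_mono_le[of J] J_Suc by blast

lemma ideal_J: "cstar_ideal A (J n)"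
  by (simp add: cstar_ideal_def cstar_ideal_axioms_def J_closed_ideal unital_cstar_algebra_axioms)

lemma J_sub: "(\<Union>n. J n) \<subseteq> carrier A"
  using cstar_ideal.J_carrier[OF ideal_J] by blast

lemma Jinf_iff: "x \<in> Jinf \<longleftrightarrow> x \<in> carrier A \<and> (\<forall>\<epsilon>>0. \<exists>n. \<exists>y\<in>J n. nrm A (x \<ominus> y) < \<epsilon>)"
  unfolding Jinf closure_of_iff[OF J_sub] by blast

lemma J_sub_Jinf: "J n \<subseteq> Jinf"
  unfolding Jinf using closure_of_subset[of "\<Union>n. J n" "cstar_topology A"] J_sub
  by (auto simp: cstar_topology_def Metric_space.topspace_mtopology[OF metric])

lemma ideal_Jinf: "cstar_ideal A Jinf"
proof -
  have carr: "y \<in> J n \<Longrightarrow> y \<in> carrier A" for y n using J_sub by blast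
  have "ideal Jinf A"
  proof (rule idealI_cstar)
    show "Jinf \<subseteq> carrier A" by (auto simp: Jinf_iff)
    show "\<zero> \<in> Jinf" using J_sub_Jinf cstar_ideal.J_zero[OF ideal_J] by blast
    fix x y
    show "x \<oplus> y \<in> Jinf" if "x \<in> Jinf" "y \<in> Jinf"
      unfolding Jinf_iff
    proof (intro conjI allI impI)
      show "x \<oplus> y \<in> carrier A" using that by (simp add: Jinf_iff)
      fix \<epsilon> :: real assume "\<epsilon> > 0"
      then have half: "\<epsilon> / 2 > 0" by simp
      obtain m u where u: "u \<in> J m" "nrm A (x \<ominus> u) < \<epsilon> / 2"
        using \<open>x \<in> Jinf\<close> half unfolding Jinf_iff by blast
      obtain n v where v: "v \<in> J n" "nrm A (y \<ominus> v) < \<epsilon> / 2"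
        using \<open>y \<in> Jinf\<close> half unfolding Jinf_iff by blast
      have "u \<in> J (max m n)" "v \<in> J (max m n)" using u v J_mono by (meson max.cobounded1 max.cobounded2 subsetD)+
      then have "u \<oplus> v \<in> J (max m n)" by (rule cstar_ideal.J_add[OF ideal_J])
      moreover have "nrm A ((x \<oplus> y) \<ominus> (u \<oplus> v)) < \<epsilon>"
        using nrm_triangle[of "x \<ominus> u" "y \<ominus> v"] u v that carr by (simp add: Jinf_iff add_diff_add)
      ultimately show "\<exists>n. \<exists>z\<in>J n. nrm A (x \<oplus> y \<ominus> z) < \<epsilon>" by blast
    qed
    show "x \<otimes> y \<in> Jinf" if x: "x \<in> carrier A" and y: "y \<in> Jinf"
      unfolding Jinf_iff
    proof (intro conjI allI impI)
      show "x \<otimes> y \<in> carrier A" using x y by (simp add: Jinf_iff)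
      fix \<epsilon> :: real assume \<epsilon>: "\<epsilon> > 0"
      have pos: "nrm A x + 1 > 0" using nrm_nonneg[OF x] by simp
      then obtain n v where v: "v \<in> J n" "nrm A (y \<ominus> v) < \<epsilon> / (nrm A x + 1)"
        using y \<epsilon> by (meson Jinf_iff divide_pos_pos)
      have "nrm A (x \<otimes> y \<ominus> x \<otimes> v) \<le> nrm A x * nrm A (y \<ominus> v)"
        using nrm_mult[of x "y \<ominus> v"] x y v carr by (simp add: Jinf_iff mult_diff_r)
      also have "\<dots> \<le> (nrm A x + 1) * nrm A (y \<ominus> v)"
        using y v carr by (intro mult_right_mono nrm_nonneg) (auto simp: Jinf_iff)
      also have "\<dots> < \<epsilon>" using v(2) pos by (simp add: pos_less_divide_eq mult.commute)
      finally show "\<exists>n. \<exists>z\<in>J n. nrm A (x \<otimes> y \<ominus> z) < \<epsilon>"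
        using cstar_ideal.J_mult_l[OF ideal_J x v(1)] by blast
    qed
    show "x \<otimes> y \<in> Jinf" if x: "x \<in> Jinf" and y: "y \<in> carrier A"
      unfolding Jinf_iff
    proof (intro conjI allI impI)
      show "x \<otimes> y \<in> carrier A" using x y by (simp add: Jinf_iff)
      fix \<epsilon> :: real assume \<epsilon>: "\<epsilon> > 0"
      have pos: "nrm A y + 1 > 0" using nrm_nonneg[OF y] by simp
      then obtain n v where v: "v \<in> J n" "nrm A (x \<ominus> v) < \<epsilon> / (nrm A y + 1)"
        using x \<epsilon> by (meson Jinf_iff divide_pos_pos)
      have "nrm A (x \<otimes> y \<ominus> v \<otimes> y) \<le> nrm A (x \<ominus> v) * nrm A y"
        using nrm_mult[of "x \<ominus> v" y] x y v carr by (simp add: Jinf_iff mult_diff_l)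
      also have "\<dots> \<le> nrm A (x \<ominus> v) * (nrm A y + 1)"
        using x v carr by (intro mult_left_mono nrm_nonneg) (auto simp: Jinf_iff)
      also have "\<dots> < \<epsilon>" using v(2) pos by (simp add: pos_less_divide_eq)
      finally show "\<exists>n. \<exists>z\<in>J n. nrm A (x \<otimes> y \<ominus> z) < \<epsilon>"
        using cstar_ideal.J_mult_r[OF ideal_J v(1) y] by blast
    qed
  qed
  then show ?thesis
    by (simp add: cstar_ideal_def cstar_ideal_axioms_def closed_ideal_def unital_cstar_algebra_axioms Jinf)
qed

text \<open>This turns an exact relation modulo the limit ideal into an approximate one at every
  late stage.\<close>

lemma qn_small:
  assumes z: "z \<in> Jinf" and \<epsilon>: "0 < \<epsilon>"
  shows "\<forall>\<^sub>F n in sequentially. cstar_ideal.qn A (J n) z \<le> \<epsilon>"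
proof -
  obtain m y where y: "y \<in> J m" "nrm A (z \<ominus> y) < \<epsilon>" using z \<epsilon> by (meson Jinf_iff)
  have "cstar_ideal.qn A (J n) z \<le> \<epsilon>" if "m \<le> n" for n
    using cstar_ideal.qn_le[OF ideal_J, of z y n] J_mono[OF that] y z by (auto simp: Jinf_iff)
  then show ?thesis by (auto simp: eventually_sequentially)
qed

end

lemma (in ideal_sequence) Jinf_invariant:
  assumes \<gamma>: "G_algebra A \<gamma>" and J_invariant: "\<And>n c. c \<in> J n \<Longrightarrow> \<gamma> g c \<in> J n" and x: "x \<in> Jinf"
  shows "\<gamma> g x \<in> Jinf"
  unfolding Jinf_iff
proof (intro conjI allI impI)
  note G = G_algebraD[OF \<gamma>]
  show "\<gamma> g x \<in> carrier A" using x by (simp add: Jinf_iff G(4))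
  fix \<epsilon> :: real assume "\<epsilon> > 0"
  then obtain m y where y: "y \<in> J m" "nrm A (x \<ominus> y) < \<epsilon>" using x unfolding Jinf_iff by blast
  have c: "x \<in> carrier A" "y \<in> carrier A" using x y(1) J_sub by (auto simp: Jinf_iff)
  then have "nrm A (\<gamma> g x \<ominus> \<gamma> g y) < \<epsilon>"
    using y(2) G_algebra_isometric[OF unital_cstar_algebra_axioms \<gamma>, of "x \<ominus> y" g]
      star_hom_diff[OF cstar_algebra_axioms cstar_algebra_axioms G(3), of x y g] by simp
  then show "\<exists>n. \<exists>y\<in>J n. nrm A (\<gamma> g x \<ominus> y) < \<epsilon>" using J_invariant[OF y(1)] by blast
qed

text \<open>Semiprojectivity supplies some stage without a lower bound. Applied to the shifted
  sequence it supplies a stage beyond any given \<open>m\<close>.\<close>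

lemma (in ideal_sequence) shift:
  "ideal_sequence A (\<lambda>k. J (m + k)) Jinf"
proof
  have "(\<Union>n. J n) = (\<Union>k. J (m + k))"
    using J_mono[OF le_add2] by blast
  then show "Jinf = cstar_topology A closure_of (\<Union>k. J (m + k))" by (simp add: Jinf)
qed (use J_closed_ideal J_Suc in auto)

section \<open>Lifting a finite dimensional algebra to a finite stage\<close>

locale finite_dim_lifting =
  F: unital_cstar_algebra F + F: dual_basis F N e co b + C: ideal_sequence C J Jinf
  for F :: "'f cstar" and N e co b and C :: "'c cstar" and J Jinf +
  fixes \<beta> :: "'g::topological_group_add \<Rightarrow> 'f \<Rightarrow> 'f" and \<gamma> :: "'g \<Rightarrow> 'c \<Rightarrow> 'c" and s :: "'f \<Rightarrow> 'c"
  assumes compact_group: "compact (UNIV :: 'g set)"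
    and \<beta>: "G_algebra F \<beta>" and \<gamma>: "G_algebra C \<gamma>"
    and J_invariant: "c \<in> J n \<Longrightarrow> \<gamma> g c \<in> J n"
    and star_cofinal: "\<exists>n\<ge>m. \<forall>c\<in>J n. invol C c \<in> J n"
    and s: "hom_mod F C Jinf s"
    and s_equivariant: "x \<in> carrier F \<Longrightarrow> cstar_ideal.cg C Jinf (s (\<beta> g x)) (\<gamma> g (s x))"
begin

lemma F_cstar: "cstar_algebra F" and C_cstar: "cstar_algebra C"
  by unfold_locales

lemma \<gamma>_isometric: "x \<in> carrier C \<Longrightarrow> nrm C (\<gamma> g x) = nrm C x"
  by (rule G_algebra_isometric[OF C.unital_cstar_algebra_axioms \<gamma>])

lemma \<gamma>_diff: "x \<in> carrier C \<Longrightarrow> y \<in> carrier C \<Longrightarrow> \<gamma> g (x \<ominus>\<^bsub>C\<^esub> y) = \<gamma> g x \<ominus>\<^bsub>C\<^esub> \<gamma> g y"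
  by (rule star_hom_diff[OF C_cstar C_cstar G_algebraD(3)[OF \<gamma>]])

lemma Jinf_invol:
  assumes x: "x \<in> Jinf"
  shows "invol C x \<in> Jinf"
  unfolding C.Jinf_iff
proof (intro conjI allI impI)
  show "invol C x \<in> carrier C" using x by (simp add: C.Jinf_iff)
  fix \<epsilon> :: real assume "\<epsilon> > 0"
  then obtain m y where y: "y \<in> J m" "nrm C (x \<ominus>\<^bsub>C\<^esub> y) < \<epsilon>" using x unfolding C.Jinf_iff by blast
  obtain n where n: "m \<le> n" "\<forall>c\<in>J n. invol C c \<in> J n" using star_cofinal by blast
  have "invol C y \<in> J n" using n y C.J_mono by blast
  moreover have "nrm C (invol C x \<ominus>\<^bsub>C\<^esub> invol C y) < \<epsilon>"
  proof -
    have "x \<in> carrier C" "y \<in> carrier C" using x y(1) C.J_sub by (auto simp: C.Jinf_iff)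
    then show ?thesis using y(2) by (simp add: C.nrm_invol flip: C.invol_diff)
  qed
  ultimately show "\<exists>n. \<exists>y\<in>J n. nrm C (invol C x \<ominus>\<^bsub>C\<^esub> y) < \<epsilon>" by blast
qed

sublocale I: star_ideal C Jinf
  using C.ideal_Jinf Jinf_invol by (simp add: star_ideal_def star_ideal_axioms_def)

text \<open>The equivariant linear lift is averaged with its conjugate under the involutions. The
  congruence survives because \<open>s\<close> respects the involution modulo \<open>Jinf\<close>,
  and equivariance because both actions consist of *-homomorphisms.\<close>

lemma equivariant_star_lift:
  "\<exists>\<psi>. clinear_map F C \<psi> \<and> (\<forall>x\<in>carrier F. I.cg (\<psi> x) (s x)) \<and>
    (\<forall>g. \<forall>x\<in>carrier F. \<psi> (\<beta> g x) = \<gamma> g (\<psi> x)) \<and> (\<forall>x\<in>carrier F. \<psi> (invol F x) = invol C (\<psi> x))"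
proof -
  note h = hom_modD[OF s]
  interpret L: equivariant_lifting F N e co b C Jinf \<beta> \<gamma> s
    by unfold_locales (use compact_group \<beta> \<gamma> C.Jinf_invariant[OF \<gamma> J_invariant] h(1) s_equivariant in auto)
  obtain p where p: "clinear_map F C p" "\<forall>x\<in>carrier F. I.cg (p x) (s x)"
    "\<forall>g. \<forall>x\<in>carrier F. p (\<beta> g x) = \<gamma> g (p x)"
    using L.equivariant_lift_exists[OF h(2,4)] by blast
  note lin = clinear_mapD[OF p(1)] and \<gamma>h = star_homD[OF G_algebraD(3)[OF \<gamma>]]
  define \<psi> where "\<psi> x = (1/2) \<odot>\<^bsub>C\<^esub> (p x \<oplus>\<^bsub>C\<^esub> invol C (p (invol F x)))" for x
  have "clinear_map F C \<psi>"
    by (rule clinear_mapI)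
      (simp_all add: \<psi>_def lin F.invol_add F.invol_smult C.invol_add C.invol_smult C.lin_simps mult.commute)
  moreover have "I.cg (\<psi> x) (s x)" if x: "x \<in> carrier F" for x
  proof -
    have "I.cg (invol C (p (invol F x))) (invol C (s (invol F x)))"
      using x p(2) by (intro I.cg_invol) simp
    also have "I.cg (invol C (s (invol F x))) (invol C (invol C (s x)))"
      using x by (intro I.cg_invol h(5))
    also have "invol C (invol C (s x)) = s x" using x h(1) by (simp add: C.invol_invol)
    finally have "I.cg (\<psi> x) ((1/2) \<odot>\<^bsub>C\<^esub> (s x \<oplus>\<^bsub>C\<^esub> s x))"
      unfolding \<psi>_def using x p(2) by (intro I.cg_smult I.cg_add) auto
    also have "(1/2) \<odot>\<^bsub>C\<^esub> (s x \<oplus>\<^bsub>C\<^esub> s x) = s x" using x h(1) by (simp add: C.sm_add_r flip: C.sm_add_l)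
    finally show ?thesis .
  qed
  moreover have "\<psi> (\<beta> g x) = \<gamma> g (\<psi> x)" if x: "x \<in> carrier F" for g x
  proof -
    have "p (invol F (\<beta> g x)) = \<gamma> g (p (invol F x))"
      using x p(3) star_homD(5)[OF G_algebraD(3)[OF \<beta>], of x g] by (metis F.invol_closed')
    then show ?thesis using x p(3) by (simp add: \<psi>_def \<gamma>h lin)
  qed
  moreover have "\<psi> (invol F x) = invol C (\<psi> x)" if x: "x \<in> carrier F" for x
    using x by (simp add: \<psi>_def lin F.invol_invol C.invol_smult C.invol_add C.invol_invol C.a_comm)
  ultimately show ?thesis by blast
qed

text \<open>All constants are fixed before the stage \<open>n\<close> is chosen: the norm of
  \<open>C\<close> dominates every quotient seminorm, so one \<open>M\<close> serves all stages, and
  what remains to be achieved by \<open>n\<close> is the smallness of finitely many elements of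
  \<open>Jinf\<close>. Equivariance and the congruence to \<open>s\<close> hold along the whole
  iteration and pass to its limit.\<close>

lemma hom_lift_exists:
  "\<exists>n l. (\<forall>c\<in>J n. invol C c \<in> J n) \<and> hom_mod F C (J n) l \<and>
    (\<forall>g. \<forall>x\<in>carrier F. cstar_ideal.cg C (J n) (l (\<beta> g x)) (\<gamma> g (l x))) \<and>
    (\<forall>x\<in>carrier F. I.cg (l x) (s x))"
proof -
  note h = hom_modD[OF s]
  obtain \<psi> where \<psi>: "clinear_map F C \<psi>" and \<psi>s: "\<And>x. x \<in> carrier F \<Longrightarrow> I.cg (\<psi> x) (s x)"
    and \<psi>e: "\<And>g x. x \<in> carrier F \<Longrightarrow> \<psi> (\<beta> g x) = \<gamma> g (\<psi> x)"
    and star: "\<And>x. x \<in> carrier F \<Longrightarrow> \<psi> (invol F x) = invol C (\<psi> x)"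
    using equivariant_star_lift by blast
  note lin = clinear_mapD[OF \<psi>]
  interpret A: approximate_hom F N e co b C Jinf by unfold_locales
  obtain K0 where K0: "K0 \<ge> 0" "\<forall>x\<in>carrier F. nrm C (\<psi> x) \<le> K0 * nrm F x * (\<Sum>i<N. nrm C (\<psi> (e i)))"
    using F.linear_estimate[where 'c = 'c] \<psi> C_cstar by blast
  \<comment> \<open>One more than a norm bound for \<open>\<psi>\<close>, to match the hypothesis
    with \<open>M - 1\<close> of the convergence argument.\<close>
  define M where "M = K0 * (\<Sum>i<N. nrm C (\<psi> (e i))) + 1"
  have "0 \<le> (\<Sum>i<N. nrm C (\<psi> (e i)))" by (intro sum_nonneg C.nrm_nonneg) (simp add: lin)
  then have M: "1 \<le> M" using K0 by (simp add: M_def)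
  have bound: "nrm C (\<psi> x) \<le> (M - 1) * nrm F x" if "x \<in> carrier F" for x
    using K0(2) that by (simp add: M_def mult_ac)
  obtain K where K: "K \<ge> 0" "\<forall>x\<in>carrier F. \<forall>i<N. cmod (co i x) \<le> K * nrm F x"
    using F.co_bound by blast
  \<comment> \<open>\<open>E\<close> dominates both coefficients in the smallness conditions on
    \<open>D\<close>, so \<open>D = 1 / (8 * E)\<close> meets them together.\<close>
  define E where "E = 2 * M * A.kappa + 2 * A.kappa + 2 * (M * A.kappa)\<^sup>2 + 1"
  have E: "1 \<le> E" using M A.kappa_nonneg by (simp add: E_def)
  define D where "D = 1 / (8 * E)"
  have D: "0 < D" using E by (simp add: D_def)
  have D1: "2 * M * A.kappa * D \<le> 1/8" and D2: "(2 * A.kappa + 2 * (M * A.kappa)\<^sup>2) * D \<le> 1/4"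
  proof -
    have "2 * M * A.kappa \<le> E" "2 * A.kappa + 2 * (M * A.kappa)\<^sup>2 \<le> E"
      using M A.kappa_nonneg by (auto simp: E_def)
    then have "2 * M * A.kappa * D \<le> E * D" "(2 * A.kappa + 2 * (M * A.kappa)\<^sup>2) * D \<le> E * D"
      using D by (intro mult_right_mono; simp)+
    moreover have "E * D = 1/8" using E by (simp add: D_def)
    ultimately show "2 * M * A.kappa * D \<le> 1/8" "(2 * A.kappa + 2 * (M * A.kappa)\<^sup>2) * D \<le> 1/4" by auto
  qed
  \<comment> \<open>\<open>defect_estimate\<close> enlarges a bound on pairs of basis vectors by the
    factor \<open>(N * K)^2\<close>.\<close>
  define \<delta> where "\<delta> = D / ((N * K)\<^sup>2 + 1)"
  have pos: "(N * K)\<^sup>2 + 1 > 0" by (rule add_nonneg_pos) auto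
  then have \<delta>: "0 < \<delta>" using D by (simp add: \<delta>_def)
  have \<delta>D: "(N * K)\<^sup>2 * \<delta> \<le> D"
  proof -
    have "(N * K)\<^sup>2 * \<delta> \<le> ((N * K)\<^sup>2 + 1) * \<delta>" using \<delta> by (intro mult_right_mono) auto
    then show ?thesis using pos by (simp add: \<delta>_def)
  qed
  have defect_Jinf: "A.defect \<psi> x y \<in> Jinf" if xy: "x \<in> carrier F" "y \<in> carrier F" for x y
  proof -
    have "I.cg (\<psi> (x \<otimes>\<^bsub>F\<^esub> y)) (s (x \<otimes>\<^bsub>F\<^esub> y))" using xy by (intro \<psi>s) simp
    also have "I.cg (s (x \<otimes>\<^bsub>F\<^esub> y)) (s x \<otimes>\<^bsub>C\<^esub> s y)" using xy by (rule h(3))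
    also have "I.cg (s x \<otimes>\<^bsub>C\<^esub> s y) (\<psi> x \<otimes>\<^bsub>C\<^esub> \<psi> y)" using xy by (intro I.cg_mult I.cg_sym[OF \<psi>s])
    finally show ?thesis unfolding A.defect_def by (rule I.cgD(3))
  qed
  have one_Jinf: "\<one>\<^bsub>C\<^esub> \<ominus>\<^bsub>C\<^esub> \<psi> \<one>\<^bsub>F\<^esub> \<in> Jinf"
    using I.cg_trans[OF \<psi>s[OF F.one_closed] h(6)] by (rule I.cgD(3)[OF I.cg_sym])
  have "\<forall>\<^sub>F n in sequentially. (\<forall>i\<in>{..<N}. \<forall>j\<in>{..<N}. cstar_ideal.qn C (J n) (A.defect \<psi> (e i) (e j)) \<le> \<delta>) \<and>
      cstar_ideal.qn C (J n) (\<one>\<^bsub>C\<^esub> \<ominus>\<^bsub>C\<^esub> \<psi> \<one>\<^bsub>F\<^esub>) \<le> 1/8"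
    using \<delta> by (intro eventually_conj eventually_ball_finite ballI C.qn_small defect_Jinf one_Jinf) auto
  then obtain m where m: "\<And>n. m \<le> n \<Longrightarrow> (\<forall>i<N. \<forall>j<N. cstar_ideal.qn C (J n) (A.defect \<psi> (e i) (e j)) \<le> \<delta>) \<and>
      cstar_ideal.qn C (J n) (\<one>\<^bsub>C\<^esub> \<ominus>\<^bsub>C\<^esub> \<psi> \<one>\<^bsub>F\<^esub>) \<le> 1/8"
    by (auto simp: eventually_sequentially)
  obtain n where n: "m \<le> n" and Jstar: "\<forall>c\<in>J n. invol C c \<in> J n" using star_cofinal by blast
  interpret Q: star_ideal C "J n"
    using C.ideal_J Jstar by (simp add: star_ideal_def star_ideal_axioms_def)
  interpret B: approximate_hom F N e co b C "J n" by unfold_locales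
  have qbound: "Q.qn (\<psi> x) \<le> (M - 1) * nrm F x" if "x \<in> carrier F" for x
    using Q.qn_le_nrm[of "\<psi> x"] bound[OF that] that by (simp add: lin)
  have qdefect: "Q.qn (B.defect \<psi> x y) \<le> D * nrm F x * nrm F y" if xy: "x \<in> carrier F" "y \<in> carrier F" for x y
  proof -
    have "Q.qn (B.defect \<psi> x y) \<le> (N * K)\<^sup>2 * \<delta> * nrm F x * nrm F y"
      by (rule B.defect_estimate[where K = K and \<delta> = \<delta>, OF \<psi>]) (use K m[OF n] \<delta> xy in auto)
    also have "\<dots> \<le> D * nrm F x * nrm F y"
      using \<delta>D F.nrm_nonneg[OF xy(1)] F.nrm_nonneg[OF xy(2)] by (intro mult_right_mono)
    finally show ?thesis .
  qed
  have qone: "Q.qn (\<one>\<^bsub>C\<^esub> \<ominus>\<^bsub>C\<^esub> \<psi> \<one>\<^bsub>F\<^esub>) \<le> 1/8" using m[OF n] by blast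
  \<comment> \<open>Outside its context the defining equation of \<open>iter\<close> carries the
    hypotheses of that context; \<open>it\<close> names the same sequence without them.\<close>
  define it where "it k = (B.newton ^^ k) \<psi>" for k
  have iter_eq: "B.iter \<psi> k = it k" for k
    unfolding it_def using B.iter_def[OF \<psi> M less_imp_le[OF D] qbound qdefect qone star D1 D2] by simp
  obtain l where l: "hom_mod F C (J n) l"
    and lim: "\<forall>x\<in>carrier F. \<exists>R. \<forall>k. Q.qn (it k x \<ominus>\<^bsub>C\<^esub> l x) \<le> R * (1/2) ^ k"
    using B.iter_limit_exists[OF \<psi> M less_imp_le[OF D] qbound qdefect qone star D1 D2]
    unfolding iter_eq by blast
  note lh = hom_modD[OF l]
  \<comment> \<open>Equivariance is exact at every step, whereas the congruence is one modulo the
    limit ideal.\<close>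
  have it: "clinear_map F C (it k) \<and> (\<forall>g. \<forall>x\<in>carrier F. it k (\<beta> g x) = \<gamma> g (it k x)) \<and>
      (\<forall>x\<in>carrier F. I.cg (it k x) (s x))" for k
  proof (induction k)
    case 0
    then show ?case using \<psi> \<psi>e \<psi>s by (simp add: it_def)
  next
    case (Suc k)
    have "it (Suc k) = B.newton (it k)" by (simp add: it_def)
    moreover have "B.newton (it k) (\<beta> g x) = \<gamma> g (B.newton (it k) x)" if "x \<in> carrier F" for g x
      using Suc that by (intro B.newton_equivariant G_algebraD(2)[OF \<beta>] G_algebraD(3)[OF \<gamma>]) auto
    moreover have "I.cg (B.newton (it k) x) (s x)" if "x \<in> carrier F" for x
      using Suc that by (intro B.newton_cong[OF I.star_ideal_axioms s]) auto
    ultimately show ?case using Suc B.newton_linear by simp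
  qed
  have itc: "it k x \<in> carrier C" if "x \<in> carrier F" for k x
    by (rule clinear_mapD(1)[OF conjunct1[OF it] that])
  have equiv: "Q.cg (l (\<beta> g x)) (\<gamma> g (l x))" if x: "x \<in> carrier F" for g x
  proof -
    have bx: "\<beta> g x \<in> carrier F" using x by (rule G_algebraD(4)[OF \<beta>])
    obtain R where R: "\<And>k. Q.qn (it k (\<beta> g x) \<ominus>\<^bsub>C\<^esub> l (\<beta> g x)) \<le> R * (1/2) ^ k" using lim bx by blast
    obtain L where L: "\<And>k. Q.qn (it k x \<ominus>\<^bsub>C\<^esub> l x) \<le> L * (1/2) ^ k" using lim x by blast
    have q\<gamma>: "Q.qn (\<gamma> g z) \<le> Q.qn z" if z: "z \<in> carrier C" for z
    proof (rule field_le_epsilon)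
      fix \<epsilon> :: real assume "\<epsilon> > 0"
      then obtain j where j: "j \<in> J n" "nrm C (z \<ominus>\<^bsub>C\<^esub> j) < Q.qn z + \<epsilon>" using Q.qn_approx z by blast
      have "Q.qn (\<gamma> g z) \<le> nrm C (\<gamma> g z \<ominus>\<^bsub>C\<^esub> \<gamma> g j)"
        using z j J_invariant by (intro Q.qn_le) (auto simp: G_algebraD(4)[OF \<gamma>])
      also have "\<dots> = nrm C (z \<ominus>\<^bsub>C\<^esub> j)" using z j Q.J_carrier by (simp add: \<gamma>_isometric flip: \<gamma>_diff)
      finally show "Q.qn (\<gamma> g z) \<le> Q.qn z + \<epsilon>" using j by simp
    qed
    show ?thesis
    proof (rule B.cg_limit)
      fix k
      show "Q.qn (it k (\<beta> g x) \<ominus>\<^bsub>C\<^esub> l (\<beta> g x)) \<le> R * (1/2) ^ k" by (rule R)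
      have "Q.qn (\<gamma> g (it k x \<ominus>\<^bsub>C\<^esub> l x)) \<le> L * (1/2) ^ k"
        using q\<gamma>[of "it k x \<ominus>\<^bsub>C\<^esub> l x"] L[of k] x itc lh(1) by force
      then show "Q.qn (\<gamma> g (it k x) \<ominus>\<^bsub>C\<^esub> \<gamma> g (l x)) \<le> L * (1/2) ^ k"
        using x itc lh(1) by (simp add: \<gamma>_diff)
      show "Q.qn (it k (\<beta> g x) \<ominus>\<^bsub>C\<^esub> \<gamma> g (it k x)) \<le> 0 * (1/2) ^ k"
        using x it itc by (simp add: Q.qn_J G_algebraD(4)[OF \<gamma>])
    qed (use x bx itc lh(1) G_algebraD(4)[OF \<gamma>] in auto)
  qed
  have cong: "I.cg (l x) (s x)" if x: "x \<in> carrier F" for x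
  proof -
    obtain L where L: "\<And>k. Q.qn (it k x \<ominus>\<^bsub>C\<^esub> l x) \<le> L * (1/2) ^ k" using lim x by blast
    \<comment> \<open>A larger ideal has the smaller quotient seminorm, so convergence modulo
      \<open>J n\<close> implies convergence modulo \<open>Jinf\<close>.\<close>
    have qle: "I.qn z \<le> Q.qn z" if z: "z \<in> carrier C" for z
    proof (rule field_le_epsilon)
      fix \<epsilon> :: real assume "\<epsilon> > 0"
      then obtain j where j: "j \<in> J n" "nrm C (z \<ominus>\<^bsub>C\<^esub> j) < Q.qn z + \<epsilon>" using Q.qn_approx z by blast
      then show "I.qn z \<le> Q.qn z + \<epsilon>" using I.qn_le[OF z, of j] C.J_sub_Jinf by force
    qed
    have "I.qn (l x \<ominus>\<^bsub>C\<^esub> s x) \<le> L * (1/2) ^ k" for k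
    proof -
      have "I.cg (l x \<ominus>\<^bsub>C\<^esub> s x) (l x \<ominus>\<^bsub>C\<^esub> it k x)"
        using x lh(1) it by (intro I.cg_diff I.cg_refl I.cg_sym[of "it k x"]) auto
      then have "I.qn (l x \<ominus>\<^bsub>C\<^esub> s x) = I.qn (l x \<ominus>\<^bsub>C\<^esub> it k x)" by (rule I.qn_cong)
      also have "\<dots> \<le> Q.qn (l x \<ominus>\<^bsub>C\<^esub> it k x)" using x lh(1) itc by (intro qle) auto
      also have "\<dots> = Q.qn (it k x \<ominus>\<^bsub>C\<^esub> l x)" using x lh(1) itc by (intro Q.qn_diff_commute) auto
      finally show ?thesis using L[of k] by simp
    qed
    from C.nonpos_if_le_geometric[OF _ _ this] have "I.qn (l x \<ominus>\<^bsub>C\<^esub> s x) \<le> 0" by simp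
    then show ?thesis using x lh(1) h(1) I.qn_zero_imp by (simp add: I.cg_def)
  qed
  show ?thesis using Jstar l equiv cong by blast
qed

end

section \<open>Tensor products\<close>

locale tensor_basis =
  F: unital_cstar_algebra F + F: dual_basis F N e co b + A: unital_cstar_algebra A +
  T: unital_cstar_algebra T + fd_tensor_product F A T \<iota>
  for F :: "'f cstar" and N e co b and A :: "'a cstar" and T :: "'t cstar" and \<iota>
begin

lemma F_cstar: "cstar_algebra F" and A_cstar: "cstar_algebra A" and T_cstar: "cstar_algebra T"
  by unfold_locales

declare tensor_closed [simp]

lemma tensor_linear_l: "a \<in> carrier A \<Longrightarrow> clinear_map F T (\<lambda>f. \<iota> f a)"
  by (rule clinear_mapI) (simp_all add: tensor_add_left tensor_smult_left)

lemma tensor_linear_r: "f \<in> carrier F \<Longrightarrow> clinear_map A T (\<iota> f)"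
  by (rule clinear_mapI) (simp_all add: tensor_add_right tensor_smult_right)

lemma tensor_induct [consumes 1, case_names tensor add]:
  assumes t: "t \<in> carrier T"
    and tensor: "\<And>f a. f \<in> carrier F \<Longrightarrow> a \<in> carrier A \<Longrightarrow> P (\<iota> f a)"
    and add: "\<And>x y. x \<in> carrier T \<Longrightarrow> y \<in> carrier T \<Longrightarrow> P x \<Longrightarrow> P y \<Longrightarrow> P (x \<oplus>\<^bsub>T\<^esub> y)"
  shows "P t"
proof -
  obtain n :: nat and f a where fa: "f \<in> {..<n} \<rightarrow> carrier F" "a \<in> {..<n} \<rightarrow> carrier A"
    "t = (\<Oplus>\<^bsub>T\<^esub>i\<in>{..<n}. \<iota> (f i) (a i))" using tensor_span[OF t] by blast
  \<comment> \<open>The empty sum is an elementary tensor, too.\<close>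
  have "\<iota> \<zero>\<^bsub>F\<^esub> \<zero>\<^bsub>A\<^esub> = \<zero>\<^bsub>T\<^esub>"
    using clinear_map_zero[OF F_cstar T_cstar tensor_linear_l[OF A.zero_closed]] by simp
  then have "P \<zero>\<^bsub>T\<^esub>" using tensor[of "\<zero>\<^bsub>F\<^esub>" "\<zero>\<^bsub>A\<^esub>"] by simp
  then show ?thesis
    unfolding fa(3) by (rule T.finsum_induct[of P]) (use fa(1,2) tensor add in \<open>auto simp: Pi_iff\<close>)
qed

lemma basis_sum_zero:
  assumes "\<And>i. i < N \<Longrightarrow> a i \<in> carrier A" "(\<Oplus>\<^bsub>T\<^esub>i\<in>{..<N}. \<iota> (e i) (a i)) = \<zero>\<^bsub>T\<^esub>" "i < N"
  shows "a i = \<zero>\<^bsub>A\<^esub>"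
  using tensor_linearly_disjoint[of e N a, OF _ _ F.independent] assms by auto

lemma basis_expansion:
  "t \<in> carrier T \<Longrightarrow> \<exists>a. (\<forall>i<N. a i \<in> carrier A) \<and> t = (\<Oplus>\<^bsub>T\<^esub>i\<in>{..<N}. \<iota> (e i) (a i))"
proof (induction t rule: tensor_induct)
  case (tensor f a)
  have "\<iota> f a = (\<Oplus>\<^bsub>T\<^esub>i\<in>{..<N}. co i f \<odot>\<^bsub>T\<^esub> \<iota> (e i) a)"
    by (rule F.clinear_map_expand[OF T_cstar tensor_linear_l[OF tensor(2)] tensor(1)])
  also have "\<dots> = (\<Oplus>\<^bsub>T\<^esub>i\<in>{..<N}. \<iota> (e i) (co i f \<odot>\<^bsub>A\<^esub> a))"
    using tensor by (intro T.finsum_eqI) (auto simp: tensor_smult_right)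
  finally show ?case using tensor by (intro exI[of _ "\<lambda>i. co i f \<odot>\<^bsub>A\<^esub> a"]) auto
next
  case (add x y)
  then obtain a c where a: "\<forall>i<N. a i \<in> carrier A" "x = (\<Oplus>\<^bsub>T\<^esub>i\<in>{..<N}. \<iota> (e i) (a i))"
    and c: "\<forall>i<N. c i \<in> carrier A" "y = (\<Oplus>\<^bsub>T\<^esub>i\<in>{..<N}. \<iota> (e i) (c i))" by blast
  have "x \<oplus>\<^bsub>T\<^esub> y = (\<Oplus>\<^bsub>T\<^esub>i\<in>{..<N}. \<iota> (e i) (a i) \<oplus>\<^bsub>T\<^esub> \<iota> (e i) (c i))"
    unfolding a(2) c(2) using a c by (intro T.finsum_addf[symmetric]) auto
  also have "\<dots> = (\<Oplus>\<^bsub>T\<^esub>i\<in>{..<N}. \<iota> (e i) (a i \<oplus>\<^bsub>A\<^esub> c i))"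
    using a c by (intro T.finsum_eqI) (auto simp: tensor_add_right)
  finally show ?case using a c by (intro exI[of _ "\<lambda>i. a i \<oplus>\<^bsub>A\<^esub> c i"]) auto
qed

text \<open>Coordinates of a tensor with respect to the basis \<open>e\<close> of \<open>F\<close>,
  with values in \<open>A\<close>. Existence is \<open>basis_expansion\<close>; uniqueness, by
  linear disjointness, is \<open>crd_unique\<close>.\<close>

definition crd :: "'t \<Rightarrow> nat \<Rightarrow> 'a" where
  "crd t = (SOME a. (\<forall>i<N. a i \<in> carrier A) \<and> t = (\<Oplus>\<^bsub>T\<^esub>i\<in>{..<N}. \<iota> (e i) (a i)))"

lemma crd_closed [simp]: "t \<in> carrier T \<Longrightarrow> i < N \<Longrightarrow> crd t i \<in> carrier A"
  and crd_expand: "t \<in> carrier T \<Longrightarrow> t = (\<Oplus>\<^bsub>T\<^esub>i\<in>{..<N}. \<iota> (e i) (crd t i))"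
  using someI_ex[OF basis_expansion] unfolding crd_def by blast+

lemma crd_unique:
  assumes a: "\<And>i. i < N \<Longrightarrow> a i \<in> carrier A" and t: "t = (\<Oplus>\<^bsub>T\<^esub>i\<in>{..<N}. \<iota> (e i) (a i))" and i: "i < N"
  shows "crd t i = a i"
proof -
  have tT: "t \<in> carrier T" unfolding t using a by (auto intro!: T.finsum_closed)
  have "(\<Oplus>\<^bsub>T\<^esub>i\<in>{..<N}. \<iota> (e i) (crd t i \<ominus>\<^bsub>A\<^esub> a i)) = (\<Oplus>\<^bsub>T\<^esub>i\<in>{..<N}. \<iota> (e i) (crd t i) \<ominus>\<^bsub>T\<^esub> \<iota> (e i) (a i))"
    using a tT by (intro T.finsum_eqI) (auto simp: clinear_map_diff[OF A_cstar T_cstar tensor_linear_r])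
  also have "\<dots> = (\<Oplus>\<^bsub>T\<^esub>i\<in>{..<N}. \<iota> (e i) (crd t i)) \<ominus>\<^bsub>T\<^esub> (\<Oplus>\<^bsub>T\<^esub>i\<in>{..<N}. \<iota> (e i) (a i))"
    using a tT by (intro T.finsum_diff) auto
  also have "\<dots> = \<zero>\<^bsub>T\<^esub>" unfolding crd_expand[OF tT, symmetric] t[symmetric] using tT by simp
  finally have "crd t i \<ominus>\<^bsub>A\<^esub> a i = \<zero>\<^bsub>A\<^esub>" using a tT i by (intro basis_sum_zero) auto
  then show ?thesis using a tT i by simp
qed

lemma crd_add:
  assumes xy: "x \<in> carrier T" "y \<in> carrier T" and i: "i < N"
  shows "crd (x \<oplus>\<^bsub>T\<^esub> y) i = crd x i \<oplus>\<^bsub>A\<^esub> crd y i"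
proof (rule crd_unique[OF _ _ i])
  have "x \<oplus>\<^bsub>T\<^esub> y = (\<Oplus>\<^bsub>T\<^esub>i\<in>{..<N}. \<iota> (e i) (crd x i)) \<oplus>\<^bsub>T\<^esub> (\<Oplus>\<^bsub>T\<^esub>i\<in>{..<N}. \<iota> (e i) (crd y i))"
    by (rule arg_cong2[OF crd_expand[OF xy(1)] crd_expand[OF xy(2)]])
  also have "\<dots> = (\<Oplus>\<^bsub>T\<^esub>i\<in>{..<N}. \<iota> (e i) (crd x i) \<oplus>\<^bsub>T\<^esub> \<iota> (e i) (crd y i))"
    using xy by (intro T.finsum_addf[symmetric]) auto
  also have "\<dots> = (\<Oplus>\<^bsub>T\<^esub>i\<in>{..<N}. \<iota> (e i) (crd x i \<oplus>\<^bsub>A\<^esub> crd y i))"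
    using xy by (intro T.finsum_eqI) (auto simp: tensor_add_right)
  finally show "x \<oplus>\<^bsub>T\<^esub> y = (\<Oplus>\<^bsub>T\<^esub>i\<in>{..<N}. \<iota> (e i) (crd x i \<oplus>\<^bsub>A\<^esub> crd y i))" .
qed (use xy in auto)

lemma crd_smult:
  assumes x: "x \<in> carrier T" and i: "i < N"
  shows "crd (c \<odot>\<^bsub>T\<^esub> x) i = c \<odot>\<^bsub>A\<^esub> crd x i"
proof (rule crd_unique[OF _ _ i])
  have "c \<odot>\<^bsub>T\<^esub> x = c \<odot>\<^bsub>T\<^esub> (\<Oplus>\<^bsub>T\<^esub>i\<in>{..<N}. \<iota> (e i) (crd x i))"
    by (rule arg_cong[OF crd_expand[OF x]])
  also have "\<dots> = (\<Oplus>\<^bsub>T\<^esub>i\<in>{..<N}. \<iota> (e i) (c \<odot>\<^bsub>A\<^esub> crd x i))"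
    using x by (subst T.sm_finsum) (auto simp: tensor_smult_right intro!: T.finsum_eqI)
  finally show "c \<odot>\<^bsub>T\<^esub> x = (\<Oplus>\<^bsub>T\<^esub>i\<in>{..<N}. \<iota> (e i) (c \<odot>\<^bsub>A\<^esub> crd x i))" .
qed (use x in auto)

lemma crd_tensor:
  assumes f: "f \<in> carrier F" and a: "a \<in> carrier A" and i: "i < N"
  shows "crd (\<iota> f a) i = co i f \<odot>\<^bsub>A\<^esub> a"
proof (rule crd_unique[OF _ _ i])
  have "\<iota> f a = (\<Oplus>\<^bsub>T\<^esub>i\<in>{..<N}. co i f \<odot>\<^bsub>T\<^esub> \<iota> (e i) a)"
    by (rule F.clinear_map_expand[OF T_cstar tensor_linear_l[OF a] f])
  also have "\<dots> = (\<Oplus>\<^bsub>T\<^esub>i\<in>{..<N}. \<iota> (e i) (co i f \<odot>\<^bsub>A\<^esub> a))"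
    using a by (intro T.finsum_eqI) (auto simp: tensor_smult_right)
  finally show "\<iota> f a = (\<Oplus>\<^bsub>T\<^esub>i\<in>{..<N}. \<iota> (e i) (co i f \<odot>\<^bsub>A\<^esub> a))" .
qed (use a in auto)

text \<open>The axioms on \<open>\<iota>\<close> do not mention the unit of \<open>T\<close>. This
  element acts as a left unit on elementary tensors and hence on all of \<open>T\<close>.\<close>

lemma one_tensor_one: "\<iota> \<one>\<^bsub>F\<^esub> \<one>\<^bsub>A\<^esub> = \<one>\<^bsub>T\<^esub>"
proof -
  have "\<iota> \<one>\<^bsub>F\<^esub> \<one>\<^bsub>A\<^esub> \<otimes>\<^bsub>T\<^esub> t = t" if "t \<in> carrier T" for t
    using that by (induction t rule: tensor_induct) (simp_all add: tensor_mult T.mult_add_right)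
  from this[OF T.one_closed] show ?thesis by simp
qed

lemma tensor_split: "f \<in> carrier F \<Longrightarrow> a \<in> carrier A \<Longrightarrow> \<iota> f \<one>\<^bsub>A\<^esub> \<otimes>\<^bsub>T\<^esub> \<iota> \<one>\<^bsub>F\<^esub> a = \<iota> f a"
  by (simp add: tensor_mult)

lemma star_hom_left: "star_hom F T (\<lambda>f. \<iota> f \<one>\<^bsub>A\<^esub>)"
  using tensor_linear_l[OF A.one_closed]
  by (simp add: star_hom_def clinear_map_def tensor_mult tensor_invol)

lemma star_hom_right: "star_hom A T (\<iota> \<one>\<^bsub>F\<^esub>)"
  using tensor_linear_r[OF F.one_closed]
  by (simp add: star_hom_def clinear_map_def tensor_mult tensor_invol)

text \<open>An elementary tensor is the product of its two one-sided parts, which are images of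
  \<open>f\<close> and \<open>a\<close> under unital *-homomorphisms and so do not exceed them in
  norm.\<close>

lemma tensor_norm_le:
  assumes f: "f \<in> carrier F" and a: "a \<in> carrier A"
  shows "nrm T (\<iota> f a) \<le> nrm F f * nrm A a"
proof -
  have "nrm T (\<iota> f a) \<le> nrm T (\<iota> f \<one>\<^bsub>A\<^esub>) * nrm T (\<iota> \<one>\<^bsub>F\<^esub> a)"
    using T.nrm_mult[of "\<iota> f \<one>\<^bsub>A\<^esub>" "\<iota> \<one>\<^bsub>F\<^esub> a"] f a by (simp add: tensor_split)
  also have "\<dots> \<le> nrm F f * nrm A a"
  proof (intro mult_mono)
    show "nrm T (\<iota> f \<one>\<^bsub>A\<^esub>) \<le> nrm F f"
      by (rule unital_star_hom_contractive[OF F.unital_cstar_algebra_axioms T.unital_cstar_algebra_axioms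
            star_hom_left one_tensor_one f])
    show "nrm T (\<iota> \<one>\<^bsub>F\<^esub> a) \<le> nrm A a"
      by (rule unital_star_hom_contractive[OF A.unital_cstar_algebra_axioms T.unital_cstar_algebra_axioms
            star_hom_right one_tensor_one a])
  qed (use f a in \<open>auto intro: F.nrm_nonneg T.nrm_nonneg\<close>)
  finally show ?thesis .
qed

text \<open>The map is defined in coordinates, where additivity is visible. Multiplicativity and the
  involution are then checked on elementary tensors, where the definition gives the expected
  value.\<close>

lemma tensor_hom_exists:
  assumes \<sigma>: "star_hom F F \<sigma>" and \<rho>: "star_hom A A \<rho>"
  shows "\<exists>\<theta>. \<theta> \<in> extensional (carrier T) \<and> star_hom T T \<theta> \<and>
    (\<forall>f\<in>carrier F. \<forall>a\<in>carrier A. \<theta> (\<iota> f a) = \<iota> (\<sigma> f) (\<rho> a))"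
proof -
  note s = star_homD[OF \<sigma>] and r = star_homD[OF \<rho>]
  define \<theta> where "\<theta> = (\<lambda>t\<in>carrier T. \<Oplus>\<^bsub>T\<^esub>i\<in>{..<N}. \<iota> (\<sigma> (e i)) (\<rho> (crd t i)))"
  have \<theta>c: "\<theta> t \<in> carrier T" if "t \<in> carrier T" for t
    using that by (auto simp: \<theta>_def s r intro!: T.finsum_closed)
  have el: "\<theta> (\<iota> f a) = \<iota> (\<sigma> f) (\<rho> a)" if f: "f \<in> carrier F" and a: "a \<in> carrier A" for f a
  proof -
    have ra: "\<rho> a \<in> carrier A" using a r by simp
    have "clinear_map F T (\<lambda>f. \<iota> (\<sigma> f) (\<rho> a))"
      by (rule clinear_mapI) (simp_all add: s ra tensor_add_left tensor_smult_left)
    then have "\<iota> (\<sigma> f) (\<rho> a) = (\<Oplus>\<^bsub>T\<^esub>i\<in>{..<N}. co i f \<odot>\<^bsub>T\<^esub> \<iota> (\<sigma> (e i)) (\<rho> a))"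
      using f by (rule F.clinear_map_expand[OF T_cstar])
    also have "\<dots> = (\<Oplus>\<^bsub>T\<^esub>i\<in>{..<N}. \<iota> (\<sigma> (e i)) (\<rho> (crd (\<iota> f a) i)))"
      using f a by (intro T.finsum_eqI) (auto simp: crd_tensor s r tensor_smult_right)
    finally show ?thesis using f a by (simp add: \<theta>_def)
  qed
  have add: "\<theta> (x \<oplus>\<^bsub>T\<^esub> y) = \<theta> x \<oplus>\<^bsub>T\<^esub> \<theta> y" if xy: "x \<in> carrier T" "y \<in> carrier T" for x y
  proof -
    have "\<theta> (x \<oplus>\<^bsub>T\<^esub> y) = (\<Oplus>\<^bsub>T\<^esub>i\<in>{..<N}. \<iota> (\<sigma> (e i)) (\<rho> (crd (x \<oplus>\<^bsub>T\<^esub> y) i)))"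
      using xy by (simp add: \<theta>_def)
    also have "\<dots> = (\<Oplus>\<^bsub>T\<^esub>i\<in>{..<N}. \<iota> (\<sigma> (e i)) (\<rho> (crd x i)) \<oplus>\<^bsub>T\<^esub> \<iota> (\<sigma> (e i)) (\<rho> (crd y i)))"
      using xy by (intro T.finsum_eqI) (auto simp: crd_add s r tensor_add_right)
    also have "\<dots> = \<theta> x \<oplus>\<^bsub>T\<^esub> \<theta> y"
      using xy by (simp add: \<theta>_def) (intro T.finsum_addf, auto simp: s r)
    finally show ?thesis .
  qed
  have smult: "\<theta> (c \<odot>\<^bsub>T\<^esub> x) = c \<odot>\<^bsub>T\<^esub> \<theta> x" if x: "x \<in> carrier T" for c x
    using x by (simp add: \<theta>_def, subst T.sm_finsum) (auto simp: crd_smult s r tensor_smult_right intro!: T.finsum_eqI)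
  have mult: "\<theta> (x \<otimes>\<^bsub>T\<^esub> y) = \<theta> x \<otimes>\<^bsub>T\<^esub> \<theta> y" if x: "x \<in> carrier T" and y: "y \<in> carrier T" for x y
    using x
  proof (induction x rule: tensor_induct)
    case (tensor f a)
    from y show ?case
    proof (induction y rule: tensor_induct)
      case (tensor f' a')
      then show ?case using \<open>f \<in> carrier F\<close> \<open>a \<in> carrier A\<close> by (simp add: tensor_mult el s r)
    next
      case (add u v)
      then show ?case using \<open>f \<in> carrier F\<close> \<open>a \<in> carrier A\<close>
        by (simp add: T.mult_add_right \<open>\<And>x y. _ \<Longrightarrow> _ \<Longrightarrow> \<theta> (x \<oplus>\<^bsub>T\<^esub> y) = \<theta> x \<oplus>\<^bsub>T\<^esub> \<theta> y\<close> \<theta>c)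
    qed
  next
    case (add u v)
    then show ?case using y
      by (simp add: T.mult_add_left \<open>\<And>x y. _ \<Longrightarrow> _ \<Longrightarrow> \<theta> (x \<oplus>\<^bsub>T\<^esub> y) = \<theta> x \<oplus>\<^bsub>T\<^esub> \<theta> y\<close> \<theta>c)
  qed
  have inv: "\<theta> (invol T x) = invol T (\<theta> x)" if x: "x \<in> carrier T" for x
    using x
  proof (induction x rule: tensor_induct)
    case (tensor f a)
    then show ?case by (simp add: tensor_invol el s r)
  next
    case (add u v)
    then show ?case
      by (simp add: T.invol_add \<open>\<And>x y. _ \<Longrightarrow> _ \<Longrightarrow> \<theta> (x \<oplus>\<^bsub>T\<^esub> y) = \<theta> x \<oplus>\<^bsub>T\<^esub> \<theta> y\<close> \<theta>c)
  qed
  have "star_hom T T \<theta>" using \<theta>c add smult mult inv by (simp add: star_hom_def)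
  moreover have "\<theta> \<in> extensional (carrier T)" by (simp add: \<theta>_def)
  ultimately show ?thesis using el by blast
qed

lemma tensor_hom_unique:
  assumes \<theta>: "star_hom T T \<theta>" "star_hom T T \<theta>'" and ext: "\<theta> \<in> extensional (carrier T)" "\<theta>' \<in> extensional (carrier T)"
    and eq: "\<And>f a. f \<in> carrier F \<Longrightarrow> a \<in> carrier A \<Longrightarrow> \<theta> (\<iota> f a) = \<theta>' (\<iota> f a)"
  shows "\<theta> = \<theta>'"
proof (rule extensionalityI[OF ext])
  fix t assume "t \<in> carrier T"
  then show "\<theta> t = \<theta>' t"
    by (induction t rule: tensor_induct) (simp_all add: eq star_homD(2)[OF \<theta>(1)] star_homD(2)[OF \<theta>(2)])
qed

text \<open>Existence and uniqueness make the definite description in \<open>tensor_hom\<close>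
  proper.\<close>

lemma tensor_hom_props:
  assumes \<sigma>: "star_hom F F \<sigma>" and \<rho>: "star_hom A A \<rho>"
  shows "star_hom T T (tensor_hom F A T \<iota> \<sigma> \<rho>)"
    and "f \<in> carrier F \<Longrightarrow> a \<in> carrier A \<Longrightarrow> tensor_hom F A T \<iota> \<sigma> \<rho> (\<iota> f a) = \<iota> (\<sigma> f) (\<rho> a)"
proof -
  have "\<exists>!\<theta>. \<theta> \<in> extensional (carrier T) \<and> star_hom T T \<theta> \<and>
      (\<forall>f\<in>carrier F. \<forall>a\<in>carrier A. \<theta> (\<iota> f a) = \<iota> (\<sigma> f) (\<rho> a))"
    using tensor_hom_exists[OF assms] tensor_hom_unique by (intro ex_ex1I) auto
  from theI'[OF this]
  show "star_hom T T (tensor_hom F A T \<iota> \<sigma> \<rho>)"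
    "f \<in> carrier F \<Longrightarrow> a \<in> carrier A \<Longrightarrow> tensor_hom F A T \<iota> \<sigma> \<rho> (\<iota> f a) = \<iota> (\<sigma> f) (\<rho> a)"
    unfolding tensor_hom_def by blast+
qed

text \<open>The group law and continuity are checked on elementary tensors and extended by
  additivity. Continuity there is a product rule estimate: \<open>tensor_norm_le\<close> together
  with the isometry of both actions.\<close>

lemma tensor_G_algebra:
  fixes \<alpha> :: "'g::topological_group_add \<Rightarrow> 'a \<Rightarrow> 'a"
  assumes \<alpha>: "G_algebra A \<alpha>" and \<beta>: "G_algebra F \<beta>"
  shows "G_algebra T (tensor_action F A T \<iota> \<beta> \<alpha>)"
proof -
  define \<theta> where "\<theta> = tensor_action F A T \<iota> \<beta> \<alpha>"
  note a = G_algebraD[OF \<alpha>] and bt = G_algebraD[OF \<beta>]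
  have hom: "star_hom T T (\<theta> g)" for g
    unfolding \<theta>_def tensor_action_def by (rule tensor_hom_props(1)[OF bt(3) a(3)])
  have el: "f \<in> carrier F \<Longrightarrow> c \<in> carrier A \<Longrightarrow> \<theta> g (\<iota> f c) = \<iota> (\<beta> g f) (\<alpha> g c)" for g f c
    unfolding \<theta>_def tensor_action_def by (rule tensor_hom_props(2)[OF bt(3) a(3)])
  note h = star_homD[OF hom]
  have zero: "\<theta> 0 t = t" if "t \<in> carrier T" for t
    using that by (induction t rule: tensor_induct) (simp_all add: el a bt h)
  have add: "\<theta> (g + k) t = \<theta> g (\<theta> k t)" if "t \<in> carrier T" for g k t
    using that by (induction t rule: tensor_induct) (simp_all add: el a bt h)
  have inv: "\<theta> (- g) (\<theta> g t) = t" "\<theta> g (\<theta> (- g) t) = t" if "t \<in> carrier T" for g t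
    using zero[OF that] add[OF that, of "- g" g] add[OF that, of g "- g"] by simp_all
  have aut: "\<theta> g \<in> cstar_aut T" for g
    unfolding cstar_aut_def using hom h(1) inv
    by (auto intro!: bij_betw_byWitness[where f' = "\<theta> (- g)"])
  have cont: "continuous_map euclidean (cstar_topology T) (\<lambda>g. \<theta> g t)" if "t \<in> carrier T" for t
    using that
  proof (induction t rule: tensor_induct)
    case (tensor f c)
    show ?case
      unfolding T.continuous_map_iff
    proof (intro conjI allI impI)
      show "\<theta> g (\<iota> f c) \<in> carrier T" for g using tensor h by simp
      fix g :: 'g and \<epsilon> :: real assume \<epsilon>: "\<epsilon> > 0"
      \<comment> \<open>As \<open>R\<close> exceeds the sum of the two norms, errors below
        \<open>\<epsilon> / (2 * R)\<close> in both factors add up to less than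
        \<open>\<epsilon>\<close>.\<close>
      define R where "R = nrm F f + nrm A c + 1"
      have R: "R > 0" using tensor F.nrm_nonneg[of f] A.nrm_nonneg[of c] by (simp add: R_def)
      have \<delta>: "\<epsilon> / (2 * R) > 0" using \<epsilon> R by simp
      obtain U where U: "open U" "g \<in> U" "\<forall>k\<in>U. nrm F (\<beta> k f \<ominus>\<^bsub>F\<^esub> \<beta> g f) < \<epsilon> / (2 * R)"
        using bt(9)[OF tensor(1)] \<delta> unfolding F.continuous_map_iff by blast
      obtain V where V: "open V" "g \<in> V" "\<forall>k\<in>V. nrm A (\<alpha> k c \<ominus>\<^bsub>A\<^esub> \<alpha> g c) < \<epsilon> / (2 * R)"
        using a(9)[OF tensor(2)] \<delta> unfolding A.continuous_map_iff by blast
      have "nrm T (\<theta> k (\<iota> f c) \<ominus>\<^bsub>T\<^esub> \<theta> g (\<iota> f c)) < \<epsilon>" if k: "k \<in> U \<inter> V" for k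
      proof -
        have "\<theta> k (\<iota> f c) \<ominus>\<^bsub>T\<^esub> \<theta> g (\<iota> f c) =
            \<iota> (\<beta> k f \<ominus>\<^bsub>F\<^esub> \<beta> g f) (\<alpha> k c) \<oplus>\<^bsub>T\<^esub> \<iota> (\<beta> g f) (\<alpha> k c \<ominus>\<^bsub>A\<^esub> \<alpha> g c)"
          using tensor a bt
          by (simp add: el clinear_map_diff[OF F_cstar T_cstar tensor_linear_l]
              clinear_map_diff[OF A_cstar T_cstar tensor_linear_r] T.diff_telescope)
        then have "nrm T (\<theta> k (\<iota> f c) \<ominus>\<^bsub>T\<^esub> \<theta> g (\<iota> f c)) \<le>
            nrm F (\<beta> k f \<ominus>\<^bsub>F\<^esub> \<beta> g f) * nrm A (\<alpha> k c) + nrm F (\<beta> g f) * nrm A (\<alpha> k c \<ominus>\<^bsub>A\<^esub> \<alpha> g c)"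
          using T.nrm_triangle[of "\<iota> (\<beta> k f \<ominus>\<^bsub>F\<^esub> \<beta> g f) (\<alpha> k c)" "\<iota> (\<beta> g f) (\<alpha> k c \<ominus>\<^bsub>A\<^esub> \<alpha> g c)"]
            tensor_norm_le[of "\<beta> k f \<ominus>\<^bsub>F\<^esub> \<beta> g f" "\<alpha> k c"] tensor_norm_le[of "\<beta> g f" "\<alpha> k c \<ominus>\<^bsub>A\<^esub> \<alpha> g c"] tensor a bt
          by simp
        also have "nrm A (\<alpha> k c) = nrm A c"
          by (rule G_algebra_isometric[OF A.unital_cstar_algebra_axioms \<alpha> tensor(2)])
        also have "nrm F (\<beta> g f) = nrm F f"
          by (rule G_algebra_isometric[OF F.unital_cstar_algebra_axioms \<beta> tensor(1)])
        also have "nrm F (\<beta> k f \<ominus>\<^bsub>F\<^esub> \<beta> g f) * nrm A c + nrm F f * nrm A (\<alpha> k c \<ominus>\<^bsub>A\<^esub> \<alpha> g c) \<le>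
            \<epsilon> / (2 * R) * nrm A c + nrm F f * (\<epsilon> / (2 * R))"
          using U(3) V(3) k tensor F.nrm_nonneg A.nrm_nonneg
          by (intro add_mono mult_right_mono mult_left_mono) (auto intro: less_imp_le)
        also have "\<dots> = \<epsilon> / (2 * R) * (R - 1)"
        proof -
          have "R - 1 = nrm A c + nrm F f" by (simp add: R_def)
          then show ?thesis by (simp only: distrib_left mult.commute[of "nrm F f"])
        qed
        also have "\<dots> < \<epsilon> / (2 * R) * (2 * R)" using \<delta> R by (intro mult_strict_left_mono) auto
        also have "\<dots> = \<epsilon>" using R by simp
        finally show ?thesis .
      qed
      then show "\<exists>U. open U \<and> g \<in> U \<and> (\<forall>h\<in>U. nrm T (\<theta> h (\<iota> f c) \<ominus>\<^bsub>T\<^esub> \<theta> g (\<iota> f c)) < \<epsilon>)"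
        using U V by (intro exI[of _ "U \<inter> V"]) auto
    qed
  next
    case (add x y)
    show ?case
      unfolding T.continuous_map_iff
    proof (intro conjI allI impI)
      show "\<theta> g (x \<oplus>\<^bsub>T\<^esub> y) \<in> carrier T" for g using add h by simp
      fix g :: 'g and \<epsilon> :: real assume "\<epsilon> > 0"
      then have \<epsilon>: "\<epsilon> / 2 > 0" by simp
      obtain U where U: "open U" "g \<in> U" "\<forall>k\<in>U. nrm T (\<theta> k x \<ominus>\<^bsub>T\<^esub> \<theta> g x) < \<epsilon> / 2"
        using add(3) \<epsilon> unfolding T.continuous_map_iff by blast
      obtain V where V: "open V" "g \<in> V" "\<forall>k\<in>V. nrm T (\<theta> k y \<ominus>\<^bsub>T\<^esub> \<theta> g y) < \<epsilon> / 2"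
        using add(4) \<epsilon> unfolding T.continuous_map_iff by blast
      have "nrm T (\<theta> k (x \<oplus>\<^bsub>T\<^esub> y) \<ominus>\<^bsub>T\<^esub> \<theta> g (x \<oplus>\<^bsub>T\<^esub> y)) < \<epsilon>" if "k \<in> U \<inter> V" for k
      proof -
        have "nrm T (\<theta> k x \<ominus>\<^bsub>T\<^esub> \<theta> g x) < \<epsilon> / 2" "nrm T (\<theta> k y \<ominus>\<^bsub>T\<^esub> \<theta> g y) < \<epsilon> / 2"
          using U V that by auto
        moreover have "nrm T (\<theta> k (x \<oplus>\<^bsub>T\<^esub> y) \<ominus>\<^bsub>T\<^esub> \<theta> g (x \<oplus>\<^bsub>T\<^esub> y)) \<le>
            nrm T (\<theta> k x \<ominus>\<^bsub>T\<^esub> \<theta> g x) + nrm T (\<theta> k y \<ominus>\<^bsub>T\<^esub> \<theta> g y)"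
          using add(1,2) T.nrm_triangle[of "\<theta> k x \<ominus>\<^bsub>T\<^esub> \<theta> g x" "\<theta> k y \<ominus>\<^bsub>T\<^esub> \<theta> g y"]
          by (simp add: h T.add_diff_add)
        ultimately show ?thesis by linarith
      qed
      then show "\<exists>U. open U \<and> g \<in> U \<and> (\<forall>h\<in>U. nrm T (\<theta> h (x \<oplus>\<^bsub>T\<^esub> y) \<ominus>\<^bsub>T\<^esub> \<theta> g (x \<oplus>\<^bsub>T\<^esub> y)) < \<epsilon>)"
        using U V by (intro exI[of _ "U \<inter> V"]) auto
    qed
  qed
  have "G_algebra T \<theta>" unfolding G_algebra_def using T_cstar aut zero add cont by blast
  then show ?thesis by (simp add: \<theta>_def)
qed

lemma tensor_action_tensor:
  assumes "G_algebra A \<alpha>" "G_algebra F \<beta>" "f \<in> carrier F" "a \<in> carrier A"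
  shows "tensor_action F A T \<iota> \<beta> \<alpha> g (\<iota> f a) = \<iota> (\<beta> g f) (\<alpha> g a)"
  unfolding tensor_action_def
  by (rule tensor_hom_props(2)[OF G_algebraD(3)[OF assms(2)] G_algebraD(3)[OF assms(1)] assms(3,4)])

end

section \<open>Homomorphisms into quotients\<close>

context cstar_ideal
begin

lemma coset_eq:
  assumes x: "x \<in> carrier A"
  shows "J +> x = {y. cg y x}"
proof (intro Set.set_eqI iffI)
  fix y assume "y \<in> J +> x"
  then obtain j where j: "j \<in> J" "y = j \<oplus> x" by (auto simp: a_r_coset_def')
  then have "y \<ominus> x = j" using x J_carrier[OF j(1)] by (simp add: lin_simps)
  then show "y \<in> {y. cg y x}" using j x J_carrier[OF j(1)] by (simp add: cg_def)
next
  fix y assume "y \<in> {y. cg y x}"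
  then have "y \<in> carrier A" "y \<ominus> x \<in> J" by (auto simp: cg_def)
  then show "y \<in> J +> x"
    using x by (auto simp: a_r_coset_def' diff_add_cancel intro!: bexI[of _ "y \<ominus> x"])
qed

lemma coset_eqI: "cg x y \<Longrightarrow> J +> x = J +> y"
  using cgD[of x y] by (auto simp: coset_eq intro: cg_trans cg_sym)

lemma cg_of_coset_eq: "x \<in> carrier A \<Longrightarrow> y \<in> carrier A \<Longrightarrow> J +> x = J +> y \<Longrightarrow> cg x y"
  using cg_refl[of x] by (simp add: coset_eq set_eq_iff)

text \<open>The union that defines \<open>coset_map\<close> is taken over one and the same
  coset.\<close>

lemma coset_map_coset:
  assumes x: "x \<in> X" and f: "\<And>y. y \<in> X \<Longrightarrow> cg (f y) z"
  shows "coset_map A J f X = J +> z"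
  using coset_eqI[OF f] x unfolding coset_map_def by auto

lemma coset_self: "x \<in> carrier A \<Longrightarrow> x \<in> J +> x"
  by (simp add: coset_eq cg_refl)

lemma quotient_carrier: "X \<in> carrier (quotient_cstar A J) \<longleftrightarrow> (\<exists>x\<in>carrier A. X = J +> x)"
  by (auto simp: quotient_cstar_def FactRing_def A_RCOSETS_def')

lemma quotient_one: "\<one>\<^bsub>quotient_cstar A J\<^esub> = J +> \<one>"
  by (simp add: quotient_cstar_def FactRing_def)

lemma quotient_add: "x \<in> carrier A \<Longrightarrow> y \<in> carrier A \<Longrightarrow>
    (J +> x) \<oplus>\<^bsub>quotient_cstar A J\<^esub> (J +> y) = J +> (x \<oplus> y)"
  by (simp add: quotient_cstar_def FactRing_def ideal.a_rcos_sum[OF J_ideal])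

lemma quotient_mult: "x \<in> carrier A \<Longrightarrow> y \<in> carrier A \<Longrightarrow>
    (J +> x) \<otimes>\<^bsub>quotient_cstar A J\<^esub> (J +> y) = J +> (x \<otimes> y)"
  by (simp add: quotient_cstar_def FactRing_def ideal.rcoset_mult_add[OF J_ideal])

lemma quotient_smult: "x \<in> carrier A \<Longrightarrow> c \<odot>\<^bsub>quotient_cstar A J\<^esub> (J +> x) = J +> (c \<odot> x)"
  unfolding quotient_cstar_def
  by (simp, rule coset_map_coset[of x]) (auto simp: coset_eq cg_refl cg_smult)

text \<open>The involution of \<open>quotient_cstar\<close> is defined as a union of cosets. That
  \<open>\<phi>\<close> respects it at zero says that the cosets of all \<open>invol A x\<close>
  with \<open>x\<close> in \<open>J\<close> unite to the zero coset, which is \<open>J\<close>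
  itself.\<close>

lemma invol_closed_if_star_hom:
  assumes B: "cstar_algebra B" and hom: "star_hom B (quotient_cstar A J) \<phi>" and x: "x \<in> J"
  shows "invol A x \<in> J"
proof -
  interpret B: cstar_algebra B by fact
  note h = star_homD[OF hom]
  obtain z where z: "z \<in> carrier A" "\<phi> \<zero>\<^bsub>B\<^esub> = J +> z"
    using h(1)[of "\<zero>\<^bsub>B\<^esub>"] by (auto simp: quotient_carrier)
  \<comment> \<open>\<open>star_hom\<close> does not list the value at zero; the scalar 0 provides
    it.\<close>
  have "\<phi> \<zero>\<^bsub>B\<^esub> = \<phi> (0 \<odot>\<^bsub>B\<^esub> \<zero>\<^bsub>B\<^esub>)" by simp
  also have "\<dots> = 0 \<odot>\<^bsub>quotient_cstar A J\<^esub> (J +> z)" by (simp only: h(4)[OF B.zero_closed] z(2))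
  also have "\<dots> = J +> \<zero>" using z by (simp add: quotient_smult)
  finally have zero: "\<phi> \<zero>\<^bsub>B\<^esub> = J +> \<zero>" .
  have "J +> \<zero> = \<phi> (invol B \<zero>\<^bsub>B\<^esub>)" using zero by simp
  also have "\<dots> = coset_map A J (invol A) (J +> \<zero>)"
    using h(5)[OF B.zero_closed] zero by (simp add: quotient_cstar_def)
  finally have "J +> \<zero> = coset_map A J (invol A) (J +> \<zero>)" .
  moreover have "x \<in> J +> \<zero>" using x by (simp add: coset_eq cg_zero_iff)
  ultimately have "J +> invol A x \<subseteq> J +> \<zero>" unfolding coset_map_def by blast
  then have "invol A x \<in> J +> \<zero>" using x J_carrier coset_self[of "invol A x"] by auto
  then show ?thesis by (simp add: coset_eq cg_zero_iff)
qed

end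

context star_ideal
begin

lemma quotient_invol: "x \<in> carrier A \<Longrightarrow> invol (quotient_cstar A J) (J +> x) = J +> invol A x"
  unfolding quotient_cstar_def
  by (simp, rule coset_map_coset[of x]) (auto simp: coset_eq cg_refl cg_invol)

lemma unital_star_hom_lift:
  assumes B: "unital_cstar_algebra B" and hom: "unital_star_hom B (quotient_cstar A J) \<phi>"
  shows "\<exists>s. hom_mod B A J s \<and> (\<forall>x\<in>carrier B. \<phi> x = J +> s x)"
proof -
  interpret B: unital_cstar_algebra B by fact
  have \<phi>: "star_hom B (quotient_cstar A J) \<phi>" and one: "\<phi> \<one>\<^bsub>B\<^esub> = \<one>\<^bsub>quotient_cstar A J\<^esub>"
    using hom by (auto simp: unital_star_hom_def)
  note h = star_homD[OF \<phi>]
  have "\<forall>x\<in>carrier B. \<exists>y\<in>carrier A. \<phi> x = J +> y" using h(1) by (simp add: quotient_carrier)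
  then obtain s where s: "\<And>x. x \<in> carrier B \<Longrightarrow> s x \<in> carrier A" "\<And>x. x \<in> carrier B \<Longrightarrow> \<phi> x = J +> s x"
    by metis
  have "hom_mod B A J s"
    unfolding hom_mod_def
  proof (intro conjI ballI allI)
    fix x y assume xy: "x \<in> carrier B" "y \<in> carrier B"
    show "cg (s (x \<oplus>\<^bsub>B\<^esub> y)) (s x \<oplus> s y)"
      using xy s h(2)[OF xy] by (intro cg_of_coset_eq) (simp_all add: quotient_add)
    show "cg (s (x \<otimes>\<^bsub>B\<^esub> y)) (s x \<otimes> s y)"
      using xy s h(3)[OF xy] by (intro cg_of_coset_eq) (simp_all add: quotient_mult)
  next
    fix c x assume x: "x \<in> carrier B"
    show "cg (s (c \<odot>\<^bsub>B\<^esub> x)) (c \<odot> s x)"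
      using x s h(4)[OF x, of c] by (intro cg_of_coset_eq) (simp_all add: quotient_smult)
  next
    fix x assume x: "x \<in> carrier B"
    show "s x \<in> carrier A" using x s by simp
    show "cg (s (invol B x)) (invol A (s x))"
      using x s h(5)[OF x] by (intro cg_of_coset_eq) (simp_all add: quotient_invol)
  next
    show "cg (s \<one>\<^bsub>B\<^esub>) \<one>" using s one by (intro cg_of_coset_eq) (simp_all add: quotient_one)
  qed
  then show ?thesis using s by blast
qed

lemma unital_star_hom_of_hom_mod:
  assumes "hom_mod B A J s"
  shows "unital_star_hom B (quotient_cstar A J) (\<lambda>x. J +> s x)"
proof -
  note h = hom_modD[OF assms]
  show ?thesis
    unfolding unital_star_hom_def star_hom_def
  proof (intro conjI ballI allI)
    show "(\<lambda>x. J +> s x) \<in> carrier B \<rightarrow> carrier (quotient_cstar A J)" using h(1) by (force simp: quotient_carrier)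
    show "J +> s \<one>\<^bsub>B\<^esub> = \<one>\<^bsub>quotient_cstar A J\<^esub>" using coset_eqI[OF h(6)] by (simp add: quotient_one)
  next
    fix x y assume xy: "x \<in> carrier B" "y \<in> carrier B"
    show "J +> s (x \<oplus>\<^bsub>B\<^esub> y) = (J +> s x) \<oplus>\<^bsub>quotient_cstar A J\<^esub> (J +> s y)"
      using coset_eqI[OF h(2)[OF xy]] xy h(1) by (simp add: quotient_add)
    show "J +> s (x \<otimes>\<^bsub>B\<^esub> y) = (J +> s x) \<otimes>\<^bsub>quotient_cstar A J\<^esub> (J +> s y)"
      using coset_eqI[OF h(3)[OF xy]] xy h(1) by (simp add: quotient_mult)
  next
    fix c x assume x: "x \<in> carrier B"
    show "J +> s (c \<odot>\<^bsub>B\<^esub> x) = c \<odot>\<^bsub>quotient_cstar A J\<^esub> (J +> s x)"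
      using coset_eqI[OF h(4)[OF x]] x h(1) by (simp add: quotient_smult)
  next
    fix x assume x: "x \<in> carrier B"
    show "J +> s (invol B x) = invol (quotient_cstar A J) (J +> s x)"
      using coset_eqI[OF h(5)[OF x]] x h(1) by (simp add: quotient_invol)
  qed
qed

lemma hom_mod_comp:
  assumes "hom_mod B A J s" "star_hom D B h" "h \<one>\<^bsub>D\<^esub> = \<one>\<^bsub>B\<^esub>"
  shows "hom_mod D A J (\<lambda>x. s (h x))"
  using hom_modD[OF assms(1)] star_homD[OF assms(2)] assms(3) by (simp add: hom_mod_def)

lemma hom_mod_cong:
  assumes s: "hom_mod B A J s" and B: "unital_cstar_algebra B"
    and st: "\<And>x. x \<in> carrier B \<Longrightarrow> cg (t x) (s x)"
  shows "hom_mod B A J t"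
proof -
  interpret B: unital_cstar_algebra B by fact
  note h = hom_modD[OF s]
  have ts: "cg (s x) (t x)" if "x \<in> carrier B" for x using cg_sym[OF st[OF that]] .
  show ?thesis
    unfolding hom_mod_def
  proof (intro conjI ballI allI)
    fix x y assume xy: "x \<in> carrier B" "y \<in> carrier B"
    show "cg (t (x \<oplus>\<^bsub>B\<^esub> y)) (t x \<oplus> t y)"
      using xy by (intro cg_trans[OF st cg_trans[OF h(2) cg_add[OF ts ts]]]) auto
    show "cg (t (x \<otimes>\<^bsub>B\<^esub> y)) (t x \<otimes> t y)"
      using xy by (intro cg_trans[OF st cg_trans[OF h(3) cg_mult[OF ts ts]]]) auto
  next
    fix c x assume x: "x \<in> carrier B"
    show "cg (t (c \<odot>\<^bsub>B\<^esub> x)) (c \<odot> t x)"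
      using x by (intro cg_trans[OF st cg_trans[OF h(4) cg_smult[OF ts]]]) auto
  next
    fix x assume x: "x \<in> carrier B"
    show "t x \<in> carrier A" using cgD(1)[OF st[OF x]] .
    show "cg (t (invol B x)) (invol A (t x))"
      using x by (intro cg_trans[OF st cg_trans[OF h(5) cg_invol[OF ts]]]) auto
  next
    show "cg (t \<one>\<^bsub>B\<^esub>) \<one>" using cg_trans[OF st h(6)] by simp
  qed
qed

end

lemma cg_mono: "cstar_ideal A J \<Longrightarrow> cstar_ideal A J' \<Longrightarrow> J \<subseteq> J' \<Longrightarrow> cstar_ideal.cg A J x y \<Longrightarrow> cstar_ideal.cg A J' x y"
  by (auto simp: cstar_ideal.cg_def)

lemma hom_mod_mono:
  assumes "cstar_ideal A J" "cstar_ideal A J'" "J \<subseteq> J'" "hom_mod B A J s"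
  shows "hom_mod B A J' s"
  using assms(4) cg_mono[OF assms(1-3)] unfolding hom_mod_def by blast

lemma quotient_action_coset:
  assumes "cstar_ideal A J" "G_algebra A \<gamma>" "\<And>g c. c \<in> J \<Longrightarrow> \<gamma> g c \<in> J" "x \<in> carrier A"
  shows "quotient_action A \<gamma> J g (J +>\<^bsub>A\<^esub> x) = J +>\<^bsub>A\<^esub> \<gamma> g x"
proof -
  interpret cstar_ideal A J by fact
  note G = G_algebraD[OF assms(2)]
  show ?thesis
    unfolding quotient_action_def
  proof (rule coset_map_coset[of x])
    fix y assume "y \<in> J +>\<^bsub>A\<^esub> x"
    then have "cg y x" using assms(4) by (simp add: coset_eq)
    then show "cg (\<gamma> g y) (\<gamma> g x)"
      by (intro cg_automorphism[OF assms(2,3)])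
  qed (use assms coset_self G(4) in auto)
qed

text \<open>The difference operation of a record refers to inverses inside its carrier, hence the
  second claim. Through it the metric of the subalgebra is the restricted one, and completeness
  follows from closedness.\<close>

lemma (in unital_cstar_algebra) subalgebra:
  assumes S: "S \<subseteq> carrier A" "\<one> \<in> S" and add: "\<And>x y. x \<in> S \<Longrightarrow> y \<in> S \<Longrightarrow> x \<oplus> y \<in> S"
    and mult: "\<And>x y. x \<in> S \<Longrightarrow> y \<in> S \<Longrightarrow> x \<otimes> y \<in> S" and smult: "\<And>c x. x \<in> S \<Longrightarrow> c \<odot> x \<in> S"
    and inv: "\<And>x. x \<in> S \<Longrightarrow> invol A x \<in> S"
    and closed: "\<And>x. x \<in> carrier A \<Longrightarrow> (\<And>\<epsilon>. \<epsilon> > 0 \<Longrightarrow> \<exists>y\<in>S. nrm A (x \<ominus> y) < \<epsilon>) \<Longrightarrow> x \<in> S"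
  shows "unital_cstar_algebra (A\<lparr>carrier := S\<rparr>)"
    and "x \<in> S \<Longrightarrow> y \<in> S \<Longrightarrow> x \<ominus>\<^bsub>A\<lparr>carrier := S\<rparr>\<^esub> y = x \<ominus> y"
proof -
  let ?S = "A\<lparr>carrier := S\<rparr>"
  have c: "x \<in> carrier A" if "x \<in> S" for x using S that by blast
  have zero: "\<zero> \<in> S" using smult[OF S(2), of 0] by simp
  have ab: "abelian_group ?S"
  proof (rule abelian_groupI)
    fix x assume "x \<in> carrier ?S"
    then show "\<exists>y\<in>carrier ?S. y \<oplus>\<^bsub>?S\<^esub> x = \<zero>\<^bsub>?S\<^esub>" using smult[of x "-1"] c by (auto intro!: bexI[of _ "(-1) \<odot> x"])
  qed (use add zero c in \<open>auto simp: a_ac\<close>)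
  interpret S: abelian_group ?S by (rule ab)
  have mi: "x \<ominus>\<^bsub>?S\<^esub> y = x \<ominus> y" if "x \<in> S" "y \<in> S" for x y
  proof -
    have "\<ominus>\<^bsub>?S\<^esub> y = (-1) \<odot> y" using that smult c by (intro S.minus_equality) auto
    then show ?thesis using that c by (simp add: a_minus_def[of ?S] diff_eq)
  qed
  then show "x \<in> S \<Longrightarrow> y \<in> S \<Longrightarrow> x \<ominus>\<^bsub>?S\<^esub> y = x \<ominus> y" .
  have dist: "cstar_dist ?S x y = cstar_dist A x y" if "x \<in> S" "y \<in> S" for x y
    using that c mi by (simp add: cstar_dist_def)
  have ring: "ring ?S"
    by (rule ringI[OF ab monoidI]) (use S mult c in \<open>auto simp: m_assoc l_distr r_distr\<close>)
  have mod: "module complex_ring ?S"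
    by (rule moduleI[OF R.is_cring ab])
      (use smult c in \<open>auto simp: complex_ring_def sm_add_l sm_add_r sm_assoc\<close>)
  have met: "Metric_space S (cstar_dist ?S)"
  proof
    fix x y z
    show "0 \<le> cstar_dist ?S x y" "cstar_dist ?S x y = cstar_dist ?S y x"
      by (auto simp: cstar_dist_def mi c nrm_nonneg nrm_diff_commute)
    show "x \<in> S \<Longrightarrow> y \<in> S \<Longrightarrow> cstar_dist ?S x y = 0 \<longleftrightarrow> x = y"
      by (simp add: cstar_dist_def mi c nrm_eq_0_iff)
    show "x \<in> S \<Longrightarrow> y \<in> S \<Longrightarrow> z \<in> S \<Longrightarrow> cstar_dist ?S x z \<le> cstar_dist ?S x y + cstar_dist ?S y z"
      by (simp add: cstar_dist_def mi c nrm_diff_triangle)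
  qed
  have compl: "Metric_space.mcomplete S (cstar_dist ?S)"
    unfolding Metric_space.mcomplete_def[OF met]
  proof (intro allI impI)
    fix \<sigma> assume \<sigma>: "Metric_space.MCauchy S (cstar_dist ?S) \<sigma>"
    have \<sigma>S: "\<sigma> n \<in> S" for n using \<sigma> by (auto simp: Metric_space.MCauchy_def[OF met])
    have "Metric_space.MCauchy (carrier A) (cstar_dist A) \<sigma>"
      using \<sigma> \<sigma>S c by (auto simp: Metric_space.MCauchy_def[OF met] Metric_space.MCauchy_def[OF metric] dist)
    then obtain x where "limitin (Metric_space.mtopology (carrier A) (cstar_dist A)) \<sigma> x sequentially"
      using complete unfolding Metric_space.mcomplete_def[OF metric] by blast
    then have x: "x \<in> carrier A" "\<forall>\<epsilon>>0. \<exists>N. \<forall>n\<ge>N. \<sigma> n \<in> carrier A \<and> nrm A (\<sigma> n \<ominus> x) < \<epsilon>"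
      using limitin_iff[of \<sigma> x] by (simp_all add: cstar_topology_def)
    have xS: "x \<in> S"
    proof (rule closed[OF x(1)])
      fix \<epsilon> :: real assume "\<epsilon> > 0"
      then obtain n where "nrm A (\<sigma> n \<ominus> x) < \<epsilon>" using x(2) by blast
      then show "\<exists>y\<in>S. nrm A (x \<ominus> y) < \<epsilon>" using \<sigma>S c x(1) by (metis nrm_diff_commute)
    qed
    have "limitin (Metric_space.mtopology S (cstar_dist ?S)) \<sigma> x sequentially"
      unfolding Metric_space.limit_metric_sequentially[OF met]
    proof (intro conjI allI impI)
      fix \<epsilon> :: real assume "\<epsilon> > 0"
      then obtain N where "\<forall>n\<ge>N. \<sigma> n \<in> carrier A \<and> nrm A (\<sigma> n \<ominus> x) < \<epsilon>" using x(2) by blast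
      then show "\<exists>N. \<forall>n\<ge>N. \<sigma> n \<in> S \<and> cstar_dist ?S (\<sigma> n) x < \<epsilon>"
        using \<sigma>S xS c by (intro exI[of _ N]) (simp add: dist, simp add: cstar_dist_def)
    qed (rule xS)
    then show "\<exists>x. limitin (Metric_space.mtopology S (cstar_dist ?S)) \<sigma> x sequentially" by blast
  qed
  have "cstar_algebra ?S"
  proof (intro cstar_algebra.intro mod cstar_algebra_axioms.intro)
    show "Metric_space.mcomplete (carrier ?S) (cstar_dist ?S)" using compl by simp
  qed (use c mult inv in \<open>auto simp: mult_assoc mult_add_left mult_add_right smult_mult_left smult_mult_right
      invol_invol invol_add invol_smult invol_mult nrm_nonneg nrm_eq_0_iff nrm_triangle nrm_smult nrm_mult cstar_identity\<close>)
  then show "unital_cstar_algebra ?S" using ring by (simp add: unital_cstar_algebra_def)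
qed

section \<open>Relative commutants\<close>

locale commutant =
  F: unital_cstar_algebra F + F: dual_basis F N e co b + C: star_ideal C J
  for F :: "'f cstar" and N e co b and C :: "'c cstar" and J +
  fixes l :: "'f \<Rightarrow> 'c"
  assumes l_linear: "clinear_map F C l" and l_hom: "hom_mod F C J l"
begin

lemmas l_closed [simp] = clinear_mapD(1)[OF l_linear] and lh = hom_modD[OF l_hom]

lemma F_cstar: "cstar_algebra F" and C_cstar: "cstar_algebra C"
  by unfold_locales

definition comm :: "'c set" where
  "comm = {c \<in> carrier C. \<forall>f\<in>carrier F. C.cg (c \<otimes>\<^bsub>C\<^esub> l f) (l f \<otimes>\<^bsub>C\<^esub> c)}"

definition comm_alg :: "'c cstar" where
  "comm_alg = C\<lparr>carrier := comm\<rparr>"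

lemma comm_carrier: "c \<in> comm \<Longrightarrow> c \<in> carrier C"
  by (simp add: comm_def)

lemma comm_cg: "c \<in> comm \<Longrightarrow> f \<in> carrier F \<Longrightarrow> C.cg (c \<otimes>\<^bsub>C\<^esub> l f) (l f \<otimes>\<^bsub>C\<^esub> c)"
  by (simp add: comm_def)

lemma commI: "c \<in> carrier C \<Longrightarrow> (\<And>f. f \<in> carrier F \<Longrightarrow> C.cg (c \<otimes>\<^bsub>C\<^esub> l f) (l f \<otimes>\<^bsub>C\<^esub> c)) \<Longrightarrow> c \<in> comm"
  by (simp add: comm_def)

lemma comm_add: "x \<in> comm \<Longrightarrow> y \<in> comm \<Longrightarrow> x \<oplus>\<^bsub>C\<^esub> y \<in> comm"
  using C.cg_add by (auto simp: comm_def C.mult_add_left C.mult_add_right)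

lemma comm_smult: "x \<in> comm \<Longrightarrow> c \<odot>\<^bsub>C\<^esub> x \<in> comm"
  using C.cg_smult by (auto simp: comm_def C.smult_mult_left C.smult_mult_right)

lemma comm_diff: "x \<in> comm \<Longrightarrow> y \<in> comm \<Longrightarrow> x \<ominus>\<^bsub>C\<^esub> y \<in> comm"
  by (simp add: C.diff_eq comm_carrier comm_add comm_smult)

lemma comm_mult:
  assumes x: "x \<in> comm" and y: "y \<in> comm"
  shows "x \<otimes>\<^bsub>C\<^esub> y \<in> comm"
proof (rule commI)
  note c = comm_carrier[OF x] comm_carrier[OF y]
  show "x \<otimes>\<^bsub>C\<^esub> y \<in> carrier C" using c by simp
  fix f assume f: "f \<in> carrier F"
  have "C.cg (x \<otimes>\<^bsub>C\<^esub> (y \<otimes>\<^bsub>C\<^esub> l f)) (x \<otimes>\<^bsub>C\<^esub> (l f \<otimes>\<^bsub>C\<^esub> y))"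
    using c by (intro C.cg_mult C.cg_refl comm_cg[OF y f])
  also have "x \<otimes>\<^bsub>C\<^esub> (l f \<otimes>\<^bsub>C\<^esub> y) = (x \<otimes>\<^bsub>C\<^esub> l f) \<otimes>\<^bsub>C\<^esub> y" using c f by (simp add: C.mult_assoc)
  also have "C.cg ((x \<otimes>\<^bsub>C\<^esub> l f) \<otimes>\<^bsub>C\<^esub> y) ((l f \<otimes>\<^bsub>C\<^esub> x) \<otimes>\<^bsub>C\<^esub> y)"
    using c by (intro C.cg_mult C.cg_refl comm_cg[OF x f])
  finally show "C.cg (x \<otimes>\<^bsub>C\<^esub> y \<otimes>\<^bsub>C\<^esub> l f) (l f \<otimes>\<^bsub>C\<^esub> (x \<otimes>\<^bsub>C\<^esub> y))" using c f by (simp add: C.mult_assoc)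
qed

lemma comm_invol:
  assumes x: "x \<in> comm"
  shows "invol C x \<in> comm"
proof (rule commI)
  note c = comm_carrier[OF x]
  show "invol C x \<in> carrier C" using c by simp
  fix f assume f: "f \<in> carrier F"
  have lf: "C.cg (l f) (invol C (l (invol F f)))"
    using lh(5)[of "invol F f"] f by (simp add: F.invol_invol)
  have "C.cg (invol C x \<otimes>\<^bsub>C\<^esub> l f) (invol C x \<otimes>\<^bsub>C\<^esub> invol C (l (invol F f)))"
    using c by (intro C.cg_mult C.cg_refl lf) simp
  also have "invol C x \<otimes>\<^bsub>C\<^esub> invol C (l (invol F f)) = invol C (l (invol F f) \<otimes>\<^bsub>C\<^esub> x)"
    using c f by (simp add: C.invol_mult)
  also have "C.cg \<dots> (invol C (x \<otimes>\<^bsub>C\<^esub> l (invol F f)))"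
    using f by (intro C.cg_invol C.cg_sym[OF comm_cg[OF x]]) simp
  also have "invol C (x \<otimes>\<^bsub>C\<^esub> l (invol F f)) = invol C (l (invol F f)) \<otimes>\<^bsub>C\<^esub> invol C x"
    using c f by (simp add: C.invol_mult)
  also have "C.cg \<dots> (l f \<otimes>\<^bsub>C\<^esub> invol C x)"
    using c by (intro C.cg_mult C.cg_refl C.cg_sym[OF lf]) simp
  finally show "C.cg (invol C x \<otimes>\<^bsub>C\<^esub> l f) (l f \<otimes>\<^bsub>C\<^esub> invol C x)" .
qed

lemma J_sub_comm: "x \<in> J \<Longrightarrow> x \<in> comm"
  using C.J_diff[OF C.J_mult_r C.J_mult_l] C.J_carrier[of x] by (auto simp: comm_def C.cg_def)

lemma one_comm: "\<one>\<^bsub>C\<^esub> \<in> comm"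
  by (auto simp: comm_def intro: C.cg_refl)

text \<open>Taking commutators with \<open>l f\<close> is a map of norm at most
  \<open>2 * nrm C (l f)\<close>, and \<open>J\<close> is closed.\<close>

lemma comm_norm_closed:
  assumes x: "x \<in> carrier C" and appr: "\<And>\<epsilon>. \<epsilon> > 0 \<Longrightarrow> \<exists>y\<in>comm. nrm C (x \<ominus>\<^bsub>C\<^esub> y) < \<epsilon>"
  shows "x \<in> comm"
proof (rule commI[OF x])
  fix f assume f: "f \<in> carrier F"
  have "x \<otimes>\<^bsub>C\<^esub> l f \<ominus>\<^bsub>C\<^esub> l f \<otimes>\<^bsub>C\<^esub> x \<in> J"
  proof (rule C.J_closed)
    fix \<epsilon> :: real assume \<epsilon>: "\<epsilon> > 0"
    define R where "R = 2 * nrm C (l f) + 1"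
    have R: "R > 0" using C.nrm_nonneg[of "l f"] f by (simp add: R_def)
    obtain y where y: "y \<in> comm" "nrm C (x \<ominus>\<^bsub>C\<^esub> y) < \<epsilon> / R" using appr[of "\<epsilon> / R"] \<epsilon> R by auto
    note yc = comm_carrier[OF y(1)]
    have "(x \<otimes>\<^bsub>C\<^esub> l f \<ominus>\<^bsub>C\<^esub> l f \<otimes>\<^bsub>C\<^esub> x) \<ominus>\<^bsub>C\<^esub> (y \<otimes>\<^bsub>C\<^esub> l f \<ominus>\<^bsub>C\<^esub> l f \<otimes>\<^bsub>C\<^esub> y) =
        (x \<ominus>\<^bsub>C\<^esub> y) \<otimes>\<^bsub>C\<^esub> l f \<ominus>\<^bsub>C\<^esub> l f \<otimes>\<^bsub>C\<^esub> (x \<ominus>\<^bsub>C\<^esub> y)"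
      using x yc f by (simp add: C.alg_simps)
    then have "nrm C ((x \<otimes>\<^bsub>C\<^esub> l f \<ominus>\<^bsub>C\<^esub> l f \<otimes>\<^bsub>C\<^esub> x) \<ominus>\<^bsub>C\<^esub> (y \<otimes>\<^bsub>C\<^esub> l f \<ominus>\<^bsub>C\<^esub> l f \<otimes>\<^bsub>C\<^esub> y)) \<le>
        nrm C (x \<ominus>\<^bsub>C\<^esub> y) * nrm C (l f) + nrm C (l f) * nrm C (x \<ominus>\<^bsub>C\<^esub> y)"
      using C.nrm_diff_le[of "(x \<ominus>\<^bsub>C\<^esub> y) \<otimes>\<^bsub>C\<^esub> l f" "l f \<otimes>\<^bsub>C\<^esub> (x \<ominus>\<^bsub>C\<^esub> y)"] C.nrm_mult[of "x \<ominus>\<^bsub>C\<^esub> y" "l f"]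
        C.nrm_mult[of "l f" "x \<ominus>\<^bsub>C\<^esub> y"] x yc f by (simp add: mult.commute)
    also have "\<dots> \<le> nrm C (x \<ominus>\<^bsub>C\<^esub> y) * R" using C.nrm_nonneg[of "x \<ominus>\<^bsub>C\<^esub> y"] x yc by (simp add: R_def algebra_simps)
    also have "\<dots> < \<epsilon>" using y(2) R by (simp add: pos_less_divide_eq)
    finally show "\<exists>z\<in>J. nrm C (x \<otimes>\<^bsub>C\<^esub> l f \<ominus>\<^bsub>C\<^esub> l f \<otimes>\<^bsub>C\<^esub> x \<ominus>\<^bsub>C\<^esub> z) < \<epsilon>"
      using C.cgD(3)[OF comm_cg[OF y(1) f]] by blast
  qed (use x f in simp)
  then show "C.cg (x \<otimes>\<^bsub>C\<^esub> l f) (l f \<otimes>\<^bsub>C\<^esub> x)" using x f by (simp add: C.cg_def)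
qed

lemma comm_sub: "comm \<subseteq> carrier C"
  using comm_carrier by blast

lemma comm_alg_unital: "unital_cstar_algebra comm_alg"
  unfolding comm_alg_def
  by (rule C.subalgebra(1)[OF comm_sub one_comm comm_add comm_mult comm_smult comm_invol comm_norm_closed])

lemma comm_alg_diff: "x \<in> comm \<Longrightarrow> y \<in> comm \<Longrightarrow> x \<ominus>\<^bsub>comm_alg\<^esub> y = x \<ominus>\<^bsub>C\<^esub> y"
  unfolding comm_alg_def
  by (rule C.subalgebra(2)[OF comm_sub one_comm comm_add comm_mult comm_smult comm_invol comm_norm_closed])

lemma comm_alg_simps [simp]:
  "carrier comm_alg = comm" "mult comm_alg = mult C" "add comm_alg = add C" "one comm_alg = one C"
  "zero comm_alg = zero C" "smult comm_alg = smult C" "invol comm_alg = invol C" "nrm comm_alg = nrm C"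
  by (simp_all add: comm_alg_def)

text \<open>For \<open>F = M\<^sub>n\<close> and matrix units \<open>l(e\<^sub>i\<^sub>j)\<close> this is \<open>c \<mapsto> n\<^sup>-\<^sup>1 \<Sum> l(e\<^sub>i\<^sub>j) c l(e\<^sub>j\<^sub>i)\<close>.\<close>

definition expect :: "'c \<Rightarrow> 'c" where
  "expect c = (\<Oplus>\<^bsub>C\<^esub>i\<in>{..<N}. l (e i) \<otimes>\<^bsub>C\<^esub> c \<otimes>\<^bsub>C\<^esub> l (b i))"

lemma expect_closed [simp]: "c \<in> carrier C \<Longrightarrow> expect c \<in> carrier C"
  by (auto simp: expect_def intro!: C.finsum_closed)

text \<open>For the bilinear map sending \<open>p\<close> and \<open>q\<close> to
  \<open>l p \<otimes> c \<otimes> l q\<close>, \<open>casimir_move\<close> carries \<open>f\<close>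
  from the right end of the sum to the left end; multiplicativity of \<open>l\<close> modulo
  \<open>J\<close> connects this with products by \<open>l f\<close>.\<close>

lemma expect_comm:
  assumes c: "c \<in> carrier C"
  shows "expect c \<in> comm"
proof (rule commI)
  fix f assume f: "f \<in> carrier F"
  note l = clinear_mapD[OF l_linear]
  have bil: "cbilinear_map F F C (\<lambda>p q. l p \<otimes>\<^bsub>C\<^esub> c \<otimes>\<^bsub>C\<^esub> l q)"
    unfolding cbilinear_map_def using c
    by (auto intro!: clinear_mapI simp: l C.mult_add_left C.mult_add_right C.smult_mult_left C.smult_mult_right)
  have "expect c \<otimes>\<^bsub>C\<^esub> l f = (\<Oplus>\<^bsub>C\<^esub>i\<in>{..<N}. l (e i) \<otimes>\<^bsub>C\<^esub> c \<otimes>\<^bsub>C\<^esub> l (b i) \<otimes>\<^bsub>C\<^esub> l f)"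
    unfolding expect_def using c f by (intro C.mult_finsum_l) auto
  also have "\<dots> = (\<Oplus>\<^bsub>C\<^esub>i\<in>{..<N}. l (e i) \<otimes>\<^bsub>C\<^esub> c \<otimes>\<^bsub>C\<^esub> (l (b i) \<otimes>\<^bsub>C\<^esub> l f))"
    using c f by (intro C.finsum_eqI) (auto simp: C.mult_assoc)
  also have "C.cg \<dots> (\<Oplus>\<^bsub>C\<^esub>i\<in>{..<N}. l (e i) \<otimes>\<^bsub>C\<^esub> c \<otimes>\<^bsub>C\<^esub> l (b i \<otimes>\<^bsub>F\<^esub> f))"
    using c f by (intro C.cg_finsum C.cg_mult C.cg_refl C.cg_sym[OF lh(3)]) auto
  also have "(\<Oplus>\<^bsub>C\<^esub>i\<in>{..<N}. l (e i) \<otimes>\<^bsub>C\<^esub> c \<otimes>\<^bsub>C\<^esub> l (b i \<otimes>\<^bsub>F\<^esub> f)) = (\<Oplus>\<^bsub>C\<^esub>i\<in>{..<N}. l (f \<otimes>\<^bsub>F\<^esub> e i) \<otimes>\<^bsub>C\<^esub> c \<otimes>\<^bsub>C\<^esub> l (b i))"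
    by (rule F.casimir_move[OF C_cstar bil f, symmetric])
  also have "C.cg \<dots> (\<Oplus>\<^bsub>C\<^esub>i\<in>{..<N}. (l f \<otimes>\<^bsub>C\<^esub> l (e i)) \<otimes>\<^bsub>C\<^esub> c \<otimes>\<^bsub>C\<^esub> l (b i))"
    using c f by (intro C.cg_finsum C.cg_mult C.cg_refl lh(3)) auto
  also have "(\<Oplus>\<^bsub>C\<^esub>i\<in>{..<N}. (l f \<otimes>\<^bsub>C\<^esub> l (e i)) \<otimes>\<^bsub>C\<^esub> c \<otimes>\<^bsub>C\<^esub> l (b i)) = (\<Oplus>\<^bsub>C\<^esub>i\<in>{..<N}. l f \<otimes>\<^bsub>C\<^esub> (l (e i) \<otimes>\<^bsub>C\<^esub> c \<otimes>\<^bsub>C\<^esub> l (b i)))"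
    using c f by (intro C.finsum_eqI) (auto simp: C.mult_assoc)
  also have "\<dots> = l f \<otimes>\<^bsub>C\<^esub> expect c"
    unfolding expect_def using c f by (intro C.mult_finsum_r[symmetric]) auto
  finally show "C.cg (expect c \<otimes>\<^bsub>C\<^esub> l f) (l f \<otimes>\<^bsub>C\<^esub> expect c)" .
qed (use c in simp)

lemma one_resolution: "C.cg (\<Oplus>\<^bsub>C\<^esub>i\<in>{..<N}. l (e i) \<otimes>\<^bsub>C\<^esub> l (b i)) \<one>\<^bsub>C\<^esub>"
proof -
  interpret H: approximate_hom F N e co b C J by unfold_locales
  have "C.cg (\<Oplus>\<^bsub>C\<^esub>i\<in>{..<N}. l (e i) \<otimes>\<^bsub>C\<^esub> l (b i)) (\<Oplus>\<^bsub>C\<^esub>i\<in>{..<N}. l (e i \<otimes>\<^bsub>F\<^esub> b i))"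
    by (intro C.cg_finsum C.cg_sym[OF lh(3)]) auto
  also have "(\<Oplus>\<^bsub>C\<^esub>i\<in>{..<N}. l (e i \<otimes>\<^bsub>F\<^esub> b i)) = l \<one>\<^bsub>F\<^esub>"
    unfolding H.unit_eq_one[symmetric] F.unit_def
    by (intro clinear_map_finsum[OF F_cstar C_cstar l_linear, symmetric]) auto
  also have "C.cg (l \<one>\<^bsub>F\<^esub>) \<one>\<^bsub>C\<^esub>" by (rule lh(6))
  finally show ?thesis .
qed

text \<open>Modulo \<open>J\<close> an element of \<open>comm\<close> moves out of the sum to the
  left, and what remains is 1 by \<open>one_resolution\<close>.\<close>

lemma expect_fixes_comm:
  assumes c: "c \<in> comm"
  shows "C.cg (expect c) c"
proof -
  note cc = comm_carrier[OF c]
  have "C.cg (expect c) (\<Oplus>\<^bsub>C\<^esub>i\<in>{..<N}. (c \<otimes>\<^bsub>C\<^esub> l (e i)) \<otimes>\<^bsub>C\<^esub> l (b i))"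
    unfolding expect_def using cc by (intro C.cg_finsum C.cg_mult C.cg_refl C.cg_sym[OF comm_cg[OF c]]) auto
  also have "(\<Oplus>\<^bsub>C\<^esub>i\<in>{..<N}. (c \<otimes>\<^bsub>C\<^esub> l (e i)) \<otimes>\<^bsub>C\<^esub> l (b i)) = c \<otimes>\<^bsub>C\<^esub> (\<Oplus>\<^bsub>C\<^esub>i\<in>{..<N}. l (e i) \<otimes>\<^bsub>C\<^esub> l (b i))"
    using cc by (subst C.mult_finsum_r) (auto simp: C.mult_assoc intro!: C.finsum_eqI)
  also have "C.cg \<dots> (c \<otimes>\<^bsub>C\<^esub> \<one>\<^bsub>C\<^esub>)" using cc by (intro C.cg_mult C.cg_refl one_resolution)
  finally show ?thesis using cc by simp
qed

lemma expect_diff: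
  assumes "x \<in> carrier C" "y \<in> carrier C"
  shows "expect (x \<ominus>\<^bsub>C\<^esub> y) = expect x \<ominus>\<^bsub>C\<^esub> expect y"
proof -
  have "expect (x \<ominus>\<^bsub>C\<^esub> y) =
      (\<Oplus>\<^bsub>C\<^esub>i\<in>{..<N}. l (e i) \<otimes>\<^bsub>C\<^esub> x \<otimes>\<^bsub>C\<^esub> l (b i) \<ominus>\<^bsub>C\<^esub> l (e i) \<otimes>\<^bsub>C\<^esub> y \<otimes>\<^bsub>C\<^esub> l (b i))"
    unfolding expect_def using assms by (intro C.finsum_eqI) (auto simp: C.mult_diff_l C.mult_diff_r)
  also have "\<dots> = expect x \<ominus>\<^bsub>C\<^esub> expect y"
    unfolding expect_def using assms by (intro C.finsum_diff) auto
  finally show ?thesis .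
qed

lemma expect_bounded: "\<exists>R>0. \<forall>x\<in>carrier C. nrm C (expect x) \<le> R * nrm C x"
proof (intro exI conjI ballI)
  let ?R = "(\<Sum>i<N. nrm C (l (e i)) * nrm C (l (b i))) + 1"
  show "?R > 0" by (intro add_nonneg_pos sum_nonneg mult_nonneg_nonneg C.nrm_nonneg) auto
  fix x assume x: "x \<in> carrier C"
  have "nrm C (expect x) \<le> (\<Sum>i<N. nrm C (l (e i) \<otimes>\<^bsub>C\<^esub> x \<otimes>\<^bsub>C\<^esub> l (b i)))"
    unfolding expect_def using x by (intro C.nrm_finsum_le) auto
  also have "\<dots> \<le> (\<Sum>i<N. nrm C (l (e i)) * nrm C x * nrm C (l (b i)))"
    using x by (intro sum_mono C.nrm_mult3) auto
  also have "\<dots> = (\<Sum>i<N. nrm C (l (e i)) * nrm C (l (b i))) * nrm C x"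
    by (simp add: sum_distrib_left sum_distrib_right mult_ac)
  also have "\<dots> \<le> ?R * nrm C x" using C.nrm_nonneg[OF x] by (intro mult_right_mono) auto
  finally show "nrm C (expect x) \<le> ?R * nrm C x" .
qed

lemma expect_ideal:
  assumes "cstar_ideal C K" "x \<in> K"
  shows "expect x \<in> K"
proof -
  interpret K: cstar_ideal C K by fact
  show ?thesis unfolding expect_def using assms(2) by (intro K.J_finsum K.J_mult_r K.J_mult_l) auto
qed

lemma comm_ideal:
  assumes K: "cstar_ideal C K"
  shows "cstar_ideal comm_alg (K \<inter> comm)"
    and "cstar_ideal.cg comm_alg (K \<inter> comm) x y \<longleftrightarrow> x \<in> comm \<and> y \<in> comm \<and> cstar_ideal.cg C K x y"
proof -
  interpret K: cstar_ideal C K by fact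
  interpret D: unital_cstar_algebra comm_alg by (rule comm_alg_unital)
  have "ideal (K \<inter> comm) comm_alg"
    by (rule D.idealI_cstar) (use K.J_add K.J_mult_l K.J_mult_r comm_add comm_mult comm_carrier J_sub_comm[OF C.J_zero] in auto)
  moreover have "closedin (cstar_topology comm_alg) (K \<inter> comm)"
    unfolding D.closedin_iff
  proof (intro conjI ballI impI)
    fix x assume x: "x \<in> carrier comm_alg" and appr: "\<forall>\<epsilon>>0. \<exists>y\<in>K \<inter> comm. nrm comm_alg (x \<ominus>\<^bsub>comm_alg\<^esub> y) < \<epsilon>"
    have "x \<in> K"
    proof (rule K.J_closed)
      show "x \<in> carrier C" using x comm_carrier by simp
      fix \<epsilon> :: real assume "\<epsilon> > 0"
      then obtain y where "y \<in> K \<inter> comm" "nrm comm_alg (x \<ominus>\<^bsub>comm_alg\<^esub> y) < \<epsilon>" using appr by blast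
      then show "\<exists>y\<in>K. nrm C (x \<ominus>\<^bsub>C\<^esub> y) < \<epsilon>" using x by (auto simp: comm_alg_diff)
    qed
    then show "x \<in> K \<inter> comm" using x by simp
  qed auto
  ultimately show *: "cstar_ideal comm_alg (K \<inter> comm)"
    by (simp add: cstar_ideal_def cstar_ideal_axioms_def closed_ideal_def comm_alg_unital)
  show "cstar_ideal.cg comm_alg (K \<inter> comm) x y \<longleftrightarrow> x \<in> comm \<and> y \<in> comm \<and> cstar_ideal.cg C K x y"
    unfolding cstar_ideal.cg_def[OF *] K.cg_def
    by (auto simp: comm_alg_diff comm_carrier comm_diff)
qed

text \<open>\<open>comm\<close> is invariant because \<open>l\<close> is equivariant modulo
  \<open>J\<close>: that \<open>\<gamma> g c\<close> commutes with \<open>l f\<close> is the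
  translate by \<open>g\<close> of the fact that \<open>c\<close> commutes with
  \<open>l (\<beta> (- g) f)\<close>.\<close>

lemma comm_G_algebra:
  assumes \<gamma>: "G_algebra C \<gamma>" and \<beta>: "G_algebra F \<beta>"
    and J_inv: "\<And>g c. c \<in> J \<Longrightarrow> \<gamma> g c \<in> J"
    and equiv: "\<And>g f. f \<in> carrier F \<Longrightarrow> C.cg (l (\<beta> g f)) (\<gamma> g (l f))"
  shows "unital_G_algebra comm_alg \<gamma>"
proof -
  interpret D: unital_cstar_algebra comm_alg by (rule comm_alg_unital)
  note G = G_algebraD[OF \<gamma>] and h = star_homD[OF G_algebraD(3)[OF \<gamma>]]
  have cg\<gamma>: "C.cg (\<gamma> g x) (\<gamma> g y)" if "C.cg x y" for g x y
    by (rule C.cg_automorphism[OF \<gamma> J_inv that])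
  have inv: "\<gamma> g c \<in> comm" if c: "c \<in> comm" for g c
  proof (rule commI)
    note cc = comm_carrier[OF c]
    show "\<gamma> g c \<in> carrier C" using cc by (rule G(4))
    fix f assume f: "f \<in> carrier F"
    define f' where "f' = \<beta> (- g) f"
    have f': "f' \<in> carrier F" "\<beta> g f' = f" using f G_algebraD(4,8)[OF \<beta>] by (simp_all add: f'_def)
    have lf: "C.cg (l f) (\<gamma> g (l f'))" using equiv[OF f'(1), of g] f' by simp
    have "C.cg (\<gamma> g c \<otimes>\<^bsub>C\<^esub> l f) (\<gamma> g c \<otimes>\<^bsub>C\<^esub> \<gamma> g (l f'))" using cc by (intro C.cg_mult C.cg_refl lf G(4))
    also have "\<gamma> g c \<otimes>\<^bsub>C\<^esub> \<gamma> g (l f') = \<gamma> g (c \<otimes>\<^bsub>C\<^esub> l f')" using cc f' by (simp add: h)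
    also have "C.cg \<dots> (\<gamma> g (l f' \<otimes>\<^bsub>C\<^esub> c))" by (intro cg\<gamma> comm_cg[OF c f'(1)])
    also have "\<gamma> g (l f' \<otimes>\<^bsub>C\<^esub> c) = \<gamma> g (l f') \<otimes>\<^bsub>C\<^esub> \<gamma> g c" using cc f' by (simp add: h)
    also have "C.cg \<dots> (l f \<otimes>\<^bsub>C\<^esub> \<gamma> g c)" using cc by (intro C.cg_mult C.cg_refl C.cg_sym[OF lf] G(4))
    finally show "C.cg (\<gamma> g c \<otimes>\<^bsub>C\<^esub> l f) (l f \<otimes>\<^bsub>C\<^esub> \<gamma> g c)" .
  qed
  have "\<gamma> g \<in> cstar_aut comm_alg" for g
  proof -
    have "star_hom comm_alg comm_alg (\<gamma> g)" using inv h by (simp add: star_hom_def comm_carrier)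
    moreover have "bij_betw (\<gamma> g) comm comm"
      by (rule bij_betw_byWitness[where f' = "\<gamma> (- g)"]) (use inv G(7,8) comm_carrier in auto)
    ultimately show ?thesis by (simp add: cstar_aut_def)
  qed
  moreover have "continuous_map euclidean (cstar_topology comm_alg) (\<lambda>g. \<gamma> g a)" if a: "a \<in> comm" for a
    using G(9)[OF comm_carrier[OF a]] inv[OF a]
    by (simp add: D.continuous_map_iff C.continuous_map_iff comm_alg_diff)
  ultimately show ?thesis
    unfolding unital_G_algebra_def G_algebra_def
    using G(5,6) comm_carrier comm_alg_unital D.cstar_algebra_axioms by simp
qed

text \<open>An element of \<open>Kinf\<close> in the commutant is close to some \<open>y\<close> in
  \<open>K n\<close>, but \<open>y\<close> need not commute; \<open>expect\<close> repairs this.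
  Since \<open>expect\<close> fixes \<open>comm\<close> only modulo \<open>J\<close>, every
  \<open>K n\<close> has to contain \<open>J\<close>.\<close>

lemma comm_closure:
  assumes seq: "ideal_sequence C K Kinf" and J: "\<And>n. J \<subseteq> K n"
  shows "Kinf \<inter> comm = cstar_topology comm_alg closure_of (\<Union>n. K n \<inter> comm)"
proof -
  interpret K: ideal_sequence C K Kinf by fact
  interpret D: unital_cstar_algebra comm_alg by (rule comm_alg_unital)
  have sub: "(\<Union>n. K n \<inter> comm) \<subseteq> carrier comm_alg" by auto
  show ?thesis
  proof (intro Set.set_eqI iffI)
    fix x assume x: "x \<in> cstar_topology comm_alg closure_of (\<Union>n. K n \<inter> comm)"
    then have xc: "x \<in> comm" and appr: "\<And>\<epsilon>. \<epsilon> > 0 \<Longrightarrow> \<exists>y\<in>(\<Union>n. K n \<inter> comm). nrm comm_alg (x \<ominus>\<^bsub>comm_alg\<^esub> y) < \<epsilon>"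
      unfolding D.closure_of_iff[OF sub] by auto
    have "x \<in> Kinf"
      unfolding K.Jinf_iff
    proof (intro conjI allI impI)
      fix \<epsilon> :: real assume "\<epsilon> > 0"
      from appr[OF this] obtain n y where y: "y \<in> K n" "y \<in> comm" "nrm comm_alg (x \<ominus>\<^bsub>comm_alg\<^esub> y) < \<epsilon>" by auto
      then show "\<exists>n. \<exists>y\<in>K n. nrm C (x \<ominus>\<^bsub>C\<^esub> y) < \<epsilon>" using xc by (auto simp: comm_alg_diff)
    qed (use xc comm_carrier in simp)
    then show "x \<in> Kinf \<inter> comm" using xc by simp
  next
    fix x assume x: "x \<in> Kinf \<inter> comm"
    then have xc: "x \<in> comm" "x \<in> carrier C" using comm_carrier by auto
    obtain R where R: "R > 0" "\<And>z. z \<in> carrier C \<Longrightarrow> nrm C (expect z) \<le> R * nrm C z" using expect_bounded by blast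
    have "\<exists>y\<in>(\<Union>n. K n \<inter> comm). nrm comm_alg (x \<ominus>\<^bsub>comm_alg\<^esub> y) < \<epsilon>" if \<epsilon>: "\<epsilon> > 0" for \<epsilon> :: real
    proof -
      have "\<epsilon> / R > 0" using \<epsilon> R by simp
      then obtain n y where y: "y \<in> K n" "nrm C (x \<ominus>\<^bsub>C\<^esub> y) < \<epsilon> / R" using x unfolding K.Jinf_iff by (metis IntD1 K.Jinf_iff)
      interpret Kn: cstar_ideal C "K n" by (rule K.ideal_J)
      have yc: "y \<in> carrier C" using y(1) by (rule Kn.J_carrier)
      \<comment> \<open>The second summand lies in \<open>J\<close>, hence in \<open>K n\<close>,
        and makes the error \<open>x - z\<close> equal to \<open>expect (x - y)\<close>.\<close>
      define z where "z = expect y \<oplus>\<^bsub>C\<^esub> (x \<ominus>\<^bsub>C\<^esub> expect x)"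
      have "x \<ominus>\<^bsub>C\<^esub> expect x \<in> K n"
        using C.cgD(3)[OF C.cg_sym[OF expect_fixes_comm[OF xc(1)]]] J by blast
      then have "z \<in> K n" unfolding z_def using expect_ideal[OF K.ideal_J y(1)] by (intro Kn.J_add)
      moreover have zc: "z \<in> comm"
        unfolding z_def using xc yc by (intro comm_add comm_diff expect_comm) auto
      moreover have "nrm comm_alg (x \<ominus>\<^bsub>comm_alg\<^esub> z) < \<epsilon>"
      proof -
        have "x \<ominus>\<^bsub>C\<^esub> z = expect (x \<ominus>\<^bsub>C\<^esub> y)"
        proof -
          have "x \<ominus>\<^bsub>C\<^esub> z = (x \<oplus>\<^bsub>C\<^esub> \<zero>\<^bsub>C\<^esub>) \<ominus>\<^bsub>C\<^esub> (x \<oplus>\<^bsub>C\<^esub> (expect y \<ominus>\<^bsub>C\<^esub> expect x))"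
            using xc yc by (simp add: z_def C.lin_simps)
          also have "\<dots> = \<zero>\<^bsub>C\<^esub> \<ominus>\<^bsub>C\<^esub> (expect y \<ominus>\<^bsub>C\<^esub> expect x)"
            using xc yc C.add_diff_add[of x "\<zero>\<^bsub>C\<^esub>" x "expect y \<ominus>\<^bsub>C\<^esub> expect x"] by simp
          also have "\<dots> = expect x \<ominus>\<^bsub>C\<^esub> expect y" using xc yc by (simp add: C.lin_simps)
          finally show ?thesis using xc yc by (simp add: expect_diff)
        qed
        then have "nrm C (x \<ominus>\<^bsub>C\<^esub> z) \<le> R * nrm C (x \<ominus>\<^bsub>C\<^esub> y)" using R(2)[of "x \<ominus>\<^bsub>C\<^esub> y"] xc yc by simp
        also have "\<dots> < \<epsilon>" using y(2) R by (simp add: pos_less_divide_eq mult.commute)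
        finally show ?thesis using xc zc by (simp add: comm_alg_diff)
      qed
      ultimately show ?thesis by blast
    qed
    then show "x \<in> cstar_topology comm_alg closure_of (\<Union>n. K n \<inter> comm)"
      unfolding D.closure_of_iff[OF sub] using xc by simp
  qed
qed

end

section \<open>Lifting homomorphisms from the limit\<close>

text \<open>That \<open>J\<close> is closed under the involution is included, so that the involution
  makes sense modulo \<open>J\<close>; for maps given on quotients
  \<open>equivariant_hom_lift\<close> derives it.\<close>

definition equivariant_hom_mod ::
  "'a cstar \<Rightarrow> ('g \<Rightarrow> 'a \<Rightarrow> 'a) \<Rightarrow> 'c cstar \<Rightarrow> ('g \<Rightarrow> 'c \<Rightarrow> 'c) \<Rightarrow> 'c set \<Rightarrow> ('a \<Rightarrow> 'c) \<Rightarrow> bool" where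
  "equivariant_hom_mod A \<alpha> C \<gamma> J s \<longleftrightarrow> star_ideal C J \<and> hom_mod A C J s \<and>
     (\<forall>g. \<forall>a\<in>carrier A. cstar_ideal.cg C J (s (\<alpha> g a)) (\<gamma> g (s a)))"

lemma equivariant_hom_of_hom_mod:
  assumes \<gamma>: "G_algebra C \<gamma>" and inv: "\<And>g c. c \<in> J \<Longrightarrow> \<gamma> g c \<in> J"
    and s: "equivariant_hom_mod A \<alpha> C \<gamma> J s"
  shows "unital_equivariant_hom A \<alpha> (quotient_cstar C J) (quotient_action C \<gamma> J) (\<lambda>a. J +>\<^bsub>C\<^esub> s a)"
proof -
  interpret star_ideal C J using s by (simp add: equivariant_hom_mod_def)
  have "hom_mod A C J s" using s by (simp add: equivariant_hom_mod_def)
  moreover have "J +>\<^bsub>C\<^esub> s (\<alpha> g a) = quotient_action C \<gamma> J g (J +>\<^bsub>C\<^esub> s a)" if "a \<in> carrier A" for g a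
    using that s coset_eqI[of "s (\<alpha> g a)" "\<gamma> g (s a)"] hom_modD(1)[OF \<open>hom_mod A C J s\<close>]
    by (simp add: equivariant_hom_mod_def quotient_action_coset[OF cstar_ideal_axioms \<gamma> inv])
  ultimately show ?thesis by (simp add: unital_equivariant_hom_def unital_star_hom_of_hom_mod)
qed

lemma equivariant_hom_lift:
  assumes A: "unital_G_algebra A \<alpha>" and \<gamma>: "G_algebra C \<gamma>" and inv: "\<And>g c. c \<in> J \<Longrightarrow> \<gamma> g c \<in> J"
    and J: "cstar_ideal C J"
    and \<phi>: "unital_equivariant_hom A \<alpha> (quotient_cstar C J) (quotient_action C \<gamma> J) \<phi>"
  shows "\<exists>s. equivariant_hom_mod A \<alpha> C \<gamma> J s \<and> (\<forall>a\<in>carrier A. \<phi> a = J +>\<^bsub>C\<^esub> s a)"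
proof -
  interpret A: unital_cstar_algebra A using A by (simp add: unital_G_algebra_def)
  interpret cstar_ideal C J by fact
  have u: "unital_star_hom A (quotient_cstar C J) \<phi>" using \<phi> by (simp add: unital_equivariant_hom_def)
  interpret star_ideal C J
    by unfold_locales (use invol_closed_if_star_hom[OF A.cstar_algebra_axioms] u in \<open>auto simp: unital_star_hom_def\<close>)
  obtain s where s: "hom_mod A C J s" "\<And>a. a \<in> carrier A \<Longrightarrow> \<phi> a = J +>\<^bsub>C\<^esub> s a"
    using unital_star_hom_lift[OF A.unital_cstar_algebra_axioms u] by blast
  have "cg (s (\<alpha> g a)) (\<gamma> g (s a))" if a: "a \<in> carrier A" for g a
  proof (rule cg_of_coset_eq)
    have \<alpha>a: "\<alpha> g a \<in> carrier A" using A a by (simp add: unital_G_algebra_def G_algebraD(4))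
    show "s (\<alpha> g a) \<in> carrier C" "\<gamma> g (s a) \<in> carrier C"
      using \<alpha>a a hom_modD(1)[OF s(1)] G_algebraD(4)[OF \<gamma>] by auto
    have "\<phi> (\<alpha> g a) = quotient_action C \<gamma> J g (\<phi> a)" using \<phi> a by (simp add: unital_equivariant_hom_def)
    then show "J +>\<^bsub>C\<^esub> s (\<alpha> g a) = J +>\<^bsub>C\<^esub> \<gamma> g (s a)"
      using \<alpha>a a hom_modD(1)[OF s(1)] by (simp add: s(2) quotient_action_coset[OF cstar_ideal_axioms \<gamma> inv])
  qed
  then have "equivariant_hom_mod A \<alpha> C \<gamma> J s" using s(1) star_ideal_axioms by (simp add: equivariant_hom_mod_def)
  then show ?thesis using s(2) by blast
qed

text \<open>Together with \<open>semiprojectiveI\<close> this restates the definition in terms of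
  representatives, so that the main argument runs inside \<open>C\<close>.\<close>

lemma semiprojectiveD:
  fixes C :: "'c cstar"
  assumes A: "equivariantly_semiprojective TYPE('c) A \<alpha>" and \<gamma>: "unital_G_algebra C \<gamma>"
    and seq: "ideal_sequence C J Jinf" and inv: "\<And>n g c. c \<in> J n \<Longrightarrow> \<gamma> g c \<in> J n"
    and s: "equivariant_hom_mod A \<alpha> C \<gamma> Jinf s"
  shows "\<exists>n s'. equivariant_hom_mod A \<alpha> C \<gamma> (J n) s' \<and> (\<forall>a\<in>carrier A. cstar_ideal.cg C Jinf (s' a) (s a))"
proof -
  interpret C: ideal_sequence C J Jinf by fact
  interpret I: star_ideal C Jinf using s by (simp add: equivariant_hom_mod_def)
  have G: "G_algebra C \<gamma>" using \<gamma> by (simp add: unital_G_algebra_def)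
  have UA: "unital_G_algebra A \<alpha>" using A by (simp add: equivariantly_semiprojective_def)
  note Jinv = C.Jinf_invariant[OF G inv]
  have "\<forall>n. invariant_ideal C \<gamma> (J n)"
    using C.J_closed_ideal inv by (auto simp: invariant_ideal_def)
  note lift = conjunct2[OF A[unfolded equivariantly_semiprojective_def], rule_format, OF \<gamma> this[rule_format]]
  obtain n \<psi> where \<psi>: "unital_equivariant_hom A \<alpha> (quotient_cstar C (J n)) (quotient_action C \<gamma> (J n)) \<psi>"
    and \<psi>s: "\<And>a. a \<in> carrier A \<Longrightarrow> coset_map C Jinf (\<lambda>x. x) (\<psi> a) = Jinf +>\<^bsub>C\<^esub> s a"
    using lift[OF C.J_Suc C.Jinf equivariant_hom_of_hom_mod[OF G Jinv s]] by blast
  interpret Jn: cstar_ideal C "J n" by (rule C.ideal_J)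
  obtain s' where s': "equivariant_hom_mod A \<alpha> C \<gamma> (J n) s'" "\<And>a. a \<in> carrier A \<Longrightarrow> \<psi> a = J n +>\<^bsub>C\<^esub> s' a"
    using equivariant_hom_lift[OF UA G inv C.ideal_J \<psi>] by blast
  have "I.cg (s' a) (s a)" if a: "a \<in> carrier A" for a
  proof (rule I.cg_of_coset_eq)
    show c: "s' a \<in> carrier C" "s a \<in> carrier C"
      using s s'(1) a by (auto simp: equivariant_hom_mod_def dest: hom_modD(1))
    have "coset_map C Jinf (\<lambda>x. x) (J n +>\<^bsub>C\<^esub> s' a) = Jinf +>\<^bsub>C\<^esub> s' a"
      by (rule I.coset_map_coset[OF Jn.coset_self[OF c(1)]])
        (use c cg_mono[OF C.ideal_J C.ideal_Jinf C.J_sub_Jinf] in \<open>auto simp: Jn.coset_eq\<close>)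
    then show "Jinf +>\<^bsub>C\<^esub> s' a = Jinf +>\<^bsub>C\<^esub> s a" using \<psi>s[OF a] s'(2)[OF a] by simp
  qed
  then show ?thesis using s'(1) by blast
qed

lemma semiprojectiveI:
  assumes A: "unital_G_algebra A \<alpha>"
    and lift: "\<And>(C :: 'c cstar) \<gamma> J Jinf s. unital_G_algebra C \<gamma> \<Longrightarrow> ideal_sequence C J Jinf \<Longrightarrow>
      (\<And>n g c. c \<in> J n \<Longrightarrow> \<gamma> g c \<in> J n) \<Longrightarrow> equivariant_hom_mod A \<alpha> C \<gamma> Jinf s \<Longrightarrow>
      \<exists>n s'. equivariant_hom_mod A \<alpha> C \<gamma> (J n) s' \<and> (\<forall>a\<in>carrier A. cstar_ideal.cg C Jinf (s' a) (s a))"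
  shows "equivariantly_semiprojective TYPE('c) A \<alpha>"
  unfolding equivariantly_semiprojective_def
proof (intro conjI A allI impI)
  fix C :: "'c cstar" and \<gamma> J Jinf \<phi>
  assume \<gamma>: "unital_G_algebra C \<gamma>" and J: "\<forall>n. invariant_ideal C \<gamma> (J n)" and Suc: "\<forall>n. J n \<subseteq> J (Suc n)"
    and Jinf: "Jinf = cstar_topology C closure_of (\<Union>n. J n)"
    and \<phi>: "unital_equivariant_hom A \<alpha> (quotient_cstar C Jinf) (quotient_action C \<gamma> Jinf) \<phi>"
  interpret C: unital_cstar_algebra C using \<gamma> by (simp add: unital_G_algebra_def)
  interpret C: ideal_sequence C J Jinf
    by unfold_locales (use J Suc Jinf in \<open>auto simp: invariant_ideal_def\<close>)
  have G: "G_algebra C \<gamma>" using \<gamma> by (simp add: unital_G_algebra_def)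
  have inv: "\<gamma> g c \<in> J n" if "c \<in> J n" for n g c using J that by (auto simp: invariant_ideal_def)
  obtain s where s: "equivariant_hom_mod A \<alpha> C \<gamma> Jinf s" "\<And>a. a \<in> carrier A \<Longrightarrow> \<phi> a = Jinf +>\<^bsub>C\<^esub> s a"
    using equivariant_hom_lift[OF A G C.Jinf_invariant[OF G inv] C.ideal_Jinf \<phi>] by blast
  interpret I: star_ideal C Jinf using s by (simp add: equivariant_hom_mod_def)
  obtain n s' where s': "equivariant_hom_mod A \<alpha> C \<gamma> (J n) s'" "\<And>a. a \<in> carrier A \<Longrightarrow> I.cg (s' a) (s a)"
    using lift[OF \<gamma> C.ideal_sequence_axioms inv s(1)] by blast
  interpret Jn: cstar_ideal C "J n" by (rule C.ideal_J)
  have "coset_map C Jinf (\<lambda>x. x) (J n +>\<^bsub>C\<^esub> s' a) = \<phi> a" if a: "a \<in> carrier A" for a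
  proof -
    have c: "s' a \<in> carrier C" using I.cgD(1)[OF s'(2)[OF a]] .
    have "coset_map C Jinf (\<lambda>x. x) (J n +>\<^bsub>C\<^esub> s' a) = Jinf +>\<^bsub>C\<^esub> s' a"
      by (rule I.coset_map_coset[OF Jn.coset_self[OF c]])
        (use c cg_mono[OF C.ideal_J C.ideal_Jinf C.J_sub_Jinf] in \<open>auto simp: Jn.coset_eq\<close>)
    then show ?thesis using I.coset_eqI[OF s'(2)[OF a]] s(2)[OF a] by simp
  qed
  then show "\<exists>n \<psi>. unital_equivariant_hom A \<alpha> (quotient_cstar C (J n)) (quotient_action C \<gamma> (J n)) \<psi> \<and>
      (\<forall>a\<in>carrier A. coset_map C Jinf (\<lambda>x. x) (\<psi> a) = \<phi> a)"
    using equivariant_hom_of_hom_mod[OF G inv s'(1)] by blast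
qed

context commutant
begin

lemma comm_star_ideal:
  assumes "star_ideal C K"
  shows "star_ideal comm_alg (K \<inter> comm)"
proof -
  interpret K: star_ideal C K by fact
  show ?thesis
    using comm_ideal(1)[OF K.cstar_ideal_axioms] K.J_invol comm_invol
    by (simp add: star_ideal_def star_ideal_axioms_def)
qed

lemma hom_mod_comm:
  assumes B: "unital_cstar_algebra B" and K: "cstar_ideal C K"
  shows "hom_mod B comm_alg (K \<inter> comm) s \<longleftrightarrow> hom_mod B C K s \<and> (\<forall>x\<in>carrier B. s x \<in> comm)"
proof -
  interpret B: unital_cstar_algebra B by fact
  show ?thesis
    unfolding hom_mod_def comm_ideal(2)[OF K] comm_alg_simps
    by (auto simp: comm_add comm_mult comm_smult comm_invol one_comm comm_carrier)
qed

end

section \<open>Homomorphisms on the tensor product modulo an ideal\<close>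

context tensor_basis
begin

lemma cg_on_tensors:
  assumes C: "cstar_ideal C K" and t: "t \<in> carrier T"
    and p: "\<And>x y. x \<in> carrier T \<Longrightarrow> y \<in> carrier T \<Longrightarrow> cstar_ideal.cg C K (p (x \<oplus>\<^bsub>T\<^esub> y)) (p x \<oplus>\<^bsub>C\<^esub> p y)"
    and q: "\<And>x y. x \<in> carrier T \<Longrightarrow> y \<in> carrier T \<Longrightarrow> cstar_ideal.cg C K (q (x \<oplus>\<^bsub>T\<^esub> y)) (q x \<oplus>\<^bsub>C\<^esub> q y)"
    and pq: "\<And>f a. f \<in> carrier F \<Longrightarrow> a \<in> carrier A \<Longrightarrow> cstar_ideal.cg C K (p (\<iota> f a)) (q (\<iota> f a))"
  shows "cstar_ideal.cg C K (p t) (q t)"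
  using t
proof (induction t rule: tensor_induct)
  case (tensor f a)
  then show ?case by (rule pq)
next
  case (add x y)
  interpret C: cstar_ideal C K by fact
  show ?case using C.cg_trans[OF p C.cg_trans[OF C.cg_add C.cg_sym[OF q]]] add by blast
qed

text \<open>The map is \<open>\<Sum> l(e_i) \<rho>(t_i)\<close> in the coordinates
  \<open>t_i\<close> of a tensor. As \<open>l\<close> is exactly linear, an elementary tensor goes
  to \<open>l f \<otimes> \<rho> a\<close> modulo \<open>K\<close>; \<open>commute\<close> then
  yields multiplicativity and compatibility with the involution.\<close>

lemma hom_mod_tensor:
  assumes C: "star_ideal C K" and l: "clinear_map F C l" "hom_mod F C K l" and \<rho>: "hom_mod A C K \<rho>"
    and commute: "\<And>f a. f \<in> carrier F \<Longrightarrow> a \<in> carrier A \<Longrightarrow> cstar_ideal.cg C K (\<rho> a \<otimes>\<^bsub>C\<^esub> l f) (l f \<otimes>\<^bsub>C\<^esub> \<rho> a)"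
  shows "\<exists>\<Psi>. hom_mod T C K \<Psi> \<and> (\<forall>f\<in>carrier F. \<forall>a\<in>carrier A. cstar_ideal.cg C K (\<Psi> (\<iota> f a)) (l f \<otimes>\<^bsub>C\<^esub> \<rho> a))"
proof -
  interpret C: star_ideal C K by fact
  note lin = clinear_mapD[OF l(1)] and lh = hom_modD[OF l(2)] and h = hom_modD[OF \<rho>]
  note closed [simp] = lin(1) h(1)
  define \<Psi> where "\<Psi> t = (\<Oplus>\<^bsub>C\<^esub>i\<in>{..<N}. l (e i) \<otimes>\<^bsub>C\<^esub> \<rho> (crd t i))" for t
  have \<Psi>c [simp]: "\<Psi> t \<in> carrier C" if "t \<in> carrier T" for t
    using that by (auto simp: \<Psi>_def intro!: C.finsum_closed)
  have \<Psi>t: "C.cg (\<Psi> (\<iota> f a)) (l f \<otimes>\<^bsub>C\<^esub> \<rho> a)" if fa: "f \<in> carrier F" "a \<in> carrier A" for f a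
  proof -
    have "C.cg (\<Psi> (\<iota> f a)) (\<Oplus>\<^bsub>C\<^esub>i\<in>{..<N}. l (e i) \<otimes>\<^bsub>C\<^esub> (co i f \<odot>\<^bsub>C\<^esub> \<rho> a))"
      unfolding \<Psi>_def using fa by (intro C.cg_finsum C.cg_mult C.cg_refl) (auto simp: crd_tensor intro!: h(4))
    also have "(\<Oplus>\<^bsub>C\<^esub>i\<in>{..<N}. l (e i) \<otimes>\<^bsub>C\<^esub> (co i f \<odot>\<^bsub>C\<^esub> \<rho> a)) = (\<Oplus>\<^bsub>C\<^esub>i\<in>{..<N}. (co i f \<odot>\<^bsub>C\<^esub> l (e i)) \<otimes>\<^bsub>C\<^esub> \<rho> a)"
      using fa by (intro C.finsum_eqI) (auto simp: C.smult_mult_left C.smult_mult_right)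
    also have "\<dots> = (\<Oplus>\<^bsub>C\<^esub>i\<in>{..<N}. co i f \<odot>\<^bsub>C\<^esub> l (e i)) \<otimes>\<^bsub>C\<^esub> \<rho> a"
      using fa by (intro C.mult_finsum_l[symmetric]) auto
    finally show ?thesis by (simp add: F.clinear_map_expand[OF C.cstar_algebra_axioms l(1) fa(1)])
  qed
  have add: "C.cg (\<Psi> (x \<oplus>\<^bsub>T\<^esub> y)) (\<Psi> x \<oplus>\<^bsub>C\<^esub> \<Psi> y)" if xy: "x \<in> carrier T" "y \<in> carrier T" for x y
  proof -
    have "C.cg (\<Psi> (x \<oplus>\<^bsub>T\<^esub> y)) (\<Oplus>\<^bsub>C\<^esub>i\<in>{..<N}. l (e i) \<otimes>\<^bsub>C\<^esub> (\<rho> (crd x i) \<oplus>\<^bsub>C\<^esub> \<rho> (crd y i)))"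
      unfolding \<Psi>_def using xy by (intro C.cg_finsum C.cg_mult C.cg_refl) (auto simp: crd_add intro!: h(2))
    also have "(\<Oplus>\<^bsub>C\<^esub>i\<in>{..<N}. l (e i) \<otimes>\<^bsub>C\<^esub> (\<rho> (crd x i) \<oplus>\<^bsub>C\<^esub> \<rho> (crd y i))) =
        (\<Oplus>\<^bsub>C\<^esub>i\<in>{..<N}. l (e i) \<otimes>\<^bsub>C\<^esub> \<rho> (crd x i) \<oplus>\<^bsub>C\<^esub> l (e i) \<otimes>\<^bsub>C\<^esub> \<rho> (crd y i))"
      using xy by (intro C.finsum_eqI) (auto simp: C.mult_add_right)
    also have "\<dots> = \<Psi> x \<oplus>\<^bsub>C\<^esub> \<Psi> y" unfolding \<Psi>_def using xy by (intro C.finsum_addf) auto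
    finally show ?thesis .
  qed
  have smult: "C.cg (\<Psi> (c \<odot>\<^bsub>T\<^esub> x)) (c \<odot>\<^bsub>C\<^esub> \<Psi> x)" if x: "x \<in> carrier T" for c x
  proof -
    have "C.cg (\<Psi> (c \<odot>\<^bsub>T\<^esub> x)) (\<Oplus>\<^bsub>C\<^esub>i\<in>{..<N}. l (e i) \<otimes>\<^bsub>C\<^esub> (c \<odot>\<^bsub>C\<^esub> \<rho> (crd x i)))"
      unfolding \<Psi>_def using x by (intro C.cg_finsum C.cg_mult C.cg_refl) (auto simp: crd_smult intro!: h(4))
    also have "(\<Oplus>\<^bsub>C\<^esub>i\<in>{..<N}. l (e i) \<otimes>\<^bsub>C\<^esub> (c \<odot>\<^bsub>C\<^esub> \<rho> (crd x i))) = (\<Oplus>\<^bsub>C\<^esub>i\<in>{..<N}. c \<odot>\<^bsub>C\<^esub> (l (e i) \<otimes>\<^bsub>C\<^esub> \<rho> (crd x i)))"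
      using x by (intro C.finsum_eqI) (auto simp: C.smult_mult_right)
    also have "\<dots> = c \<odot>\<^bsub>C\<^esub> \<Psi> x" unfolding \<Psi>_def using x by (intro C.sm_finsum[symmetric]) auto
    finally show ?thesis .
  qed
  have mult_tensor: "C.cg (\<Psi> (\<iota> f a \<otimes>\<^bsub>T\<^esub> \<iota> f' a')) (\<Psi> (\<iota> f a) \<otimes>\<^bsub>C\<^esub> \<Psi> (\<iota> f' a'))"
    if m: "f \<in> carrier F" "a \<in> carrier A" "f' \<in> carrier F" "a' \<in> carrier A" for f a f' a'
  proof -
    have "C.cg (\<Psi> (\<iota> f a \<otimes>\<^bsub>T\<^esub> \<iota> f' a')) (l (f \<otimes>\<^bsub>F\<^esub> f') \<otimes>\<^bsub>C\<^esub> \<rho> (a \<otimes>\<^bsub>A\<^esub> a'))"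
      using m by (simp add: tensor_mult \<Psi>t)
    also have "C.cg \<dots> ((l f \<otimes>\<^bsub>C\<^esub> l f') \<otimes>\<^bsub>C\<^esub> (\<rho> a \<otimes>\<^bsub>C\<^esub> \<rho> a'))" using m by (intro C.cg_mult lh(3) h(3))
    also have "(l f \<otimes>\<^bsub>C\<^esub> l f') \<otimes>\<^bsub>C\<^esub> (\<rho> a \<otimes>\<^bsub>C\<^esub> \<rho> a') = (l f \<otimes>\<^bsub>C\<^esub> (l f' \<otimes>\<^bsub>C\<^esub> \<rho> a)) \<otimes>\<^bsub>C\<^esub> \<rho> a'" using m by (simp add: C.mult_assoc)
    also have "C.cg \<dots> ((l f \<otimes>\<^bsub>C\<^esub> (\<rho> a \<otimes>\<^bsub>C\<^esub> l f')) \<otimes>\<^bsub>C\<^esub> \<rho> a')"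
      using m by (intro C.cg_mult C.cg_refl C.cg_sym[OF commute]) auto
    also have "(l f \<otimes>\<^bsub>C\<^esub> (\<rho> a \<otimes>\<^bsub>C\<^esub> l f')) \<otimes>\<^bsub>C\<^esub> \<rho> a' = (l f \<otimes>\<^bsub>C\<^esub> \<rho> a) \<otimes>\<^bsub>C\<^esub> (l f' \<otimes>\<^bsub>C\<^esub> \<rho> a')" using m by (simp add: C.mult_assoc)
    also have "C.cg \<dots> (\<Psi> (\<iota> f a) \<otimes>\<^bsub>C\<^esub> \<Psi> (\<iota> f' a'))" using m by (intro C.cg_mult C.cg_sym[OF \<Psi>t])
    finally show ?thesis .
  qed
  \<comment> \<open>Both sides are additive modulo \<open>K\<close> in each variable, so elementary
    tensors suffice, first for \<open>x\<close> and then for \<open>y\<close>.\<close>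
  have mult: "C.cg (\<Psi> (x \<otimes>\<^bsub>T\<^esub> y)) (\<Psi> x \<otimes>\<^bsub>C\<^esub> \<Psi> y)" if x: "x \<in> carrier T" and y: "y \<in> carrier T" for x y
  proof (rule cg_on_tensors[OF C.cstar_ideal_axioms x, where p = "\<lambda>x. \<Psi> (x \<otimes>\<^bsub>T\<^esub> y)" and q = "\<lambda>x. \<Psi> x \<otimes>\<^bsub>C\<^esub> \<Psi> y"])
    fix x x' assume x: "x \<in> carrier T" "x' \<in> carrier T"
    show "C.cg (\<Psi> ((x \<oplus>\<^bsub>T\<^esub> x') \<otimes>\<^bsub>T\<^esub> y)) (\<Psi> (x \<otimes>\<^bsub>T\<^esub> y) \<oplus>\<^bsub>C\<^esub> \<Psi> (x' \<otimes>\<^bsub>T\<^esub> y))"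
      using x y by (simp add: T.mult_add_left add)
    show "C.cg (\<Psi> (x \<oplus>\<^bsub>T\<^esub> x') \<otimes>\<^bsub>C\<^esub> \<Psi> y) (\<Psi> x \<otimes>\<^bsub>C\<^esub> \<Psi> y \<oplus>\<^bsub>C\<^esub> \<Psi> x' \<otimes>\<^bsub>C\<^esub> \<Psi> y)"
      using C.cg_mult[OF add[OF x] C.cg_refl[OF \<Psi>c[OF y]]] x y by (simp add: C.mult_add_left)
  next
    fix f a assume fa: "f \<in> carrier F" "a \<in> carrier A"
    have \<iota>: "\<iota> f a \<in> carrier T" using fa by simp
    show "C.cg (\<Psi> (\<iota> f a \<otimes>\<^bsub>T\<^esub> y)) (\<Psi> (\<iota> f a) \<otimes>\<^bsub>C\<^esub> \<Psi> y)"
    proof (rule cg_on_tensors[OF C.cstar_ideal_axioms y, where p = "\<lambda>y. \<Psi> (\<iota> f a \<otimes>\<^bsub>T\<^esub> y)" and q = "\<lambda>y. \<Psi> (\<iota> f a) \<otimes>\<^bsub>C\<^esub> \<Psi> y"])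
      fix y y' assume y: "y \<in> carrier T" "y' \<in> carrier T"
      show "C.cg (\<Psi> (\<iota> f a \<otimes>\<^bsub>T\<^esub> (y \<oplus>\<^bsub>T\<^esub> y'))) (\<Psi> (\<iota> f a \<otimes>\<^bsub>T\<^esub> y) \<oplus>\<^bsub>C\<^esub> \<Psi> (\<iota> f a \<otimes>\<^bsub>T\<^esub> y'))"
        using y \<iota> by (simp add: T.mult_add_right add)
      show "C.cg (\<Psi> (\<iota> f a) \<otimes>\<^bsub>C\<^esub> \<Psi> (y \<oplus>\<^bsub>T\<^esub> y')) (\<Psi> (\<iota> f a) \<otimes>\<^bsub>C\<^esub> \<Psi> y \<oplus>\<^bsub>C\<^esub> \<Psi> (\<iota> f a) \<otimes>\<^bsub>C\<^esub> \<Psi> y')"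
        using C.cg_mult[OF C.cg_refl[OF \<Psi>c[OF \<iota>]] add[OF y]] y \<iota> by (simp add: C.mult_add_right)
    qed (use fa mult_tensor in auto)
  qed
  have inv: "C.cg (\<Psi> (invol T x)) (invol C (\<Psi> x))" if x: "x \<in> carrier T" for x
  proof (rule cg_on_tensors[OF C.cstar_ideal_axioms x])
    fix x y assume xy: "x \<in> carrier T" "y \<in> carrier T"
    show "C.cg (\<Psi> (invol T (x \<oplus>\<^bsub>T\<^esub> y))) (\<Psi> (invol T x) \<oplus>\<^bsub>C\<^esub> \<Psi> (invol T y))" using xy by (simp add: T.invol_add add)
    show "C.cg (invol C (\<Psi> (x \<oplus>\<^bsub>T\<^esub> y))) (invol C (\<Psi> x) \<oplus>\<^bsub>C\<^esub> invol C (\<Psi> y))"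
      using C.cg_invol[OF add[OF xy]] xy by (simp add: C.invol_add)
  next
    fix f a assume fa: "f \<in> carrier F" "a \<in> carrier A"
    have "C.cg (\<Psi> (invol T (\<iota> f a))) (l (invol F f) \<otimes>\<^bsub>C\<^esub> \<rho> (invol A a))" using fa by (simp add: tensor_invol \<Psi>t)
    also have "C.cg \<dots> (invol C (l f) \<otimes>\<^bsub>C\<^esub> invol C (\<rho> a))" using fa by (intro C.cg_mult lh(5) h(5))
    also have "invol C (l f) \<otimes>\<^bsub>C\<^esub> invol C (\<rho> a) = invol C (\<rho> a \<otimes>\<^bsub>C\<^esub> l f)" using fa by (simp add: C.invol_mult)
    also have "C.cg \<dots> (invol C (\<Psi> (\<iota> f a)))"
      using fa by (intro C.cg_invol C.cg_trans[OF commute C.cg_sym[OF \<Psi>t]])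
    finally show "C.cg (\<Psi> (invol T (\<iota> f a))) (invol C (\<Psi> (\<iota> f a)))" .
  qed
  have "C.cg (\<Psi> \<one>\<^bsub>T\<^esub>) (l \<one>\<^bsub>F\<^esub> \<otimes>\<^bsub>C\<^esub> \<rho> \<one>\<^bsub>A\<^esub>)" using \<Psi>t[of "\<one>\<^bsub>F\<^esub>" "\<one>\<^bsub>A\<^esub>"] by (simp add: one_tensor_one)
  also have "C.cg \<dots> (\<one>\<^bsub>C\<^esub> \<otimes>\<^bsub>C\<^esub> \<one>\<^bsub>C\<^esub>)" by (intro C.cg_mult lh(6) h(6))
  finally have one: "C.cg (\<Psi> \<one>\<^bsub>T\<^esub>) \<one>\<^bsub>C\<^esub>" by simp
  have "hom_mod T C K \<Psi>"
    unfolding hom_mod_def using add mult smult inv one by simp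
  then show ?thesis using \<Psi>t by blast
qed

end

text \<open>Three stages occur: \<open>n\<close>, where the lift of \<open>F\<close> and its
  commutant live; \<open>n + k\<close>, supplied by semiprojectivity of \<open>A\<close> for the
  commutant; and \<open>m\<close>, a stage beyond both that is closed under the involution.\<close>

lemma (in tensor_basis) semiprojective_tensor:
  fixes \<alpha> :: "'g::topological_group_add \<Rightarrow> 'a \<Rightarrow> 'a"
  assumes compact_group: "compact (UNIV :: 'g set)"
    and A: "equivariantly_semiprojective TYPE('c) A \<alpha>" and \<beta>: "G_algebra F \<beta>"
  shows "equivariantly_semiprojective TYPE('c) T (tensor_action F A T \<iota> \<beta> \<alpha>)"
proof (rule semiprojectiveI)
  have UA: "unital_G_algebra A \<alpha>" and \<alpha>: "G_algebra A \<alpha>"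
    using A by (auto simp: equivariantly_semiprojective_def unital_G_algebra_def)
  let ?\<theta> = "tensor_action F A T \<iota> \<beta> \<alpha>"
  have \<theta>: "G_algebra T ?\<theta>" by (rule tensor_G_algebra[OF \<alpha> \<beta>])
  note \<theta>_tensor = tensor_action_tensor[OF \<alpha> \<beta>] and \<alpha>c = G_algebraD(4)[OF \<alpha>] and \<beta>c = G_algebraD(4)[OF \<beta>]
  have one_fixed: "\<alpha> g \<one>\<^bsub>A\<^esub> = \<one>\<^bsub>A\<^esub>" "\<beta> g \<one>\<^bsub>F\<^esub> = \<one>\<^bsub>F\<^esub>" for g
    using cstar_aut_one[OF A.unital_cstar_algebra_axioms G_algebraD(2)[OF \<alpha>]]
      cstar_aut_one[OF F.unital_cstar_algebra_axioms G_algebraD(2)[OF \<beta>]] by auto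
  show "unital_G_algebra T ?\<theta>"
    using \<theta> T.unital_cstar_algebra_axioms by (simp add: unital_G_algebra_def)
  fix C :: "'c cstar" and \<gamma> J Jinf s
  assume \<gamma>: "unital_G_algebra C \<gamma>" and seq: "ideal_sequence C J Jinf"
    and inv: "\<And>n g c. c \<in> J n \<Longrightarrow> \<gamma> g c \<in> J n" and s: "equivariant_hom_mod T ?\<theta> C \<gamma> Jinf s"
  interpret C: ideal_sequence C J Jinf by fact
  interpret I: star_ideal C Jinf using s by (simp add: equivariant_hom_mod_def)
  have \<gamma>': "G_algebra C \<gamma>" using \<gamma> by (simp add: unital_G_algebra_def)
  note \<gamma>c = G_algebraD(4)[OF \<gamma>'] and \<gamma>h = star_homD[OF G_algebraD(3)[OF \<gamma>']]
  have s_hom: "hom_mod T C Jinf s" using s by (simp add: equivariant_hom_mod_def)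
  note sh = hom_modD[OF s_hom]
  have s_eq: "I.cg (s (?\<theta> g t)) (\<gamma> g (s t))" if "t \<in> carrier T" for g t
    using s that by (simp add: equivariant_hom_mod_def)
  note Jinv = C.Jinf_invariant[OF \<gamma>' inv]
  have mono: "I.cg x y" if "cstar_ideal.cg C (J m) x y" for m x y
    by (rule cg_mono[OF C.ideal_J C.ideal_Jinf C.J_sub_Jinf that])
  have mono_J: "cstar_ideal.cg C (J m') x y" if "m \<le> m'" "cstar_ideal.cg C (J m) x y" for m m' x y
    by (rule cg_mono[OF C.ideal_J C.ideal_J C.J_mono[OF that(1)] that(2)])
  have s_right: "hom_mod A C Jinf (\<lambda>a. s (\<iota> \<one>\<^bsub>F\<^esub> a))"
    by (rule I.hom_mod_comp[OF s_hom star_hom_right one_tensor_one])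
  have s_right_eq: "I.cg (s (\<iota> \<one>\<^bsub>F\<^esub> (\<alpha> g a))) (\<gamma> g (s (\<iota> \<one>\<^bsub>F\<^esub> a)))" if "a \<in> carrier A" for g a
    using s_eq[of "\<iota> \<one>\<^bsub>F\<^esub> a" g] that by (simp add: \<theta>_tensor one_fixed)
  have s_left: "hom_mod F C Jinf (\<lambda>f. s (\<iota> f \<one>\<^bsub>A\<^esub>))"
    by (rule I.hom_mod_comp[OF s_hom star_hom_left one_tensor_one])
  have s_left_eq: "I.cg (s (\<iota> (\<beta> g f) \<one>\<^bsub>A\<^esub>)) (\<gamma> g (s (\<iota> f \<one>\<^bsub>A\<^esub>)))" if "f \<in> carrier F" for g f
    using s_eq[of "\<iota> f \<one>\<^bsub>A\<^esub>" g] that by (simp add: \<theta>_tensor one_fixed)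
  \<comment> \<open>Lifting the restriction of \<open>s\<close> to \<open>A\<close> along the
    sequence started at \<open>m\<close> exhibits a later ideal that is closed under the involution.
    The lift itself is discarded here, since it need not commute with a lift of
    \<open>F\<close>.\<close>
  have cofinal: "\<exists>n\<ge>m. star_ideal C (J n)" for m
  proof -
    have "equivariant_hom_mod A \<alpha> C \<gamma> Jinf (\<lambda>a. s (\<iota> \<one>\<^bsub>F\<^esub> a))"
      using s_right s_right_eq I.star_ideal_axioms by (simp add: equivariant_hom_mod_def)
    then obtain n s' where "equivariant_hom_mod A \<alpha> C \<gamma> (J (m + n)) s'"
      using semiprojectiveD[OF A \<gamma> C.shift[of m] inv] by blast
    then show ?thesis by (intro exI[of _ "m + n"]) (simp add: equivariant_hom_mod_def)
  qed
  interpret L: finite_dim_lifting F N e co b C J Jinf \<beta> \<gamma> "\<lambda>f. s (\<iota> f \<one>\<^bsub>A\<^esub>)"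
  proof unfold_locales
    fix m
    obtain n where n: "n \<ge> m" "star_ideal C (J n)" using cofinal by blast
    show "\<exists>n\<ge>m. \<forall>c\<in>J n. invol C c \<in> J n" using n(1) star_ideal.J_invol[OF n(2)] by (intro exI[of _ n]) simp
  qed (fact compact_group \<beta> \<gamma>' inv s_left s_left_eq)+
  obtain n l0 where n: "\<forall>c\<in>J n. invol C c \<in> J n" and l0: "hom_mod F C (J n) l0"
    and l0_eq: "\<And>g f. f \<in> carrier F \<Longrightarrow> cstar_ideal.cg C (J n) (l0 (\<beta> g f)) (\<gamma> g (l0 f))"
    and l0_s: "\<And>f. f \<in> carrier F \<Longrightarrow> I.cg (l0 f) (s (\<iota> f \<one>\<^bsub>A\<^esub>))"
    using L.hom_lift_exists by blast
  interpret Jn: star_ideal C "J n"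
    using n C.ideal_J by (simp add: star_ideal_def star_ideal_axioms_def)
  \<comment> \<open>\<open>commutant\<close> and \<open>hom_mod_tensor\<close> want an exactly
    linear map; linearizing \<open>l0\<close> does not change it modulo \<open>J n\<close>.\<close>
  obtain l where l_linear: "clinear_map F C l" and l_l0: "\<And>f. f \<in> carrier F \<Longrightarrow> Jn.cg (l f) (l0 f)"
    using F.linearize_mod[OF Jn.cstar_ideal_axioms hom_modD(1,2,4)[OF l0]] by blast
  interpret K: commutant F N e co b C "J n" l
    by unfold_locales (rule l_linear, rule Jn.hom_mod_cong[OF l0 F.unital_cstar_algebra_axioms l_l0])
  have l_eq: "Jn.cg (l (\<beta> g f)) (\<gamma> g (l f))" if f: "f \<in> carrier F" for g f
    using Jn.cg_trans[OF l_l0[OF \<beta>c[OF f]] Jn.cg_trans[OF l0_eq[OF f]]]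
      Jn.cg_automorphism[OF \<gamma>' inv Jn.cg_sym[OF l_l0[OF f]]] by blast
  have l_s: "I.cg (l f) (s (\<iota> f \<one>\<^bsub>A\<^esub>))" if "f \<in> carrier F" for f
    using I.cg_trans[OF mono[OF l_l0] l0_s] that by blast
  \<comment> \<open>\<open>s (\<iota> 1 a)\<close> commutes with the image of \<open>F\<close>
    modulo \<open>Jinf\<close>, whereas \<open>K.comm\<close> is defined modulo \<open>J n\<close>.
    \<open>K.expect\<close> moves the element into \<open>K.comm\<close> and, by
    \<open>sA_s\<close>, leaves it unchanged modulo \<open>Jinf\<close>.\<close>
  define sA where "sA a = K.expect (s (\<iota> \<one>\<^bsub>F\<^esub> a))" for a
  have sA_comm: "sA a \<in> K.comm" if "a \<in> carrier A" for a
    using that by (simp add: sA_def K.expect_comm sh(1))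
  have sA_s: "I.cg (sA a) (s (\<iota> \<one>\<^bsub>F\<^esub> a))" if a: "a \<in> carrier A" for a
  proof -
    have unit: "\<iota> \<one>\<^bsub>F\<^esub> a = (\<Oplus>\<^bsub>T\<^esub>i\<in>{..<N}. \<iota> (e i \<otimes>\<^bsub>F\<^esub> b i) a)"
    proof -
      interpret H: approximate_hom F N e co b C Jinf by unfold_locales
      show ?thesis
        unfolding H.unit_eq_one[symmetric] F.unit_def
        by (rule clinear_map_finsum[OF F_cstar T_cstar tensor_linear_l[OF a]]) auto
    qed
    have "I.cg (sA a) (\<Oplus>\<^bsub>C\<^esub>i\<in>{..<N}. s (\<iota> (e i) \<one>\<^bsub>A\<^esub>) \<otimes>\<^bsub>C\<^esub> s (\<iota> \<one>\<^bsub>F\<^esub> a) \<otimes>\<^bsub>C\<^esub> s (\<iota> (b i) \<one>\<^bsub>A\<^esub>))"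
      unfolding sA_def K.expect_def using a by (intro I.cg_finsum I.cg_mult I.cg_refl l_s) (auto simp: sh(1))
    also have "I.cg \<dots> (\<Oplus>\<^bsub>C\<^esub>i\<in>{..<N}. s (\<iota> (e i) a \<otimes>\<^bsub>T\<^esub> \<iota> (b i) \<one>\<^bsub>A\<^esub>))"
    proof (intro I.cg_finsum)
      fix i assume "i \<in> {..<N}"
      then have i: "e i \<in> carrier F" "b i \<in> carrier F" by auto
      have "I.cg (s (\<iota> (e i) a)) (s (\<iota> (e i) \<one>\<^bsub>A\<^esub>) \<otimes>\<^bsub>C\<^esub> s (\<iota> \<one>\<^bsub>F\<^esub> a))"
        using sh(3)[of "\<iota> (e i) \<one>\<^bsub>A\<^esub>" "\<iota> \<one>\<^bsub>F\<^esub> a"] a i by (simp add: tensor_split)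
      then have "I.cg (s (\<iota> (e i) a) \<otimes>\<^bsub>C\<^esub> s (\<iota> (b i) \<one>\<^bsub>A\<^esub>)) (s (\<iota> (e i) \<one>\<^bsub>A\<^esub>) \<otimes>\<^bsub>C\<^esub> s (\<iota> \<one>\<^bsub>F\<^esub> a) \<otimes>\<^bsub>C\<^esub> s (\<iota> (b i) \<one>\<^bsub>A\<^esub>))"
        using i by (intro I.cg_mult I.cg_refl) (auto simp: sh(1))
      then show "I.cg (s (\<iota> (e i) \<one>\<^bsub>A\<^esub>) \<otimes>\<^bsub>C\<^esub> s (\<iota> \<one>\<^bsub>F\<^esub> a) \<otimes>\<^bsub>C\<^esub> s (\<iota> (b i) \<one>\<^bsub>A\<^esub>)) (s (\<iota> (e i) a \<otimes>\<^bsub>T\<^esub> \<iota> (b i) \<one>\<^bsub>A\<^esub>))"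
        using I.cg_trans[OF sh(3)] I.cg_sym i a by (meson tensor_closed A.one_closed)
    qed simp
    also have "(\<Oplus>\<^bsub>C\<^esub>i\<in>{..<N}. s (\<iota> (e i) a \<otimes>\<^bsub>T\<^esub> \<iota> (b i) \<one>\<^bsub>A\<^esub>)) = (\<Oplus>\<^bsub>C\<^esub>i\<in>{..<N}. s (\<iota> (e i \<otimes>\<^bsub>F\<^esub> b i) a))"
      using a by (intro C.finsum_eqI) (auto simp: tensor_mult sh(1))
    also have "I.cg \<dots> (s (\<Oplus>\<^bsub>T\<^esub>i\<in>{..<N}. \<iota> (e i \<otimes>\<^bsub>F\<^esub> b i) a))"
      using a by (intro I.cg_sym[OF I.cg_additive_finsum[OF T_cstar sh(1,2,4)]]) auto
    finally show ?thesis by (simp only: unit)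
  qed
  \<comment> \<open>Starting at \<open>n\<close> makes every ideal of the sequence contain
    \<open>J n\<close>, as \<open>K.comm_closure\<close> requires.\<close>
  have comm_seq: "ideal_sequence K.comm_alg (\<lambda>k. J (n + k) \<inter> K.comm) (Jinf \<inter> K.comm)"
  proof -
    interpret D: unital_cstar_algebra K.comm_alg by (rule K.comm_alg_unital)
    show ?thesis
    proof
      show "closed_ideal K.comm_alg (J (n + k) \<inter> K.comm)" for k
        using K.comm_ideal(1)[OF C.ideal_J] by (simp add: cstar_ideal_def cstar_ideal_axioms_def)
      show "Jinf \<inter> K.comm = cstar_topology K.comm_alg closure_of (\<Union>k. J (n + k) \<inter> K.comm)"
        by (rule K.comm_closure[OF C.shift]) (simp add: C.J_mono)
    qed (use C.J_Suc in auto)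
  qed
  have comm_G: "unital_G_algebra K.comm_alg \<gamma>" by (rule K.comm_G_algebra[OF \<gamma>' \<beta> inv l_eq])
  have "equivariant_hom_mod A \<alpha> K.comm_alg \<gamma> (Jinf \<inter> K.comm) sA"
    unfolding equivariant_hom_mod_def
  proof (intro conjI allI ballI)
    show "star_ideal K.comm_alg (Jinf \<inter> K.comm)" by (rule K.comm_star_ideal[OF I.star_ideal_axioms])
    show "hom_mod A K.comm_alg (Jinf \<inter> K.comm) sA"
      using K.hom_mod_comm[OF A.unital_cstar_algebra_axioms C.ideal_Jinf] sA_comm
        I.hom_mod_cong[OF s_right A.unital_cstar_algebra_axioms sA_s] by blast
    fix g a assume a: "a \<in> carrier A"
    have "\<gamma> g (sA a) \<in> K.comm"
      using G_algebraD(4)[of K.comm_alg \<gamma> "sA a" g] comm_G sA_comm[OF a] by (simp add: unital_G_algebra_def)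
    moreover have "I.cg (sA (\<alpha> g a)) (\<gamma> g (sA a))"
      using I.cg_trans[OF sA_s[OF \<alpha>c[OF a]] I.cg_trans[OF s_right_eq[OF a]]]
        I.cg_automorphism[OF \<gamma>' Jinv I.cg_sym[OF sA_s[OF a]]] by blast
    ultimately show "cstar_ideal.cg K.comm_alg (Jinf \<inter> K.comm) (sA (\<alpha> g a)) (\<gamma> g (sA a))"
      using sA_comm[OF \<alpha>c[OF a]] by (simp add: K.comm_ideal(2)[OF C.ideal_Jinf])
  qed
  moreover have "\<gamma> g c \<in> J (n + k) \<inter> K.comm" if "c \<in> J (n + k) \<inter> K.comm" for k g c
    using that inv G_algebraD(4)[of K.comm_alg \<gamma> c g] comm_G by (simp add: unital_G_algebra_def)
  ultimately obtain k \<rho> where \<rho>: "equivariant_hom_mod A \<alpha> K.comm_alg \<gamma> (J (n + k) \<inter> K.comm) \<rho>"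
    and \<rho>_sA: "\<And>a. a \<in> carrier A \<Longrightarrow> cstar_ideal.cg K.comm_alg (Jinf \<inter> K.comm) (\<rho> a) (sA a)"
    using semiprojectiveD[OF A comm_G comm_seq] by blast
  have \<rho>_hom: "hom_mod A C (J (n + k)) \<rho>" and \<rho>_comm: "\<And>a. a \<in> carrier A \<Longrightarrow> \<rho> a \<in> K.comm"
    using \<rho> K.hom_mod_comm[OF A.unital_cstar_algebra_axioms C.ideal_J] by (auto simp: equivariant_hom_mod_def)
  have \<rho>_eq: "cstar_ideal.cg C (J (n + k)) (\<rho> (\<alpha> g a)) (\<gamma> g (\<rho> a))" if "a \<in> carrier A" for g a
    using \<rho> that by (simp add: equivariant_hom_mod_def K.comm_ideal(2)[OF C.ideal_J])
  have \<rho>_s: "I.cg (\<rho> a) (s (\<iota> \<one>\<^bsub>F\<^esub> a))" if "a \<in> carrier A" for a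
    using I.cg_trans[OF _ sA_s] \<rho>_sA that by (simp add: K.comm_ideal(2)[OF C.ideal_Jinf])
  \<comment> \<open>\<open>\<rho>\<close> only tells that the intersection of
    \<open>J (n + k)\<close> with \<open>K.comm\<close> is closed under the involution, so a later
    ideal that is closed itself is taken.\<close>
  obtain m where m: "n + k \<le> m" "star_ideal C (J m)" using cofinal by blast
  then have nm: "n \<le> m" by simp
  interpret Jm: star_ideal C "J m" by fact
  note \<rho>m = hom_mod_mono[OF C.ideal_J C.ideal_J C.J_mono[OF m(1)] \<rho>_hom]
  note lm = hom_mod_mono[OF C.ideal_J C.ideal_J C.J_mono[OF nm] K.l_hom]
  obtain \<Psi> where \<Psi>: "hom_mod T C (J m) \<Psi>"
    and \<Psi>_tensor: "\<And>f a. f \<in> carrier F \<Longrightarrow> a \<in> carrier A \<Longrightarrow> Jm.cg (\<Psi> (\<iota> f a)) (l f \<otimes>\<^bsub>C\<^esub> \<rho> a)"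
    using hom_mod_tensor[OF m(2) l_linear lm \<rho>m] mono_J[OF nm K.comm_cg[OF \<rho>_comm]] by blast
  note \<Psi>h = hom_modD[OF \<Psi>] and \<theta>h = star_homD[OF G_algebraD(3)[OF \<theta>]]
  have "Jm.cg (\<Psi> (?\<theta> g t)) (\<gamma> g (\<Psi> t))" if t: "t \<in> carrier T" for g t
  proof (rule cg_on_tensors[OF C.ideal_J t, where p = "\<lambda>t. \<Psi> (?\<theta> g t)"])
    fix x y assume xy: "x \<in> carrier T" "y \<in> carrier T"
    show "Jm.cg (\<Psi> (?\<theta> g (x \<oplus>\<^bsub>T\<^esub> y))) (\<Psi> (?\<theta> g x) \<oplus>\<^bsub>C\<^esub> \<Psi> (?\<theta> g y))"
      using \<Psi>h(2)[of "?\<theta> g x" "?\<theta> g y"] xy G_algebraD(4)[OF \<theta>] by (simp add: \<theta>h(2))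
    show "Jm.cg (\<gamma> g (\<Psi> (x \<oplus>\<^bsub>T\<^esub> y))) (\<gamma> g (\<Psi> x) \<oplus>\<^bsub>C\<^esub> \<gamma> g (\<Psi> y))"
      using Jm.cg_automorphism[OF \<gamma>' inv \<Psi>h(2)[OF xy]] xy by (simp add: \<gamma>h(2) \<Psi>h(1))
  next
    fix f a assume fa: "f \<in> carrier F" "a \<in> carrier A"
    have "Jm.cg (\<Psi> (?\<theta> g (\<iota> f a))) (l (\<beta> g f) \<otimes>\<^bsub>C\<^esub> \<rho> (\<alpha> g a))"
      using fa \<Psi>_tensor[OF \<beta>c \<alpha>c] by (simp add: \<theta>_tensor)
    also have "Jm.cg \<dots> (\<gamma> g (l f) \<otimes>\<^bsub>C\<^esub> \<gamma> g (\<rho> a))"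
      using fa by (intro Jm.cg_mult mono_J[OF nm l_eq] mono_J[OF m(1) \<rho>_eq])
    also have "\<gamma> g (l f) \<otimes>\<^bsub>C\<^esub> \<gamma> g (\<rho> a) = \<gamma> g (l f \<otimes>\<^bsub>C\<^esub> \<rho> a)"
      using fa by (simp add: \<gamma>h(3) hom_modD(1)[OF \<rho>_hom])
    also have "Jm.cg \<dots> (\<gamma> g (\<Psi> (\<iota> f a)))"
      using fa by (intro Jm.cg_automorphism[OF \<gamma>' inv] Jm.cg_sym[OF \<Psi>_tensor])
    finally show "Jm.cg (\<Psi> (?\<theta> g (\<iota> f a))) (\<gamma> g (\<Psi> (\<iota> f a)))" .
  qed
  then have "equivariant_hom_mod T ?\<theta> C \<gamma> (J m) \<Psi>" using m(2) \<Psi> by (simp add: equivariant_hom_mod_def)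
  moreover have "I.cg (\<Psi> t) (s t)" if t: "t \<in> carrier T" for t
  proof (rule cg_on_tensors[OF C.ideal_Jinf t mono[OF \<Psi>h(2)] sh(2)])
    fix f a assume fa: "f \<in> carrier F" "a \<in> carrier A"
    have "I.cg (\<Psi> (\<iota> f a)) (l f \<otimes>\<^bsub>C\<^esub> \<rho> a)" by (rule mono[OF \<Psi>_tensor[OF fa]])
    also have "I.cg \<dots> (s (\<iota> f \<one>\<^bsub>A\<^esub>) \<otimes>\<^bsub>C\<^esub> s (\<iota> \<one>\<^bsub>F\<^esub> a))" using fa by (intro I.cg_mult l_s \<rho>_s)
    also have "I.cg \<dots> (s (\<iota> f \<one>\<^bsub>A\<^esub> \<otimes>\<^bsub>T\<^esub> \<iota> \<one>\<^bsub>F\<^esub> a))" using fa by (intro I.cg_sym[OF sh(3)]) auto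
    finally show "I.cg (\<Psi> (\<iota> f a)) (s (\<iota> f a))" using fa by (simp add: tensor_split)
  qed
  ultimately show "\<exists>n s'. equivariant_hom_mod T ?\<theta> C \<gamma> (J n) s' \<and> (\<forall>t\<in>carrier T. I.cg (s' t) (s t))" by blast
qed

theorem theorem2p8:
  fixes F :: "'f cstar" and A :: "'a cstar" and T :: "'t cstar"
    and \<iota> :: "'f \<Rightarrow> 'a \<Rightarrow> 't"
    and \<alpha> :: "'g::topological_group_add \<Rightarrow> 'a \<Rightarrow> 'a"
    and \<beta> :: "'g \<Rightarrow> 'f \<Rightarrow> 'f"
  assumes compact_G: "compact (UNIV :: 'g set)"
    and A: "unital_cstar_algebra A"
    and F: "cstar_algebra F" "finite_dimensional F"
    and \<alpha>: "equivariantly_semiprojective TYPE('c) A \<alpha>"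
    and \<beta>: "G_algebra F \<beta>"
    and T: "unital_cstar_algebra T" "fd_tensor_product F A T \<iota>"
  shows "equivariantly_semiprojective TYPE('c) T (tensor_action F A T \<iota> \<beta> \<alpha>)"
proof -
  obtain N e co b where "dual_basis F N e co b" using cstar_algebra.dual_basis_exists[OF F] by blast
  then interpret F: dual_basis F N e co b .
  \<comment> \<open>The field \<open>one\<close> of \<open>F\<close> is arbitrary; \<open>F'\<close>
    holds the actual unit there. All other operations agree, and neither \<open>G_algebra\<close>
    nor the tensor product refers to this field.\<close>
  define F' where "F' = F\<lparr>one := F.unit\<rparr>"
  have F': "unital_cstar_algebra F'" unfolding F'_def by (rule F.unital)
  have simps [simp]: "carrier F' = carrier F" "mult F' = mult F" "add F' = add F" "zero F' = zero F"
    "smult F' = smult F" "invol F' = invol F" "nrm F' = nrm F" "finsum F' = finsum F"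
    "add_monoid F' = add_monoid F"
    by (simp_all add: F'_def finsum_def fun_eq_iff)
  have "cstar_dist F' = cstar_dist F"
    by (simp add: cstar_dist_def a_minus_def a_inv_def fun_eq_iff)
  then have top: "cstar_topology F' = cstar_topology F" by (simp add: cstar_topology_def)
  have F'_cstar: "cstar_algebra F'" using F' by (simp add: unital_cstar_algebra_def)
  have fd: "finite_dimensional F'" using F(2) by (simp add: finite_dimensional_def)
  have "G_algebra F' \<beta>" using \<beta> F'_cstar by (simp add: G_algebra_def cstar_aut_def star_hom_def top)
  moreover have "fd_tensor_product F' A T \<iota>"
    using T(2) F'_cstar fd by (simp add: fd_tensor_product_def fd_tensor_product_axioms_def)
  moreover obtain N e co b where "dual_basis F' N e co b" using cstar_algebra.dual_basis_exists[OF F'_cstar fd] by blast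
  ultimately have "equivariantly_semiprojective TYPE('c) T (tensor_action F' A T \<iota> \<beta> \<alpha>)"
    using tensor_basis.semiprojective_tensor[of F' N e co b A T \<iota> \<alpha> \<beta>] A T(1) F' compact_G \<alpha>
    by (simp add: tensor_basis_def)
  moreover have "tensor_action F' A T \<iota> \<beta> \<alpha> = tensor_action F A T \<iota> \<beta> \<alpha>"
    by (simp add: tensor_action_def tensor_hom_def fun_eq_iff)
  ultimately show ?thesis by simp
qed

end
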